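(* Let $\theta \in (0,1)$, let $0 < \lambda \le \Lambda < \infty$ and let $Q_0\subset\mathbb{R}^n$ be a cube. Let $a$ be a $(\lambda,\Lambda)$-elliptic coefficient in $3Q_0$, and let $\Omega$ be the interior of $3Q_0$. Let $q_l \in (1,2]$ be an admissible lower exponent for $a$ and let $q_h \in (2,\infty)$ be an admissible upper exponent for $a$ (both relative to $\Omega$). Denote $$A = N^{\Omega}_{l}(a,q_l), \qquad B = N^{\Omega}_{h,loc}(a,q_h).$$ Let $p > q_l$ and assume that $F \in L^{p}(3Q_0;\mathbb{R}^n)$ and $f \in L^{p_*}(3Q_0)$. If $f$ is not identically zero, assume $q_{l*} > 1$. Let $u \in W^{1,2}_0(3Q_0)$ be a solution to $$\operatorname{div} a(x,\nabla u(x)) = \operatorname{div} F(x) + f(x), \quad x \in 3Q_0.$$ Let $g \in L^{\infty}(3Q_0)$ be non-negative. Then there exists a $(1-\theta)$-sparse family $\mathcal{P}$ of cubes such that $3P \subset 3Q_0$ for all $P \in \mathcal{P}$ and $$\int_{Q_0} |\nabla u (x)|g(x) \, dx \le C \sum_{P \in \mathcal{P}} |P| \langle |F|\rangle_{3P,q_l}\langle g\rangle_{P,q_h'} + C \sum_{P \in \mathcal{P}} |P|\, 3\ell(P) \langle |f|\rangle_{3P,q_{l*}} \langle g\rangle_{P,q_h'},$$ where $$C = 9^{n/q_l} (A\Lambda+1)AB \left( \frac{\|M\|_{L^{1}(\mathbb{R}^n) \to L^{1,\infty}(\mathbb{R}^n)} }{\theta} \right)^{1/q_l}.$$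
   Context: A cube is a cartesian product of $n$ equally long intervals in $\mathbb{R}^n$; $\ell(Q)=|Q|^{1/n}$; $cQ$ is the concentric cube of side length $c\,\ell(Q)$. For a measurable set $E$ of finite positive measure and $s\in(0,\infty)$, $\langle h\rangle_{E,s} := \left(\frac{1}{|E|}\int_E |h|^s\,dx\right)^{1/s}$. Exponents: $p_*=np/(n+p)$ (so $q_{l*}=nq_l/(n+q_l)$) and $p'=p/(p-1)$. Maximal function: $\mathcal{D}(Q_0)$ is the collection of dyadic subcubes of $Q_0$ (images, under the translation and scaling taking $[0,1)^n$ to $Q_0$, of the standard dyadic cubes $2^k([0,1)^n+j)$, $k\in\mathbb{Z}$, $j\in\mathbb{Z}^n$, contained in $[0,1)^n$), and $Mh(x)=\sup_{P\in\mathcal{D}(Q_0)}1_P(x)\langle h\rangle_{3P,1}$. Sparse family: for $\eta\in(0,1)$, a family $\mathcal{Q}$ of cubes is $\eta$-sparse if for each $Q\in\mathcal{Q}$ there is $E_Q\subset Q$ with $|E_Q|\ge \eta|Q|$ and $\sum_{Q\in\mathcal{Q}} 1_{E_Q}(x)\le 1$ for all $x\in\mathbb{R}^n$. Elliptic coefficient: $a:U\times\mathbb{R}^n\to\mathbb{R}^n$ is a $(\lambda,\Lambda)$-elliptic coefficient in $U$ if $x\mapsto a(x,\xi)$ is measurable for all $\xi$; $\xi\mapsto a(x,\xi)$ is continuously differentiable for all $x$; and for all $x\in U$, $\xi,\eta\in\mathbb{R}^n$: $a(x,0)=0$, $|a(x,\xi)-a(x,\eta)|\le\Lambda|\xi-\eta|$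 and $(a(x,\xi)-a(x,\eta))\cdot(\xi-\eta)\ge\lambda|\xi-\eta|^2$. Solution: for a domain $U$, $F\in L^1_{loc}(U;\mathbb{R}^n)$, $f\in L^1_{loc}(U)$, a function $u\in W^{1,2}(U)$ solves $\operatorname{div} a(x,\nabla u)=\operatorname{div}F+f$ in $U$ if $\int_U a(x,\nabla u)\cdot\nabla\varphi\,dx=\int_U F\cdot\nabla\varphi\,dx+\int_U f\varphi\,dx$ for all $\varphi\in C_c^\infty(U)$. Smoothened cubes: fix a smooth domain $O_0$ with $\frac{299}{100}[-1/2,1/2]^n\subset O_0\subset 3[-1/2,1/2]^n$. For a cube $Q$, $O_Q=A_Q^{-1}O_0$, where $A_Q$ is the scaling and translation with $A_QQ=[-1/2,1/2]^n$. Weak reverse Hölder inequality: for a domain $U$, $w\in L^1_{loc}(U)$ non-negative and $q>2$, $w$ satisfies a $q$-weak reverse Hölder inequality in $U$ if there is a constant $C_{w,q}$ such that $\left(\frac{1}{|P|}\int_P1_Uw^q\right)^{1/q}\le C_{w,q}\left(\frac{1}{|2P|}\int_{2P}1_Uw^{1/2}\right)^2$ for all cubes $P$; it is "local" if this holds only for $P$ with $2P\subset U$, and "boundary" if it holds only for $P$ with $P\cap U\ne\varnothing$. Admissible upper exponent (relative to a domain $\Omega$): for a cube $Q$ let $\mathcal{U}(Q)$ be the family of pairs $(u,v)$, $u,v\in W^{1,2}_0(\Omega)$ (extended by zero), such that $\operatorname{div}a(x,\nabla u)=\operatorname{div}a(x,\nabla v)$ weakly in $O_Q\cap\Omega$.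 A number $q>2$ is an admissible upper exponent for $a$ if for any cube $Q$ and any $(u,v)\in\mathcal{U}(Q)$ the function $1_{2Q}|\nabla u-\nabla v|$ satisfies a local or boundary $q$-weak reverse Hölder inequality in $\Omega\cap2Q$. One denotes $$N^{\Omega}_{h,loc}(a,q)=\sup_Q\ \sup_{(u,v)\in\mathcal{U}(Q)}\ \sup_{P\subset2Q:\,2P\subset\Omega}\frac{\langle|\nabla u-\nabla v|\rangle_{P,q}}{\langle|\nabla u-\nabla v|\rangle_{2P,1/2}},$$ where $Q$, $P$ range over cubes. Admissible lower exponent (relative to $\Omega$): $1<q\le2$ is an admissible lower exponent for $a$ if there is a finite number $N^{\Omega}_l(a,q)$ such that for all cubes $P$, all $F\in L^q_{loc}(\Omega;\mathbb{R}^n)$, $f\in L^{q_*}_{loc}(\Omega)$ (with $f\equiv0$ required if $q_*\le1$), and any solution $u\in W^{1,2}_0(O_P\cap\Omega)$ to $\operatorname{div}a(x,\nabla u)=\operatorname{div}F+f$ in $O_P\cap\Omega$, $$\|\nabla u\|_{L^q(O_P\cap\Omega)}\le N^{\Omega}_l(a,q)\left(\int_{O_P\cap\Omega}|F|^q\,dx+\left(\int_{O_P\cap\Omega}|f|^{q_*}\,dx\right)^{q/q_*}\right)^{1/q}.$$ *)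

theory Defs
  imports "HOL-Analysis.Analysis"
begin

section \<open>Cubes\<close>

text \<open>Cubes are sets; each factor is an interval of any kind (open, closed or half-open).\<close>

definition is_cube :: "(real^'n) set \<Rightarrow> bool" where
  "is_cube Q \<longleftrightarrow> (\<exists>I l. 0 < l \<and>
     (\<forall>i. is_interval (I i) \<and> emeasure lborel (I i) = ennreal l) \<and>
     Q = {x. \<forall>i. x $ i \<in> I i})"

definition side :: "(real^'n) set \<Rightarrow> real" where
  "side Q = measure lebesgue Q powr (1 / real CARD('n))"

definition center :: "(real^'n) set \<Rightarrow> real^'n" where
  "center Q = (\<chi> i. (Inf ((\<lambda>x. x $ i) ` Q) + Sup ((\<lambda>x. x $ i) ` Q)) / 2)"

definition dilate :: "real \<Rightarrow> (real^'n) set \<Rightarrow> (real^'n) set" where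
  "dilate c Q = (\<lambda>x. center Q + c *\<^sub>R (x - center Q)) ` Q"


section \<open>Averages and Lebesgue spaces\<close>

text \<open>Real powers of extended non-negative numbers, used for exponents \<open>s > 0\<close> only.\<close>

definition epowr :: "ennreal \<Rightarrow> real \<Rightarrow> ennreal" where
  "epowr x s = (if x = \<infinity> then \<infinity> else ennreal (enn2real x powr s))"

definition Lp_norm :: "real \<Rightarrow> (real^'n) set \<Rightarrow> (real^'n \<Rightarrow> 'b::real_normed_vector) \<Rightarrow> ennreal" where
  "Lp_norm p U h = epowr (\<integral>\<^sup>+x\<in>U. ennreal (norm (h x) powr p) \<partial>lebesgue) (1 / p)"

definition avg :: "(real^'n) set \<Rightarrow> real \<Rightarrow> (real^'n \<Rightarrow> real) \<Rightarrow> ennreal" where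
  "avg E s h =
     epowr ((\<integral>\<^sup>+x\<in>E. ennreal (\<bar>h x\<bar> powr s) \<partial>lebesgue) / emeasure lebesgue E) (1 / s)"

definition Lp :: "real \<Rightarrow> (real^'n) set \<Rightarrow> (real^'n \<Rightarrow> 'b::real_normed_vector) \<Rightarrow> bool" where
  "Lp p U h \<longleftrightarrow> h \<in> borel_measurable (lebesgue_on U) \<and>
     (\<integral>\<^sup>+x\<in>U. ennreal (norm (h x) powr p) \<partial>lebesgue) < \<infinity>"

definition Linfty :: "(real^'n) set \<Rightarrow> (real^'n \<Rightarrow> real) \<Rightarrow> bool" where
  "Linfty U h \<longleftrightarrow> h \<in> borel_measurable (lebesgue_on U) \<and>
     (\<exists>K. AE x in lebesgue_on U. \<bar>h x\<bar> \<le> K)"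

definition Lp_loc :: "real \<Rightarrow> (real^'n) set \<Rightarrow> (real^'n \<Rightarrow> 'b::real_normed_vector) \<Rightarrow> bool" where
  "Lp_loc p U h \<longleftrightarrow> h \<in> borel_measurable (lebesgue_on U) \<and>
     (\<forall>K. compact K \<and> K \<subseteq> U \<longrightarrow> Lp p K h)"

definition lower_star :: "'n::finite itself \<Rightarrow> real \<Rightarrow> real" where
  "lower_star _ p = real CARD('n) * p / (real CARD('n) + p)"

definition conj_exp :: "real \<Rightarrow> real" where
  "conj_exp p = p / (p - 1)"


section \<open>The dyadic maximal function\<close>

definition unit_cube :: "(real^'n) set" where
  "unit_cube = {x. \<forall>i. 0 \<le> x $ i \<and> x $ i < 1}"

definition std_dyadic :: "int \<Rightarrow> int^'n \<Rightarrow> (real^'n) set" where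
  "std_dyadic k j = (\<lambda>x. (2 powi k) *\<^sub>R (x + (\<chi> i. real_of_int (j $ i)))) ` unit_cube"

text \<open>The translation and scaling in the image takes the half-open unit cube onto \<open>Q\<^sub>0\<close>
  up to the boundary of \<open>Q\<^sub>0\<close>, and exactly if \<open>Q\<^sub>0\<close> is half-open.\<close>

definition dyadic_subcubes :: "(real^'n) set \<Rightarrow> (real^'n) set set" where
  "dyadic_subcubes Q0 =
     {(\<lambda>x. center Q0 + side Q0 *\<^sub>R (x - (\<chi> i. 1 / 2))) ` std_dyadic k j | k j.
        std_dyadic k j \<subseteq> unit_cube}"

definition dyadic_maximal :: "(real^'n) set \<Rightarrow> (real^'n \<Rightarrow> real) \<Rightarrow> real^'n \<Rightarrow> ennreal" where
  "dyadic_maximal Q0 h x =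
     (SUP P\<in>dyadic_subcubes Q0. indicator P x * avg (dilate 3 P) 1 h)"

definition weak_L1_norm :: "(real^'n \<Rightarrow> ennreal) \<Rightarrow> ennreal" where
  "weak_L1_norm H = (SUP t\<in>{0<..}. ennreal t * emeasure lebesgue {x. H x > ennreal t})"

definition maximal_weak_norm :: "(real^'n) set \<Rightarrow> ennreal" where
  "maximal_weak_norm Q0 =
     (SUP h\<in>{h. Lp 1 UNIV h}. weak_L1_norm (dyadic_maximal Q0 h) / Lp_norm 1 UNIV h)"


section \<open>Sparse families\<close>

definition sparse_family :: "real \<Rightarrow> (real^'n) set set \<Rightarrow> bool" where
  "sparse_family \<eta> \<Q> \<longleftrightarrow> (\<forall>Q\<in>\<Q>. is_cube Q) \<and>
     (\<exists>E. (\<forall>Q\<in>\<Q>. E Q \<in> sets lebesgue \<and> E Q \<subseteq> Q \<and>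
              emeasure lebesgue (E Q) \<ge> ennreal \<eta> * emeasure lebesgue Q) \<and>
          (\<forall>x. (\<Sum>\<^sub>\<infinity>Q\<in>\<Q>. indicator (E Q) x :: ennreal) \<le> 1))"


section \<open>Smooth functions, smooth domains, Sobolev spaces\<close>

definition grad :: "(real^'n \<Rightarrow> real) \<Rightarrow> real^'n \<Rightarrow> real^'n" where
  "grad \<phi> x = (\<chi> i. frechet_derivative \<phi> (at x) (axis i 1))"

primrec Ck :: "nat \<Rightarrow> (real^'n \<Rightarrow> real) \<Rightarrow> bool" where
  "Ck 0 \<phi> \<longleftrightarrow> continuous_on UNIV \<phi>"
| "Ck (Suc k) \<phi> \<longleftrightarrow> (\<forall>x. \<phi> differentiable (at x)) \<and> (\<forall>i. Ck k (\<lambda>x. grad \<phi> x $ i))"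

definition smooth :: "(real^'n \<Rightarrow> real) \<Rightarrow> bool" where
  "smooth \<phi> \<longleftrightarrow> (\<forall>k. Ck k \<phi>)"

definition test_functions :: "(real^'n) set \<Rightarrow> (real^'n \<Rightarrow> real) set" where
  "test_functions U =
     {\<phi>. smooth \<phi> \<and> compact (closure {x. \<phi> x \<noteq> 0}) \<and> closure {x. \<phi> x \<noteq> 0} \<subseteq> U}"

text \<open>A smooth boundary is described by local defining functions with non-vanishing gradient.\<close>

definition smooth_domain :: "(real^'n) set \<Rightarrow> bool" where
  "smooth_domain U \<longleftrightarrow> open U \<and> connected U \<and> U \<noteq> {} \<and>
     (\<forall>x\<in>frontier U. \<exists>r>0. \<exists>\<psi>. smooth \<psi> \<and> grad \<psi> x \<noteq> 0 \<and>
        U \<inter> ball x r = {y \<in> ball x r. \<psi> y < 0})"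

definition is_weak_gradient ::
  "(real^'n) set \<Rightarrow> (real^'n \<Rightarrow> real) \<Rightarrow> (real^'n \<Rightarrow> real^'n) \<Rightarrow> bool" where
  "is_weak_gradient U u V \<longleftrightarrow> Lp_loc 1 U u \<and> Lp_loc 1 U V \<and>
     (\<forall>\<phi>\<in>test_functions U.
        (LINT x|lebesgue_on U. u x *\<^sub>R grad \<phi> x) = - (LINT x|lebesgue_on U. \<phi> x *\<^sub>R V x))"

text \<open>A representative of the weak gradient. It is meaningful on \<open>U\<close> only, where it is
  unique almost everywhere.\<close>

definition weak_grad :: "(real^'n) set \<Rightarrow> (real^'n \<Rightarrow> real) \<Rightarrow> real^'n \<Rightarrow> real^'n" where
  "weak_grad U u = (SOME V. is_weak_gradient U u V)"

definition W12 :: "(real^'n) set \<Rightarrow> (real^'n \<Rightarrow> real) set" where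
  "W12 U = {u. Lp 2 U u \<and> (\<exists>V. is_weak_gradient U u V \<and> Lp 2 U V)}"

definition W12_0 :: "(real^'n) set \<Rightarrow> (real^'n \<Rightarrow> real) set" where
  "W12_0 U = {u \<in> W12 U. \<forall>\<epsilon>>0. \<exists>\<phi>\<in>test_functions U.
     Lp_norm 2 U (\<lambda>x. u x - \<phi> x) + Lp_norm 2 U (\<lambda>x. weak_grad U u x - grad \<phi> x) < ennreal \<epsilon>}"


section \<open>Elliptic equations\<close>

definition elliptic_coeff ::
  "real \<Rightarrow> real \<Rightarrow> (real^'n) set \<Rightarrow> (real^'n \<Rightarrow> real^'n \<Rightarrow> real^'n) \<Rightarrow> bool" where
  "elliptic_coeff lam \<Lambda> U a \<longleftrightarrow>
     (\<forall>\<xi>. (\<lambda>x. a x \<xi>) \<in> borel_measurable (lebesgue_on U)) \<and>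
     (\<forall>x\<in>U. \<exists>D. (\<forall>\<xi>. (a x has_derivative blinfun_apply (D \<xi>)) (at \<xi>)) \<and> continuous_on UNIV D) \<and>
     (\<forall>x\<in>U. a x 0 = 0) \<and>
     (\<forall>x\<in>U. \<forall>\<xi> \<eta>. norm (a x \<xi> - a x \<eta>) \<le> \<Lambda> * norm (\<xi> - \<eta>)) \<and>
     (\<forall>x\<in>U. \<forall>\<xi> \<eta>. (a x \<xi> - a x \<eta>) \<bullet> (\<xi> - \<eta>) \<ge> lam * (norm (\<xi> - \<eta>))\<^sup>2)"

definition solves ::
  "(real^'n) set \<Rightarrow> (real^'n \<Rightarrow> real^'n \<Rightarrow> real^'n) \<Rightarrow> (real^'n \<Rightarrow> real^'n) \<Rightarrow>
   (real^'n \<Rightarrow> real) \<Rightarrow> (real^'n \<Rightarrow> real) \<Rightarrow> bool" where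
  "solves U a F f u \<longleftrightarrow> Lp_loc 1 U F \<and> Lp_loc 1 U f \<and> u \<in> W12 U \<and>
     (\<forall>\<phi>\<in>test_functions U.
        (LINT x|lebesgue_on U. a x (weak_grad U u x) \<bullet> grad \<phi> x) =
        (LINT x|lebesgue_on U. F x \<bullet> grad \<phi> x) + (LINT x|lebesgue_on U. f x * \<phi> x))"

text \<open>The preimage of \<open>O\<^sub>0\<close> under the scaling and translation that takes \<open>Q\<close> to the cube
  of side length one centred at the origin.\<close>

definition smoothened :: "(real^'n) set \<Rightarrow> (real^'n) set \<Rightarrow> (real^'n) set" where
  "smoothened O0 Q = (\<lambda>x. (1 / side Q) *\<^sub>R (x - center Q)) -` O0"


section \<open>Admissible exponents\<close>

definition solution_pairs ::
  "(real^'n) set \<Rightarrow> (real^'n) set \<Rightarrow> (real^'n \<Rightarrow> real^'n \<Rightarrow> real^'n) \<Rightarrow> (real^'n) set \<Rightarrow>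
   ((real^'n \<Rightarrow> real) \<times> (real^'n \<Rightarrow> real)) set" where
  "solution_pairs O0 \<Omega> a Q = {(u, v). u \<in> W12_0 \<Omega> \<and> v \<in> W12_0 \<Omega> \<and>
     (\<forall>\<phi>\<in>test_functions (smoothened O0 Q \<inter> \<Omega>).
        (LINT x|lebesgue_on (smoothened O0 Q \<inter> \<Omega>). a x (weak_grad \<Omega> u x) \<bullet> grad \<phi> x) =
        (LINT x|lebesgue_on (smoothened O0 Q \<inter> \<Omega>). a x (weak_grad \<Omega> v x) \<bullet> grad \<phi> x))}"

text \<open>The weak reverse Hoelder inequality for a single cube \<open>P\<close>. The square on the right-hand
  side is the exponent \<open>1 / s\<close> of the average with \<open>s = 1 / 2\<close>.\<close>

definition weak_rh_at ::
  "(real^'n) set \<Rightarrow> real \<Rightarrow> (real^'n \<Rightarrow> real) \<Rightarrow> real \<Rightarrow> (real^'n) set \<Rightarrow> bool" where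
  "weak_rh_at U q w C P \<longleftrightarrow>
     avg P q (\<lambda>x. indicator U x * w x) \<le>
       ennreal C * avg (dilate 2 P) (1 / 2) (\<lambda>x. indicator U x * w x)"

definition local_weak_rh :: "(real^'n) set \<Rightarrow> real \<Rightarrow> (real^'n \<Rightarrow> real) \<Rightarrow> bool" where
  "local_weak_rh U q w \<longleftrightarrow> (\<exists>C. \<forall>P. is_cube P \<and> dilate 2 P \<subseteq> U \<longrightarrow> weak_rh_at U q w C P)"

definition boundary_weak_rh :: "(real^'n) set \<Rightarrow> real \<Rightarrow> (real^'n \<Rightarrow> real) \<Rightarrow> bool" where
  "boundary_weak_rh U q w \<longleftrightarrow> (\<exists>C. \<forall>P. is_cube P \<and> P \<inter> U \<noteq> {} \<longrightarrow> weak_rh_at U q w C P)"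

definition admissible_upper ::
  "(real^'n) set \<Rightarrow> (real^'n) set \<Rightarrow> (real^'n \<Rightarrow> real^'n \<Rightarrow> real^'n) \<Rightarrow> real \<Rightarrow> bool" where
  "admissible_upper O0 \<Omega> a q \<longleftrightarrow> 2 < q \<and>
     (\<forall>Q. is_cube Q \<longrightarrow> (\<forall>(u, v)\<in>solution_pairs O0 \<Omega> a Q.
        let w = (\<lambda>x. indicator (dilate 2 Q) x * norm (weak_grad \<Omega> u x - weak_grad \<Omega> v x))
        in local_weak_rh (\<Omega> \<inter> dilate 2 Q) q w \<or> boundary_weak_rh (\<Omega> \<inter> dilate 2 Q) q w))"

text \<open>The supremum may be infinite. In \<^typ>\<open>ennreal\<close>, \<open>0 / 0 = 0\<close> and \<open>x / 0 = \<infinity>\<close>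
  for \<open>x > 0\<close>.\<close>

definition N_high_loc ::
  "(real^'n) set \<Rightarrow> (real^'n) set \<Rightarrow> (real^'n \<Rightarrow> real^'n \<Rightarrow> real^'n) \<Rightarrow> real \<Rightarrow> ennreal" where
  "N_high_loc O0 \<Omega> a q =
     (SUP Q\<in>{Q. is_cube Q}. SUP (u, v)\<in>solution_pairs O0 \<Omega> a Q.
        SUP P\<in>{P. is_cube P \<and> P \<subseteq> dilate 2 Q \<and> dilate 2 P \<subseteq> \<Omega>}.
          avg P q (\<lambda>x. norm (weak_grad \<Omega> u x - weak_grad \<Omega> v x)) /
          avg (dilate 2 P) (1 / 2) (\<lambda>x. norm (weak_grad \<Omega> u x - weak_grad \<Omega> v x)))"

definition lower_estimate ::
  "(real^'n) set \<Rightarrow> (real^'n) set \<Rightarrow> (real^'n \<Rightarrow> real^'n \<Rightarrow> real^'n) \<Rightarrow> real \<Rightarrow> ennreal \<Rightarrow> bool" where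
  "lower_estimate O0 \<Omega> a q N \<longleftrightarrow>
     (\<forall>P F f u. is_cube P \<longrightarrow> Lp_loc q \<Omega> F \<longrightarrow> Lp_loc (lower_star TYPE('n) q) \<Omega> f \<longrightarrow>
        (lower_star TYPE('n) q \<le> 1 \<longrightarrow> (AE x in lebesgue_on \<Omega>. f x = 0)) \<longrightarrow>
        u \<in> W12_0 (smoothened O0 P \<inter> \<Omega>) \<longrightarrow> solves (smoothened O0 P \<inter> \<Omega>) a F f u \<longrightarrow>
        Lp_norm q (smoothened O0 P \<inter> \<Omega>) (weak_grad (smoothened O0 P \<inter> \<Omega>) u) \<le>
          N * epowr
            ((\<integral>\<^sup>+x\<in>smoothened O0 P \<inter> \<Omega>. ennreal (norm (F x) powr q) \<partial>lebesgue) +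
             epowr (\<integral>\<^sup>+x\<in>smoothened O0 P \<inter> \<Omega>. ennreal (\<bar>f x\<bar> powr lower_star TYPE('n) q) \<partial>lebesgue)
               (q / lower_star TYPE('n) q))
            (1 / q))"

definition admissible_lower ::
  "(real^'n) set \<Rightarrow> (real^'n) set \<Rightarrow> (real^'n \<Rightarrow> real^'n \<Rightarrow> real^'n) \<Rightarrow> real \<Rightarrow> bool" where
  "admissible_lower O0 \<Omega> a q \<longleftrightarrow> 1 < q \<and> q \<le> 2 \<and> (\<exists>N<\<infinity>. lower_estimate O0 \<Omega> a q N)"

text \<open>The least constant in the estimate.\<close>

definition N_low ::
  "(real^'n) set \<Rightarrow> (real^'n) set \<Rightarrow> (real^'n \<Rightarrow> real^'n \<Rightarrow> real^'n) \<Rightarrow> real \<Rightarrow> ennreal" where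
  "N_low O0 \<Omega> a q = Inf {N. lower_estimate O0 \<Omega> a q N}"

end

theory Submission
  imports Defs
begin

text \<open>
  The estimate is a stopping time argument in the dyadic subcubes of Q0.  Each dyadic cube Q
  carries the local solution \<open>v\<^sub>Q\<close>, which has zero boundary values in the smoothened cube of Q and
  solves the same equation as u there; at the root it is u itself.  The lower exponent bounds
  \<open>\<nabla>v\<^sub>Q\<close> in \<open>L\<^sup>q\<close> by the averages of F and f over 3Q (data_bound).  The children of Q are
  the maximal dyadic subcubes P for which the average of \<open>|\<nabla>v\<^sub>Q|\<^sup>q\<close> over 3P exceeds a level.  The
  level is chosen such that, by the weak type inequality for M, the children cover at most the
  fraction \<theta> of Q (children_small).

  One step of the argument (stopping_step) splits the integral of \<open>|\<nabla>v\<^sub>Q| g\<close> over Q.  Off the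
  children, Lebesgue points show that \<open>|\<nabla>v\<^sub>Q|\<close> is at most the q-th root of the level.  On a child
  P, the functions \<open>v\<^sub>Q\<close> and \<open>v\<^sub>P\<close> solve the same equation in the smoothened cube of P, so the upper exponent
  bounds the average of \<open>|\<nabla>v\<^sub>Q - \<nabla>v\<^sub>P|\<close> over P with exponent \<open>q\<^sub>h\<close> by one
  over 2P.  The averages over 2P are controlled by the level,
  because P is maximal, and because \<open>v\<^sub>P\<close> is bounded by \<open>v\<^sub>Q\<close> through the lower exponent with
  right-hand side \<open>a(x, \<nabla>v\<^sub>Q)\<close> (children_difference).  Hoelder's inequality against g then leaves the
  integrals of \<open>|\<nabla>v\<^sub>P| g\<close> over the children, to which the step applies again.

  After n steps the remainder lives on a set of measure at most \<open>\<theta>\<^sup>n |Q0|\<close> and is dominated by roots of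
  maximal functions of the data, which are integrable by Kolmogorov's inequality; so it tends to
  zero (remainder_small).  The cubes of all generations are sparse, with Q minus its children as
  the large disjoint parts.

  The step needs 1 \<le> B.  If B < 1, the reverse Hoelder inequality on cubes that shrink to a
  Lebesgue point forces \<open>\<nabla>u = \<nabla>v\<^sub>P\<close> almost everywhere in the part of Q0
  inside the smoothened cube of P; as \<open>\<nabla>v\<^sub>P\<close> has mean zero, \<nabla>u vanishes
  in Q0 (small_B_imp_zero) and the empty family suffices.  The local solutions come from the
  Dirichlet problem for strongly monotone coefficients (Dirichlet_problem), which is solved by
  test functions with small residual and the completeness of \<open>L\<^sup>2\<close>.
\<close>

abbreviation vol :: "'a::euclidean_space set \<Rightarrow> ennreal" where
  "vol \<equiv> emeasure lebesgue"

section \<open>Powers of extended reals, Hoelder and Jensen\<close>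

lemma ennreal_cancel: "0 < c \<Longrightarrow> ennreal c * (x / ennreal c) = x"
  by (cases x) (auto simp: divide_ennreal ennreal_mult[symmetric] ennreal_top_divide ennreal_mult_top)

lemma epowr_ennreal: "0 \<le> r \<Longrightarrow> epowr (ennreal r) s = ennreal (r powr s)"
  by (simp add: epowr_def)

lemma epowr_top [simp]: "epowr top s = top"
  by (simp add: epowr_def)

lemma epowr_zero [simp]: "epowr 0 s = 0"
  by (simp add: epowr_def)

lemma epowr_one [simp]: "epowr x 1 = x"
  by (cases x) (auto simp: epowr_def)

lemma epowr_eq_0_iff [simp]: "epowr x s = 0 \<longleftrightarrow> x = 0"
  by (cases x) (auto simp: epowr_def ennreal_eq_0_iff)

lemma epowr_eq_top_iff [simp]: "epowr x s = top \<longleftrightarrow> x = top"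
  by (cases x) (auto simp: epowr_def)

lemma epowr_mono: "x \<le> y \<Longrightarrow> 0 \<le> s \<Longrightarrow> epowr x s \<le> epowr y s"
  by (cases x; cases y)
     (auto simp: epowr_def top_unique intro!: ennreal_leI powr_mono2)

lemma epowr_mult: "epowr (x * y) s = epowr x s * epowr y s"
  by (cases x; cases y)
     (auto simp: epowr_def powr_mult ennreal_mult_top ennreal_top_mult ennreal_mult[symmetric])

lemma epowr_epowr: "epowr (epowr x s) t = epowr x (s * t)"
  by (cases x) (auto simp: epowr_def powr_powr)

lemma epowr_inverse_cancel: "s \<noteq> 0 \<Longrightarrow> epowr (epowr x s) (1 / s) = x"
    "s \<noteq> 0 \<Longrightarrow> epowr (epowr x (1 / s)) s = x"
  by (simp_all add: epowr_epowr)

lemma epowr_divide: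
  assumes "0 < c" shows "epowr (x / ennreal c) s = epowr x s / ennreal (c powr s)"
  using assms
  by (cases x) (auto simp: epowr_def divide_ennreal powr_divide ennreal_top_divide)

lemma epowr_mono_iff: "0 < s \<Longrightarrow> epowr x s \<le> epowr y s \<longleftrightarrow> x \<le> y"
  using epowr_mono[of x y s] epowr_mono[of "epowr x s" "epowr y s" "1 / s"]
  by (auto simp: epowr_inverse_cancel)

lemma epowr_le_iff: "0 < s \<Longrightarrow> epowr x (1 / s) \<le> y \<longleftrightarrow> x \<le> epowr y s"
  using epowr_mono_iff[of s "epowr x (1/s)" y] by (simp add: epowr_inverse_cancel)

lemma powr_add_le:
  assumes "0 \<le> a" "0 \<le> b" "0 < s" "s \<le> (1::real)"
  shows "(a + b) powr s \<le> a powr s + b powr s"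
proof (cases "a + b = 0")
  case False
  then have ab: "a + b > 0" using assms by linarith
  have "x / (a + b) \<le> (x / (a + b)) powr s" if "0 \<le> x" "x \<le> a + b" for x
    using powr_mono'[of s 1 "x / (a + b)"] that ab assms by simp
  from this[of a] this[of b] have "1 \<le> (a / (a + b)) powr s + (b / (a + b)) powr s"
    using assms ab by (simp add: add_divide_distrib[symmetric])
       (smt (verit, best) ab add_divide_distrib divide_self)
  then show ?thesis
    using assms ab by (simp add: powr_divide add_divide_distrib[symmetric])
qed (use assms in auto)

lemma epowr_add_le:
  assumes "0 < s" "s \<le> 1"
  shows "epowr (x + y) s \<le> epowr x s + epowr y s"
proof (cases x)
  case (real a) note x = this
  show ?thesis
  proof (cases y)
    case (real b)
    then show ?thesis using x assms powr_add_le[of a b s]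
      by (simp add: epowr_ennreal ennreal_plus[symmetric] del: ennreal_plus)
  qed simp
qed simp

lemma epowr_measurable [measurable]:
  assumes [measurable]: "h \<in> borel_measurable M"
  shows "(\<lambda>x. epowr (h x) s) \<in> borel_measurable M"
  unfolding epowr_def by measurable

text \<open>The scalar inequality behind Hoelder's inequality, for extended reals.\<close>

lemma ennreal_Young:
  assumes "1 < p" "1 < q" "1 / p + 1 / q = (1::real)"
  shows "x * y \<le> epowr x p / ennreal p + epowr y q / ennreal q"
proof -
  consider "x = 0" | "y = 0" | "x \<noteq> 0" "y \<noteq> 0" "x = top \<or> y = top"
    | r s where "x = ennreal r" "y = ennreal s" "0 \<le> r" "0 \<le> s"
    by (cases x; cases y) auto
  then show ?thesis
  proof cases
    case 3
    then have *: "epowr x p / ennreal p + epowr y q / ennreal q = top"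
      by (auto simp: ennreal_top_divide)
    show ?thesis unfolding * by (rule top_greatest)
  next
    case 4
    then show ?thesis
      using Youngs_inequality[of p q r s] assms
      by (simp add: epowr_ennreal divide_ennreal ennreal_mult[symmetric] ennreal_plus[symmetric]
           del: ennreal_plus)
  qed auto
qed

lemma nn_integral_Hoelder:
  assumes [measurable]: "u \<in> borel_measurable M" "v \<in> borel_measurable M"
    and pq: "1 < p" "1 < q" "1 / p + 1 / q = (1::real)"
  shows "(\<integral>\<^sup>+x. u x * v x \<partial>M) \<le>
    epowr (\<integral>\<^sup>+x. epowr (u x) p \<partial>M) (1 / p) * epowr (\<integral>\<^sup>+x. epowr (v x) q \<partial>M) (1 / q)"
    (is "_ \<le> epowr ?U _ * epowr ?V _")
proof -
  have null: "(\<integral>\<^sup>+x. u x * v x \<partial>M) = 0" if "?U = 0 \<or> ?V = 0"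
    using that
  proof
    assume "?U = 0"
    then have "AE x in M. u x = 0" by (simp add: nn_integral_0_iff_AE)
    then show ?thesis by (subst nn_integral_0_iff_AE) auto
  next
    assume "?V = 0"
    then have "AE x in M. v x = 0" by (simp add: nn_integral_0_iff_AE)
    then show ?thesis by (subst nn_integral_0_iff_AE) auto
  qed
  consider "?U = 0 \<or> ?V = 0" | "?U \<noteq> 0" "?V \<noteq> 0" "?U = top \<or> ?V = top"
    | a b where "?U = ennreal a" "?V = ennreal b" "0 < a" "0 < b"
    by (cases ?U; cases ?V) (auto simp: ennreal_eq_0_iff; metis ennreal_0 less_eq_real_def)+
  then show ?thesis
  proof cases
    case 1 with null show ?thesis by simp
  next
    case 2
    then have "epowr ?U (1/p) * epowr ?V (1/q) = top"
      by (auto simp: ennreal_mult_top ennreal_top_mult)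
    then show ?thesis by (simp only: top_greatest)
  next
    case 3
    define \<alpha> where "\<alpha> = a powr (1 / p)"
    define \<beta> where "\<beta> = b powr (1 / q)"
    have ab: "0 < \<alpha>" "0 < \<beta>" using 3 by (auto simp: \<alpha>_def \<beta>_def)
    have ap: "\<alpha> powr p = a" and bq: "\<beta> powr q = b"
      using 3 pq by (auto simp: \<alpha>_def \<beta>_def powr_powr)
    have "(\<integral>\<^sup>+x. (u x / ennreal \<alpha>) * (v x / ennreal \<beta>) \<partial>M) \<le>
       (\<integral>\<^sup>+x. epowr (u x / ennreal \<alpha>) p / ennreal p + epowr (v x / ennreal \<beta>) q / ennreal q \<partial>M)"
      by (intro nn_integral_mono ennreal_Young pq)
    also have "\<dots> = ?U / ennreal a / ennreal p + ?V / ennreal b / ennreal q"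
      using ab by (subst nn_integral_add)
        (auto simp: epowr_divide ap bq nn_integral_divide)
    also have "\<dots> = ennreal (1 / p) + ennreal (1 / q)"
      using 3 pq by (simp add: divide_ennreal[of _ p] divide_ennreal[of _ q] ennreal_1[symmetric] del: ennreal_1)
    also have "\<dots> = ennreal (1 / p + 1 / q)"
      using pq by (simp add: ennreal_plus[symmetric] del: ennreal_plus)
    also have "\<dots> = 1" using pq by simp
    finally have le1: "(\<integral>\<^sup>+x. (u x / ennreal \<alpha>) * (v x / ennreal \<beta>) \<partial>M) \<le> 1" .
    have eq: "u x * v x = ennreal (\<alpha> * \<beta>) * ((u x / ennreal \<alpha>) * (v x / ennreal \<beta>))" for x
    proof -
      have "u x = ennreal \<alpha> * (u x / ennreal \<alpha>)" "v x = ennreal \<beta> * (v x / ennreal \<beta>)"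
        using ab by (auto simp: ennreal_cancel)
      then have "u x * v x = (ennreal \<alpha> * (u x / ennreal \<alpha>)) * (ennreal \<beta> * (v x / ennreal \<beta>))"
        by simp
      then show ?thesis using ab by (simp only: ennreal_mult less_imp_le mult_ac)
    qed
    have "(\<integral>\<^sup>+x. u x * v x \<partial>M) =
        (\<integral>\<^sup>+x. ennreal (\<alpha> * \<beta>) * ((u x / ennreal \<alpha>) * (v x / ennreal \<beta>)) \<partial>M)"
      by (subst eq) simp
    also have "\<dots> = ennreal (\<alpha> * \<beta>) * (\<integral>\<^sup>+x. (u x / ennreal \<alpha>) * (v x / ennreal \<beta>) \<partial>M)"
      by (rule nn_integral_cmult) measurable
    also have "\<dots> \<le> ennreal (\<alpha> * \<beta>)"
      using mult_left_mono[OF le1, of "ennreal (\<alpha> * \<beta>)"] by simp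
    also have "\<dots> = epowr ?U (1/p) * epowr ?V (1/q)"
      using 3 ab by (simp add: epowr_ennreal \<alpha>_def \<beta>_def ennreal_mult)
    finally show ?thesis .
  qed
qed

lemma avg_eq_0_iff:
  assumes "h \<in> borel_measurable (lebesgue_on E)" "E \<in> sets lebesgue" "0 < s"
    "0 < vol E" "vol E < \<infinity>"
  shows "avg E s h = 0 \<longleftrightarrow> (AE x in lebesgue_on E. h x = 0)"
proof -
  have [measurable]: "E \<in> sets lebesgue" "h \<in> borel_measurable (lebesgue_on E)" by fact+
  have "avg E s h = 0 \<longleftrightarrow> (\<integral>\<^sup>+x\<in>E. ennreal (\<bar>h x\<bar> powr s) \<partial>lebesgue) = 0"
    using assms by (auto simp: avg_def ennreal_divide_eq_0_iff)
  also have "(\<integral>\<^sup>+x\<in>E. ennreal (\<bar>h x\<bar> powr s) \<partial>lebesgue) = (\<integral>\<^sup>+x. ennreal (\<bar>h x\<bar> powr s) \<partial>lebesgue_on E)"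
    by (simp add: nn_integral_restrict_space)
  also have "\<dots> = 0 \<longleftrightarrow> (AE x in lebesgue_on E. h x = 0)"
    by (subst nn_integral_0_iff_AE) (auto simp: ennreal_eq_0_iff)
  finally show ?thesis .
qed

lemma avg_Hoelder:
  fixes h g :: "real^'n \<Rightarrow> real"
  assumes [measurable]: "E \<in> sets lebesgue" "h \<in> borel_measurable (lebesgue_on E)"
      "g \<in> borel_measurable (lebesgue_on E)"
    and E: "0 < vol E" "vol E < \<infinity>"
    and pq: "1 < p" "1 < q" "1 / p + 1 / q = 1"
  shows "(\<integral>\<^sup>+x\<in>E. ennreal (\<bar>h x\<bar> * \<bar>g x\<bar>) \<partial>lebesgue) \<le> vol E * avg E p h * avg E q g"
proof -
  obtain m where m: "vol E = ennreal m" "0 < m"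
    using E by (cases "vol E") auto
  have "(\<integral>\<^sup>+x\<in>E. ennreal (\<bar>h x\<bar> * \<bar>g x\<bar>) \<partial>lebesgue)
      = (\<integral>\<^sup>+x. ennreal \<bar>h x\<bar> * ennreal \<bar>g x\<bar> \<partial>lebesgue_on E)"
    by (simp add: nn_integral_restrict_space ennreal_mult)
  also have "\<dots> \<le> epowr (\<integral>\<^sup>+x. epowr (ennreal \<bar>h x\<bar>) p \<partial>lebesgue_on E) (1 / p) *
      epowr (\<integral>\<^sup>+x. epowr (ennreal \<bar>g x\<bar>) q \<partial>lebesgue_on E) (1 / q)"
    by (intro nn_integral_Hoelder pq) measurable
  also have "\<dots> = epowr (\<integral>\<^sup>+x\<in>E. ennreal (\<bar>h x\<bar> powr p) \<partial>lebesgue) (1 / p) *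
      epowr (\<integral>\<^sup>+x\<in>E. ennreal (\<bar>g x\<bar> powr q) \<partial>lebesgue) (1 / q)"
    by (simp add: nn_integral_restrict_space epowr_ennreal)
  also have "\<dots> = vol E * avg E p h * avg E q g"
  proof -
    have *: "ennreal (m powr (1/s)) * avg E s k = epowr (\<integral>\<^sup>+x\<in>E. ennreal (\<bar>k x\<bar> powr s) \<partial>lebesgue) (1 / s)"
      for s and k :: "real^'n \<Rightarrow> real"
      using m unfolding avg_def m(1)
      by (subst epowr_divide[OF m(2)]) (simp add: ennreal_cancel)
    have "m = m powr (1/p) * m powr (1/q)"
      using m pq by (simp add: powr_add[symmetric])
    then have "ennreal m = ennreal (m powr (1/p)) * ennreal (m powr (1/q))"
      by (metis ennreal_mult powr_ge_zero)
    then show ?thesis unfolding *[symmetric] m(1) by (simp only: mult_ac)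
  qed
  finally show ?thesis .
qed

lemma avg_const_1:
  assumes "0 < vol E" "vol E < \<infinity>" "E \<in> sets lebesgue"
  shows "avg E s (\<lambda>x. 1) = 1"
  using assms ennreal_divide_self[of "vol E"]
  by (simp add: avg_def epowr_def)

text \<open>Hoelder's inequality against the constant one.\<close>

lemma avg_mono_exp:
  fixes h :: "real^'n \<Rightarrow> real"
  assumes [measurable]: "E \<in> sets lebesgue" "h \<in> borel_measurable (lebesgue_on E)"
    and E: "0 < vol E" "vol E < \<infinity>"
    and sr: "0 < s" "s \<le> r"
  shows "avg E s h \<le> avg E r h"
proof (cases "s = r")
  case False
  then have sr': "1 < r / s" using sr by simp
  define q where "q = (r / s) / (r / s - 1)"
  have q: "1 < q" "1 / (r / s) + 1 / q = 1" using sr' sr by (simp_all add: q_def divide_simps)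
  have "(\<integral>\<^sup>+x\<in>E. ennreal (\<bar>\<bar>h x\<bar> powr s\<bar> * \<bar>1\<bar>) \<partial>lebesgue) \<le>
    vol E * avg E (r / s) (\<lambda>x. \<bar>h x\<bar> powr s) * avg E q (\<lambda>x. 1)"
    by (intro avg_Hoelder E sr' q) measurable
  then have "(\<integral>\<^sup>+x\<in>E. ennreal (\<bar>h x\<bar> powr s) \<partial>lebesgue) / vol E \<le>
    avg E (r / s) (\<lambda>x. \<bar>h x\<bar> powr s)"
    using E by (simp add: avg_const_1 divide_le_posI_ennreal mult.commute)
  then have "epowr ((\<integral>\<^sup>+x\<in>E. ennreal (\<bar>h x\<bar> powr s) \<partial>lebesgue) / vol E) (1 / s) \<le>
    epowr (avg E (r / s) (\<lambda>x. \<bar>h x\<bar> powr s)) (1 / s)"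
    using sr by (intro epowr_mono) auto
  also have "\<dots> = avg E r h"
    using sr by (simp add: avg_def epowr_epowr powr_powr)
  finally show ?thesis by (simp add: avg_def)
qed simp

lemma avg_1_eq: "avg E 1 h = (\<integral>\<^sup>+x\<in>E. ennreal \<bar>h x\<bar> \<partial>lebesgue) / vol E"
  by (simp add: avg_def)

lemma avg_epowr: "0 < s \<Longrightarrow>
  epowr (avg E s h) s = (\<integral>\<^sup>+x\<in>E. ennreal (\<bar>h x\<bar> powr s) \<partial>lebesgue) / vol E"
  by (simp add: avg_def epowr_inverse_cancel)

lemma avg_cong_AE:
  assumes "AE x in lebesgue. x \<in> E \<longrightarrow> \<bar>h x\<bar> = \<bar>k x\<bar>"
  shows "avg E s h = avg E s k"
proof -
  have "(\<integral>\<^sup>+x\<in>E. ennreal (\<bar>h x\<bar> powr s) \<partial>lebesgue) = (\<integral>\<^sup>+x\<in>E. ennreal (\<bar>k x\<bar> powr s) \<partial>lebesgue)"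
    by (rule nn_integral_cong_AE) (use assms in \<open>auto elim!: AE_mp split: split_indicator\<close>)
  then show ?thesis by (simp add: avg_def)
qed

lemma avg_cong_set:
  assumes "AE x in lebesgue. x \<in> E \<longleftrightarrow> x \<in> E'" "E \<in> sets lebesgue" "E' \<in> sets lebesgue"
  shows "avg E s h = avg E' s h"
proof -
  have "(\<integral>\<^sup>+x\<in>E. ennreal (\<bar>h x\<bar> powr s) \<partial>lebesgue) = (\<integral>\<^sup>+x\<in>E'. ennreal (\<bar>h x\<bar> powr s) \<partial>lebesgue)"
    by (rule nn_integral_cong_AE) (use assms(1) in \<open>auto elim!: AE_mp split: split_indicator\<close>)
  moreover have "vol E = vol E'"
    using assms by (intro emeasure_eq_AE) auto
  ultimately show ?thesis by (simp add: avg_def)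
qed

section \<open>Cubes given by centre and side length\<close>

abbreviation open_cube :: "real^'n \<Rightarrow> real \<Rightarrow> (real^'n) set" where
  "open_cube m s \<equiv> box (m - vec (s / 2)) (m + vec (s / 2))"

abbreviation closed_cube :: "real^'n \<Rightarrow> real \<Rightarrow> (real^'n) set" where
  "closed_cube m s \<equiv> cbox (m - vec (s / 2)) (m + vec (s / 2))"

text \<open>Measures, averages, dilates and centres of a cube depend on its interior only up to null sets;
  this relation allows arbitrary faces and keeps just the centre and the side length.\<close>

definition cube_at :: "(real^'n) set \<Rightarrow> real^'n \<Rightarrow> real \<Rightarrow> bool" where
  "cube_at Q m s \<longleftrightarrow> 0 < s \<and> open_cube m s \<subseteq> Q \<and> Q \<subseteq> closed_cube m s"

lemma mem_open_cube: "x \<in> open_cube m s \<longleftrightarrow> (\<forall>i. m $ i - s / 2 < x $ i \<and> x $ i < m $ i + s / 2)"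
  by (simp add: mem_box_cart)

lemma mem_closed_cube: "x \<in> closed_cube m s \<longleftrightarrow> (\<forall>i. m $ i - s / 2 \<le> x $ i \<and> x $ i \<le> m $ i + s / 2)"
  by (simp add: mem_box_cart)

lemma emeasure_closed_cube:
  fixes m :: "real^'n"
  assumes "0 \<le> s" shows "vol (closed_cube m s) = ennreal (s ^ CARD('n))"
proof -
  have *: "vec r \<bullet> b = r" if "b \<in> Basis" for b :: "real^'n" and r :: real
    using that by (auto simp: Basis_vec_def inner_axis)
  have "emeasure lborel (closed_cube m s) = ennreal (\<Prod>b\<in>Basis. ((m + vec (s/2)) - (m - vec (s/2))) \<bullet> b)"
    by (rule emeasure_lborel_cbox) (use assms in \<open>simp add: inner_diff_left inner_add_left *\<close>)
  also have "(\<Prod>b\<in>Basis. ((m + vec (s/2)) - (m - vec (s/2))) \<bullet> b) = (\<Prod>b\<in>(Basis::(real^'n) set). s)"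
    by (rule prod.cong[OF refl], simp only: inner_diff_left inner_add_left *; simp)
  finally show ?thesis by simp
qed

lemma cube_at_open_cube: "0 < s \<Longrightarrow> cube_at (open_cube m s) m s"
  unfolding cube_at_def using box_subset_cbox by blast

lemma cube_at_AE_open:
  assumes "cube_at Q m s"
  shows "AE x in lebesgue. x \<in> Q \<longleftrightarrow> x \<in> open_cube m s"
proof -
  have "negligible (closed_cube m s - open_cube m s)" by (rule negligible_frontier_interval)
  then have "AE x in lebesgue. x \<notin> closed_cube m s - open_cube m s"
    by (intro AE_not_in) (simp add: negligible_iff_null_sets)
  then show ?thesis
    by eventually_elim (use assms in \<open>auto simp: cube_at_def\<close>)
qed

lemma cube_at_sets:
  assumes "cube_at Q m s" shows "Q \<in> sets lebesgue"
proof -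
  have "negligible (Q - open_cube m s)"
    by (rule negligible_subset[OF negligible_frontier_interval[of "m - vec (s/2)" "m + vec (s/2)"]])
       (use assms in \<open>auto simp: cube_at_def\<close>)
  then have "Q - open_cube m s \<in> sets lebesgue" by (rule negligible_imp_sets)
  moreover have "Q = open_cube m s \<union> (Q - open_cube m s)" using assms by (auto simp: cube_at_def)
  ultimately show ?thesis by (metis box_borel sets.Un sets_completionI_sets sets_lborel)
qed

lemma cube_at_emeasure:
  fixes m :: "real^'n"
  assumes "cube_at Q m s" shows "vol Q = ennreal (s ^ CARD('n))"
proof -
  have s: "0 < s" using assms by (simp add: cube_at_def)
  have c: "cube_at (closed_cube m s) m s" using s box_subset_cbox by (auto simp: cube_at_def)
  have "AE x in lebesgue. x \<in> Q \<longleftrightarrow> x \<in> closed_cube m s"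
    using cube_at_AE_open[OF assms] cube_at_AE_open[OF c] by eventually_elim blast
  then have "vol Q = vol (closed_cube m s)"
    by (intro emeasure_eq_AE) (use cube_at_sets[OF assms] in auto)
  then show ?thesis using emeasure_closed_cube[of s m] s by simp
qed

lemma cube_at_measure:
  fixes m :: "real^'n"
  assumes "cube_at Q m s" shows "measure lebesgue Q = s ^ CARD('n)"
  using cube_at_emeasure[OF assms] assms by (simp add: measure_def cube_at_def)

lemma cube_at_emeasure_pos:
  fixes m :: "real^'n"
  assumes "cube_at Q m s" shows "0 < vol Q" "vol Q < \<infinity>"
  using cube_at_emeasure[OF assms] assms by (auto simp: cube_at_def)

lemma cube_at_side:
  fixes m :: "real^'n"
  assumes "cube_at Q m s" shows "side Q = s"
proof -
  have "0 < s" using assms by (simp add: cube_at_def)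
  then show ?thesis
    by (simp add: side_def cube_at_measure[OF assms] powr_realpow[symmetric] powr_powr)
qed

lemma Inf_Sup_between:
  fixes X :: "real set"
  assumes "l < u" "{l<..<u} \<subseteq> X" "X \<subseteq> {l..u}"
  shows "Inf X = l" "Sup X = u"
proof -
  have b: "bdd_below X" "bdd_above X" using assms(3) by (auto intro: bdd_below_mono bdd_above_mono)
  have ne: "{l<..<u} \<noteq> {}" using assms(1) by auto
  have "Inf X \<le> Inf {l<..<u}" by (rule cInf_superset_mono) (use ne b assms in auto)
  moreover have "l \<le> Inf X" by (rule cInf_greatest) (use ne assms in auto)
  ultimately show "Inf X = l" using assms(1) by simp
  have "Sup {l<..<u} \<le> Sup X" by (rule cSup_subset_mono) (use ne b assms in auto)
  moreover have "Sup X \<le> u" by (rule cSup_least) (use ne assms in auto)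
  ultimately show "Sup X = u" using assms(1) by simp
qed

lemma cube_at_center:
  fixes m :: "real^'n"
  assumes "cube_at Q m s" shows "center Q = m"
proof -
  have s: "0 < s" using assms by (simp add: cube_at_def)
  have "Inf ((\<lambda>x. x $ i) ` Q) = m $ i - s / 2 \<and> Sup ((\<lambda>x. x $ i) ` Q) = m $ i + s / 2" for i
  proof -
    have "{m $ i - s / 2<..<m $ i + s / 2} \<subseteq> (\<lambda>x. x $ i) ` Q"
    proof
      fix t assume t: "t \<in> {m $ i - s / 2<..<m $ i + s / 2}"
      define x where "x = (\<chi> j. if j = i then t else m $ j)"
      have "x \<in> Q" using assms t s by (auto simp: cube_at_def x_def mem_open_cube subset_iff)
      moreover have "x $ i = t" by (simp add: x_def)
      ultimately show "t \<in> (\<lambda>x. x $ i) ` Q" by force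
    qed
    moreover have "(\<lambda>x. x $ i) ` Q \<subseteq> {m $ i - s / 2..m $ i + s / 2}"
      using assms by (auto simp: cube_at_def mem_closed_cube subset_iff)
    ultimately show ?thesis using Inf_Sup_between[of "m $ i - s / 2" "m $ i + s / 2"] s by auto
  qed
  then show ?thesis by (simp add: center_def vec_eq_iff)
qed

lemma mem_dilate:
  assumes "cube_at Q m s" "0 < c"
  shows "x \<in> dilate c Q \<longleftrightarrow> m + (1 / c) *\<^sub>R (x - m) \<in> Q"
proof
  assume "x \<in> dilate c Q"
  then show "m + (1 / c) *\<^sub>R (x - m) \<in> Q"
    using assms(2) by (auto simp: dilate_def cube_at_center[OF assms(1)])
next
  assume "m + (1 / c) *\<^sub>R (x - m) \<in> Q"
  moreover have "x = m + c *\<^sub>R ((m + (1 / c) *\<^sub>R (x - m)) - m)" using assms(2) by simp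
  ultimately show "x \<in> dilate c Q"
    unfolding dilate_def cube_at_center[OF assms(1)] by blast
qed

lemma dilate_coord_iff:
  fixes m x :: "real^'n"
  assumes "0 < c"
  shows "m + (1 / c) *\<^sub>R (x - m) \<in> open_cube m s \<longleftrightarrow> x \<in> open_cube m (c * s)"
    "m + (1 / c) *\<^sub>R (x - m) \<in> closed_cube m s \<longleftrightarrow> x \<in> closed_cube m (c * s)"
proof -
  have "m $ i - s / 2 < m $ i + (1 / c) * (x $ i - m $ i) \<longleftrightarrow> m $ i - c * s / 2 < x $ i"
    "m $ i + (1 / c) * (x $ i - m $ i) < m $ i + s / 2 \<longleftrightarrow> x $ i < m $ i + c * s / 2"
    "m $ i - s / 2 \<le> m $ i + (1 / c) * (x $ i - m $ i) \<longleftrightarrow> m $ i - c * s / 2 \<le> x $ i"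
    "m $ i + (1 / c) * (x $ i - m $ i) \<le> m $ i + s / 2 \<longleftrightarrow> x $ i \<le> m $ i + c * s / 2" for i
    using assms by (auto simp: field_simps)
  then show "m + (1 / c) *\<^sub>R (x - m) \<in> open_cube m s \<longleftrightarrow> x \<in> open_cube m (c * s)"
    "m + (1 / c) *\<^sub>R (x - m) \<in> closed_cube m s \<longleftrightarrow> x \<in> closed_cube m (c * s)"
    unfolding mem_open_cube mem_closed_cube by simp_all
qed

lemma cube_at_dilate:
  assumes "cube_at Q m s" "0 < c" shows "cube_at (dilate c Q) m (c * s)"
  using assms dilate_coord_iff[OF assms(2), of m _ s] mem_dilate[OF assms]
  unfolding cube_at_def by (simp add: subset_iff) blast

lemma dilate_open_cube:
  assumes "0 < s" "0 < c" shows "dilate c (open_cube m s) = open_cube m (c * s)"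
  using mem_dilate[OF cube_at_open_cube[OF assms(1)] assms(2)] dilate_coord_iff(1)[OF assms(2)]
  by blast

lemma cube_at_interior:
  assumes "cube_at Q m s" shows "interior Q = open_cube m s"
proof
  show "interior Q \<subseteq> open_cube m s"
    using interior_mono[of Q "closed_cube m s"] assms by (auto simp: cube_at_def interior_cbox)
  show "open_cube m s \<subseteq> interior Q"
    using assms by (intro interior_maximal) (auto simp: cube_at_def open_box)
qed

text \<open>Each factor of a cube is squeezed between an open and a closed interval with the same end points.\<close>

lemma interval_between:
  assumes "is_interval I" "emeasure lborel I = ennreal l" "0 < l"
  obtains a where "{a<..<a + l} \<subseteq> I" "I \<subseteq> {a..a + (l::real)}"
proof -
  have I: "I \<in> sets lborel" using assms(2,3) emeasure_notin_sets by fastforce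
  have ne: "I \<noteq> {}" using assms by auto
  have d: "y - x \<le> l" if "x \<in> I" "y \<in> I" for x y
  proof (cases "x \<le> y")
    case True
    have "t \<in> I" if "x \<le> t" "t \<le> y" for t
      using that \<open>x \<in> I\<close> \<open>y \<in> I\<close> assms(1) unfolding is_interval_1 by blast
    then have "{x..y} \<subseteq> I" by auto
    then have "emeasure lborel {x..y} \<le> ennreal l" using emeasure_mono[of "{x..y}" I lborel] I assms(2) by simp
    then show ?thesis using True assms(3) by simp
  qed (use assms(3) in simp)
  obtain z where z: "z \<in> I" using ne by blast
  have b: "bdd_below I" "bdd_above I"
  proof -
    show "bdd_below I" by (rule bdd_belowI[of _ "z - l"]) (use d[OF _ z] in \<open>simp add: algebra_simps\<close>)
    show "bdd_above I" by (rule bdd_aboveI[of _ "z + l"]) (use d[OF z] in \<open>simp add: algebra_simps\<close>)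
  qed
  define a where "a = Inf I"
  define c where "c = Sup I"
  have sub: "I \<subseteq> {a..c}" using b by (auto simp: a_def c_def intro: cInf_lower cSup_upper)
  have sup: "{a<..<c} \<subseteq> I"
  proof
    fix t assume t: "t \<in> {a<..<c}"
    obtain x where "x \<in> I" "x < t" using t cInf_lessD[OF ne] by (auto simp: a_def)
    moreover obtain y where "y \<in> I" "t < y" using t less_cSupD[OF ne] by (auto simp: c_def)
    ultimately show "t \<in> I" using assms(1) unfolding is_interval_1 by (meson less_imp_le)
  qed
  have ac: "a \<le> c" using sub z by auto
  have "emeasure lborel I \<le> emeasure lborel {a..c}" by (rule emeasure_mono) (use sub in auto)
  moreover have "emeasure lborel {a<..<c} \<le> emeasure lborel I" by (rule emeasure_mono) (use sup I in auto)
  ultimately have "l \<le> c - a \<and> c - a \<le> l" using ac assms(2,3) by (simp add: ennreal_le_iff)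
  then have "c = a + l" by simp
  with sub sup show ?thesis using that by blast
qed

lemma is_cube_imp_cube_at:
  assumes "is_cube (Q :: (real^'n) set)" obtains m s where "cube_at Q m s"
proof -
  obtain I l where l: "0 < l" and I: "\<And>i. is_interval (I i)" "\<And>i. emeasure lborel (I i) = ennreal l"
    and Q: "Q = {x. \<forall>i. x $ i \<in> I i}"
    using assms unfolding is_cube_def by metis
  have "\<exists>a. {a<..<a + l} \<subseteq> I i \<and> I i \<subseteq> {a..a + l}" for i
    using interval_between[OF I(1) I(2) l, of i] by metis
  then obtain a where a: "\<And>i. {a i<..<a i + l} \<subseteq> I i" "\<And>i. I i \<subseteq> {a i..a i + l}" by metis
  have "a i < t \<and> t < a i + l \<Longrightarrow> t \<in> I i" "t \<in> I i \<Longrightarrow> a i \<le> t \<and> t \<le> a i + l" for i t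
    using a[of i] by auto
  then have "cube_at Q (\<chi> i. a i + l / 2) l"
    unfolding cube_at_def subset_iff mem_open_cube mem_closed_cube Q using l
    by (simp add: add.commute[of l])
  then show ?thesis by (rule that)
qed

lemma is_cube_open_cube:
  assumes "0 < s" shows "is_cube (open_cube m s)"
  unfolding is_cube_def
proof (intro exI conjI allI)
  show "0 < s" by fact
  show "is_interval {m $ i - s / 2<..<m $ i + s / 2}" for i by (simp add: is_interval_1)
  show "emeasure lborel {m $ i - s / 2<..<m $ i + s / 2} = ennreal s" for i using assms by simp
  show "open_cube m s = {x. \<forall>i. x $ i \<in> {m $ i - s / 2<..<m $ i + s / 2}}"
    by (auto simp: mem_box_cart)
qed

lemma cube_at_avg:
  assumes "cube_at Q m s" shows "avg Q p h = avg (open_cube m s) p h"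
  using cube_at_AE_open[OF assms] cube_at_sets[OF assms] by (intro avg_cong_set) auto

lemma open_cube_mono:
  fixes m :: "real^'n"
  assumes "\<And>i. \<bar>m $ i - m' $ i\<bar> \<le> (s' - s) / 2"
  shows "open_cube m s \<subseteq> open_cube m' s'" "closed_cube m s \<subseteq> closed_cube m' s'"
proof -
  have "m' $ i - s' / 2 \<le> m $ i - s / 2 \<and> m $ i + s / 2 \<le> m' $ i + s' / 2" for i
    using abs_le_D1[OF assms[of i]] abs_le_D2[OF assms[of i]] unfolding minus_diff_eq diff_divide_distrib by linarith
  then show "open_cube m s \<subseteq> open_cube m' s'" "closed_cube m s \<subseteq> closed_cube m' s'"
    unfolding subset_iff mem_open_cube mem_closed_cube by (meson le_less_trans less_le_trans order_trans)+
qed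

text \<open>A cube inside another one has its centre at a distance that the difference of the side lengths
  controls; this is how inclusions are transferred to dilates.\<close>

lemma cube_at_subset_centers:
  fixes m :: "real^'n"
  assumes "cube_at Q m s" "cube_at Q' m' s'" "Q \<subseteq> Q'"
  shows "\<bar>m $ i - m' $ i\<bar> \<le> (s' - s) / 2"
proof -
  have s: "0 < s" using assms(1) by (simp add: cube_at_def)
  have sub: "open_cube m s \<subseteq> closed_cube m' s'" using assms unfolding cube_at_def by blast
  have "box (m - vec (s/2)) (m + vec (s/2)) \<noteq> {}" using s by (simp add: interval_ne_empty_cart)
  then have "closure (box (m - vec (s/2)) (m + vec (s/2))) = closed_cube m s" by (rule closure_box)
  then have "closed_cube m s \<subseteq> closed_cube m' s'"
    using closure_mono[OF sub] by simp
  moreover have "m - vec (s/2) \<in> closed_cube m s" "m + vec (s/2) \<in> closed_cube m s"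
    using s by (auto simp: mem_closed_cube)
  ultimately have "m - vec (s/2) \<in> closed_cube m' s'" "m + vec (s/2) \<in> closed_cube m' s'" by blast+
  then have "m' $ i - s' / 2 \<le> m $ i - s / 2" "m $ i + s / 2 \<le> m' $ i + s' / 2"
    unfolding mem_closed_cube by simp_all
  then show ?thesis unfolding abs_le_iff by (simp add: field_simps)
qed

lemma smoothened_eq:
  assumes "cube_at Q m s"
  shows "smoothened O0 Q = (\<lambda>x. (1 / s) *\<^sub>R (x - m)) -` O0"
  by (simp add: smoothened_def cube_at_center[OF assms] cube_at_side[OF assms])

lemma smoothened_bounds:
  fixes m :: "real^'n"
  assumes Q: "cube_at Q m s"
    and O0: "open O0" "cbox (\<chi> i. - (299 / 200)) (\<chi> i. 299 / 200) \<subseteq> O0"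
      "O0 \<subseteq> cbox (\<chi> i. - (3 / 2)) (\<chi> i. 3 / 2)"
  shows "open (smoothened O0 Q)" "open_cube m (299 / 100 * s) \<subseteq> smoothened O0 Q"
    "smoothened O0 Q \<subseteq> open_cube m (3 * s)"
proof -
  have s: "0 < s" using Q by (simp add: cube_at_def)
  show op: "open (smoothened O0 Q)" unfolding smoothened_eq[OF Q]
    by (intro open_vimage O0 continuous_intros)
  have eq: "- b \<le> (1 / s) * (y - k) \<longleftrightarrow> k - b * s \<le> y"
      "(1 / s) * (y - k) \<le> b \<longleftrightarrow> y \<le> k + b * s" for b y k :: real
    using s by (auto simp: field_simps)
  show "open_cube m (299 / 100 * s) \<subseteq> smoothened O0 Q"
  proof
    fix x assume x: "x \<in> open_cube m (299 / 100 * s)"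
    have "(1 / s) *\<^sub>R (x - m) \<in> cbox (\<chi> i. - (299 / 200)) (\<chi> i. 299 / 200)"
      using x unfolding mem_open_cube mem_box_cart vector_scaleR_component vec_lambda_beta
        vector_minus_component real_scaleR_def eq by (auto simp: less_imp_le)
    then show "x \<in> smoothened O0 Q" using O0 unfolding smoothened_eq[OF Q] by auto
  qed
  have "smoothened O0 Q \<subseteq> closed_cube m (3 * s)"
  proof
    fix x assume "x \<in> smoothened O0 Q"
    then have "(1 / s) *\<^sub>R (x - m) \<in> cbox (\<chi> i. - (3 / 2)) (\<chi> i. 3 / 2)"
      using O0 unfolding smoothened_eq[OF Q] by auto
    then show "x \<in> closed_cube m (3 * s)"
      unfolding mem_closed_cube mem_box_cart vector_scaleR_component vec_lambda_beta
        vector_minus_component real_scaleR_def eq by (auto simp: algebra_simps)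
  qed
  then have "interior (smoothened O0 Q) \<subseteq> interior (closed_cube m (3 * s))" by (rule interior_mono)
  then show "smoothened O0 Q \<subseteq> open_cube m (3 * s)"
    using op by (simp add: interior_open interior_cbox)
qed

section \<open>Dyadic cubes\<close>

text \<open>The dyadic cube of generation k that contains the point x, in the grid generated by the half-open
  cube with centre m and side s.  Indexing by points makes nestedness and countability immediate.\<close>

definition dyad :: "real^'n \<Rightarrow> real \<Rightarrow> nat \<Rightarrow> real^'n \<Rightarrow> (real^'n) set" where
  "dyad m s k x = {y. \<forall>i. \<lfloor>2 ^ k * ((y $ i - m $ i) / s + 1 / 2)\<rfloor> = \<lfloor>2 ^ k * ((x $ i - m $ i) / s + 1 / 2)\<rfloor>}"

definition dyad_center :: "real^'n \<Rightarrow> real \<Rightarrow> nat \<Rightarrow> real^'n \<Rightarrow> real^'n" where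
  "dyad_center m s k x =
     (\<chi> i. m $ i - s / 2 + s / 2 ^ k * (of_int \<lfloor>2 ^ k * ((x $ i - m $ i) / s + 1 / 2)\<rfloor> + 1 / 2))"

lemma dyad_self [simp]: "x \<in> dyad m s k x"
  by (simp add: dyad_def)

lemma dyad_eq: "y \<in> dyad m s k x \<Longrightarrow> dyad m s k y = dyad m s k x"
  by (auto simp: dyad_def)

lemma dyad_mono:
  assumes "j \<le> k" shows "dyad m s k x \<subseteq> dyad m s j x"
proof -
  have "\<lfloor>2 ^ j * t\<rfloor> = \<lfloor>2 ^ k * t\<rfloor> div 2 ^ (k - j)" for t :: real
  proof -
    have "(2::real) ^ k = 2 ^ j * 2 ^ (k - j)" using assms by (simp flip: power_add)
    then have "2 ^ j * t = (2 ^ k * t) / real_of_int (2 ^ (k - j))" by simp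
    also have "\<lfloor>\<dots>\<rfloor> = \<lfloor>2 ^ k * t\<rfloor> div 2 ^ (k - j)" by (rule floor_divide_real_eq_div) simp
    finally show ?thesis .
  qed
  then show ?thesis by (auto simp: dyad_def)
qed

lemma mem_dyad_iff:
  assumes "0 < s"
  shows "y \<in> dyad m s k x \<longleftrightarrow> (\<forall>i. dyad_center m s k x $ i - (s / 2 ^ k) / 2 \<le> y $ i \<and>
    y $ i < dyad_center m s k x $ i + (s / 2 ^ k) / 2)"
proof -
  have "\<lfloor>2 ^ k * ((y $ i - m $ i) / s + 1 / 2)\<rfloor> = j \<longleftrightarrow>
      m $ i - s / 2 + s / 2 ^ k * (of_int j + 1 / 2) - (s / 2 ^ k) / 2 \<le> y $ i \<and>
      y $ i < m $ i - s / 2 + s / 2 ^ k * (of_int j + 1 / 2) + (s / 2 ^ k) / 2" for i j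
  proof -
    define w where "w = s / 2 ^ k"
    have w: "0 < w" "2 ^ k * ((y $ i - m $ i) / s + 1 / 2) = (y $ i - m $ i + s / 2) / w"
      using assms by (auto simp: w_def field_simps)
    have "\<lfloor>(y $ i - m $ i + s / 2) / w\<rfloor> = j \<longleftrightarrow>
       of_int j * w \<le> y $ i - m $ i + s / 2 \<and> y $ i - m $ i + s / 2 < (of_int j + 1) * w"
      unfolding floor_eq_iff using w(1) by (simp add: le_divide_eq divide_less_eq)
    then show ?thesis unfolding w(2) w_def[symmetric] by (auto simp: algebra_simps)
  qed
  then show ?thesis by (simp add: dyad_def dyad_center_def)
qed

lemma cube_at_dyad:
  assumes "0 < s" shows "cube_at (dyad m s k x) (dyad_center m s k x) (s / 2 ^ k)"
  unfolding cube_at_def subset_iff mem_open_cube mem_closed_cube mem_dyad_iff[OF assms]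
  using assms by (simp; meson less_imp_le)

lemma countable_dyads:
  fixes m :: "real^'n"
  shows "countable (range (\<lambda>(k, x). dyad m s k x))"
proof -
  have "range (\<lambda>(k, x). dyad m s k x) \<subseteq>
     range (\<lambda>(k, j). {y. \<forall>i. \<lfloor>2 ^ k * ((y $ i - m $ i) / s + 1 / 2)\<rfloor> = (j :: int^'n) $ i})"
  proof (clarsimp simp: dyad_def)
    fix k and x :: "real^'n"
    show "{y. \<forall>i. \<lfloor>2 ^ k * ((y $ i - m $ i) / s + 1 / 2)\<rfloor> = \<lfloor>2 ^ k * ((x $ i - m $ i) / s + 1 / 2)\<rfloor>}
      \<in> range (\<lambda>(k, j). {y. \<forall>i. \<lfloor>2 ^ k * ((y $ i - m $ i) / s + 1 / 2)\<rfloor> = (j :: int^'n) $ i})"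
      by (rule range_eqI[of _ _ "(k, \<chi> i. \<lfloor>2 ^ k * ((x $ i - m $ i) / s + 1 / 2)\<rfloor>)"]) simp
  qed
  then show ?thesis by (rule countable_subset) simp
qed

lemma dyad_nested:
  assumes "j \<le> k" "dyad m s k x \<inter> dyad m s j y \<noteq> {}"
  shows "dyad m s k x \<subseteq> dyad m s j y"
proof -
  obtain z where z: "z \<in> dyad m s k x" "z \<in> dyad m s j y" using assms(2) by blast
  have "dyad m s k z \<subseteq> dyad m s j z" by (rule dyad_mono) fact
  then show ?thesis using z dyad_eq by metis
qed

lemma mem_std_dyadic:
  "z \<in> std_dyadic K j \<longleftrightarrow> (\<forall>i. 2 powi K * of_int (j $ i) \<le> z $ i \<and> z $ i < 2 powi K * (of_int (j $ i) + 1))"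
proof -
  define w :: real where "w = 2 powi K"
  have w: "0 < w" by (simp add: w_def)
  have "z \<in> std_dyadic K j \<longleftrightarrow> (1 / w) *\<^sub>R z - (\<chi> i. real_of_int (j $ i)) \<in> unit_cube" (is "?L \<longleftrightarrow> ?R")
  proof
    assume ?L then show ?R using w by (auto simp: std_dyadic_def w_def[symmetric])
  next
    assume ?R
    moreover have "z = w *\<^sub>R (((1 / w) *\<^sub>R z - (\<chi> i. real_of_int (j $ i))) + (\<chi> i. real_of_int (j $ i)))"
      using w by simp
    ultimately show ?L unfolding std_dyadic_def w_def[symmetric] by blast
  qed
  also have "\<dots> \<longleftrightarrow> (\<forall>i. w * of_int (j $ i) \<le> z $ i \<and> z $ i < w * (of_int (j $ i) + 1))"
    using w by (auto simp: unit_cube_def field_simps)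
  finally show ?thesis by (simp add: w_def)
qed

lemma mem_dyadic_image:
  fixes m :: "real^'n"
  assumes "0 < s"
  shows "y \<in> (\<lambda>x. m + s *\<^sub>R (x - (\<chi> i. 1 / 2))) ` std_dyadic K j \<longleftrightarrow>
    (\<forall>i. 2 powi K * of_int (j $ i) \<le> (y $ i - m $ i) / s + 1 / 2 \<and>
         (y $ i - m $ i) / s + 1 / 2 < 2 powi K * (of_int (j $ i) + 1))"
proof -
  have "y \<in> (\<lambda>x. m + s *\<^sub>R (x - (\<chi> i. 1 / 2))) ` std_dyadic K j \<longleftrightarrow>
      (\<chi> i. (y $ i - m $ i) / s + 1 / 2) \<in> std_dyadic K j" (is "?L \<longleftrightarrow> ?R")
  proof
    assume ?L
    then obtain x where x: "y = m + s *\<^sub>R (x - (\<chi> i. 1 / 2))" "x \<in> std_dyadic K j" by blast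
    have "(\<chi> i. (y $ i - m $ i) / s + 1 / 2) = x" using assms x by (simp add: vec_eq_iff)
    then show ?R using x by simp
  next
    assume ?R
    moreover have "y = m + s *\<^sub>R ((\<chi> i. (y $ i - m $ i) / s + 1 / 2) - (\<chi> i. 1 / 2))"
      using assms by (simp add: vec_eq_iff)
    ultimately show ?L by blast
  qed
  then show ?thesis by (simp add: mem_std_dyadic)
qed

lemma dyad_in_dyadic_subcubes:
  assumes Q: "cube_at Q0 m s" and x: "x \<in> dyad m s 0 m"
  shows "dyad m s k x \<in> dyadic_subcubes Q0"
proof -
  have s: "0 < s" using Q by (simp add: cube_at_def)
  define j where "j = (\<chi> i. \<lfloor>2 ^ k * ((x $ i - m $ i) / s + 1 / 2)\<rfloor>)"
  have p: "(2::real) powi (- int k) = 1 / 2 ^ k" by (simp add: power_int_minus inverse_eq_divide)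
  have *: "\<lfloor>2 ^ k * t\<rfloor> = i \<longleftrightarrow> 2 powi (- int k) * of_int i \<le> t \<and> t < 2 powi (- int k) * (of_int i + 1)"
    for t :: real and i
    unfolding floor_eq_iff p by (auto simp: field_simps)
  have eq: "dyad m s k x = (\<lambda>x. m + s *\<^sub>R (x - (\<chi> i. 1 / 2))) ` std_dyadic (- int k) j"
    by (rule set_eqI, subst mem_dyadic_image[OF s]) (simp add: dyad_def j_def * del: floor_eq_iff)
  have sub: "std_dyadic (- int k) j \<subseteq> unit_cube"
  proof
    fix z assume z: "z \<in> std_dyadic (- int k) j"
    then have "m + s *\<^sub>R (z - (\<chi> i. 1 / 2)) \<in> dyad m s k x" unfolding eq by blast
    moreover have "dyad m s k x \<subseteq> dyad m s 0 m" using dyad_mono[of 0 k m s x] dyad_eq[OF x] by simp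
    ultimately have "m + s *\<^sub>R (z - (\<chi> i. 1 / 2)) \<in> dyad m s 0 m" by blast
    then have "\<lfloor>z $ i\<rfloor> = \<lfloor>1 / 2 :: real\<rfloor>" for i using s by (simp add: dyad_def)
    moreover have "\<lfloor>1 / 2 :: real\<rfloor> = 0" by linarith
    ultimately show "z \<in> unit_cube" by (auto simp: unit_cube_def floor_eq_iff)
  qed
  show ?thesis unfolding dyadic_subcubes_def cube_at_center[OF Q] cube_at_side[OF Q]
    using eq sub by blast
qed

lemma dyadic_subcubes_cube_at:
  assumes Q: "cube_at Q0 m s" and P: "P \<in> dyadic_subcubes Q0"
  obtains c r where "cube_at P c r" "r \<le> s"
proof -
  have s: "0 < s" using Q by (simp add: cube_at_def)
  obtain K j where Pe: "P = (\<lambda>x. m + s *\<^sub>R (x - (\<chi> i. 1 / 2))) ` std_dyadic K j"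
    and sub: "std_dyadic K j \<subseteq> unit_cube"
    using P unfolding dyadic_subcubes_def cube_at_center[OF Q] cube_at_side[OF Q] by blast
  define w :: real where "w = 2 powi K"
  have w: "0 < w" by (simp add: w_def)
  have "cube_at (std_dyadic K j) (\<chi> i. w * (of_int (j $ i) + 1 / 2)) w"
    using w unfolding cube_at_def subset_iff mem_std_dyadic mem_open_cube mem_closed_cube w_def[symmetric]
    by (auto simp: algebra_simps less_imp_le)
  moreover have "cube_at unit_cube (\<chi> i. 1 / 2) 1"
    unfolding cube_at_def subset_iff mem_open_cube mem_closed_cube unit_cube_def by (auto simp: less_imp_le)
  ultimately have "\<bar>(\<chi> i. w * (of_int (j $ i) + 1 / 2)) $ i - (\<chi> i. 1 / 2) $ i\<bar> \<le> (1 - w) / 2" for i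
    using sub by (rule cube_at_subset_centers)
  from order_trans[OF abs_ge_zero this] have w1: "w \<le> 1" by simp
  have "cube_at P (\<chi> i. m $ i + s * (w * (of_int (j $ i) + 1 / 2) - 1 / 2)) (s * w)"
  proof -
    have *: "A \<le> (y $ i - m $ i) / s + 1 / 2 \<longleftrightarrow> m $ i + s * A - s / 2 \<le> y $ i"
      "(y $ i - m $ i) / s + 1 / 2 < A \<longleftrightarrow> y $ i < m $ i + s * A - s / 2" for A y i
      using s by (simp_all add: field_simps)
    have 1: "m $ i + s * (2 powi K * of_int (j $ i)) - s / 2 =
        m $ i + s * (w * (of_int (j $ i) + 1 / 2) - 1 / 2) - s * w / 2" for i
      by (simp add: w_def[symmetric] algebra_simps)
    have 2: "m $ i + s * (2 powi K * (of_int (j $ i) + 1)) - s / 2 =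
        m $ i + s * (w * (of_int (j $ i) + 1 / 2) - 1 / 2) + s * w / 2" for i
      by (simp add: w_def[symmetric] field_simps)
    have "y \<in> P \<longleftrightarrow> (\<forall>i. m $ i + s * (w * (of_int (j $ i) + 1 / 2) - 1 / 2) - s * w / 2 \<le> y $ i \<and>
       y $ i < m $ i + s * (w * (of_int (j $ i) + 1 / 2) - 1 / 2) + s * w / 2)" for y
      unfolding Pe mem_dyadic_image[OF s] * 1 2 ..
    then show ?thesis using s w unfolding cube_at_def subset_iff mem_open_cube mem_closed_cube
      by (simp add: less_imp_le)
  qed
  then show ?thesis using that s w1 by (simp add: mult_le_cancel_left1)
qed

lemma countable_dyadic_subcubes: "countable (dyadic_subcubes Q0)"
proof -
  have "dyadic_subcubes Q0 \<subseteq> range (\<lambda>(k, j). (\<lambda>x. center Q0 + side Q0 *\<^sub>R (x - (\<chi> i. 1 / 2))) ` std_dyadic k j)"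
    by (auto simp: dyadic_subcubes_def)
  then show ?thesis by (rule countable_subset) simp
qed

section \<open>The maximal function is of weak type\<close>

lemma dyadic_maximal_superlevel:
  "{x. t < dyadic_maximal Q0 h x} = \<Union>{P \<in> dyadic_subcubes Q0. t < avg (dilate 3 P) 1 h}"
  by (auto simp: dyadic_maximal_def less_SUP_iff split: split_indicator_asm)
     (auto simp: indicator_def)

lemma dyadic_maximal_superlevel_sets:
  assumes "cube_at Q0 m s" shows "{x. t < dyadic_maximal Q0 h x} \<in> sets lebesgue"
proof -
  have "P \<in> sets lebesgue" if "P \<in> dyadic_subcubes Q0" for P
    using dyadic_subcubes_cube_at[OF assms that] cube_at_sets by metis
  moreover have "countable {P \<in> dyadic_subcubes Q0. t < avg (dilate 3 P) 1 h}"
    by (rule countable_subset[OF _ countable_dyadic_subcubes[of Q0]]) auto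
  ultimately show ?thesis unfolding dyadic_maximal_superlevel
    by (intro sets.countable_Union) auto
qed

lemma emeasure_UN_le_nn_integral_count_space:
  assumes I: "countable I" and X: "\<And>i. i \<in> I \<Longrightarrow> X i \<in> sets M"
  shows "emeasure M (\<Union>i\<in>I. X i) \<le> (\<integral>\<^sup>+i. emeasure M (X i) \<partial>count_space I)"
proof -
  have "emeasure M (\<Union>i\<in>I. X i) = (\<integral>\<^sup>+x. indicator (\<Union>i\<in>I. X i) x \<partial>M)"
    using I X by (intro nn_integral_indicator[symmetric] sets.countable_UN') auto
  also have "\<dots> \<le> (\<integral>\<^sup>+x. (\<integral>\<^sup>+i. indicator (X i) x \<partial>count_space I) \<partial>M)"
  proof (rule nn_integral_mono)
    fix x
    show "indicator (\<Union>i\<in>I. X i) x \<le> (\<integral>\<^sup>+i. indicator (X i) x \<partial>count_space I)"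
    proof (cases "x \<in> (\<Union>i\<in>I. X i)")
      case True
      then obtain i where i: "i \<in> I" "x \<in> X i" by blast
      have "indicator (X i) x \<le> (\<integral>\<^sup>+i. indicator (X i) x \<partial>count_space I)"
        by (rule nn_integral_ge_point[OF i(1)])
      then show ?thesis using i True by simp
    qed simp
  qed
  also have "\<dots> = (\<integral>\<^sup>+i. (\<integral>\<^sup>+x. indicator (X i) x \<partial>M) \<partial>count_space I)"
    by (rule nn_integral_count_space_nn_integral) (use I X in auto)
  also have "\<dots> = (\<integral>\<^sup>+i. emeasure M (X i) \<partial>count_space I)"
    using X by (intro nn_integral_cong) auto
  finally show ?thesis .
qed

lemma closed_cube_subset_ball:
  fixes c :: "real^'n"
  assumes "0 < r" shows "closed_cube c (3 * r) \<subseteq> ball c (2 * real CARD('n) * r)"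
proof
  fix x assume x: "x \<in> closed_cube c (3 * r)"
  have "norm (x - c) \<le> (\<Sum>i\<in>UNIV. \<bar>(x - c) $ i\<bar>)" by (rule norm_le_l1_cart)
  also have "\<dots> \<le> (\<Sum>i\<in>(UNIV::'n set). 3 * r / 2)"
  proof (rule sum_mono)
    fix i
    have "c $ i - 3 * r / 2 \<le> x $ i" "x $ i \<le> c $ i + 3 * r / 2" using x by (auto simp: mem_closed_cube)
    then show "\<bar>(x - c) $ i\<bar> \<le> 3 * r / 2" unfolding vector_minus_component by linarith
  qed
  also have "\<dots> < 2 * real CARD('n) * r" using assms by simp
  finally show "x \<in> ball c (2 * real CARD('n) * r)" by (simp add: dist_norm norm_minus_commute)
qed

text \<open>Vitali's covering lemma for balls that are comparable with the cubes.\<close>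

lemma dyadic_maximal_weak_bound:
  fixes Q0 :: "(real^'n) set"
  assumes Q: "cube_at Q0 m s" and h: "h \<in> borel_measurable lebesgue" and t: "0 < t"
  shows "ennreal t * vol {x. ennreal t < dyadic_maximal Q0 h x} \<le>
    ennreal (unit_ball_vol (real CARD('n)) * (10 * real CARD('n)) ^ CARD('n)) * (\<integral>\<^sup>+x. ennreal \<bar>h x\<bar> \<partial>lebesgue)"
proof -
  let ?n = "real CARD('n)"
  have n: "?n \<ge> 1" by (simp add: Suc_le_eq)
  define K where "K = {P \<in> dyadic_subcubes Q0. ennreal t < avg (dilate 3 P) 1 h}"
  have "\<exists>c r. cube_at P c r \<and> r \<le> s" if "P \<in> K" for P
    using dyadic_subcubes_cube_at[OF Q] that by (metis (no_types, lifting) K_def mem_Collect_eq)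
  then obtain c r where cr: "\<And>P. P \<in> K \<Longrightarrow> cube_at P (c P) (r P)" "\<And>P. P \<in> K \<Longrightarrow> r P \<le> s"
    by metis
  have r0: "0 < r P" if "P \<in> K" for P using cr(1)[OF that] by (simp add: cube_at_def)
  \<comment> \<open>This ball contains 3P; its fivefold dilate has measure at most \<kappa> |3P| for the \<kappa> below.\<close>
  define R where "R P = 2 * ?n * r P" for P
  have ball3: "dilate 3 P \<subseteq> ball (c P) (R P)" if "P \<in> K" for P
    using closed_cube_subset_ball[OF r0[OF that], of "c P"] cube_at_dilate[OF cr(1)[OF that], of 3]
    unfolding cube_at_def R_def by auto
  have cl: "P \<subseteq> ball (c P) (R P)" if "P \<in> K" for P
  proof -
    have "P \<subseteq> closed_cube (c P) (r P)" using cr(1)[OF that] by (simp add: cube_at_def)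
    also have "\<dots> \<subseteq> closed_cube (c P) (3 * r P)" using r0[OF that] by (intro open_cube_mono) simp
    also have "\<dots> \<subseteq> ball (c P) (R P)" unfolding R_def by (rule closed_cube_subset_ball[OF r0[OF that]])
    finally show ?thesis .
  qed
  have cov: "\<Union>K \<subseteq> (\<Union>P\<in>K. ball (c P) (R P))" using cl by blast
  have rb: "0 < R P \<and> R P \<le> 2 * ?n * s" if "P \<in> K" for P
    using r0[OF that] cr(2)[OF that] n by (simp add: R_def)
  obtain C where C: "countable C" "C \<subseteq> K"
    "pairwise (\<lambda>i j. disjnt (ball (c i) (R i)) (ball (c j) (R j))) C"
    "\<Union>K \<subseteq> (\<Union>P\<in>C. ball (c P) (5 * R P))"
    by (rule Vitali_covering_lemma_balls[OF cov rb])
  define \<kappa> where "\<kappa> = unit_ball_vol ?n * (10 * ?n) ^ CARD('n)"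
  have \<kappa>: "0 \<le> \<kappa>" using n by (simp add: \<kappa>_def)
  have m3: "dilate 3 P \<in> sets lebesgue" if "P \<in> K" for P
    using cube_at_sets[OF cube_at_dilate[OF cr(1)[OF that], of 3]] by simp
  have e3: "vol (dilate 3 P) = ennreal ((3 * r P) ^ CARD('n))" if "P \<in> K" for P
    using cube_at_emeasure[OF cube_at_dilate[OF cr(1)[OF that], of 3]] by simp
  have one: "ennreal t * vol (ball (c P) (5 * R P)) \<le>
      ennreal \<kappa> * (\<integral>\<^sup>+x\<in>dilate 3 P. ennreal \<bar>h x\<bar> \<partial>lebesgue)" if P: "P \<in> K" for P
  proof -
    have "vol (ball (c P) (5 * R P)) = ennreal (unit_ball_vol ?n * (5 * R P) ^ CARD('n))"
      using rb[OF P] by (simp add: emeasure_ball)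
    also have "\<dots> \<le> ennreal \<kappa> * vol (dilate 3 P)"
    proof -
      have "(5 * R P) ^ CARD('n) \<le> ((10 * ?n) * (3 * r P)) ^ CARD('n)"
        using r0[OF P] n by (intro power_mono) (auto simp: R_def)
      then have "unit_ball_vol ?n * (5 * R P) ^ CARD('n) \<le> \<kappa> * (3 * r P) ^ CARD('n)"
        unfolding \<kappa>_def power_mult_distrib mult.assoc by (intro mult_left_mono) auto
      then show ?thesis using \<kappa> r0[OF P] by (simp add: e3[OF P] ennreal_mult[symmetric] ennreal_leI del: power_mult_distrib)
    qed
    finally have 1: "vol (ball (c P) (5 * R P)) \<le> ennreal \<kappa> * vol (dilate 3 P)" .
    have "ennreal t * vol (dilate 3 P) \<le> avg (dilate 3 P) 1 h * vol (dilate 3 P)"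
      using P by (intro mult_right_mono) (auto simp: K_def less_imp_le)
    also have "\<dots> = (\<integral>\<^sup>+x\<in>dilate 3 P. ennreal \<bar>h x\<bar> \<partial>lebesgue)"
      unfolding avg_1_eq e3[OF P] using r0[OF P]
      by (subst mult.commute, intro ennreal_cancel) simp
    finally have 2: "ennreal t * vol (dilate 3 P) \<le> (\<integral>\<^sup>+x\<in>dilate 3 P. ennreal \<bar>h x\<bar> \<partial>lebesgue)" .
    have "ennreal t * vol (ball (c P) (5 * R P)) \<le> ennreal t * (ennreal \<kappa> * vol (dilate 3 P))"
      by (intro mult_left_mono 1) simp
    also have "\<dots> = ennreal \<kappa> * (ennreal t * vol (dilate 3 P))" by (simp add: mult_ac)
    also have "\<dots> \<le> ennreal \<kappa> * (\<integral>\<^sup>+x\<in>dilate 3 P. ennreal \<bar>h x\<bar> \<partial>lebesgue)" by (intro mult_left_mono 2) simp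
    finally show ?thesis .
  qed
  have disj: "(\<integral>\<^sup>+P. (\<integral>\<^sup>+x\<in>dilate 3 P. ennreal \<bar>h x\<bar> \<partial>lebesgue) \<partial>count_space C) \<le> (\<integral>\<^sup>+x. ennreal \<bar>h x\<bar> \<partial>lebesgue)"
  proof -
    have "(\<integral>\<^sup>+P. (\<integral>\<^sup>+x\<in>dilate 3 P. ennreal \<bar>h x\<bar> \<partial>lebesgue) \<partial>count_space C) =
        (\<integral>\<^sup>+P. emeasure (density lebesgue (\<lambda>x. ennreal \<bar>h x\<bar>)) (dilate 3 P) \<partial>count_space C)"
      using C(2) m3 h by (intro nn_integral_cong) (auto simp: emeasure_density)
    also have "\<dots> = emeasure (density lebesgue (\<lambda>x. ennreal \<bar>h x\<bar>)) (\<Union>P\<in>C. dilate 3 P)"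
    proof (rule emeasure_UN_countable[symmetric])
      show "disjoint_family_on (dilate 3) C"
        unfolding disjoint_family_on_def
      proof (intro ballI impI)
        fix P P' assume "P \<in> C" "P' \<in> C" "P \<noteq> P'"
        then have "disjnt (ball (c P) (R P)) (ball (c P') (R P'))" using C(3) by (auto simp: pairwise_def)
        then show "dilate 3 P \<inter> dilate 3 P' = {}"
          using ball3[of P] ball3[of P'] \<open>P \<in> C\<close> \<open>P' \<in> C\<close> C(2) unfolding disjnt_def by blast
      qed
    qed (use C m3 in auto)
    also have "\<dots> \<le> emeasure (density lebesgue (\<lambda>x. ennreal \<bar>h x\<bar>)) (space lebesgue)"
      by (rule emeasure_mono) auto
    also have "\<dots> = (\<integral>\<^sup>+x. ennreal \<bar>h x\<bar> \<partial>lebesgue)" using h by (subst emeasure_density) auto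
    finally show ?thesis .
  qed
  have "vol (\<Union>K) \<le> vol (\<Union>P\<in>C. ball (c P) (5 * R P))"
    by (rule emeasure_mono[OF C(4)]) (use C(1) in auto)
  also have "\<dots> \<le> (\<integral>\<^sup>+P. vol (ball (c P) (5 * R P)) \<partial>count_space C)"
    by (rule emeasure_UN_le_nn_integral_count_space) (use C(1) in auto)
  finally have "ennreal t * vol (\<Union>K) \<le>
     ennreal t * (\<integral>\<^sup>+P. vol (ball (c P) (5 * R P)) \<partial>count_space C)"
    by (rule mult_left_mono) simp
  also have "\<dots> = (\<integral>\<^sup>+P. ennreal t * vol (ball (c P) (5 * R P)) \<partial>count_space C)"
    by (simp add: nn_integral_cmult)
  also have "\<dots> \<le> (\<integral>\<^sup>+P. ennreal \<kappa> * (\<integral>\<^sup>+x\<in>dilate 3 P. ennreal \<bar>h x\<bar> \<partial>lebesgue) \<partial>count_space C)"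
    by (rule nn_integral_mono) (use one C(2) in auto)
  also have "\<dots> = ennreal \<kappa> * (\<integral>\<^sup>+P. (\<integral>\<^sup>+x\<in>dilate 3 P. ennreal \<bar>h x\<bar> \<partial>lebesgue) \<partial>count_space C)"
    by (simp add: nn_integral_cmult)
  also have "\<dots> \<le> ennreal \<kappa> * (\<integral>\<^sup>+x. ennreal \<bar>h x\<bar> \<partial>lebesgue)" by (intro mult_left_mono disj) simp
  finally show ?thesis unfolding dyadic_maximal_superlevel K_def \<kappa>_def .
qed

lemma Lp_norm_1_UNIV: "Lp_norm 1 UNIV h = (\<integral>\<^sup>+x. ennreal (norm (h x)) \<partial>lebesgue)"
  by (simp add: Lp_norm_def)

text \<open>The supremum defining the norm is bounded by the constant of the covering argument.\<close>

lemma maximal_weak_norm_finite: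
  fixes Q0 :: "(real^'n) set"
  assumes Q: "cube_at Q0 m s"
  shows "maximal_weak_norm Q0 < top"
proof -
  define \<kappa> where "\<kappa> = ennreal (unit_ball_vol (real CARD('n)) * (10 * real CARD('n)) ^ CARD('n))"
  have "weak_L1_norm (dyadic_maximal Q0 h) / Lp_norm 1 UNIV h \<le> \<kappa>" if h: "Lp 1 UNIV h" for h
  proof -
    have hm: "h \<in> borel_measurable lebesgue" using h by (simp add: Lp_def lebesgue_on_UNIV_eq)
    have w: "weak_L1_norm (dyadic_maximal Q0 h) \<le> \<kappa> * Lp_norm 1 UNIV h"
      unfolding weak_L1_norm_def \<kappa>_def Lp_norm_1_UNIV real_norm_def
      by (rule SUP_least) (use dyadic_maximal_weak_bound[OF Q hm] in auto)
    show ?thesis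
    proof (cases "Lp_norm 1 UNIV h = 0")
      case True
      then show ?thesis using w by simp
    next
      case False
      then show ?thesis using w by (intro divide_le_posI_ennreal) (auto simp: mult.commute zero_less_iff_neq_zero)
    qed
  qed
  then have "maximal_weak_norm Q0 \<le> \<kappa>" unfolding maximal_weak_norm_def by (intro SUP_least) auto
  also have "\<kappa> < top" by (simp add: \<kappa>_def)
  finally show ?thesis .
qed

lemma maximal_weak_type:
  fixes Q0 :: "(real^'n) set"
  assumes Q: "cube_at Q0 m s" and h: "h \<in> borel_measurable lebesgue"
    and fin: "(\<integral>\<^sup>+x. ennreal \<bar>h x\<bar> \<partial>lebesgue) < top" and t: "0 < t"
  shows "ennreal t * vol {x. ennreal t < dyadic_maximal Q0 h x} \<le>
    maximal_weak_norm Q0 * (\<integral>\<^sup>+x. ennreal \<bar>h x\<bar> \<partial>lebesgue)"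
proof -
  let ?I = "\<integral>\<^sup>+x. ennreal \<bar>h x\<bar> \<partial>lebesgue"
  have h1: "Lp 1 UNIV h" using h fin by (simp add: Lp_def lebesgue_on_UNIV_eq)
  have "weak_L1_norm (dyadic_maximal Q0 h) / ?I \<le> maximal_weak_norm Q0"
    unfolding maximal_weak_norm_def using h1
    by (intro SUP_upper2[of h]) (auto simp: Lp_norm_1_UNIV)
  moreover have "ennreal t * vol {x. ennreal t < dyadic_maximal Q0 h x} \<le>
      weak_L1_norm (dyadic_maximal Q0 h)"
    unfolding weak_L1_norm_def using t by (intro SUP_upper) auto
  ultimately have le: "ennreal t * vol {x. ennreal t < dyadic_maximal Q0 h x} / ?I \<le> maximal_weak_norm Q0"
    by (meson divide_right_mono_ennreal order_trans)
  show ?thesis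
  proof (cases "?I = 0")
    case True
    then show ?thesis using le maximal_weak_norm_finite[OF Q]
      by (cases "ennreal t * vol {x. ennreal t < dyadic_maximal Q0 h x} = 0")
         (auto simp: ennreal_divide_zero top_unique)
  next
    case False
    then obtain I where I: "?I = ennreal I" "0 < I" using fin
      by (cases ?I) (auto simp: less_eq_real_def)
    from mult_left_mono[OF le, of ?I] show ?thesis
      unfolding I(1) ennreal_cancel[OF I(2)] by (simp add: mult.commute)
  qed
qed

text \<open>The form in which the weak type estimate chooses the stopping threshold; the
  threshold may be zero.\<close>

lemma maximal_weak_type_threshold:
  fixes Q0 :: "(real^'n) set"
  assumes Q: "cube_at Q0 m s" and h: "h \<in> borel_measurable lebesgue"
    and fin: "(\<integral>\<^sup>+x. ennreal \<bar>h x\<bar> \<partial>lebesgue) < top"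
    and t: "0 \<le> t" and le: "maximal_weak_norm Q0 * (\<integral>\<^sup>+x. ennreal \<bar>h x\<bar> \<partial>lebesgue) \<le> ennreal t * c"
  shows "vol {x. ennreal t < dyadic_maximal Q0 h x} \<le> c"
proof -
  \<comment> \<open>The weak type inequality concerns positive thresholds only, so t is approached from above.\<close>
  define S where "S i = {x. ennreal (t + 1 / Suc i) < dyadic_maximal Q0 h x}" for i :: nat
  have Sm: "S i \<in> sets lebesgue" for i unfolding S_def by (rule dyadic_maximal_superlevel_sets[OF Q])
  have "vol (S i) \<le> c" for i
  proof -
    define r where "r = t + 1 / Suc i"
    have r: "0 < r" "t \<le> r" using t by (auto simp: r_def add_nonneg_pos)
    have "ennreal r * vol (S i) \<le> ennreal t * c"
      using maximal_weak_type[OF Q h fin r(1)] le unfolding S_def r_def by (rule order_trans)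
    also have "\<dots> \<le> ennreal r * c" using r by (intro mult_right_mono ennreal_leI) auto
    finally show ?thesis using r by (subst (asm) ennreal_mult_le_mult_iff) auto
  qed
  moreover have "{x. ennreal t < dyadic_maximal Q0 h x} = (\<Union>i. S i)"
  proof (intro equalityI subsetI)
    fix x assume "x \<in> {x. ennreal t < dyadic_maximal Q0 h x}"
    then have x: "ennreal t < dyadic_maximal Q0 h x" by simp
    show "x \<in> (\<Union>i. S i)"
    proof (cases "dyadic_maximal Q0 h x")
      case (real r)
      then have "t < r" using x t by (simp add: ennreal_less_iff)
      then obtain i where "1 / Suc i < r - t" using nat_approx_posE[of "r - t"] by auto
      then have "ennreal (t + 1 / Suc i) < ennreal r"
        using t by (simp add: ennreal_less_iff del: ennreal_plus)
      then have "x \<in> S i" using real by (simp add: S_def del: ennreal_plus)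
      then show ?thesis by blast
    next
      case top
      then have "x \<in> S 0" by (simp add: S_def)
      then show ?thesis by blast
    qed
  next
    fix x assume "x \<in> (\<Union>i. S i)"
    then obtain i where "ennreal (t + 1 / Suc i) < dyadic_maximal Q0 h x" by (auto simp: S_def)
    moreover have "ennreal t \<le> ennreal (t + 1 / Suc i)" by (intro ennreal_leI) simp
    ultimately have "ennreal t < dyadic_maximal Q0 h x" by (rule le_less_trans[rotated])
    then show "x \<in> {x. ennreal t < dyadic_maximal Q0 h x}" by simp
  qed
  moreover have "incseq S"
  proof (rule incseq_SucI, rule subsetI)
    fix i x assume "x \<in> S i"
    then have "ennreal (t + 1 / Suc i) < dyadic_maximal Q0 h x" by (simp only: S_def mem_Collect_eq)
    moreover have "ennreal (t + 1 / Suc (Suc i)) \<le> ennreal (t + 1 / Suc i)"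
      by (intro ennreal_leI) (simp add: frac_le)
    ultimately show "x \<in> S (Suc i)" unfolding S_def mem_Collect_eq by (rule le_less_trans[rotated])
  qed
  then have "(SUP i. vol (S i)) = vol (\<Union>i. S i)"
    using Sm by (intro SUP_emeasure_incseq) auto
  moreover have "(SUP i. vol (S i)) \<le> c" if "\<And>i. vol (S i) \<le> c"
    by (rule SUP_least) (rule that)
  ultimately show ?thesis by simp
qed

lemma dyadic_maximal_measurable:
  assumes "cube_at Q0 m s" shows "dyadic_maximal Q0 h \<in> borel_measurable lebesgue"
  using dyadic_maximal_superlevel_sets[OF assms, of _ h]
  by (intro borel_measurableI_greater) simp

lemma avg_le_dyadic_maximal:
  assumes "cube_at Q0 m s" "y \<in> dyad m s 0 m" "x \<in> dyad m s k y"
  shows "avg (dilate 3 (dyad m s k y)) 1 h \<le> dyadic_maximal Q0 h x"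
  unfolding dyadic_maximal_def
  using SUP_upper[OF dyad_in_dyadic_subcubes[OF assms(1,2), of k],
      of "\<lambda>P. indicator P x * avg (dilate 3 P) 1 h"] assms(3) by simp

section \<open>Integrability of powers of the maximal function\<close>

text \<open>Kolmogorov's inequality: functions of weak type are integrable on sets of finite measure
  after taking a root.  The proof cuts at the powers of two.\<close>

lemma maximal_root_integrable:
  fixes Q0 E :: "(real^'n) set"
  assumes Q: "cube_at Q0 m s" and h: "h \<in> borel_measurable lebesgue"
    and fin: "(\<integral>\<^sup>+x. ennreal \<bar>h x\<bar> \<partial>lebesgue) < top" and \<sigma>: "1 < \<sigma>"
    and E: "E \<in> sets lebesgue" "vol E < top"
  shows "(\<integral>\<^sup>+x\<in>E. epowr (dyadic_maximal Q0 h x) (1 / \<sigma>) \<partial>lebesgue) < top"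
proof -
  define \<Phi> where "\<Phi> x = epowr (dyadic_maximal Q0 h x) (1 / \<sigma>)" for x
  \<comment> \<open>The set where \<Phi> exceeds \<open>2\<^sup>j\<close> has measure of order 2 to the power -\<sigma>j, which beats \<open>2\<^sup>j\<close> because \<sigma> > 1.\<close>
  define S where "S j = {x. ennreal (2 ^ j) < \<Phi> x}" for j :: nat
  define Y where "Y = maximal_weak_norm Q0 * (\<integral>\<^sup>+x. ennreal \<bar>h x\<bar> \<partial>lebesgue)"
  have Y: "Y < top" unfolding Y_def using fin maximal_weak_norm_finite[OF Q]
    by (simp add: ennreal_mult_less_top)
  have S_eq: "S j = {x. ennreal (2 powr (\<sigma> * j)) < dyadic_maximal Q0 h x}" for j
  proof -
    have "\<Phi> x \<le> ennreal (2 ^ j) \<longleftrightarrow> dyadic_maximal Q0 h x \<le> ennreal (2 powr (\<sigma> * j))" for x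
      using \<sigma> unfolding \<Phi>_def
      by (subst epowr_le_iff) (auto simp: epowr_ennreal powr_realpow[symmetric] powr_powr mult.commute)
    then show ?thesis unfolding S_def by (simp flip: not_le)
  qed
  have Sm: "S j \<in> sets lebesgue" for j unfolding S_eq by (rule dyadic_maximal_superlevel_sets[OF Q])
  have [measurable]: "\<Phi> \<in> borel_measurable lebesgue"
    unfolding \<Phi>_def using dyadic_maximal_measurable[OF Q] by measurable
  have S_le: "ennreal (2 ^ Suc j) * vol (S j) \<le> 2 * Y * ennreal ((2 powr (1 - \<sigma>)) ^ j)" for j
  proof -
    have "ennreal (2 powr (\<sigma> * j)) * vol (S j) \<le> Y"
      unfolding S_eq Y_def by (rule maximal_weak_type[OF Q h fin]) simp
    then have *: "ennreal (2 * (2 powr (1 - \<sigma>)) ^ j) * (ennreal (2 powr (\<sigma> * j)) * vol (S j)) \<le>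
       ennreal (2 * (2 powr (1 - \<sigma>)) ^ j) * Y" by (rule mult_left_mono) simp
    have "2 * (2 powr (1 - \<sigma>)) ^ j * 2 powr (\<sigma> * j) = (2::real) ^ Suc j"
    proof -
      have "(2 powr (1 - \<sigma>)) ^ j = (2::real) powr ((1 - \<sigma>) * j)"
        by (simp add: powr_realpow[symmetric] powr_powr)
      then have "(2 powr (1 - \<sigma>)) ^ j * 2 powr (\<sigma> * j) = (2::real) powr j"
        by (simp add: powr_add[symmetric] algebra_simps)
      then show ?thesis by (simp add: powr_realpow)
    qed
    then have "ennreal (2 ^ Suc j) = ennreal (2 * (2 powr (1 - \<sigma>)) ^ j) * ennreal (2 powr (\<sigma> * j))"
      by (subst ennreal_mult[symmetric]) simp_all
    then have "ennreal (2 ^ Suc j) * vol (S j) \<le> ennreal (2 * (2 powr (1 - \<sigma>)) ^ j) * Y"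
      using * by (simp only: mult.assoc)
    also have "ennreal (2 * (2 powr (1 - \<sigma>)) ^ j) = 2 * ennreal ((2 powr (1 - \<sigma>)) ^ j)"
      by (subst ennreal_mult) simp_all
    finally show ?thesis by (simp only: mult_ac)
  qed
  \<comment> \<open>A finite value of \<Phi> above one is at most the term of the last set that contains the point.\<close>
  define Z where "Z x = (\<Sum>j. ennreal (2 ^ Suc j) * indicator (S j) x)" for x
  have term_le: "ennreal (2 ^ Suc j) * indicator (S j) x \<le> Z x" for j x
  proof -
    have "sum (\<lambda>j. ennreal (2 ^ Suc j) * indicator (S j) x) {j} \<le> Z x"
      unfolding Z_def by (intro sum_le_suminf summableI) simp_all
    then show ?thesis by (simp only: sum.insert sum.empty finite.emptyI empty_iff not_False_eq_True add_0_right)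
  qed
  have pt: "\<Phi> x \<le> 1 + Z x" for x
  proof (cases "\<Phi> x \<le> 1")
    case True
    moreover have "1 \<le> 1 + Z x" by simp
    ultimately show ?thesis by (rule order_trans)
  next
    case False
    show ?thesis
    proof (cases "\<Phi> x")
      case (real r)
      have r: "1 < r" using False real by (simp flip: ennreal_1)
      obtain k where "r < 2 ^ k" using real_arch_pow[of 2 r] by auto
      then have "r \<le> 2 ^ k" by simp
      define j where "j = (LEAST k. r \<le> 2 ^ k)"
      have j: "r \<le> 2 ^ j" unfolding j_def by (rule LeastI) fact
      have "j \<noteq> 0" using j r by (cases j) auto
      then obtain i where i: "j = Suc i" by (cases j) auto
      have "\<not> r \<le> 2 ^ i" using not_less_Least[of i "\<lambda>k. r \<le> 2 ^ k"] i j_def by simp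
      then have "x \<in> S i" using real r by (simp add: S_def ennreal_less_iff)
      then have "\<Phi> x \<le> ennreal (2 ^ Suc i) * indicator (S i) x"
        using real j i by (simp add: ennreal_leI del: power_Suc)
      also have "\<dots> \<le> Z x" by (rule term_le)
      also have "\<dots> \<le> 1 + \<dots>" by simp
      finally show ?thesis .
    next
      case top
      have big: "ennreal (2 ^ j) \<le> Z x" for j
      proof -
        have "x \<in> S j" using top by (simp add: S_def)
        then have "ennreal (2 ^ Suc j) \<le> Z x" using term_le[of j x] by (simp only: indicator_simps mult_1_right)
        moreover have "ennreal (2 ^ j) \<le> ennreal (2 ^ Suc j)" by (rule ennreal_leI) simp
        ultimately show ?thesis by (rule order_trans[rotated])
      qed
      have *: "Z x = top"
      proof (rule ccontr)
        assume "Z x \<noteq> top"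
        then obtain r where r: "0 \<le> r" "Z x = ennreal r" by (cases "Z x") auto
        obtain j where "r < 2 ^ j" using real_arch_pow[of 2 r] by auto
        then show False using iffD1[OF ennreal_le_iff[OF r(1)] big[of j, unfolded r(2)]] by linarith
      qed
      show ?thesis unfolding * by simp
    qed
  qed
  have "(\<integral>\<^sup>+x\<in>E. \<Phi> x \<partial>lebesgue) \<le>
     (\<integral>\<^sup>+x. indicator E x + (\<Sum>j. ennreal (2 ^ Suc j) * indicator (S j) x) \<partial>lebesgue)"
  proof (rule nn_integral_mono)
    fix x show "\<Phi> x * indicator E x \<le> indicator E x + (\<Sum>j. ennreal (2 ^ Suc j) * indicator (S j) x)"
      unfolding Z_def[symmetric] using pt[of x]
      by (cases "x \<in> E") (simp_all only: indicator_simps mult_1_right mult_zero_right zero_le not_False_eq_True)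
  qed
  also have "\<dots> = vol E + (\<integral>\<^sup>+x. (\<Sum>j. ennreal (2 ^ Suc j) * indicator (S j) x) \<partial>lebesgue)"
    using E Sm by (subst nn_integral_add) auto
  also have "(\<integral>\<^sup>+x. (\<Sum>j. ennreal (2 ^ Suc j) * indicator (S j) x) \<partial>lebesgue) =
     (\<Sum>j. ennreal (2 ^ Suc j) * vol (S j))"
    using Sm by (subst nn_integral_suminf) (auto simp: nn_integral_cmult)
  also have "\<dots> \<le> (\<Sum>j. 2 * Y * ennreal ((2 powr (1 - \<sigma>)) ^ j))"
    by (intro suminf_le S_le) auto
  also have "\<dots> = 2 * Y * (\<Sum>j. ennreal ((2 powr (1 - \<sigma>)) ^ j))" by simp
  also have "(\<Sum>j. ennreal ((2 powr (1 - \<sigma>)) ^ j)) = ennreal (\<Sum>j. (2 powr (1 - \<sigma>)) ^ j)"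
    using \<sigma> by (intro suminf_ennreal2 summable_geometric) (auto simp: powr_less_one)
  finally have "(\<integral>\<^sup>+x\<in>E. \<Phi> x \<partial>lebesgue) \<le> vol E + 2 * Y * ennreal (\<Sum>j. (2 powr (1 - \<sigma>)) ^ j)"
    by (simp add: add_left_mono)
  also have "\<dots> < top" using E Y by (simp add: ennreal_mult_less_top)
  finally show ?thesis by (simp add: \<Phi>_def)
qed

text \<open>Continuity from above of the measure with density f, along sets that decrease to a null set.\<close>

lemma nn_integral_decseq_null:
  assumes f: "f \<in> borel_measurable M" and E: "E \<in> sets M" and fin: "(\<integral>\<^sup>+x\<in>E. f x \<partial>M) < top"
    and S: "\<And>k. S k \<in> sets M" "\<And>k. S (Suc k) \<subseteq> S k" "S 0 \<subseteq> E"
    and null: "(\<lambda>k. emeasure M (S k)) \<longlonglongrightarrow> 0" and e: "0 < e"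
  shows "\<exists>k. (\<integral>\<^sup>+x\<in>S k. f x \<partial>M) < e"
proof -
  have dec: "decseq S" by (rule decseq_SucI) (rule S(2))
  define I where "I = (\<Inter>k. S k)"
  have "emeasure M I \<le> emeasure M (S k)" for k
    unfolding I_def by (rule emeasure_mono) (use S in auto)
  then have "emeasure M I \<le> 0" using null by (intro LIMSEQ_le_const) auto
  then have "I \<in> null_sets M" using S(1) unfolding I_def by (auto intro!: null_setsI)
  then have ae: "AE x in M. x \<notin> I" by (rule AE_not_in)
  have "(INF k. \<integral>\<^sup>+x\<in>S k. f x \<partial>M) = (\<integral>\<^sup>+x. (INF k. f x * indicator (S k) x) \<partial>M)"
  proof (rule nn_integral_monotone_convergence_INF_decseq[symmetric])
    show "decseq (\<lambda>k x. f x * indicator (S k) x)"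
      using S(2) by (intro decseq_SucI le_funI mult_left_mono) (auto simp: indicator_def)
    show "(\<integral>\<^sup>+x\<in>S 0. f x \<partial>M) < \<infinity>"
    proof (rule le_less_trans)
      show "(\<integral>\<^sup>+x\<in>S 0. f x \<partial>M) \<le> (\<integral>\<^sup>+x\<in>E. f x \<partial>M)"
        using S(3) by (intro nn_integral_mono mult_left_mono) (auto simp: indicator_def)
    qed (use fin in simp)
  qed (use f S(1) in auto)
  also have "\<dots> = (\<integral>\<^sup>+x. 0 \<partial>M)"
  proof (rule nn_integral_cong_AE)
    show "AE x in M. (INF k. f x * indicator (S k) x) = 0"
      using ae
    proof eventually_elim
      fix x assume "x \<notin> I"
      then obtain k where "x \<notin> S k" by (auto simp: I_def)
      then have "(INF k. f x * indicator (S k) x) \<le> 0" by (intro INF_lower2[of k]) auto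
      then show "(INF k. f x * indicator (S k) x) = 0" by simp
    qed
  qed
  finally have "(INF k. \<integral>\<^sup>+x\<in>S k. f x \<partial>M) < e" using e by simp
  then show ?thesis by (auto simp: INF_less_iff)
qed

section \<open>Lebesgue points along dyadic cubes\<close>

lemma avg_1_triangle:
  assumes E: "E \<in> sets lebesgue" and a: "a \<in> borel_measurable lebesgue" and b: "b \<in> borel_measurable lebesgue"
    and le: "\<And>y. y \<in> E \<Longrightarrow> \<bar>h y\<bar> \<le> \<bar>a y\<bar> + \<bar>b y\<bar>"
  shows "avg E 1 h \<le> avg E 1 a + avg E 1 b"
proof -
  have "(\<integral>\<^sup>+x\<in>E. ennreal \<bar>h x\<bar> \<partial>lebesgue) \<le> (\<integral>\<^sup>+x. ennreal \<bar>a x\<bar> * indicator E x + ennreal \<bar>b x\<bar> * indicator E x \<partial>lebesgue)"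
    using le by (intro nn_integral_mono)
      (auto simp: indicator_def ennreal_plus[symmetric] simp del: ennreal_plus intro!: ennreal_leI)
  also have "\<dots> = (\<integral>\<^sup>+x\<in>E. ennreal \<bar>a x\<bar> \<partial>lebesgue) + (\<integral>\<^sup>+x\<in>E. ennreal \<bar>b x\<bar> \<partial>lebesgue)"
    by (rule nn_integral_add) (use a b E in auto)
  finally show ?thesis
    unfolding avg_1_eq add_divide_distrib_ennreal[symmetric] by (rule divide_right_mono_ennreal)
qed

lemma avg_1_le_const:
  assumes "E \<in> sets lebesgue" "0 < vol E" "vol E < \<infinity>"
    and "\<And>y. y \<in> E \<Longrightarrow> \<bar>h y\<bar> \<le> c"
  shows "avg E 1 h \<le> ennreal c"
proof -
  have "(\<integral>\<^sup>+x\<in>E. ennreal \<bar>h x\<bar> \<partial>lebesgue) \<le> (\<integral>\<^sup>+x. ennreal c * indicator E x \<partial>lebesgue)"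
    using assms(4) by (intro nn_integral_mono) (auto simp: indicator_def intro!: ennreal_leI)
  also have "\<dots> = ennreal c * vol E" using assms(1) by (simp add: nn_integral_cmult)
  finally show ?thesis unfolding avg_1_eq using assms
    by (intro divide_le_posI_ennreal) (auto simp: mult.commute)
qed

lemma dilate_dyad_subset_ball:
  fixes m x :: "real^'n"
  assumes "0 < s" shows "dilate 3 (dyad m s k x) \<subseteq> ball x (4 * real CARD('n) * (s / 2 ^ k))"
proof
  define c where "c = dyad_center m s k x"
  define r where "r = s / 2 ^ k"
  have r: "0 < r" using assms by (simp add: r_def)
  have cube: "cube_at (dyad m s k x) c r" unfolding c_def r_def by (rule cube_at_dyad[OF assms])
  have sub: "closed_cube c (3 * r) \<subseteq> ball c (2 * real CARD('n) * r)" by (rule closed_cube_subset_ball[OF r])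
  have "x \<in> closed_cube c r" using cube dyad_self[of x m s k] by (auto simp: cube_at_def)
  then have "x \<in> closed_cube c (3 * r)" using open_cube_mono(2)[of c c "3 * r" r] r by auto
  then have x: "dist c x < 2 * real CARD('n) * r" using sub by auto
  fix y assume "y \<in> dilate 3 (dyad m s k x)"
  then have "y \<in> closed_cube c (3 * r)" using cube_at_dilate[OF cube, of 3] by (auto simp: cube_at_def)
  then have "dist c y < 2 * real CARD('n) * r" using sub by auto
  then show "y \<in> ball x (4 * real CARD('n) * (s / 2 ^ k))"
    using x dist_triangle3[of x y c] unfolding r_def[symmetric] mem_ball by linarith
qed

lemma dyads_shrink:
  assumes s: "0 < s" and V: "open V" "x \<in> V"
  obtains K where "\<And>k. K \<le> k \<Longrightarrow> dilate 3 (dyad m s k x) \<subseteq> (V :: (real^'n) set)"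
proof -
  obtain \<delta> where \<delta>: "0 < \<delta>" "ball x \<delta> \<subseteq> V" using V by (meson open_contains_ball)
  have "(\<lambda>k. 4 * real CARD('n) * s * (1 / 2) ^ k) \<longlonglongrightarrow> 4 * real CARD('n) * s * 0"
    by (intro tendsto_intros) auto
  then have "eventually (\<lambda>k. 4 * real CARD('n) * s * (1 / 2) ^ k < \<delta>) sequentially"
    using \<delta>(1) by (intro order_tendstoD(2)) auto
  then obtain K where K: "\<And>k. K \<le> k \<Longrightarrow> 4 * real CARD('n) * s * (1 / 2) ^ k < \<delta>"
    by (auto simp: eventually_sequentially)
  have "dilate 3 (dyad m s k x) \<subseteq> V" if "K \<le> k" for k
  proof -
    have "4 * real CARD('n) * (s / 2 ^ k) \<le> \<delta>" using K[OF that] by (simp add: power_one_over field_simps)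
    then show ?thesis using dilate_dyad_subset_ball[OF s, of m k x] \<delta>(2) subset_ball by (meson order_trans)
  qed
  then show ?thesis by (rule that)
qed

text \<open>Functions that are approximated in \<open>L\<^sup>1\<close> by continuous ones have Lebesgue points almost
  everywhere: the weak type estimate controls the averages of the difference.\<close>

lemma AE_dyadic_Lebesgue_point:
  fixes Q0 :: "(real^'n) set" and h :: "real^'n \<Rightarrow> real^'n"
  assumes Q: "cube_at Q0 m s" and h: "h \<in> borel_measurable lebesgue"
    and appr: "\<And>e. 0 < e \<Longrightarrow> \<exists>\<phi>. continuous_on UNIV \<phi> \<and> (\<integral>\<^sup>+x. ennreal (norm (h x - \<phi> x)) \<partial>lebesgue) \<le> ennreal e"
  shows "AE x in lebesgue. x \<in> dyad m s 0 m \<longrightarrow>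
    (\<forall>e>0. \<exists>K. \<forall>k\<ge>K. avg (dilate 3 (dyad m s k x)) 1 (\<lambda>y. norm (h y - h x)) \<le> ennreal e)"
proof -
  have s: "0 < s" using Q by (simp add: cube_at_def)
  define G where "G e x \<longleftrightarrow> (\<exists>K. \<forall>k\<ge>K. avg (dilate 3 (dyad m s k x)) 1 (\<lambda>y. norm (h y - h x)) \<le> ennreal e)" for e x
  have D: "dilate 3 (dyad m s k x) \<in> sets lebesgue" "0 < vol (dilate 3 (dyad m s k x))"
     "vol (dilate 3 (dyad m s k x)) < \<infinity>" for k and x :: "real^'n"
    using cube_at_dilate[OF cube_at_dyad[OF s], of 3 m k x] cube_at_sets cube_at_emeasure_pos by auto
  obtain N where N: "maximal_weak_norm Q0 = ennreal N" "0 \<le> N"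
    using maximal_weak_norm_finite[OF Q] by (cases "maximal_weak_norm Q0") auto
  have neg: "negligible {x \<in> dyad m s 0 m. \<not> G (3 * e) x}" if e: "0 < e" for e
    unfolding negligible_outer_le
  proof (intro allI impI)
    fix d :: real assume d: "0 < d"
    \<comment> \<open>The exceptional set has measure at most (N \<epsilon> + \<epsilon>) / e, which this choice makes equal to d.\<close>
    define \<epsilon> where "\<epsilon> = d * e / (N + 1)"
    have \<epsilon>: "0 < \<epsilon>" using d e N by (simp add: \<epsilon>_def)
    obtain \<phi> where \<phi>: "continuous_on UNIV \<phi>" "(\<integral>\<^sup>+x. ennreal (norm (h x - \<phi> x)) \<partial>lebesgue) \<le> ennreal \<epsilon>"
      using appr[OF \<epsilon>] by blast
    have \<phi>m: "\<phi> \<in> borel_measurable lebesgue"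
      using \<phi>(1) by (simp add: borel_measurable_continuous_onI measurable_completion)
    define w where "w x = norm (h x - \<phi> x)" for x
    have w: "w \<in> borel_measurable lebesgue" unfolding w_def using h \<phi>m by measurable
    have wint: "(\<integral>\<^sup>+x. ennreal \<bar>w x\<bar> \<partial>lebesgue) \<le> ennreal \<epsilon>" using \<phi>(2) by (simp add: w_def)
    define T1 where "T1 = {x. ennreal e < dyadic_maximal Q0 w x}"
    define T2 where "T2 = {x. e \<le> w x}"
    have T1m: "T1 \<in> sets lebesgue" unfolding T1_def by (rule dyadic_maximal_superlevel_sets[OF Q])
    have T2m: "T2 \<in> sets lebesgue" using w borel_measurable_iff_ge[of w lebesgue] by (simp add: T2_def)
    have "ennreal e * vol T1 \<le> maximal_weak_norm Q0 * (\<integral>\<^sup>+x. ennreal \<bar>w x\<bar> \<partial>lebesgue)"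
      unfolding T1_def using wint by (intro maximal_weak_type[OF Q w _ e]) (simp add: le_less_trans)
    also have "\<dots> \<le> ennreal N * ennreal \<epsilon>" unfolding N by (intro mult_left_mono wint) simp
    finally have m1: "ennreal e * vol T1 \<le> ennreal N * ennreal \<epsilon>" .
    have "ennreal e * vol T2 = (\<integral>\<^sup>+x. ennreal e * indicator T2 x \<partial>lebesgue)"
      using T2m by (simp add: nn_integral_cmult)
    also have "\<dots> \<le> (\<integral>\<^sup>+x. ennreal \<bar>w x\<bar> \<partial>lebesgue)"
      by (intro nn_integral_mono) (auto simp: T2_def indicator_def intro!: ennreal_leI)
    finally have m2: "ennreal e * vol T2 \<le> ennreal \<epsilon>" using wint by (rule order_trans)
    have "ennreal e * vol (T1 \<union> T2) \<le> ennreal e * (vol T1 + vol T2)"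
      using T1m T2m by (intro mult_left_mono emeasure_subadditive) auto
    also have "\<dots> \<le> ennreal N * ennreal \<epsilon> + ennreal \<epsilon>" using m1 m2 by (simp add: distrib_left add_mono)
    also have "\<dots> = ennreal e * ennreal d"
    proof -
      have "N * \<epsilon> + \<epsilon> = (N + 1) * \<epsilon>" by (simp add: distrib_right)
      also have "\<dots> = e * d" using N unfolding \<epsilon>_def by simp
      finally have "N * \<epsilon> + \<epsilon> = e * d" .
      then show ?thesis using N \<epsilon> e d
        by (simp add: ennreal_mult[symmetric] ennreal_plus[symmetric] del: ennreal_plus)
    qed
    finally have md: "vol (T1 \<union> T2) \<le> ennreal d"
      using e by (subst (asm) ennreal_mult_le_mult_iff) auto
    have sub: "{x \<in> dyad m s 0 m. \<not> G (3 * e) x} \<subseteq> T1 \<union> T2"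
    proof (rule subsetI, rule ccontr)
      fix x assume x: "x \<in> {x \<in> dyad m s 0 m. \<not> G (3 * e) x}" and nT: "x \<notin> T1 \<union> T2"
      have M: "dyadic_maximal Q0 w x \<le> ennreal e" and wx: "w x < e" using nT by (auto simp: T1_def T2_def)
      obtain \<delta> where \<delta>: "0 < \<delta>" "\<And>y. dist y x < \<delta> \<Longrightarrow> dist (\<phi> y) (\<phi> x) < e"
        using \<phi>(1) e unfolding continuous_on_iff by (metis UNIV_I)
      obtain K where K: "\<And>k. K \<le> k \<Longrightarrow> dilate 3 (dyad m s k x) \<subseteq> ball x \<delta>"
        by (rule dyads_shrink[where m = m and x = x, OF s open_ball centre_in_ball[THEN iffD2, OF \<delta>(1)]]) (rule that)
      have "avg (dilate 3 (dyad m s k x)) 1 (\<lambda>y. norm (h y - h x)) \<le> ennreal (3 * e)" if k: "K \<le> k" for k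
      proof -
        let ?D = "dilate 3 (dyad m s k x)"
        have "avg ?D 1 (\<lambda>y. norm (h y - h x)) \<le> avg ?D 1 w + avg ?D 1 (\<lambda>y. 2 * e)"
        proof (rule avg_1_triangle[OF D(1) w])
          fix y assume y: "y \<in> ?D"
          have "dist x y < \<delta>" using y K[OF k] by auto
          then have "dist (\<phi> y) (\<phi> x) < e" using \<delta>(2)[of y] by (simp add: dist_commute)
          moreover have "h y - h x = (h y - \<phi> y) + (\<phi> y - \<phi> x) + (\<phi> x - h x)" by simp
          then have "norm (h y - h x) \<le> norm (h y - \<phi> y) + norm (\<phi> y - \<phi> x) + norm (\<phi> x - h x)"
            by (metis norm_triangle_ineq norm_triangle_mono order_refl)
          ultimately show "\<bar>norm (h y - h x)\<bar> \<le> \<bar>w y\<bar> + \<bar>2 * e\<bar>"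
            using wx e by (simp add: w_def dist_norm norm_minus_commute)
        qed simp
        also have "avg ?D 1 w \<le> dyadic_maximal Q0 w x"
          using x avg_le_dyadic_maximal[OF Q, of x x k w] by simp
        also note M
        also have "avg ?D 1 (\<lambda>y. 2 * e) \<le> ennreal (2 * e)" using e by (intro avg_1_le_const D) simp
        also have "ennreal e + ennreal (2 * e) = ennreal (3 * e)"
          using e by (simp add: ennreal_plus[symmetric] del: ennreal_plus)
        finally show ?thesis by (simp add: add_mono)
      qed
      then have "G (3 * e) x" unfolding G_def by blast
      then show False using x by simp
    qed
    show "\<exists>T. {x \<in> dyad m s 0 m. \<not> G (3 * e) x} \<subseteq> T \<and> T \<in> lmeasurable \<and> measure lebesgue T \<le> d"
    proof (intro exI conjI)
      show "{x \<in> dyad m s 0 m. \<not> G (3 * e) x} \<subseteq> T1 \<union> T2" by (rule sub)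
      show "T1 \<union> T2 \<in> lmeasurable" using T1m T2m md
        by (intro fmeasurableI) (auto intro: le_less_trans)
      then show "measure lebesgue (T1 \<union> T2) \<le> d"
        using md d by (simp add: emeasure_eq_measure2 ennreal_le_iff fmeasurableD2)
    qed
  qed
  have "{x \<in> dyad m s 0 m. \<not> G (3 * (1 / Suc i)) x} \<in> null_sets lebesgue" for i :: nat
    unfolding negligible_iff_null_sets[symmetric] by (rule neg) simp
  then have "AE x in lebesgue. x \<notin> {x \<in> dyad m s 0 m. \<not> G (3 * (1 / Suc i)) x}" for i :: nat
    by (rule AE_not_in)
  then have "AE x in lebesgue. \<not> (x \<in> dyad m s 0 m \<and> \<not> G (3 * (1 / Suc i)) x)" for i :: nat
    by (simp only: mem_Collect_eq)
  then have "AE x in lebesgue. \<forall>i::nat. \<not> (x \<in> dyad m s 0 m \<and> \<not> G (3 * (1 / Suc i)) x)"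
    unfolding AE_all_countable by (rule allI)
  then show ?thesis
  proof eventually_elim
    fix x assume *: "\<forall>i::nat. \<not> (x \<in> dyad m s 0 m \<and> \<not> G (3 * (1 / Suc i)) x)"
    show "x \<in> dyad m s 0 m \<longrightarrow>
      (\<forall>e>0. \<exists>K. \<forall>k\<ge>K. avg (dilate 3 (dyad m s k x)) 1 (\<lambda>y. norm (h y - h x)) \<le> ennreal e)"
    proof (intro impI allI)
      fix e :: real assume x: "x \<in> dyad m s 0 m" and e: "0 < e"
      obtain i where i: "1 / Suc i < e / 3" using nat_approx_posE[of "e / 3"] e by auto
      have "G (3 * (1 / Suc i)) x" using * x by blast
      moreover have "ennreal (3 * (1 / Suc i)) \<le> ennreal e" using i by (intro ennreal_leI) simp
      ultimately show "\<exists>K. \<forall>k\<ge>K. avg (dilate 3 (dyad m s k x)) 1 (\<lambda>y. norm (h y - h x)) \<le> ennreal e"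
        unfolding G_def using order_trans by blast
    qed
  qed
qed

section \<open>Smooth functions\<close>

lemma grad_nth:
  assumes "(\<phi> has_derivative D) (at x)" shows "grad \<phi> x $ i = D (axis i 1)"
  using frechet_derivative_at[OF assms] by (simp add: grad_def)

lemma Ck_Suc_imp: "Ck (Suc k) \<phi> \<Longrightarrow> Ck k \<phi>"
proof (induction k arbitrary: \<phi>)
  case 0
  then show ?case
    by (auto intro!: continuous_at_imp_continuous_on differentiable_imp_continuous_within)
next
  case (Suc k)
  then show ?case using Ck.simps(2) by metis
qed

lemma Ck_const [simp]: "Ck k (\<lambda>x :: real^'n. c)"
proof (induction k arbitrary: c)
  case (Suc k)
  have "grad (\<lambda>x :: real^'n. c) x $ i = 0" for x i
    using grad_nth[OF has_derivative_const[of c "at x"]] by simp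
  then show ?case using Suc by simp
qed simp

lemma Ck_add: "Ck k \<phi> \<Longrightarrow> Ck k \<psi> \<Longrightarrow> Ck k (\<lambda>x. \<phi> x + \<psi> x)"
proof (induction k arbitrary: \<phi> \<psi>)
  case 0
  then show ?case by (auto intro: continuous_on_add)
next
  case (Suc k)
  have d: "(\<phi> has_derivative frechet_derivative \<phi> (at x)) (at x)" "(\<psi> has_derivative frechet_derivative \<psi> (at x)) (at x)" for x
    using Suc.prems by (auto simp: frechet_derivative_works[symmetric])
  have "grad (\<lambda>x. \<phi> x + \<psi> x) x $ i = grad \<phi> x $ i + grad \<psi> x $ i" for x i
    unfolding grad_nth[OF has_derivative_add[OF d]] by (simp add: grad_def)
  then show ?case using Suc by auto
qed

lemma Ck_mult: "Ck k \<phi> \<Longrightarrow> Ck k \<psi> \<Longrightarrow> Ck k (\<lambda>x. \<phi> x * \<psi> x)"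
proof (induction k arbitrary: \<phi> \<psi>)
  case 0
  then show ?case by (auto intro: continuous_on_mult)
next
  case (Suc k)
  have d: "(\<phi> has_derivative frechet_derivative \<phi> (at x)) (at x)" "(\<psi> has_derivative frechet_derivative \<psi> (at x)) (at x)" for x
    using Suc.prems by (auto simp: frechet_derivative_works[symmetric])
  have "grad (\<lambda>x. \<phi> x * \<psi> x) x $ i = \<phi> x * grad \<psi> x $ i + grad \<phi> x $ i * \<psi> x" for x i
    unfolding grad_nth[OF has_derivative_mult[OF d]] by (simp add: grad_def)
  moreover have "Ck k (\<lambda>x. \<phi> x * grad \<psi> x $ i + grad \<phi> x $ i * \<psi> x)" for i
    by (rule Ck_add; rule Suc.IH) (use Suc.prems Ck_Suc_imp in \<open>auto simp del: Ck.simps(1)\<close>)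
  ultimately show ?case using Suc.prems by auto
qed

lemma Ck_prod: "finite I \<Longrightarrow> (\<And>i. i \<in> I \<Longrightarrow> Ck k (\<phi> i)) \<Longrightarrow> Ck k (\<lambda>x. \<Prod>i\<in>I. \<phi> i x)"
  by (induction I rule: finite_induct) (auto intro: Ck_mult)

lemma grad_linear:
  assumes "\<phi> differentiable (at x)" "\<psi> differentiable (at x)"
  shows "grad (\<lambda>x. \<phi> x + c * \<psi> x) x = grad \<phi> x + c *\<^sub>R grad \<psi> x"
proof -
  have d: "(\<phi> has_derivative frechet_derivative \<phi> (at x)) (at x)" "(\<psi> has_derivative frechet_derivative \<psi> (at x)) (at x)"
    using assms by (auto simp: frechet_derivative_works[symmetric])
  show ?thesis
    unfolding vec_eq_iff grad_nth[OF has_derivative_add[OF d(1) has_derivative_mult_right[OF d(2), of c]]]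
    by (simp add: grad_def)
qed

lemma grad_mult:
  assumes "\<phi> differentiable (at x)" "\<psi> differentiable (at x)"
  shows "grad (\<lambda>x. \<phi> x * \<psi> x) x = \<phi> x *\<^sub>R grad \<psi> x + \<psi> x *\<^sub>R grad \<phi> x"
proof -
  have d: "(\<phi> has_derivative frechet_derivative \<phi> (at x)) (at x)" "(\<psi> has_derivative frechet_derivative \<psi> (at x)) (at x)"
    using assms by (auto simp: frechet_derivative_works[symmetric])
  show ?thesis
    unfolding vec_eq_iff grad_nth[OF has_derivative_mult[OF d]] by (simp add: grad_def)
qed

lemma has_derivative_nth: "((\<lambda>x :: real^'n. x $ i) has_derivative (\<lambda>h. h $ i)) (at x)"
  by (rule bounded_linear.has_derivative[OF bounded_linear_vec_nth has_derivative_ident])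

lemma Ck_nth [simp]: "Ck k (\<lambda>x :: real^'n. x $ i)"
proof (cases k)
  case 0 then show ?thesis by (simp add: continuous_on_component)
next
  case (Suc j)
  have "grad (\<lambda>x :: real^'n. x $ i) x $ l = axis l 1 $ i" for x l
    by (rule grad_nth[OF has_derivative_nth])
  then show ?thesis using Suc differentiableI[OF has_derivative_nth[of i]] by simp
qed

text \<open>The functions p(1/t) exp(-1/t), extended by zero to t \<le> 0: a class of functions
  that is closed under differentiation.\<close>

definition flat :: "real poly \<Rightarrow> real \<Rightarrow> real" where
  "flat p t = (if 0 < t then poly p (1 / t) * exp (- (1 / t)) else 0)"

lemma poly_div_exp_tendsto_0: "((\<lambda>y. poly p y / exp y) \<longlongrightarrow> (0::real)) at_top"
proof -
  have "((\<lambda>y. \<Sum>i\<le>degree p. coeff p i * (y ^ i / exp y)) \<longlongrightarrow> (\<Sum>i\<le>degree p. coeff p i * 0)) at_top"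
    by (intro tendsto_intros tendsto_power_div_exp_0)
  moreover have "(\<lambda>y. \<Sum>i\<le>degree p. coeff p i * (y ^ i / exp y)) = (\<lambda>y. poly p y / exp y)"
    by (simp add: poly_altdef sum_divide_distrib)
  ultimately show ?thesis by simp
qed

lemma flat_tendsto_0: "(flat p \<longlongrightarrow> 0) (at 0)"
  unfolding filterlim_at_split
proof
  show "(flat p \<longlongrightarrow> 0) (at_left 0)"
  proof (rule tendsto_eventually)
    show "\<forall>\<^sub>F t in at_left 0. flat p t = 0"
      unfolding eventually_at_filter by (simp add: flat_def)
  qed
  have "((\<lambda>t. poly p (inverse t) / exp (inverse t)) \<longlongrightarrow> 0) (at_right 0)"
    by (rule filterlim_compose[OF poly_div_exp_tendsto_0 filterlim_inverse_at_top_right])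
  moreover have "\<forall>\<^sub>F t in at_right 0. poly p (inverse t) / exp (inverse t) = flat p t"
    unfolding eventually_at_filter by (simp add: flat_def exp_minus inverse_eq_divide)
  ultimately show "(flat p \<longlongrightarrow> 0) (at_right 0)" by (rule Lim_transform_eventually)
qed

text \<open>The substitution y = 1/t gives the derivative \<open>y\<^sup>2 (p(y) - p'(y)) exp(-y)\<close>.\<close>

lemma flat_deriv: "(flat p has_real_derivative flat (pCons 0 (pCons 0 (p - pderiv p))) t) (at t)"
proof -
  consider "t < 0" | "t = 0" | "0 < t" by linarith
  then show ?thesis
  proof cases
    case 1
    have "((\<lambda>t. 0) has_real_derivative 0) (at t)" by simp
    moreover have "\<forall>\<^sub>F s in nhds t. flat p s = 0"
      using 1 by (intro eventually_nhds_in_open[THEN eventually_mono, of "{..<0}"]) (auto simp: flat_def)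
    ultimately show ?thesis using 1 DERIV_cong_ev[of t t "flat p" "\<lambda>_. 0" 0 0] by (simp add: flat_def)
  next
    case 2
    have "flat p h / h = flat (pCons 0 p) h" for h by (simp add: flat_def)
    then show ?thesis using 2 flat_tendsto_0[of "pCons 0 p"] by (simp add: DERIV_def flat_def[of _ 0])
  next
    case 3
    have "((\<lambda>t. poly p (1 / t) * exp (- (1 / t))) has_real_derivative
       poly (pderiv p) (1 / t) * (- (1 / t\<^sup>2)) * exp (- (1 / t)) + poly p (1 / t) * (exp (- (1 / t)) * (1 / t\<^sup>2))) (at t)"
      using 3 by (auto intro!: derivative_eq_intros poly_DERIV[THEN DERIV_chain2] simp: power2_eq_square)
    moreover have "poly (pderiv p) (1 / t) * (- (1 / t\<^sup>2)) * exp (- (1 / t)) + poly p (1 / t) * (exp (- (1 / t)) * (1 / t\<^sup>2)) =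
       flat (pCons 0 (pCons 0 (p - pderiv p))) t"
      using 3 by (simp add: flat_def field_simps power2_eq_square)
    moreover have "\<forall>\<^sub>F s in nhds t. flat p s = poly p (1 / s) * exp (- (1 / s))"
      using 3 by (intro eventually_nhds_in_open[THEN eventually_mono, of "{0<..}"]) (auto simp: flat_def)
    ultimately show ?thesis
      using DERIV_cong_ev[of t t "flat p" "\<lambda>t. poly p (1 / t) * exp (- (1 / t))"] by metis
  qed
qed

lemma Ck_flat: "Ck k (\<lambda>x :: real^'n. flat p (c + d * x $ i))"
proof (induction k arbitrary: p)
  case 0
  have "isCont (flat p) t" for t by (rule DERIV_isCont[OF flat_deriv])
  then have c: "continuous_on UNIV (flat p)" by (simp add: continuous_at_imp_continuous_on)
  have "continuous_on UNIV (\<lambda>x :: real^'n. flat p (c + d * x $ i))"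
    by (rule continuous_on_compose2[OF c]) (auto intro!: continuous_intros continuous_on_component)
  then show ?case by simp
next
  case (Suc k)
  define q where "q = pCons 0 (pCons 0 (p - pderiv p))"
  have D: "((\<lambda>x :: real^'n. flat p (c + d * x $ i)) has_derivative (\<lambda>h. flat q (c + d * x $ i) * (d * h $ i))) (at x)" for x
  proof -
    have 1: "(flat p has_derivative (*) (flat q (c + d * x $ i))) (at (c + d * x $ i))"
      using flat_deriv[of p "c + d * x $ i"] by (simp add: has_field_derivative_def q_def)
    have 2: "((\<lambda>x :: real^'n. c + d * x $ i) has_derivative (\<lambda>h. d * h $ i)) (at x)"
      by (auto intro!: derivative_eq_intros has_derivative_nth)
    show ?thesis using diff_chain_at[OF 2 1] by (simp add: o_def)
  qed
  have "grad (\<lambda>x :: real^'n. flat p (c + d * x $ i)) x $ j = (d * axis j 1 $ i) * flat q (c + d * x $ i)" for x j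
    using grad_nth[OF D] by (simp add: mult_ac)
  moreover have "Ck k (\<lambda>x :: real^'n. (d * axis j 1 $ i) * flat q (c + d * x $ i))" for j
    by (rule Ck_mult[OF Ck_const Suc.IH])
  ultimately show ?case using differentiableI[OF D] by simp
qed

section \<open>Test functions\<close>

lemma test_functions_mono: "U \<subseteq> U' \<Longrightarrow> test_functions U \<subseteq> test_functions U'"
  by (auto simp: test_functions_def)

lemma test_functionsI:
  assumes "smooth \<phi>" "compact K" "K \<subseteq> U" "\<And>x. x \<notin> K \<Longrightarrow> \<phi> x = 0"
  shows "\<phi> \<in> test_functions U"
proof -
  have "{x. \<phi> x \<noteq> 0} \<subseteq> K" using assms(4) by blast
  then have sub: "closure {x. \<phi> x \<noteq> 0} \<subseteq> K" using assms(2) by (simp add: closure_minimal compact_imp_closed)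
  then have "compact (closure {x. \<phi> x \<noteq> 0})"
    using compact_Int_closed[OF assms(2), of "closure {x. \<phi> x \<noteq> 0}"] by (simp add: inf.absorb2)
  then show ?thesis using sub assms by (auto simp: test_functions_def)
qed

lemma grad_zero_outside:
  assumes "compact K" "\<And>x. x \<notin> K \<Longrightarrow> \<phi> x = 0" "x \<notin> K"
  shows "grad \<phi> x = 0"
proof -
  have "((\<lambda>x. 0) has_derivative (\<lambda>h. 0)) (at x)" by simp
  moreover have "open (- K)" using assms(1) by (simp add: compact_imp_closed open_Compl)
  ultimately have "(\<phi> has_derivative (\<lambda>h. 0)) (at x)"
    by (rule has_derivative_transform_within_open) (use assms in auto)
  then show ?thesis by (simp add: vec_eq_iff grad_nth)
qed

lemma Ck1_D:
  assumes "Ck 1 \<phi>"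
  shows "\<phi> differentiable (at x)" "continuous_on UNIV \<phi>" "continuous_on UNIV (grad \<phi>)"
proof -
  show "\<phi> differentiable (at x)" using assms by simp
  show "continuous_on UNIV \<phi>" using Ck_Suc_imp[of 0 \<phi>] assms by simp
  have "continuous_on UNIV (\<lambda>x. \<chi> i. grad \<phi> x $ i)"
    using assms by (intro continuous_on_vec_lambda) simp
  then show "continuous_on UNIV (grad \<phi>)" by simp
qed

lemma test_functionsE:
  assumes "\<phi> \<in> test_functions U"
  obtains K where "compact K" "K \<subseteq> U" "\<And>x. x \<notin> K \<Longrightarrow> \<phi> x = 0" "\<And>x. x \<notin> K \<Longrightarrow> grad \<phi> x = 0"
proof -
  define K where "K = closure {x. \<phi> x \<noteq> 0}"
  have K: "compact K" "K \<subseteq> U" using assms by (auto simp: test_functions_def K_def)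
  have z: "x \<notin> K \<Longrightarrow> \<phi> x = 0" for x using closure_subset[of "{x. \<phi> x \<noteq> 0}"] by (auto simp: K_def)
  show ?thesis by (rule that[OF K z]) (auto intro: grad_zero_outside[OF K(1) z])
qed

lemma test_functions_Ck: "\<phi> \<in> test_functions U \<Longrightarrow> Ck k \<phi>"
  by (auto simp: test_functions_def smooth_def)

lemmas test_differentiable = Ck1_D(1)[OF test_functions_Ck]
lemmas test_continuous = Ck1_D(2)[OF test_functions_Ck]
lemmas test_grad_continuous = Ck1_D(3)[OF test_functions_Ck]

lemma continuous_measurable_lebesgue:
  fixes f :: "real^'n \<Rightarrow> 'b::euclidean_space"
  shows "continuous_on UNIV f \<Longrightarrow> f \<in> borel_measurable lebesgue"
  by (simp add: borel_measurable_continuous_onI measurable_completion)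

lemma test_linear:
  assumes "\<phi> \<in> test_functions U" "\<psi> \<in> test_functions U"
  shows "(\<lambda>x. \<phi> x + c * \<psi> x) \<in> test_functions U"
proof -
  obtain K where K: "compact K" "K \<subseteq> U" "\<And>x. x \<notin> K \<Longrightarrow> \<phi> x = 0" using test_functionsE[OF assms(1)] by metis
  obtain L where L: "compact L" "L \<subseteq> U" "\<And>x. x \<notin> L \<Longrightarrow> \<psi> x = 0" using test_functionsE[OF assms(2)] by metis
  show ?thesis
  proof (rule test_functionsI[of _ "K \<union> L"])
    show "smooth (\<lambda>x. \<phi> x + c * \<psi> x)" unfolding smooth_def
      using assms by (intro allI Ck_add Ck_mult Ck_const) (auto intro: test_functions_Ck)
  qed (use K L in auto)
qed

lemma test_zero: "(\<lambda>x. 0) \<in> test_functions U"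
  by (rule test_functionsI[of _ "{}"]) (auto simp: smooth_def)

lemma test_grad_linear:
  assumes "\<phi> \<in> test_functions U" "\<psi> \<in> test_functions U"
  shows "grad (\<lambda>x. \<phi> x + c * \<psi> x) = (\<lambda>x. grad \<phi> x + c *\<^sub>R grad \<psi> x)"
  using assms by (intro ext grad_linear test_differentiable)

lemma compact_support_bounded:
  fixes f :: "real^'n \<Rightarrow> 'b::euclidean_space"
  assumes "continuous_on UNIV f" "compact K" "\<And>x. x \<notin> K \<Longrightarrow> f x = 0"
  obtains B where "0 < B" "\<And>x. norm (f x) \<le> B"
proof -
  have "compact (f ` K)" using assms by (intro compact_continuous_image) (auto intro: continuous_on_subset)
  then obtain B where B: "0 < B" "\<forall>y\<in>f ` K. norm y \<le> B" using compact_imp_bounded bounded_pos by metis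
  show ?thesis
  proof (rule that[OF B(1)])
    fix x show "norm (f x) \<le> B" using B assms(3)[of x] by (cases "x \<in> K") auto
  qed
qed

lemma compact_support_integrable:
  fixes f :: "real^'n \<Rightarrow> 'b::euclidean_space"
  assumes "continuous_on UNIV f" "compact K" "\<And>x. x \<notin> K \<Longrightarrow> f x = 0"
  shows "integrable lebesgue f"
proof -
  obtain B where B: "0 < B" "\<And>x. norm (f x) \<le> B" using compact_support_bounded[OF assms] by metis
  have K: "K \<in> sets lebesgue" "vol K < \<infinity>"
    using fmeasurableD[OF lmeasurable_compact[OF assms(2)]] fmeasurableD2[OF lmeasurable_compact[OF assms(2)]]
    by (simp_all add: less_top)
  have "integrable lebesgue (\<lambda>x. B * indicator K x :: real)"
    using K by (intro integrable_mult_right integrable_real_indicator) auto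
  then show ?thesis
    by (rule Bochner_Integration.integrable_bound)
       (use B assms in \<open>auto intro!: AE_I2 continuous_measurable_lebesgue split: split_indicator\<close>)
qed

text \<open>Products of exp(-1/t) in the coordinates: test functions that increase to the
  indicator of a box.\<close>

definition box_bump :: "real^'n \<Rightarrow> real^'n \<Rightarrow> nat \<Rightarrow> real^'n \<Rightarrow> real" where
  "box_bump a b k x = (\<Prod>i\<in>UNIV. flat 1 (- (real k * a $ i) + real k * x $ i) * flat 1 (real k * b $ i + - real k * x $ i))"

lemma box_bump_test:
  assumes "cbox a b \<subseteq> U" shows "box_bump a b k \<in> test_functions U"
proof (rule test_functionsI[OF _ compact_cbox assms])
  show "smooth (box_bump a b k)"
    unfolding smooth_def box_bump_def[abs_def] by (intro allI Ck_prod Ck_mult Ck_flat) simp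
  fix x assume "x \<notin> cbox a b"
  then obtain i where "x $ i < a $ i \<or> b $ i < x $ i" by (auto simp: mem_box_cart not_le)
  then have "flat 1 (- (real k * a $ i) + real k * x $ i) * flat 1 (real k * b $ i + - real k * x $ i) = 0"
    by (auto simp: flat_def mult_less_cancel_left)
  then show "box_bump a b k x = 0" unfolding box_bump_def by (subst prod_zero_iff) auto
qed

lemma flat_1_bounds: "0 \<le> flat 1 t" "flat 1 t \<le> 1"
  by (auto simp: flat_def)

lemma flat_1_limit: "(\<lambda>k. flat 1 (real k * t)) \<longlonglongrightarrow> (if 0 < t then 1 else 0)"
proof (cases "0 < t")
  case True
  have "(\<lambda>k. exp (- (1 / t) * (1 / real k))) \<longlonglongrightarrow> exp (- (1 / t) * 0)"
    by (intro tendsto_intros lim_1_over_n)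
  moreover have "\<forall>\<^sub>F k in sequentially. exp (- (1 / t) * (1 / real k)) = flat 1 (real k * t)"
    using eventually_gt_at_top[of 0] by eventually_elim (use True in \<open>simp add: flat_def mult.commute\<close>)
  ultimately show ?thesis using True by (simp add: Lim_transform_eventually)
next
  case False
  then have "flat 1 (real k * t) = 0" for k by (auto simp: flat_def zero_less_mult_iff)
  then show ?thesis using False by simp
qed

lemma box_bump_bounds: "0 \<le> box_bump a b k x" "box_bump a b k x \<le> indicator (cbox a b) x"
proof -
  show "0 \<le> box_bump a b k x" unfolding box_bump_def by (intro prod_nonneg mult_nonneg_nonneg flat_1_bounds)
  have "box_bump a b k x \<le> 1" unfolding box_bump_def
    by (intro prod_le_1 conjI mult_nonneg_nonneg mult_le_one flat_1_bounds)
  moreover have "x \<notin> cbox a b \<Longrightarrow> box_bump a b k x = 0"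
    using test_functionsE[OF box_bump_test[of a b "cbox a b" k]] by (metis order_refl subsetD)
  ultimately show "box_bump a b k x \<le> indicator (cbox a b) x" by (auto split: split_indicator)
qed

lemma box_bump_limit: "(\<lambda>k. box_bump a b k x) \<longlonglongrightarrow> indicator (box a b) x"
proof -
  have "(\<lambda>k. \<Prod>i\<in>UNIV. flat 1 (real k * (x $ i - a $ i)) * flat 1 (real k * (b $ i - x $ i))) \<longlonglongrightarrow>
     (\<Prod>i\<in>UNIV. (if 0 < x $ i - a $ i then 1 else 0) * (if 0 < b $ i - x $ i then 1 else 0))"
    by (intro tendsto_prod tendsto_mult flat_1_limit)
  moreover have "(\<Prod>i\<in>UNIV. (if 0 < x $ i - a $ i then 1 else 0) * (if 0 < b $ i - x $ i then 1 else (0::real))) =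
     indicator (box a b) x"
  proof (cases "x \<in> box a b")
    case False
    then obtain i where "\<not> (a $ i < x $ i \<and> x $ i < b $ i)" by (auto simp: mem_box_cart)
    then have "(\<Prod>i\<in>UNIV. (if 0 < x $ i - a $ i then 1 else 0) * (if 0 < b $ i - x $ i then 1 else (0::real))) = 0"
      by (subst prod_zero_iff) auto
    then show ?thesis using False by simp
  qed (simp add: mem_box_cart)
  ultimately show ?thesis by (simp add: box_bump_def algebra_simps)
qed

section \<open>Integration by parts\<close>

lemma integral_translate_lebesgue:
  fixes f :: "real^'n \<Rightarrow> real"
  assumes "continuous_on UNIV f"
  shows "(\<integral>x. f (c + x) \<partial>lebesgue) = (\<integral>x. f x \<partial>lebesgue)"
proof -
  have m: "f \<in> borel_measurable borel" using assms by (rule borel_measurable_continuous_onI)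
  have "(\<integral>x. f x \<partial>lborel) = (\<integral>x. f x \<partial>distr lborel borel ((+) c))" by (simp add: lborel_distr_plus)
  also have "\<dots> = (\<integral>x. f (c + x) \<partial>lborel)" by (rule integral_distr) (use m in auto)
  finally show ?thesis using m by (simp add: integral_completion)
qed

text \<open>The integral of a partial derivative of a compactly supported function is the limit of
  the integrals of difference quotients, which vanish by translation invariance.\<close>

lemma integral_grad_zero:
  fixes \<psi> :: "real^'n \<Rightarrow> real"
  assumes \<psi>: "Ck 1 \<psi>" and K: "compact K" "\<And>x. x \<notin> K \<Longrightarrow> \<psi> x = 0"
  shows "(\<integral>x. grad \<psi> x $ i \<partial>lebesgue) = 0"
proof -
  define e where "e = (axis i 1 :: real^'n)"
  have ne: "norm e = 1" by (simp add: e_def)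
  define t where "t k = 1 / (real k + 1)" for k
  have t: "0 < t k" "t k \<le> 1" for k by (auto simp: t_def)
  have t0: "t \<longlonglongrightarrow> 0" unfolding t_def using LIMSEQ_inverse_real_of_nat by (simp add: inverse_eq_divide add.commute)
  \<comment> \<open>The difference quotients are bounded on a common ball, so dominated convergence applies.\<close>
  define q where "q k x = (\<psi> (t k *\<^sub>R e + x) - \<psi> x) / t k" for k x
  have cont: "continuous_on UNIV \<psi>" by (rule Ck1_D(2)[OF \<psi>])
  have g0: "x \<notin> K \<Longrightarrow> grad \<psi> x = 0" for x using grad_zero_outside[OF K] .
  obtain B where B: "0 < B" "\<And>x. norm (grad \<psi> x) \<le> B"
    using compact_support_bounded[OF Ck1_D(3)[OF \<psi>] K(1) g0] by metis
  have line: "((\<lambda>s. \<psi> (s *\<^sub>R e + x)) has_real_derivative grad \<psi> (s *\<^sub>R e + x) $ i) (at s)" for x s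
  proof -
    have d: "(\<psi> has_derivative frechet_derivative \<psi> (at (s *\<^sub>R e + x))) (at (s *\<^sub>R e + x))"
      using Ck1_D(1)[OF \<psi>] by (simp add: frechet_derivative_works[symmetric])
    have l: "((\<lambda>s. s *\<^sub>R e + x) has_derivative (\<lambda>d. d *\<^sub>R e)) (at s)"
      by (auto intro!: derivative_eq_intros)
    have "frechet_derivative \<psi> (at (s *\<^sub>R e + x)) (r *\<^sub>R e) = r * grad \<psi> (s *\<^sub>R e + x) $ i" for r
      using linear_cmul[OF has_derivative_linear[OF d], of r e] by (simp add: grad_def e_def)
    then show ?thesis using diff_chain_at[OF l d]
      by (simp add: has_field_derivative_def o_def mult.commute[of _ "grad \<psi> _ $ i"])
  qed
  have qgrad: "\<exists>z. 0 < z \<and> z < t k \<and> q k x = grad \<psi> (z *\<^sub>R e + x) $ i" for k x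
    using MVT2[of 0 "t k" "\<lambda>s. \<psi> (s *\<^sub>R e + x)" "\<lambda>s. grad \<psi> (s *\<^sub>R e + x) $ i"] line t[of k]
    by (auto simp: q_def)
  obtain R where R: "\<And>x. x \<in> K \<Longrightarrow> norm x \<le> R" using compact_imp_bounded[OF K(1)] by (auto simp: bounded_iff)
  have bound: "norm (q k x) \<le> B * indicator (cball 0 (R + 1)) x" for k x
  proof -
    obtain z where z: "0 < z" "z < t k" "q k x = grad \<psi> (z *\<^sub>R e + x) $ i" using qgrad by blast
    have "norm (q k x) \<le> norm (grad \<psi> (z *\<^sub>R e + x))" using z(3) component_le_norm_cart by simp
    also have "\<dots> \<le> B * indicator (cball 0 (R + 1)) x"
    proof (cases "x \<in> cball 0 (R + 1)")
      case False
      have "norm x \<le> norm (z *\<^sub>R e + x) + norm (z *\<^sub>R e)" by (metis add_diff_cancel_left' norm_triangle_sub add.commute norm_minus_commute norm_triangle_ineq4)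
      then have "R < norm (z *\<^sub>R e + x)" using False z t[of k] ne by simp
      then have "z *\<^sub>R e + x \<notin> K" using R by force
      then show ?thesis using g0 False by simp
    qed (use B in simp)
    finally show ?thesis .
  qed
  have lim: "(\<lambda>k. q k x) \<longlonglongrightarrow> grad \<psi> x $ i" for x
  proof -
    have "(\<lambda>h. (\<psi> ((0 + h) *\<^sub>R e + x) - \<psi> (0 *\<^sub>R e + x)) / h) \<midarrow>0\<rightarrow> grad \<psi> (0 *\<^sub>R e + x) $ i"
      using line[of x 0] unfolding DERIV_def .
    then have *: "(\<lambda>h. (\<psi> (h *\<^sub>R e + x) - \<psi> x) / h) \<midarrow>0\<rightarrow> grad \<psi> x $ i" by simp
    have "filterlim t (at 0) sequentially" using t0 t(1) by (auto simp: filterlim_at intro!: always_eventually less_imp_neq[symmetric])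
    then show ?thesis unfolding q_def by (rule filterlim_compose[OF *])
  qed
  have qc: "continuous_on UNIV (q k)" for k
    unfolding q_def[abs_def] using t(1)[of k]
    by (intro continuous_intros continuous_on_compose2[OF cont]) auto
  have "(\<lambda>k. \<integral>x. q k x \<partial>lebesgue) \<longlonglongrightarrow> (\<integral>x. grad \<psi> x $ i \<partial>lebesgue)"
  proof (rule integral_dominated_convergence[where w = "\<lambda>x. B * indicator (cball 0 (R + 1)) x"])
    show "(\<lambda>x. grad \<psi> x $ i) \<in> borel_measurable lebesgue" using \<psi> by (intro continuous_measurable_lebesgue) simp
    show "q k \<in> borel_measurable lebesgue" for k by (rule continuous_measurable_lebesgue[OF qc])
    show "integrable lebesgue (\<lambda>x. B * indicator (cball (0 :: real^'n) (R + 1)) x)"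
      by (intro integrable_mult_right integrable_real_indicator) (use fmeasurableD2[OF lmeasurable_cball[of "0 :: real^'n" "R + 1"]] in \<open>auto simp: less_top\<close>)
  qed (use lim bound in auto)
  moreover have "(\<integral>x. q k x \<partial>lebesgue) = 0" for k
  proof -
    have i1: "integrable lebesgue \<psi>" by (rule compact_support_integrable[OF cont K])
    have c2: "continuous_on UNIV (\<lambda>x. \<psi> (t k *\<^sub>R e + x))"
      by (intro continuous_on_compose2[OF cont] continuous_intros) auto
    have i2: "integrable lebesgue (\<lambda>x. \<psi> (t k *\<^sub>R e + x))"
    proof (rule compact_support_integrable[OF c2])
      show "compact ((\<lambda>y. y - t k *\<^sub>R e) ` K)" using K(1) by (intro compact_continuous_image continuous_intros)
      fix x assume "x \<notin> (\<lambda>y. y - t k *\<^sub>R e) ` K"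
      then have "t k *\<^sub>R e + x \<notin> K" by (metis add_diff_cancel_left' image_eqI)
      then show "\<psi> (t k *\<^sub>R e + x) = 0" by (rule K(2))
    qed
    show ?thesis unfolding q_def
      using i1 i2 by (simp add: integral_translate_lebesgue[OF cont])
  qed
  ultimately show ?thesis by (simp add: LIMSEQ_const_iff)
qed

lemma integral_vec_nth:
  fixes f :: "'a \<Rightarrow> real^'n"
  assumes "integrable M f" shows "(\<integral>x. f x \<partial>M) $ i = (\<integral>x. f x $ i \<partial>M)"
  using integral_bounded_linear[OF bounded_linear_vec_nth assms] by simp

lemma integrable_vec_nth:
  fixes f :: "'a \<Rightarrow> real^'n"
  shows "integrable M f \<Longrightarrow> integrable M (\<lambda>x. f x $ i)"
  using integrable_bounded_linear[OF bounded_linear_vec_nth] .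

lemma test_integration_by_parts:
  fixes \<phi> \<psi> :: "real^'n \<Rightarrow> real"
  assumes \<phi>: "\<phi> \<in> test_functions U" and \<psi>: "\<psi> \<in> test_functions U'"
  shows "(\<integral>x. \<phi> x *\<^sub>R grad \<psi> x \<partial>lebesgue) = - (\<integral>x. \<psi> x *\<^sub>R grad \<phi> x \<partial>lebesgue)"
proof -
  obtain K where K: "compact K" "\<And>x. x \<notin> K \<Longrightarrow> \<phi> x = 0" "\<And>x. x \<notin> K \<Longrightarrow> grad \<phi> x = 0"
    using test_functionsE[OF \<phi>] by metis
  obtain L where L: "compact L" "\<And>x. x \<notin> L \<Longrightarrow> \<psi> x = 0" "\<And>x. x \<notin> L \<Longrightarrow> grad \<psi> x = 0"
    using test_functionsE[OF \<psi>] by metis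
  have c: "continuous_on UNIV (\<lambda>x. \<phi> x *\<^sub>R grad \<psi> x)" "continuous_on UNIV (\<lambda>x. \<psi> x *\<^sub>R grad \<phi> x)"
    by (intro continuous_on_scaleR test_continuous[OF \<phi>] test_continuous[OF \<psi>]
        test_grad_continuous[OF \<phi>] test_grad_continuous[OF \<psi>])+
  have i1: "integrable lebesgue (\<lambda>x. \<phi> x *\<^sub>R grad \<psi> x)"
    by (rule compact_support_integrable[OF c(1) K(1)]) (simp add: K)
  have i2: "integrable lebesgue (\<lambda>x. \<psi> x *\<^sub>R grad \<phi> x)"
    by (rule compact_support_integrable[OF c(2) K(1)]) (simp add: K)
  have "(\<integral>x. \<phi> x *\<^sub>R grad \<psi> x \<partial>lebesgue) $ i + (\<integral>x. \<psi> x *\<^sub>R grad \<phi> x \<partial>lebesgue) $ i = 0" for i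
  proof -
    have "(\<integral>x. grad (\<lambda>x. \<phi> x * \<psi> x) x $ i \<partial>lebesgue) = 0"
      by (rule integral_grad_zero[OF Ck_mult K(1)])
        (use test_functions_Ck[OF \<phi>] test_functions_Ck[OF \<psi>] K in auto)
    moreover have "grad (\<lambda>x. \<phi> x * \<psi> x) x $ i = (\<phi> x *\<^sub>R grad \<psi> x) $ i + (\<psi> x *\<^sub>R grad \<phi> x) $ i" for x
      by (simp add: grad_mult[OF test_differentiable[OF \<phi>] test_differentiable[OF \<psi>]])
    ultimately show ?thesis
      unfolding integral_vec_nth[OF i1] integral_vec_nth[OF i2]
      using Bochner_Integration.integral_add[OF integrable_vec_nth[OF i1, of i] integrable_vec_nth[OF i2, of i]] by simp
  qed
  then show ?thesis by (simp add: vec_eq_iff eq_neg_iff_add_eq_0)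
qed

text \<open>Poincare's inequality, by integrating the derivative of \<open>x\<^sub>i \<phi>\<^sup>2\<close>.\<close>

lemma test_Poincare:
  fixes \<phi> :: "real^'n \<Rightarrow> real"
  assumes \<phi>: "\<phi> \<in> test_functions U" and R: "\<And>x. x \<in> U \<Longrightarrow> norm x \<le> R"
  shows "(\<integral>x. (\<phi> x)\<^sup>2 \<partial>lebesgue) \<le> 4 * R\<^sup>2 * (\<integral>x. (norm (grad \<phi> x))\<^sup>2 \<partial>lebesgue)"
proof -
  obtain i :: 'n where True by simp
  obtain K where K: "compact K" "K \<subseteq> U" "\<And>x. x \<notin> K \<Longrightarrow> \<phi> x = 0" "\<And>x. x \<notin> K \<Longrightarrow> grad \<phi> x = 0"
    using test_functionsE[OF \<phi>] by metis
  have Ck: "Ck 1 (\<lambda>x. x $ i * (\<phi> x * \<phi> x))"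
    by (intro Ck_mult Ck_nth test_functions_Ck[OF \<phi>])
  have cont: "continuous_on UNIV \<phi>" "continuous_on UNIV (grad \<phi>)"
    by (rule test_continuous[OF \<phi>] test_grad_continuous[OF \<phi>])+
  have i1: "integrable lebesgue (\<lambda>x. (\<phi> x)\<^sup>2)"
    by (rule compact_support_integrable[OF _ K(1)]) (use cont K in \<open>auto intro!: continuous_intros\<close>)
  have i2: "integrable lebesgue (\<lambda>x. (norm (grad \<phi> x))\<^sup>2)"
    by (rule compact_support_integrable[OF _ K(1)]) (use cont K in \<open>auto intro!: continuous_intros\<close>)
  have i3: "integrable lebesgue (\<lambda>x. grad (\<lambda>x. x $ i * (\<phi> x * \<phi> x)) x $ i)"
  proof (rule compact_support_integrable[OF _ K(1)])
    show "continuous_on UNIV (\<lambda>x. grad (\<lambda>x. x $ i * (\<phi> x * \<phi> x)) x $ i)"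
      using Ck by simp
    show "grad (\<lambda>x. x $ i * (\<phi> x * \<phi> x)) x $ i = 0" if "x \<notin> K" for x
      using grad_zero_outside[OF K(1), of "\<lambda>x. x $ i * (\<phi> x * \<phi> x)" x] that K(3) by simp
  qed
  \<comment> \<open>The product rule for \<open>x\<^sub>i \<phi>\<^sup>2\<close>, with Young's inequality for the mixed term.\<close>
  have pt: "(\<phi> x)\<^sup>2 \<le> (1 / 2) * (\<phi> x)\<^sup>2 + 2 * R\<^sup>2 * (norm (grad \<phi> x))\<^sup>2 + grad (\<lambda>x. x $ i * (\<phi> x * \<phi> x)) x $ i" for x
  proof (cases "x \<in> K")
    case False
    then show ?thesis using K grad_zero_outside[OF K(1), of "\<lambda>x. x $ i * (\<phi> x * \<phi> x)" x] by simp
  next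
    case True
    then have xR: "\<bar>x $ i\<bar> \<le> R" using K(2) R component_le_norm_cart[of x i] by (meson order_trans subsetD)
    have dphi: "\<phi> differentiable (at x)" by (rule test_differentiable[OF \<phi>])
    have "grad (\<lambda>x. x $ i) x $ i = 1"
      by (simp add: grad_nth[OF has_derivative_nth])
    then have g: "grad (\<lambda>x. x $ i * (\<phi> x * \<phi> x)) x $ i = (\<phi> x)\<^sup>2 + 2 * x $ i * \<phi> x * grad \<phi> x $ i"
      using dphi by (simp add: grad_mult differentiableI[OF has_derivative_nth] differentiable_mult power2_eq_square algebra_simps)
    have "(x $ i * grad \<phi> x $ i)\<^sup>2 \<le> R\<^sup>2 * (norm (grad \<phi> x))\<^sup>2"
    proof -
      have "\<bar>x $ i * grad \<phi> x $ i\<bar> \<le> R * norm (grad \<phi> x)"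
        unfolding abs_mult using xR component_le_norm_cart[of "grad \<phi> x" i] by (intro mult_mono) auto
      then have "(x $ i * grad \<phi> x $ i)\<^sup>2 \<le> (R * norm (grad \<phi> x))\<^sup>2"
        by (metis abs_le_square_iff abs_of_nonneg abs_ge_zero order_trans)
      then show ?thesis by (simp add: power_mult_distrib)
    qed
    moreover have "0 \<le> (1 / 2) * (\<phi> x + 2 * (x $ i * grad \<phi> x $ i))\<^sup>2" by simp
    then have "0 \<le> (1 / 2) * (\<phi> x)\<^sup>2 + 2 * (x $ i * grad \<phi> x $ i) * \<phi> x + 2 * (x $ i * grad \<phi> x $ i)\<^sup>2"
      by (simp add: power2_sum power_mult_distrib field_simps)
    ultimately show ?thesis unfolding g by (simp add: algebra_simps)
  qed
  have "(\<integral>x. (\<phi> x)\<^sup>2 \<partial>lebesgue) \<le>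
      (\<integral>x. (1 / 2) * (\<phi> x)\<^sup>2 + 2 * R\<^sup>2 * (norm (grad \<phi> x))\<^sup>2 + grad (\<lambda>x. x $ i * (\<phi> x * \<phi> x)) x $ i \<partial>lebesgue)"
    by (rule integral_mono) (use i1 i2 i3 pt in auto)
  also have "\<dots> = (1 / 2) * (\<integral>x. (\<phi> x)\<^sup>2 \<partial>lebesgue) + 2 * R\<^sup>2 * (\<integral>x. (norm (grad \<phi> x))\<^sup>2 \<partial>lebesgue)
      + (\<integral>x. grad (\<lambda>x. x $ i * (\<phi> x * \<phi> x)) x $ i \<partial>lebesgue)"
    using i1 i2 i3 by simp
  also have "(\<integral>x. grad (\<lambda>x. x $ i * (\<phi> x * \<phi> x)) x $ i \<partial>lebesgue) = 0"
    by (rule integral_grad_zero[OF Ck K(1)]) (simp add: K)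
  finally show ?thesis by simp
qed

section \<open>Uniqueness of weak gradients\<close>

text \<open>The positive and the negative part of f, as densities, give measures that agree on boxes.  Boxes
  generate the Borel sets and are stable under intersection, so the two measures are equal.\<close>

lemma integral_boxes_zero_imp_AE:
  fixes f :: "'a::euclidean_space \<Rightarrow> real"
  assumes f: "integrable lebesgue f" and zero: "\<And>a b. (\<integral>x. indicator (box a b) x * f x \<partial>lebesgue) = 0"
  shows "AE x in lebesgue. f x = 0"
proof -
  obtain g where g: "g \<in> borel_measurable lborel" "AE x in lborel. f x = g x"
    using completion_ex_borel_measurable_real[of f lborel] f by auto
  have fg: "AE x in lebesgue. f x = g x" using g(2) by (simp add: AE_completion)
  have gl: "g \<in> borel_measurable lebesgue" using g(1) by (rule measurable_completion)
  have gi': "integrable lebesgue g" by (rule integrable_cong_AE_imp[OF f gl]) (use fg in \<open>auto elim: AE_mp\<close>)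
  then have gi: "integrable lborel g" using g(1) integrable_completion by blast
  have [measurable]: "g \<in> borel_measurable borel" using g(1) by simp
  have z: "(\<integral>x. indicator (box a b) x * g x \<partial>lborel) = 0" for a b
  proof -
    have "(\<integral>x. indicator (box a b) x * g x \<partial>lborel) = (\<integral>x. indicator (box a b) x * g x \<partial>lebesgue)"
      by (subst integral_completion) auto
    also have "\<dots> = (\<integral>x. indicator (box a b) x * f x \<partial>lebesgue)"
    proof (rule integral_cong_AE)
      have i: "indicat_real (box a b) \<in> borel_measurable lebesgue" by (rule borel_measurable_indicator) simp
      show "(\<lambda>x. indicator (box a b) x * g x) \<in> borel_measurable lebesgue"
        by (rule borel_measurable_times[OF i gl])
      show "(\<lambda>x. indicator (box a b) x * f x) \<in> borel_measurable lebesgue"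
        by (rule borel_measurable_times[OF i borel_measurable_integrable[OF f]])
      show "AE x in lebesgue. indicator (box a b) x * g x = indicator (box a b) x * f x"
        using fg by eventually_elim simp
    qed
    finally show ?thesis using zero by simp
  qed
  have "density lborel (\<lambda>x. ennreal (g x)) = density lborel (\<lambda>x. ennreal (- g x))"
  proof (rule measure_eqI_generator_eq)
    let ?E = "range (\<lambda>(a, b). box a b::'a set)"
    let ?A = "\<lambda>n::nat. box (- (real n *\<^sub>R One)) (real n *\<^sub>R One) :: 'a set"
    show "Int_stable ?E" by (auto simp: Int_stable_def box_Int_box)
    show "?E \<subseteq> Pow UNIV" by simp
    show "sets (density lborel (\<lambda>x. ennreal (g x))) = sigma_sets UNIV ?E"
      "sets (density lborel (\<lambda>x. ennreal (- g x))) = sigma_sets UNIV ?E"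
      by (simp_all add: borel_eq_box)
    show "range ?A \<subseteq> ?E" "(\<Union>i. ?A i) = UNIV" unfolding UN_box_eq_UNIV by auto
    have em: "emeasure (density lborel (\<lambda>x. ennreal (c * g x))) (box a b) =
       (\<integral>\<^sup>+x. ennreal (c * (indicator (box a b) x * g x)) \<partial>lborel)" for a b and c :: real
      by (subst emeasure_density) (auto intro!: nn_integral_cong split: split_indicator)
    have int: "integrable lborel (\<lambda>x. indicator (box a b) x * g x)" for a b
      using integrable_mult_indicator[of "box a b" lborel g] gi by simp
    have fin: "(\<integral>\<^sup>+x. ennreal (c * (indicator (box a b) x * g x)) \<partial>lborel) < top" for a b and c :: real
    proof (rule le_less_trans)
      show "(\<integral>\<^sup>+x. ennreal (c * (indicator (box a b) x * g x)) \<partial>lborel) \<le>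
         (\<integral>\<^sup>+x. ennreal (norm (c * (indicator (box a b) x * g x))) \<partial>lborel)"
        by (intro nn_integral_mono ennreal_leI) simp
      show "\<dots> < top" using conjunct2[OF iffD1[OF integrable_iff_bounded integrable_mult_right[OF int, of c a b]]]
        by (simp only: infinity_ennreal_def)
    qed
    show "emeasure (density lborel (\<lambda>x. ennreal (g x))) (?A i) \<noteq> \<infinity>" for i
      using em[of 1 "- (real i *\<^sub>R One)" "real i *\<^sub>R One"] fin[of 1 "- (real i *\<^sub>R One)" "real i *\<^sub>R One"] by simp
    show "emeasure (density lborel (\<lambda>x. ennreal (g x))) X = emeasure (density lborel (\<lambda>x. ennreal (- g x))) X"
      if XE: "X \<in> ?E" for X
    proof -
      obtain a b where X: "X = box a b" using XE by auto
      define h where "h x = indicator (box a b) x * g x" for x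
      have hi: "integrable lborel h" unfolding h_def[abs_def] by (rule int)
      have "enn2real (\<integral>\<^sup>+x. ennreal (h x) \<partial>lborel) - enn2real (\<integral>\<^sup>+x. ennreal (- h x) \<partial>lborel) = 0"
        using z[of a b] unfolding h_def[symmetric] real_lebesgue_integral_def[OF hi] .
      moreover have "(\<integral>\<^sup>+x. ennreal (h x) \<partial>lborel) < top" "(\<integral>\<^sup>+x. ennreal (- h x) \<partial>lborel) < top"
        using fin[of 1 a b] fin[of "-1" a b] by (simp_all add: h_def)
      ultimately have "(\<integral>\<^sup>+x. ennreal (h x) \<partial>lborel) = (\<integral>\<^sup>+x. ennreal (- h x) \<partial>lborel)"
        by (metis ennreal_enn2real eq_iff_diff_eq_0)
      then show ?thesis using em[of 1 a b] em[of "-1" a b] by (simp add: X h_def)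
    qed
  qed
  then have "AE x in lborel. ennreal (g x) = ennreal (- g x)"
    by (subst (asm) sigma_finite_measure.density_unique_iff[OF sigma_finite_lborel]) auto
  then have "AE x in lborel. g x = 0"
  proof eventually_elim
    fix x assume "ennreal (g x) = ennreal (- g x)"
    moreover have "ennreal (g x) = 0 \<or> ennreal (- g x) = 0" by (cases "0 \<le> g x") (auto simp: ennreal_neg)
    ultimately have "ennreal (g x) = 0" "ennreal (- g x) = 0" by auto
    then show "g x = 0" by (simp add: ennreal_eq_0_iff)
  qed
  then have "AE x in lebesgue. g x = 0" by (simp add: AE_completion)
  with fg show ?thesis by eventually_elim simp
qed

lemma Lp_loc_1_integrable:
  fixes V :: "real^'n \<Rightarrow> 'b::real_normed_vector" and G :: "real^'n \<Rightarrow> 'c::euclidean_space"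
  assumes V: "Lp_loc 1 U V" and U: "U \<in> sets lebesgue" and K: "compact K" "K \<subseteq> U"
    and G: "G \<in> borel_measurable (lebesgue_on U)"
    and le: "\<And>x. x \<in> U \<Longrightarrow> norm (G x) \<le> indicator K x * (B * norm (V x))" and B: "0 \<le> B"
  shows "integrable (lebesgue_on U) G"
proof (rule integrableI_bounded[OF G])
  have "Lp 1 K V" using V K by (simp add: Lp_loc_def)
  then have fin: "(\<integral>\<^sup>+x\<in>K. ennreal (norm (V x)) \<partial>lebesgue) < top" and Km: "V \<in> borel_measurable (lebesgue_on K)"
    by (simp_all add: Lp_def)
  have Ks: "K \<in> sets lebesgue" using fmeasurableD[OF lmeasurable_compact[OF K(1)]] .
  have m: "(\<lambda>x. ennreal (norm (V x)) * indicator K x) \<in> borel_measurable lebesgue"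
    using Km Ks by (subst borel_measurable_restrict_space_iff_ennreal[symmetric]) auto
  have "(\<integral>\<^sup>+x. ennreal (norm (G x)) \<partial>lebesgue_on U) = (\<integral>\<^sup>+x\<in>U. ennreal (norm (G x)) \<partial>lebesgue)"
    using U by (simp add: nn_integral_restrict_space)
  also have "\<dots> \<le> (\<integral>\<^sup>+x. ennreal B * (ennreal (norm (V x)) * indicator K x) \<partial>lebesgue)"
  proof (rule nn_integral_mono)
    fix x show "ennreal (norm (G x)) * indicator U x \<le> ennreal B * (ennreal (norm (V x)) * indicator K x)"
      using le[of x] K(2) B
      by (cases "x \<in> K"; cases "x \<in> U") (auto simp: ennreal_mult[symmetric] intro!: ennreal_leI)
  qed
  also have "\<dots> = ennreal B * (\<integral>\<^sup>+x\<in>K. ennreal (norm (V x)) \<partial>lebesgue)" by (rule nn_integral_cmult[OF m])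
  also have "\<dots> < top" using fin by (simp add: ennreal_mult_less_top)
  finally show "(\<integral>\<^sup>+x. ennreal (norm (G x)) \<partial>lebesgue_on U) < \<infinity>" by simp
qed

lemma test_times_Lp_loc_integrable:
  fixes V :: "real^'n \<Rightarrow> 'b::euclidean_space"
  assumes V: "Lp_loc 1 U V" and U: "U \<in> sets lebesgue" and \<phi>: "\<phi> \<in> test_functions U"
  shows "integrable (lebesgue_on U) (\<lambda>x. \<phi> x *\<^sub>R V x)"
proof -
  obtain K where K: "compact K" "K \<subseteq> U" "\<And>x. x \<notin> K \<Longrightarrow> \<phi> x = 0" using test_functionsE[OF \<phi>] by metis
  obtain B where B: "0 < B" "\<And>x. norm (\<phi> x) \<le> B"
    using compact_support_bounded[OF test_continuous[OF \<phi>] K(1,3)] by metis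
  show ?thesis
  proof (rule Lp_loc_1_integrable[OF V U K(1,2)])
    have "\<phi> \<in> borel_measurable (lebesgue_on U)"
      by (rule measurable_restrict_space1[OF continuous_measurable_lebesgue[OF test_continuous[OF \<phi>]]])
    then show "(\<lambda>x. \<phi> x *\<^sub>R V x) \<in> borel_measurable (lebesgue_on U)"
      using V by (intro borel_measurable_scaleR) (auto simp: Lp_loc_def)
    show "norm (\<phi> x *\<^sub>R V x) \<le> indicator K x * (B * norm (V x))" for x
      using B(2)[of x] K(3)[of x] by (auto simp: mult_right_mono split: split_indicator)
  qed (use B in simp)
qed

text \<open>The bumps increase to the indicators of boxes, so V has integral zero over every small box.\<close>

lemma test_annihilates_imp_AE_zero:
  fixes V :: "real^'n \<Rightarrow> real"
  assumes U: "open U" and V: "Lp_loc 1 U V"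
    and zero: "\<And>\<phi>. \<phi> \<in> test_functions U \<Longrightarrow> (\<integral>x. \<phi> x * V x \<partial>lebesgue_on U) = 0"
  shows "AE x in lebesgue. x \<in> U \<longrightarrow> V x = 0"
proof -
  have Us: "U \<in> sets lebesgue" using U by simp
  have on_box: "AE x in lebesgue. x \<in> cbox c d \<longrightarrow> V x = 0" if cd: "cbox c d \<subseteq> U" for c d
  proof -
    define W where "W x = indicator (cbox c d) x * V x" for x
    have "Lp 1 (cbox c d) V" using V cd by (simp add: Lp_loc_def)
    then have Vm: "V \<in> borel_measurable (lebesgue_on (cbox c d))"
      and fin: "(\<integral>\<^sup>+x\<in>cbox c d. ennreal (norm (V x)) \<partial>lebesgue) < top" by (simp_all add: Lp_def)
    have Wm: "W \<in> borel_measurable lebesgue"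
      unfolding W_def[abs_def] using Vm borel_measurable_restrict_space_iff[of "cbox c d" lebesgue V] by simp
    have Wi: "integrable lebesgue W"
    proof (rule integrableI_bounded[OF Wm])
      have "(\<integral>\<^sup>+x. ennreal (norm (W x)) \<partial>lebesgue) = (\<integral>\<^sup>+x\<in>cbox c d. ennreal (norm (V x)) \<partial>lebesgue)"
        by (intro nn_integral_cong) (simp add: W_def indicator_def)
      then show "(\<integral>\<^sup>+x. ennreal (norm (W x)) \<partial>lebesgue) < \<infinity>" using fin by simp
    qed
    have box0: "(\<integral>x. indicator (box a b) x * W x \<partial>lebesgue) = 0" if ab: "cbox a b \<subseteq> cbox c d" for a b
    proof -
      have "(\<lambda>k. \<integral>x. box_bump a b k x * W x \<partial>lebesgue) \<longlonglongrightarrow> (\<integral>x. indicator (box a b) x * W x \<partial>lebesgue)"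
      proof (rule integral_dominated_convergence[where w = "\<lambda>x. norm (W x)"])
        have "box_bump a b k \<in> borel_measurable lebesgue" for k
          by (rule continuous_measurable_lebesgue[OF test_continuous[OF box_bump_test[OF order_refl]]])
        then show "(\<lambda>x. box_bump a b k x * W x) \<in> borel_measurable lebesgue" for k using Wm by simp
        show "AE x in lebesgue. norm (box_bump a b k x * W x) \<le> norm (W x)" for k
        proof (rule AE_I2)
          fix x have "\<bar>box_bump a b k x\<bar> \<le> 1"
            using box_bump_bounds[of a b k x] by (cases "x \<in> cbox a b") auto
          from mult_right_mono[OF this abs_ge_zero[of "W x"]]
          show "norm (box_bump a b k x * W x) \<le> norm (W x)" by (simp add: abs_mult)
        qed
        show "(\<lambda>x. indicat_real (box a b) x * W x) \<in> borel_measurable lebesgue"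
          by (intro borel_measurable_times borel_measurable_indicator Wm) simp
      qed (use Wi Wm box_bump_limit[of a b] in \<open>auto intro!: tendsto_mult_right\<close>)
      moreover have "(\<integral>x. box_bump a b k x * W x \<partial>lebesgue) = 0" for k
      proof -
        have t: "box_bump a b k \<in> test_functions U" using ab cd by (intro box_bump_test) blast
        have "box_bump a b k x * W x = indicator U x *\<^sub>R (box_bump a b k x * V x)" for x
        proof (cases "x \<in> cbox a b")
          case True
          then have "x \<in> cbox c d" using ab by (rule subsetD[rotated])
          moreover from this have "x \<in> U" using cd by (rule subsetD[rotated])
          ultimately show ?thesis by (simp add: W_def)
        next
          case False
          then have "box_bump a b k x = 0" using box_bump_bounds[of a b k x] by simp
          then show ?thesis by simp
        qed
        then have "(\<integral>x. box_bump a b k x * W x \<partial>lebesgue) =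
            (\<integral>x. indicator U x *\<^sub>R (box_bump a b k x * V x) \<partial>lebesgue)" by (rule Bochner_Integration.integral_cong[OF refl])
        also have "\<dots> = (\<integral>x. box_bump a b k x * V x \<partial>lebesgue_on U)"
          using Us by (subst integral_restrict_space) auto
        finally have "(\<integral>x. box_bump a b k x * W x \<partial>lebesgue) = (\<integral>x. box_bump a b k x * V x \<partial>lebesgue_on U)" .
        then show ?thesis using zero[OF t] by simp
      qed
      ultimately show ?thesis by (simp add: LIMSEQ_const_iff)
    qed
    have "AE x in lebesgue. indicator (box c d) x * W x = 0"
    proof (rule integral_boxes_zero_imp_AE)
      show "integrable lebesgue (\<lambda>x. indicator (box c d) x * W x)"
        using integrable_mult_indicator[of "box c d" lebesgue W] Wi by simp
      fix a b
      obtain a' b' where ab': "box a b \<inter> box c d = box a' b'" by (rule that[OF box_Int_box])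
      have eq: "indicator (box a b) x * (indicator (box c d) x * W x) = indicator (box a' b') x * W x" for x
        unfolding ab'[symmetric] by (simp add: indicator_inter_arith)
      show "(\<integral>x. indicator (box a b) x * (indicator (box c d) x * W x) \<partial>lebesgue) = 0"
      proof (cases "box a' b' = {}")
        case False
        then have "cbox a' b' = closure (box a' b')" by (simp add: closure_box)
        also have "\<dots> \<subseteq> closure (box c d)" using ab' by (intro closure_mono) blast
        also have "\<dots> \<subseteq> cbox c d" by (rule closure_minimal[OF box_subset_cbox closed_cbox])
        finally show ?thesis unfolding eq by (rule box0)
      qed (simp add: eq)
    qed
    moreover have "AE x in lebesgue. x \<notin> cbox c d - box c d"
      using negligible_frontier_interval[of c d] by (intro AE_not_in) (simp add: negligible_iff_null_sets)
    ultimately show ?thesis by eventually_elim (auto simp: W_def indicator_def split: if_splits)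
  qed
  obtain \<D> where D: "countable \<D>" "\<D> \<subseteq> Pow U" "\<And>X. X \<in> \<D> \<Longrightarrow> \<exists>a b. X = cbox a b" "\<Union>\<D> = U"
    by (rule open_countable_Union_open_cbox[OF U]) (rule that)
  have "AE x in lebesgue. \<forall>X\<in>\<D>. x \<in> X \<longrightarrow> V x = 0"
  proof (subst AE_ball_countable[OF D(1)], rule ballI)
    fix X assume X: "X \<in> \<D>"
    then obtain a b where "X = cbox a b" using D(3) by metis
    then show "AE x in lebesgue. x \<in> X \<longrightarrow> V x = 0" using on_box D(2) X by auto
  qed
  then show ?thesis by eventually_elim (use D(4) in auto)
qed

lemma Lp_loc_diff_nth:
  fixes V W :: "real^'n \<Rightarrow> real^'n"
  assumes "Lp_loc 1 U V" "Lp_loc 1 U W"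
  shows "Lp_loc 1 U (\<lambda>x. V x $ i - W x $ i)"
proof -
  have m: "(\<lambda>x. V x $ i - W x $ i) \<in> borel_measurable (lebesgue_on A)"
    if "V \<in> borel_measurable (lebesgue_on A)" "W \<in> borel_measurable (lebesgue_on A)" for A
    using measurable_compose[OF that(1), of "\<lambda>v. v $ i" borel] measurable_compose[OF that(2), of "\<lambda>v. v $ i" borel]
    by (intro borel_measurable_diff)
       (auto simp: borel_measurable_continuous_onI continuous_on_component)
  have "Lp 1 K (\<lambda>x. V x $ i - W x $ i)" if K: "compact K" "K \<subseteq> U" for K
  proof -
    have Vk: "Lp 1 K V" "Lp 1 K W" using assms K by (auto simp: Lp_loc_def)
    have Ks: "K \<in> sets lebesgue" using fmeasurableD[OF lmeasurable_compact[OF K(1)]] .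
    have mm: "(\<lambda>x. ennreal (norm (V x)) * indicator K x) \<in> borel_measurable lebesgue"
      "(\<lambda>x. ennreal (norm (W x)) * indicator K x) \<in> borel_measurable lebesgue"
      using Vk Ks by (subst borel_measurable_restrict_space_iff_ennreal[symmetric]; auto simp: Lp_def)+
    have "(\<integral>\<^sup>+x\<in>K. ennreal \<bar>V x $ i - W x $ i\<bar> \<partial>lebesgue) \<le>
      (\<integral>\<^sup>+x. ennreal (norm (V x)) * indicator K x + ennreal (norm (W x)) * indicator K x \<partial>lebesgue)"
    proof (rule nn_integral_mono)
      fix x
      have "\<bar>V x $ i - W x $ i\<bar> \<le> norm (V x) + norm (W x)"
        using component_le_norm_cart[of "V x" i] component_le_norm_cart[of "W x" i] by linarith
      then show "ennreal \<bar>V x $ i - W x $ i\<bar> * indicator K x \<le>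
        ennreal (norm (V x)) * indicator K x + ennreal (norm (W x)) * indicator K x"
        by (auto simp: indicator_def ennreal_plus[symmetric] simp del: ennreal_plus intro!: ennreal_leI)
    qed
    also have "\<dots> = (\<integral>\<^sup>+x\<in>K. ennreal (norm (V x)) \<partial>lebesgue) + (\<integral>\<^sup>+x\<in>K. ennreal (norm (W x)) \<partial>lebesgue)"
      by (rule nn_integral_add[OF mm])
    also have "\<dots> < top" using Vk by (simp add: Lp_def)
    finally show ?thesis using m[of K] Vk by (simp add: Lp_def)
  qed
  then show ?thesis using m[of U] assms by (simp add: Lp_loc_def)
qed

text \<open>The difference of two weak gradients annihilates all test functions.\<close>

lemma weak_gradient_unique:
  fixes V W :: "real^'n \<Rightarrow> real^'n"
  assumes U: "open U" and V: "is_weak_gradient U u V" and W: "is_weak_gradient U u W"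
  shows "AE x in lebesgue. x \<in> U \<longrightarrow> V x = W x"
proof -
  have Us: "U \<in> sets lebesgue" using U by simp
  have L: "Lp_loc 1 U V" "Lp_loc 1 U W" using V W by (auto simp: is_weak_gradient_def)
  have "AE x in lebesgue. x \<in> U \<longrightarrow> V x $ i - W x $ i = 0" for i
  proof (rule test_annihilates_imp_AE_zero[OF U Lp_loc_diff_nth[OF L]])
    fix \<phi> assume \<phi>: "\<phi> \<in> test_functions U"
    note iV = test_times_Lp_loc_integrable[OF L(1) Us \<phi>] and iW = test_times_Lp_loc_integrable[OF L(2) Us \<phi>]
    have "(\<integral>x. \<phi> x *\<^sub>R V x \<partial>lebesgue_on U) = (\<integral>x. \<phi> x *\<^sub>R W x \<partial>lebesgue_on U)"
    proof -
      have "(\<integral>x. u x *\<^sub>R grad \<phi> x \<partial>lebesgue_on U) = - (\<integral>x. \<phi> x *\<^sub>R V x \<partial>lebesgue_on U)"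
        "(\<integral>x. u x *\<^sub>R grad \<phi> x \<partial>lebesgue_on U) = - (\<integral>x. \<phi> x *\<^sub>R W x \<partial>lebesgue_on U)"
        using V W \<phi> unfolding is_weak_gradient_def by blast+
      then show ?thesis by simp
    qed
    then have "(\<integral>x. \<phi> x *\<^sub>R V x \<partial>lebesgue_on U) $ i = (\<integral>x. \<phi> x *\<^sub>R W x \<partial>lebesgue_on U) $ i" by simp
    then show "(\<integral>x. \<phi> x * (V x $ i - W x $ i) \<partial>lebesgue_on U) = 0"
      unfolding integral_vec_nth[OF iV] integral_vec_nth[OF iW]
      using Bochner_Integration.integral_diff[OF integrable_vec_nth[OF iV, of i] integrable_vec_nth[OF iW, of i]]
      by (simp add: right_diff_distrib)
  qed
  then have "AE x in lebesgue. \<forall>i. x \<in> U \<longrightarrow> V x $ i - W x $ i = 0"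
    by (simp only: AE_all_countable) blast
  then show ?thesis by eventually_elim (auto simp: vec_eq_iff)
qed

lemma weak_grad_is_weak_gradient:
  "is_weak_gradient U u V \<Longrightarrow> is_weak_gradient U u (weak_grad U u)"
  unfolding weak_grad_def by (rule someI[of "is_weak_gradient U u"])

lemma weak_grad_AE_eq:
  assumes "open U" "is_weak_gradient U u V"
  shows "AE x in lebesgue. x \<in> U \<longrightarrow> weak_grad U u x = V x"
  using weak_gradient_unique[OF assms(1) weak_grad_is_weak_gradient[OF assms(2)] assms(2)] .

section \<open>Square integrable functions\<close>

text \<open>Square integrable functions are kept as functions on the whole space; functions on a subset enter
  after extension by zero.\<close>

definition sq_int :: "(real^'n \<Rightarrow> 'b::euclidean_space) \<Rightarrow> bool" where
  "sq_int f \<longleftrightarrow> f \<in> borel_measurable lebesgue \<and> integrable lebesgue (\<lambda>x. (norm (f x))\<^sup>2)"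

definition l2_inner :: "(real^'n \<Rightarrow> 'b::euclidean_space) \<Rightarrow> (real^'n \<Rightarrow> 'b) \<Rightarrow> real" where
  "l2_inner f g = (\<integral>x. f x \<bullet> g x \<partial>lebesgue)"

definition l2_norm :: "(real^'n \<Rightarrow> 'b::euclidean_space) \<Rightarrow> real" where
  "l2_norm f = sqrt (\<integral>x. (norm (f x))\<^sup>2 \<partial>lebesgue)"

lemma sq_int_measurable: "sq_int f \<Longrightarrow> f \<in> borel_measurable lebesgue"
  by (simp add: sq_int_def)

lemma l2_norm_nonneg [simp]: "0 \<le> l2_norm f"
  by (simp add: l2_norm_def)

lemma l2_norm_sq: "(l2_norm f)\<^sup>2 = (\<integral>x. (norm (f x))\<^sup>2 \<partial>lebesgue)"
  by (simp add: l2_norm_def)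

lemma l2_norm_sq_inner: "(l2_norm f)\<^sup>2 = l2_inner f f"
  by (simp add: l2_norm_sq l2_inner_def power2_norm_eq_inner)

lemma sq_int_dominated:
  fixes f :: "real^'n \<Rightarrow> 'b::euclidean_space" and g :: "real^'n \<Rightarrow> 'c::euclidean_space"
  assumes g: "sq_int g" and f: "f \<in> borel_measurable lebesgue"
    and le: "AE x in lebesgue. norm (f x) \<le> c * norm (g x)" and c: "0 \<le> c"
  shows "sq_int f" "l2_norm f \<le> c * l2_norm g"
proof -
  have gi: "integrable lebesgue (\<lambda>x. c\<^sup>2 * (norm (g x))\<^sup>2)" using g by (simp add: sq_int_def)
  have le2: "AE x in lebesgue. (norm (f x))\<^sup>2 \<le> c\<^sup>2 * (norm (g x))\<^sup>2"
    using le by eventually_elim (metis norm_ge_zero power_mono power_mult_distrib)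
  have fi: "integrable lebesgue (\<lambda>x. (norm (f x))\<^sup>2)"
  proof (rule Bochner_Integration.integrable_bound[OF gi])
    show "(\<lambda>x. (norm (f x))\<^sup>2) \<in> borel_measurable lebesgue" using f by simp
    show "AE x in lebesgue. norm ((norm (f x))\<^sup>2) \<le> norm (c\<^sup>2 * (norm (g x))\<^sup>2)"
      using le2 by eventually_elim simp
  qed
  then show "sq_int f" using f by (simp add: sq_int_def)
  have "(\<integral>x. (norm (f x))\<^sup>2 \<partial>lebesgue) \<le> (\<integral>x. c\<^sup>2 * (norm (g x))\<^sup>2 \<partial>lebesgue)"
    by (rule integral_mono_AE[OF fi gi le2])
  then have "(l2_norm f)\<^sup>2 \<le> (c * l2_norm g)\<^sup>2" by (simp add: l2_norm_sq power_mult_distrib)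
  then show "l2_norm f \<le> c * l2_norm g" by (rule power2_le_imp_le) (simp add: c)
qed

lemma sq_int_lin:
  fixes f g :: "real^'n \<Rightarrow> 'b::euclidean_space"
  assumes f: "sq_int f" and g: "sq_int g" shows "sq_int (\<lambda>x. f x + c *\<^sub>R g x)"
proof -
  have i: "integrable lebesgue (\<lambda>x. 2 * (norm (f x))\<^sup>2 + 2 * c\<^sup>2 * (norm (g x))\<^sup>2)"
    using f g unfolding sq_int_def by (intro Bochner_Integration.integrable_add integrable_mult_right) auto
  have m: "(\<lambda>x. f x + c *\<^sub>R g x) \<in> borel_measurable lebesgue"
    by (intro borel_measurable_add borel_measurable_scaleR borel_measurable_const sq_int_measurable f g)
  have le: "(norm (a + c *\<^sub>R b))\<^sup>2 \<le> 2 * (norm a)\<^sup>2 + 2 * c\<^sup>2 * (norm b)\<^sup>2" for a b :: 'b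
  proof -
    have "(norm (a + c *\<^sub>R b))\<^sup>2 + (norm (a - c *\<^sub>R b))\<^sup>2 = 2 * (norm a)\<^sup>2 + 2 * c\<^sup>2 * (norm b)\<^sup>2"
      unfolding power2_norm_eq_inner
      by (simp add: inner_add_left inner_add_right inner_diff_left inner_diff_right power2_eq_square algebra_simps)
    then show ?thesis using zero_le_power2[of "norm (a - c *\<^sub>R b)"] by linarith
  qed
  have "integrable lebesgue (\<lambda>x. (norm (f x + c *\<^sub>R g x))\<^sup>2)"
  proof (rule Bochner_Integration.integrable_bound[OF i])
    show "(\<lambda>x. (norm (f x + c *\<^sub>R g x))\<^sup>2) \<in> borel_measurable lebesgue" using m by simp
    show "AE x in lebesgue. norm ((norm (f x + c *\<^sub>R g x))\<^sup>2) \<le> norm (2 * (norm (f x))\<^sup>2 + 2 * c\<^sup>2 * (norm (g x))\<^sup>2)"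
      using le by (intro AE_I2) simp
  qed
  then show ?thesis using m by (simp add: sq_int_def)
qed

lemma sq_int_diff: "sq_int f \<Longrightarrow> sq_int g \<Longrightarrow> sq_int (\<lambda>x. f x - g x)"
  using sq_int_lin[of f g "-1"] by simp

lemma sq_int_zero [simp]: "sq_int (\<lambda>x. 0)"
  by (simp add: sq_int_def)

lemma sq_int_inner_integrable:
  fixes f g :: "real^'n \<Rightarrow> 'b::euclidean_space"
  assumes f: "sq_int f" and g: "sq_int g" shows "integrable lebesgue (\<lambda>x. f x \<bullet> g x)"
proof (rule Bochner_Integration.integrable_bound)
  show "integrable lebesgue (\<lambda>x. (norm (f x))\<^sup>2 + (norm (g x))\<^sup>2)" using f g by (simp add: sq_int_def)
  show "(\<lambda>x. f x \<bullet> g x) \<in> borel_measurable lebesgue"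
    by (intro borel_measurable_inner sq_int_measurable f g)
  have "\<bar>a \<bullet> b\<bar> \<le> (norm a)\<^sup>2 + (norm b)\<^sup>2" for a b :: 'b
  proof -
    have "\<bar>a \<bullet> b\<bar> \<le> norm a * norm b" by (rule Cauchy_Schwarz_ineq2)
    also have "\<dots> \<le> (norm a)\<^sup>2 + (norm b)\<^sup>2"
      using sum_squares_bound[of "norm a" "norm b"] mult_nonneg_nonneg[OF norm_ge_zero[of a] norm_ge_zero[of b]] by linarith
    finally show ?thesis .
  qed
  then show "AE x in lebesgue. norm (f x \<bullet> g x) \<le> norm ((norm (f x))\<^sup>2 + (norm (g x))\<^sup>2)"
    by (intro AE_I2) simp
qed

lemma l2_inner_commute: "l2_inner f g = l2_inner g f"
  by (simp add: l2_inner_def inner_commute)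

lemma l2_inner_lin:
  assumes "sq_int f" "sq_int g" "sq_int h"
  shows "l2_inner (\<lambda>x. f x + c *\<^sub>R g x) h = l2_inner f h + c * l2_inner g h"
  using sq_int_inner_integrable[OF assms(1,3)] sq_int_inner_integrable[OF assms(2,3)]
  by (simp add: l2_inner_def inner_add_left)

lemma l2_inner_diff:
  assumes "sq_int f" "sq_int g" "sq_int h"
  shows "l2_inner (\<lambda>x. f x - g x) h = l2_inner f h - l2_inner g h"
  using l2_inner_lin[OF assms, of "-1"] by simp

lemma l2_norm_lin_sq:
  assumes f: "sq_int f" and g: "sq_int g"
  shows "(l2_norm (\<lambda>x. f x + c *\<^sub>R g x))\<^sup>2 = (l2_norm f)\<^sup>2 + 2 * c * l2_inner f g + c\<^sup>2 * (l2_norm g)\<^sup>2"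
proof -
  have h: "sq_int (\<lambda>x. f x + c *\<^sub>R g x)" by (rule sq_int_lin[OF f g])
  have "(l2_norm (\<lambda>x. f x + c *\<^sub>R g x))\<^sup>2 = l2_inner f (\<lambda>x. f x + c *\<^sub>R g x) + c * l2_inner g (\<lambda>x. f x + c *\<^sub>R g x)"
    unfolding l2_norm_sq_inner by (rule l2_inner_lin[OF f g h])
  also have "l2_inner f (\<lambda>x. f x + c *\<^sub>R g x) = l2_inner f f + c * l2_inner g f"
    by (subst l2_inner_commute) (rule l2_inner_lin[OF f g f])
  also have "l2_inner g (\<lambda>x. f x + c *\<^sub>R g x) = l2_inner f g + c * l2_inner g g"
    by (subst l2_inner_commute) (rule l2_inner_lin[OF f g g])
  finally show ?thesis
    by (simp add: l2_norm_sq_inner l2_inner_commute[of g f] power2_eq_square[of c] algebra_simps)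
qed

lemma l2_Cauchy_Schwarz:
  assumes f: "sq_int f" and g: "sq_int g"
  shows "\<bar>l2_inner f g\<bar> \<le> l2_norm f * l2_norm g"
proof -
  define p where "p = l2_inner f g"
  have pos: "0 \<le> (l2_norm f)\<^sup>2 + 2 * c * p + c\<^sup>2 * (l2_norm g)\<^sup>2" for c
    unfolding p_def l2_norm_lin_sq[OF f g, symmetric] by simp
  show ?thesis
  proof (cases "l2_norm g = 0")
    case True
    have "p = 0"
    proof (rule ccontr)
      assume p: "p \<noteq> 0"
      have "0 \<le> (l2_norm f)\<^sup>2 + 2 * (- ((l2_norm f)\<^sup>2 + 1) / (2 * p)) * p"
        using pos[of "- ((l2_norm f)\<^sup>2 + 1) / (2 * p)"] True by simp
      moreover have "2 * (- ((l2_norm f)\<^sup>2 + 1) / (2 * p)) * p = - ((l2_norm f)\<^sup>2 + 1)" using p by simp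
      ultimately show False by linarith
    qed
    then show ?thesis using True by (simp add: p_def)
  next
    case False
    then have g0: "0 < (l2_norm g)\<^sup>2" by simp
    have "0 \<le> (l2_norm f)\<^sup>2 - p\<^sup>2 / (l2_norm g)\<^sup>2"
      using pos[of "- p / (l2_norm g)\<^sup>2"] g0 False by (simp add: power2_eq_square power_divide field_simps)
    then have "p\<^sup>2 \<le> (l2_norm f * l2_norm g)\<^sup>2"
      using g0 by (simp add: power_mult_distrib field_simps)
    then show ?thesis unfolding p_def by (simp add: abs_le_square_iff[symmetric] abs_mult)
  qed
qed

lemma l2_inner_limit:
  assumes f: "\<And>k. sq_int (f k)" and f0: "sq_int f0" and g: "sq_int g"
    and lim: "(\<lambda>k. l2_norm (\<lambda>x. f k x - f0 x)) \<longlonglongrightarrow> 0"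
  shows "(\<lambda>k. l2_inner (f k) g) \<longlonglongrightarrow> l2_inner f0 g"
proof -
  have "(\<lambda>k. l2_inner (f k) g - l2_inner f0 g) \<longlonglongrightarrow> 0"
  proof (rule Lim_null_comparison)
    show "\<forall>\<^sub>F k in sequentially. norm (l2_inner (f k) g - l2_inner f0 g) \<le> l2_norm (\<lambda>x. f k x - f0 x) * l2_norm g"
      using l2_Cauchy_Schwarz[OF sq_int_diff[OF f f0] g] l2_inner_diff[OF f f0 g] by simp
    show "(\<lambda>k. l2_norm (\<lambda>x. f k x - f0 x) * l2_norm g) \<longlonglongrightarrow> 0"
      using tendsto_mult_right[OF lim, of "l2_norm g"] by simp
  qed
  then show ?thesis by (simp add: LIM_zero_iff)
qed

lemma sq_int_nn_integral:
  assumes "f \<in> borel_measurable lebesgue"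
  shows "sq_int f \<longleftrightarrow> (\<integral>\<^sup>+x. ennreal ((norm (f x))\<^sup>2) \<partial>lebesgue) < top"
  using assms by (simp add: sq_int_def integrable_iff_bounded)

lemma l2_nn_integral:
  assumes "sq_int f"
  shows "(\<integral>\<^sup>+x. ennreal ((norm (f x))\<^sup>2) \<partial>lebesgue) = ennreal ((l2_norm f)\<^sup>2)"
  using assms unfolding sq_int_def l2_norm_sq by (intro nn_integral_eq_integral) auto

text \<open>Completeness: a fast Cauchy sequence converges almost everywhere, and Fatou's lemma
  identifies the limit.\<close>

lemma l2_complete:
  fixes f :: "nat \<Rightarrow> real^'n \<Rightarrow> 'b::euclidean_space"
  assumes f: "\<And>k. sq_int (f k)"
    and cauchy: "\<And>k j. k \<le> j \<Longrightarrow> l2_norm (\<lambda>x. f k x - f j x) \<le> (1 / 2) ^ k"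
  shows "\<exists>f0. sq_int f0 \<and> (\<lambda>k. l2_norm (\<lambda>x. f k x - f0 x)) \<longlonglongrightarrow> 0"
proof -
  have fm: "f k \<in> borel_measurable lebesgue" for k using f by (simp add: sq_int_def)
  \<comment> \<open>The squared differences have integral at most 4 to the power -k, so the weights \<open>2\<^sup>k\<close> leave a summable series.\<close>
  define d where "d k x = (norm (f k x - f (Suc k) x))\<^sup>2" for k x
  have dm: "d k \<in> borel_measurable lebesgue" for k unfolding d_def[abs_def] using fm by simp
  have nn: "(\<integral>\<^sup>+x. ennreal ((norm (f k x - f j x))\<^sup>2) \<partial>lebesgue) \<le> ennreal ((1 / 4) ^ k)" if "k \<le> j" for k j
  proof -
    have "(l2_norm (\<lambda>x. f k x - f j x))\<^sup>2 \<le> ((1 / 2) ^ k)\<^sup>2" by (intro power_mono cauchy[OF that]) simp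
    also have "((1 / 2) ^ k)\<^sup>2 = ((1 / 4) ^ k :: real)" by (simp add: power2_eq_square power_mult_distrib[symmetric])
    finally show ?thesis by (simp add: l2_nn_integral[OF sq_int_diff[OF f f]] ennreal_leI)
  qed
  have "(\<integral>\<^sup>+x. (\<Sum>k. ennreal (2 ^ k) * ennreal (d k x)) \<partial>lebesgue) = (\<Sum>k. ennreal (2 ^ k) * (\<integral>\<^sup>+x. ennreal (d k x) \<partial>lebesgue))"
    using dm by (subst nn_integral_suminf) (auto simp: nn_integral_cmult)
  also have "\<dots> \<le> (\<Sum>k. ennreal ((1 / 2) ^ k))"
  proof (rule suminf_le)
    fix k
    have "ennreal (2 ^ k) * (\<integral>\<^sup>+x. ennreal (d k x) \<partial>lebesgue) \<le> ennreal (2 ^ k) * ennreal ((1 / 4) ^ k)"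
      unfolding d_def by (intro mult_left_mono nn) auto
    also have "\<dots> = ennreal ((1 / 2) ^ k)"
      by (subst ennreal_mult[symmetric]) (auto simp: power_mult_distrib[symmetric])
    finally show "ennreal (2 ^ k) * (\<integral>\<^sup>+x. ennreal (d k x) \<partial>lebesgue) \<le> ennreal ((1 / 2) ^ k)" .
  qed auto
  also have "\<dots> = ennreal (\<Sum>k. (1 / 2) ^ k)" by (intro suminf_ennreal2 summable_geometric) auto
  also have "\<dots> < top" by simp
  finally have fin: "(\<integral>\<^sup>+x. (\<Sum>k. ennreal (2 ^ k) * ennreal (d k x)) \<partial>lebesgue) < top" .
  have "AE x in lebesgue. (\<Sum>k. ennreal (2 ^ k) * ennreal (d k x)) \<noteq> \<infinity>"
    by (rule nn_integral_PInf_AE) (use dm fin in auto)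
  then have conv: "AE x in lebesgue. convergent (\<lambda>k. f k x)"
  proof eventually_elim
    fix x assume "(\<Sum>k. ennreal (2 ^ k) * ennreal (d k x)) \<noteq> \<infinity>"
    then obtain C where C: "0 \<le> C" "(\<Sum>k. ennreal (2 ^ k) * ennreal (d k x)) = ennreal C"
      by (cases "(\<Sum>k. ennreal (2 ^ k) * ennreal (d k x))") auto
    have term_le: "norm (f k x - f (Suc k) x) \<le> sqrt C * (sqrt (1 / 2)) ^ k" for k
    proof -
      have "sum (\<lambda>k. ennreal (2 ^ k) * ennreal (d k x)) {k} \<le> ennreal C"
        unfolding C(2)[symmetric] by (intro sum_le_suminf summableI) simp_all
      then have "ennreal (2 ^ k * d k x) \<le> ennreal C" by (simp add: ennreal_mult d_def)
      then have "2 ^ k * d k x \<le> C" using C(1) by (simp add: ennreal_le_iff)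
      then have "d k x \<le> C * (1 / 2) ^ k" by (simp add: field_simps power_one_over)
      then have "sqrt (d k x) \<le> sqrt (C * (1 / 2) ^ k)" by (rule real_sqrt_le_mono)
      then show ?thesis by (simp add: d_def real_sqrt_mult real_sqrt_power)
    qed
    have sq: "sqrt (1 / 2) < (1 :: real)" by (simp add: real_sqrt_divide)
    have "summable (\<lambda>k. f (Suc k) x - f k x)"
    proof (rule summable_comparison_test')
      show "summable (\<lambda>k. sqrt C * (sqrt (1 / 2)) ^ k)" by (intro summable_mult summable_geometric) (use sq in simp)
      show "norm (f (Suc k) x - f k x) \<le> sqrt C * (sqrt (1 / 2)) ^ k" if "0 \<le> k" for k
        using term_le[of k] by (simp add: norm_minus_commute)
    qed
    then have "convergent (\<lambda>n. \<Sum>k<n. f (Suc k) x - f k x)" by (simp add: summable_iff_convergent)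
    then have "convergent (\<lambda>n. f n x - f 0 x)" by (simp only: sum_lessThan_telescope[of "\<lambda>k. f k x"])
    then have "convergent (\<lambda>n. (f n x - f 0 x) + f 0 x)" by (intro convergent_add convergent_const)
    then show "convergent (\<lambda>k. f k x)" by simp
  qed
  define f0 where "f0 x = lim (\<lambda>k. f k x)" for x
  have f0m: "f0 \<in> borel_measurable lebesgue" unfolding f0_def[abs_def] using fm by (rule borel_measurable_lim_metric)
  have bound: "(\<integral>\<^sup>+x. ennreal ((norm (f k x - f0 x))\<^sup>2) \<partial>lebesgue) \<le> ennreal ((1 / 4) ^ k)" for k
  proof -
    have "(\<integral>\<^sup>+x. ennreal ((norm (f k x - f0 x))\<^sup>2) \<partial>lebesgue) =
       (\<integral>\<^sup>+x. liminf (\<lambda>j. ennreal ((norm (f k x - f j x))\<^sup>2)) \<partial>lebesgue)"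
    proof (rule nn_integral_cong_AE)
      show "AE x in lebesgue. ennreal ((norm (f k x - f0 x))\<^sup>2) = liminf (\<lambda>j. ennreal ((norm (f k x - f j x))\<^sup>2))"
        using conv
      proof eventually_elim
        fix x assume "convergent (\<lambda>k. f k x)"
        then have "(\<lambda>k. f k x) \<longlonglongrightarrow> f0 x" by (simp add: f0_def convergent_LIMSEQ_iff)
        then have "(\<lambda>j. ennreal ((norm (f k x - f j x))\<^sup>2)) \<longlonglongrightarrow> ennreal ((norm (f k x - f0 x))\<^sup>2)"
          by (intro tendsto_ennrealI tendsto_intros)
        then show "ennreal ((norm (f k x - f0 x))\<^sup>2) = liminf (\<lambda>j. ennreal ((norm (f k x - f j x))\<^sup>2))"
          by (rule lim_imp_Liminf[OF sequentially_bot, symmetric])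
      qed
    qed
    also have "\<dots> \<le> liminf (\<lambda>j. \<integral>\<^sup>+x. ennreal ((norm (f k x - f j x))\<^sup>2) \<partial>lebesgue)"
      by (rule nn_integral_liminf) (use fm in simp)
    also have "\<dots> \<le> ennreal ((1 / 4) ^ k)"
    proof (rule Liminf_le)
      show "\<forall>\<^sub>F j in sequentially. (\<integral>\<^sup>+x. ennreal ((norm (f k x - f j x))\<^sup>2) \<partial>lebesgue) \<le> ennreal ((1 / 4) ^ k)"
        using eventually_ge_at_top[of k] by eventually_elim (rule nn)
    qed simp
    finally show ?thesis .
  qed
  have sd: "sq_int (\<lambda>x. f k x - f0 x)" for k
    using bound[of k] fm f0m by (subst sq_int_nn_integral) (auto intro: le_less_trans)
  have "sq_int (\<lambda>x. f 0 x - (f 0 x - f0 x))" by (rule sq_int_diff[OF f sd])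
  then have s0: "sq_int f0" by simp
  have le: "l2_norm (\<lambda>x. f k x - f0 x) \<le> (1 / 2) ^ k" for k
  proof (rule power2_le_imp_le)
    have "ennreal ((l2_norm (\<lambda>x. f k x - f0 x))\<^sup>2) \<le> ennreal ((1 / 4) ^ k)"
      using bound[of k] l2_nn_integral[OF sd] by simp
    then have "(l2_norm (\<lambda>x. f k x - f0 x))\<^sup>2 \<le> (1 / 4) ^ k" by (simp add: ennreal_le_iff)
    also have "\<dots> = ((1 / 2) ^ k)\<^sup>2" by (simp add: power2_eq_square power_mult_distrib[symmetric])
    finally show "(l2_norm (\<lambda>x. f k x - f0 x))\<^sup>2 \<le> ((1 / 2) ^ k)\<^sup>2" .
  qed simp
  have "(\<lambda>k. l2_norm (\<lambda>x. f k x - f0 x)) \<longlonglongrightarrow> 0"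
  proof (rule Lim_null_comparison)
    show "\<forall>\<^sub>F k in sequentially. norm (l2_norm (\<lambda>x. f k x - f0 x)) \<le> (1 / 2) ^ k" using le by simp
    show "(\<lambda>k. (1 / 2 :: real) ^ k) \<longlonglongrightarrow> 0" by (rule LIMSEQ_realpow_zero) auto
  qed
  then show ?thesis using s0 by blast
qed

section \<open>Sobolev functions as limits of test functions\<close>

lemma test_sq_int:
  assumes "\<phi> \<in> test_functions U" shows "sq_int \<phi>" "sq_int (grad \<phi>)"
proof -
  obtain K where K: "compact K" "\<And>x. x \<notin> K \<Longrightarrow> \<phi> x = 0" "\<And>x. x \<notin> K \<Longrightarrow> grad \<phi> x = 0"
    using test_functionsE[OF assms] by metis
  have c: "continuous_on UNIV \<phi>" "continuous_on UNIV (grad \<phi>)"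
    by (rule test_continuous[OF assms] test_grad_continuous[OF assms])+
  show "sq_int \<phi>" unfolding sq_int_def
  proof
    show "integrable lebesgue (\<lambda>x. (norm (\<phi> x))\<^sup>2)"
      by (rule compact_support_integrable[OF _ K(1)]) (use c K in \<open>auto intro!: continuous_intros\<close>)
  qed (rule continuous_measurable_lebesgue[OF c(1)])
  show "sq_int (grad \<phi>)" unfolding sq_int_def
  proof
    show "integrable lebesgue (\<lambda>x. (norm (grad \<phi> x))\<^sup>2)"
      by (rule compact_support_integrable[OF _ K(1)]) (use c K in \<open>auto intro!: continuous_intros\<close>)
  qed (rule continuous_measurable_lebesgue[OF c(2)])
qed

lemma powr_2_norm: "norm x powr 2 = (norm x)\<^sup>2"
  using powr_numeral[of "norm x" Num.One] powr_numeral[of "norm x" "num.Bit0 num.One"] by simp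

lemma Lp_2_iff_sq_int:
  fixes h :: "real^'n \<Rightarrow> 'b::euclidean_space"
  assumes U: "U \<in> sets lebesgue"
  shows "Lp 2 U h \<longleftrightarrow> sq_int (\<lambda>x. indicator U x *\<^sub>R h x)"
proof -
  have m: "h \<in> borel_measurable (lebesgue_on U) \<longleftrightarrow> (\<lambda>x. indicator U x *\<^sub>R h x) \<in> borel_measurable lebesgue"
    using U by (intro borel_measurable_restrict_space_iff) simp
  have i: "(\<integral>\<^sup>+x\<in>U. ennreal (norm (h x) powr 2) \<partial>lebesgue) = (\<integral>\<^sup>+x. ennreal ((norm (indicator U x *\<^sub>R h x))\<^sup>2) \<partial>lebesgue)"
    by (intro nn_integral_cong) (auto simp: powr_2_norm split: split_indicator)
  show ?thesis
  proof (cases "h \<in> borel_measurable (lebesgue_on U)")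
    case True
    then show ?thesis using m i sq_int_nn_integral[of "\<lambda>x. indicator U x *\<^sub>R h x"] by (simp add: Lp_def)
  next
    case False
    then show ?thesis using m by (simp add: Lp_def sq_int_def)
  qed
qed

lemma sq_int_indicator:
  fixes h :: "real^'n \<Rightarrow> 'b::euclidean_space"
  assumes h: "sq_int h" and U: "U \<in> sets lebesgue" shows "sq_int (\<lambda>x. indicator U x *\<^sub>R h x)"
proof (rule sq_int_dominated(1)[OF h, of _ 1])
  show "(\<lambda>x. indicator U x *\<^sub>R h x) \<in> borel_measurable lebesgue"
    using h U by (intro borel_measurable_scaleR borel_measurable_indicator) (auto simp: sq_int_def)
qed (auto intro!: AE_I2 split: split_indicator)

lemma sq_int_Lp_1:
  fixes h :: "real^'n \<Rightarrow> 'b::euclidean_space"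
  assumes h: "sq_int h" and K: "K \<in> sets lebesgue" "vol K < top"
  shows "Lp 1 K h"
proof -
  have hm: "h \<in> borel_measurable lebesgue" using h by (simp add: sq_int_def)
  have "(\<integral>\<^sup>+x\<in>K. ennreal (norm (h x) powr 1) \<partial>lebesgue) \<le> (\<integral>\<^sup>+x. indicator K x + ennreal ((norm (h x))\<^sup>2) \<partial>lebesgue)"
  proof (rule nn_integral_mono)
    fix x
    have "norm (h x) \<le> 1 + (norm (h x))\<^sup>2"
      using sum_squares_bound[of "norm (h x)" 1] norm_ge_zero[of "h x"] unfolding power_one mult_1_right by linarith
    then have "ennreal (norm (h x)) \<le> ennreal (1 + (norm (h x))\<^sup>2)" by (rule ennreal_leI)
    also have "\<dots> = 1 + ennreal ((norm (h x))\<^sup>2)" by simp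
    finally show "ennreal (norm (h x) powr 1) * indicator K x \<le> indicator K x + ennreal ((norm (h x))\<^sup>2)"
      by (cases "x \<in> K") auto
  qed
  also have "\<dots> = vol K + (\<integral>\<^sup>+x. ennreal ((norm (h x))\<^sup>2) \<partial>lebesgue)"
    using K hm by (subst nn_integral_add) auto
  also have "\<dots> < top" using K h hm by (simp add: sq_int_nn_integral)
  finally show ?thesis using hm by (simp add: Lp_def measurable_restrict_space1)
qed

lemma sq_int_Lp_loc_1:
  fixes h :: "real^'n \<Rightarrow> 'b::euclidean_space"
  assumes h: "sq_int h" shows "Lp_loc 1 U h"
  unfolding Lp_loc_def
proof (intro conjI allI impI)
  show "h \<in> borel_measurable (lebesgue_on U)" using h by (simp add: sq_int_def measurable_restrict_space1)
  fix K assume "compact K \<and> K \<subseteq> U"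
  then have "K \<in> lmeasurable" by (simp add: lmeasurable_compact)
  then show "Lp 1 K h" using fmeasurableD[of K lebesgue] fmeasurableD2[of K lebesgue]
    by (intro sq_int_Lp_1[OF h]) (simp_all only: less_top[symmetric] not_False_eq_True)
qed

lemma Lp_norm_2_le:
  fixes h :: "real^'n \<Rightarrow> 'b::euclidean_space"
  assumes h: "sq_int h" shows "Lp_norm 2 U h \<le> ennreal (l2_norm h)"
proof -
  have "(\<integral>\<^sup>+x\<in>U. ennreal (norm (h x) powr 2) \<partial>lebesgue) \<le> (\<integral>\<^sup>+x. ennreal ((norm (h x))\<^sup>2) \<partial>lebesgue)"
    by (intro nn_integral_mono) (auto simp: powr_2_norm split: split_indicator)
  also have "\<dots> = ennreal ((l2_norm h)\<^sup>2)" by (rule l2_nn_integral[OF h])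
  finally have "Lp_norm 2 U h \<le> epowr (ennreal ((l2_norm h)\<^sup>2)) (1 / 2)"
    unfolding Lp_norm_def by (rule epowr_mono) simp
  also have "\<dots> = ennreal (l2_norm h)" by (simp add: epowr_ennreal powr_half_sqrt)
  finally show ?thesis .
qed

lemma l2_norm_nth_le:
  fixes f :: "real^'n \<Rightarrow> real^'n"
  assumes "sq_int f" shows "sq_int (\<lambda>x. f x $ i)" "l2_norm (\<lambda>x. f x $ i) \<le> l2_norm f"
proof -
  have m: "(\<lambda>x. f x $ i) \<in> borel_measurable lebesgue"
    using assms measurable_compose[of f lebesgue borel "\<lambda>v. v $ i" borel]
    by (simp add: sq_int_def borel_measurable_continuous_onI continuous_on_component)
  show "sq_int (\<lambda>x. f x $ i)" "l2_norm (\<lambda>x. f x $ i) \<le> l2_norm f"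
    using sq_int_dominated[OF assms m, of 1] component_le_norm_cart by auto
qed

text \<open>Integration by parts passes to the limit in \<open>L\<^sup>2\<close>.  The same sequence witnesses the zero boundary
  values.\<close>

lemma sobolev_limit:
  fixes v :: "real^'n \<Rightarrow> real" and V :: "real^'n \<Rightarrow> real^'n"
  assumes U: "open U" and \<phi>: "\<And>k. \<phi> k \<in> test_functions U" and v: "sq_int v" and V: "sq_int V"
    and lim: "(\<lambda>k. l2_norm (\<lambda>x. \<phi> k x - v x)) \<longlonglongrightarrow> 0" "(\<lambda>k. l2_norm (\<lambda>x. grad (\<phi> k) x - V x)) \<longlonglongrightarrow> 0"
  shows "is_weak_gradient U v V" "v \<in> W12_0 U" "AE x in lebesgue. x \<in> U \<longrightarrow> weak_grad U v x = V x"
proof -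
  have Us: "U \<in> sets lebesgue" using U by simp
  show weak: "is_weak_gradient U v V"
    unfolding is_weak_gradient_def
  proof (intro conjI sq_int_Lp_loc_1 v V ballI)
    fix \<psi> assume \<psi>: "\<psi> \<in> test_functions U"
    obtain K where K: "compact K" "K \<subseteq> U" "\<And>x. x \<notin> K \<Longrightarrow> \<psi> x = 0" "\<And>x. x \<notin> K \<Longrightarrow> grad \<psi> x = 0"
      using test_functionsE[OF \<psi>] by metis
    have res: "(\<integral>x. h x \<partial>lebesgue_on U) = (\<integral>x. h x \<partial>lebesgue)" if "\<And>x. x \<notin> K \<Longrightarrow> h x = 0" for h :: "real^'n \<Rightarrow> real^'n"
    proof -
      have "(\<integral>x. h x \<partial>lebesgue_on U) = (\<integral>x. indicator U x *\<^sub>R h x \<partial>lebesgue)" using Us by (simp add: integral_restrict_space)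
      also have "(\<lambda>x. indicator U x *\<^sub>R h x) = h"
        using that K(2) by (auto simp: fun_eq_iff split: split_indicator)
      finally show ?thesis .
    qed
    have i1: "integrable lebesgue (\<lambda>x. v x *\<^sub>R grad \<psi> x)" "integrable lebesgue (\<lambda>x. \<psi> x *\<^sub>R V x)"
    proof -
      have I: "integrable lebesgue (\<lambda>x. p x *\<^sub>R P x)" if p: "sq_int p" and P: "sq_int P"
        for p :: "real^'n \<Rightarrow> real" and P :: "real^'n \<Rightarrow> real^'n"
      proof (rule Bochner_Integration.integrable_bound)
        show "integrable lebesgue (\<lambda>x. (norm (p x))\<^sup>2 + (norm (P x))\<^sup>2)" using p P by (simp add: sq_int_def)
        show "(\<lambda>x. p x *\<^sub>R P x) \<in> borel_measurable lebesgue"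
          by (intro borel_measurable_scaleR sq_int_measurable p P)
        have "r * s \<le> r\<^sup>2 + s\<^sup>2" if "0 \<le> r" "0 \<le> s" for r s :: real
          using sum_squares_bound[of r s] mult_nonneg_nonneg[OF that] by linarith
        then show "AE x in lebesgue. norm (p x *\<^sub>R P x) \<le> norm ((norm (p x))\<^sup>2 + (norm (P x))\<^sup>2)"
          by (intro AE_I2) (metis abs_ge_self abs_ge_zero norm_ge_zero norm_scaleR order_trans real_norm_def)
      qed
      show "integrable lebesgue (\<lambda>x. v x *\<^sub>R grad \<psi> x)" by (rule I[OF v test_sq_int(2)[OF \<psi>]])
      show "integrable lebesgue (\<lambda>x. \<psi> x *\<^sub>R V x)" by (rule I[OF test_sq_int(1)[OF \<psi>] V])
    qed
    have "(\<integral>x. v x *\<^sub>R grad \<psi> x \<partial>lebesgue) $ i = - (\<integral>x. \<psi> x *\<^sub>R V x \<partial>lebesgue) $ i" for i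
    proof -
      have gi: "sq_int (\<lambda>x. grad \<psi> x $ i)" by (rule l2_norm_nth_le(1)[OF test_sq_int(2)[OF \<psi>]])
      have "(\<lambda>k. l2_inner (\<phi> k) (\<lambda>x. grad \<psi> x $ i)) \<longlonglongrightarrow> l2_inner v (\<lambda>x. grad \<psi> x $ i)"
        by (rule l2_inner_limit[OF test_sq_int(1)[OF \<phi>] v gi lim(1)])
      moreover have "(\<lambda>k. l2_inner (\<lambda>x. grad (\<phi> k) x $ i) \<psi>) \<longlonglongrightarrow> l2_inner (\<lambda>x. V x $ i) \<psi>"
      proof (rule l2_inner_limit[OF _ _ test_sq_int(1)[OF \<psi>]])
        show "sq_int (\<lambda>x. grad (\<phi> k) x $ i)" for k by (rule l2_norm_nth_le(1)[OF test_sq_int(2)[OF \<phi>]])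
        show "sq_int (\<lambda>x. V x $ i)" by (rule l2_norm_nth_le(1)[OF V])
        show "(\<lambda>k. l2_norm (\<lambda>x. grad (\<phi> k) x $ i - V x $ i)) \<longlonglongrightarrow> 0"
        proof (rule Lim_null_comparison[OF _ lim(2)])
          show "\<forall>\<^sub>F k in sequentially. norm (l2_norm (\<lambda>x. grad (\<phi> k) x $ i - V x $ i)) \<le> l2_norm (\<lambda>x. grad (\<phi> k) x - V x)"
            using l2_norm_nth_le(2)[OF sq_int_diff[OF test_sq_int(2)[OF \<phi>] V], of _ i] by simp
        qed
      qed
      moreover have "l2_inner (\<phi> k) (\<lambda>x. grad \<psi> x $ i) = - l2_inner (\<lambda>x. grad (\<phi> k) x $ i) \<psi>" for k
      proof -
        obtain L where L: "compact L" "\<And>x. x \<notin> L \<Longrightarrow> \<phi> k x = 0" using test_functionsE[OF \<phi>[of k]] by metis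
        have a: "integrable lebesgue (\<lambda>x. \<phi> k x *\<^sub>R grad \<psi> x)"
          by (rule compact_support_integrable[OF _ L(1)])
            (use L(2) in \<open>auto intro!: continuous_on_scaleR test_continuous[OF \<phi>] test_grad_continuous[OF \<psi>]\<close>)
        have b: "integrable lebesgue (\<lambda>x. \<psi> x *\<^sub>R grad (\<phi> k) x)"
          by (rule compact_support_integrable[OF _ K(1)])
            (use K in \<open>auto intro!: continuous_on_scaleR test_continuous[OF \<psi>] test_grad_continuous[OF \<phi>]\<close>)
        have "(\<integral>x. \<phi> k x *\<^sub>R grad \<psi> x \<partial>lebesgue) $ i = - (\<integral>x. \<psi> x *\<^sub>R grad (\<phi> k) x \<partial>lebesgue) $ i"
          unfolding test_integration_by_parts[OF \<phi> \<psi>] by simp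
        then show ?thesis unfolding integral_vec_nth[OF a] integral_vec_nth[OF b] l2_inner_def by (simp add: mult.commute)
      qed
      ultimately have "(\<lambda>k. - l2_inner (\<lambda>x. grad (\<phi> k) x $ i) \<psi>) \<longlonglongrightarrow> l2_inner v (\<lambda>x. grad \<psi> x $ i)"
        "(\<lambda>k. - l2_inner (\<lambda>x. grad (\<phi> k) x $ i) \<psi>) \<longlonglongrightarrow> - l2_inner (\<lambda>x. V x $ i) \<psi>"
        by (auto intro: tendsto_minus)
      then have "l2_inner v (\<lambda>x. grad \<psi> x $ i) = - l2_inner (\<lambda>x. V x $ i) \<psi>" by (rule LIMSEQ_unique)
      then show ?thesis unfolding integral_vec_nth[OF i1(1)] integral_vec_nth[OF i1(2)] l2_inner_def by (simp add: mult.commute)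
    qed
    then have "(\<integral>x. v x *\<^sub>R grad \<psi> x \<partial>lebesgue) = - (\<integral>x. \<psi> x *\<^sub>R V x \<partial>lebesgue)" by (simp add: vec_eq_iff)
    then show "(\<integral>x. v x *\<^sub>R grad \<psi> x \<partial>lebesgue_on U) = - (\<integral>x. \<psi> x *\<^sub>R V x \<partial>lebesgue_on U)"
      using K by (subst (1 2) res) auto
  qed
  show ae: "AE x in lebesgue. x \<in> U \<longrightarrow> weak_grad U v x = V x" by (rule weak_grad_AE_eq[OF U weak])
  have W: "v \<in> W12 U" unfolding W12_def
    using weak Lp_2_iff_sq_int[OF Us, of v] Lp_2_iff_sq_int[OF Us, of V] sq_int_indicator[OF v Us] sq_int_indicator[OF V Us] by blast
  show "v \<in> W12_0 U"
    unfolding W12_0_def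
  proof (intro CollectI conjI W allI impI)
    fix \<epsilon> :: real assume \<epsilon>: "0 < \<epsilon>"
    have "\<forall>\<^sub>F k in sequentially. l2_norm (\<lambda>x. \<phi> k x - v x) < \<epsilon> / 2 \<and> l2_norm (\<lambda>x. grad (\<phi> k) x - V x) < \<epsilon> / 2"
      using order_tendstoD(2)[OF lim(1), of "\<epsilon> / 2"] order_tendstoD(2)[OF lim(2), of "\<epsilon> / 2"] \<epsilon> by (simp add: eventually_conj_iff)
    then obtain k where k: "l2_norm (\<lambda>x. \<phi> k x - v x) < \<epsilon> / 2" "l2_norm (\<lambda>x. grad (\<phi> k) x - V x) < \<epsilon> / 2"
      by (auto simp: eventually_sequentially)
    have "Lp_norm 2 U (\<lambda>x. v x - \<phi> k x) = Lp_norm 2 U (\<lambda>x. \<phi> k x - v x)"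
      by (simp add: Lp_norm_def abs_minus_commute)
    also have "\<dots> \<le> ennreal (l2_norm (\<lambda>x. \<phi> k x - v x))"
      by (rule Lp_norm_2_le[OF sq_int_diff[OF test_sq_int(1)[OF \<phi>] v]])
    finally have 1: "Lp_norm 2 U (\<lambda>x. v x - \<phi> k x) \<le> ennreal (l2_norm (\<lambda>x. \<phi> k x - v x))" .
    have "Lp_norm 2 U (\<lambda>x. weak_grad U v x - grad (\<phi> k) x) = Lp_norm 2 U (\<lambda>x. grad (\<phi> k) x - V x)"
    proof -
      have "(\<integral>\<^sup>+x\<in>U. ennreal (norm (weak_grad U v x - grad (\<phi> k) x) powr 2) \<partial>lebesgue) =
        (\<integral>\<^sup>+x\<in>U. ennreal (norm (grad (\<phi> k) x - V x) powr 2) \<partial>lebesgue)"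
        by (rule nn_integral_cong_AE) (use ae in \<open>eventually_elim, auto simp: norm_minus_commute split: split_indicator\<close>)
      then show ?thesis by (simp add: Lp_norm_def)
    qed
    also have "\<dots> \<le> ennreal (l2_norm (\<lambda>x. grad (\<phi> k) x - V x))"
      by (rule Lp_norm_2_le[OF sq_int_diff[OF test_sq_int(2)[OF \<phi>] V]])
    finally have 2: "Lp_norm 2 U (\<lambda>x. weak_grad U v x - grad (\<phi> k) x) \<le> ennreal (l2_norm (\<lambda>x. grad (\<phi> k) x - V x))" .
    have "Lp_norm 2 U (\<lambda>x. v x - \<phi> k x) + Lp_norm 2 U (\<lambda>x. weak_grad U v x - grad (\<phi> k) x) \<le>
      ennreal (l2_norm (\<lambda>x. \<phi> k x - v x)) + ennreal (l2_norm (\<lambda>x. grad (\<phi> k) x - V x))" by (rule add_mono[OF 1 2])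
    also have "\<dots> = ennreal (l2_norm (\<lambda>x. \<phi> k x - v x) + l2_norm (\<lambda>x. grad (\<phi> k) x - V x))"
      by (simp add: ennreal_plus)
    also have "\<dots> < ennreal \<epsilon>" using k by (intro ennreal_lessI \<epsilon>) linarith
    finally show "\<exists>\<phi>\<in>test_functions U. Lp_norm 2 U (\<lambda>x. v x - \<phi> x) + Lp_norm 2 U (\<lambda>x. weak_grad U v x - grad \<phi> x) < ennreal \<epsilon>"
      using \<phi> by blast
  qed
qed

lemma W12_weak_grad:
  fixes u :: "real^'n \<Rightarrow> real"
  assumes U: "open U" and u: "u \<in> W12 U"
  shows "is_weak_gradient U u (weak_grad U u)" "sq_int (\<lambda>x. indicator U x *\<^sub>R weak_grad U u x)"
proof -
  have Us: "U \<in> sets lebesgue" using U by simp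
  obtain V where V: "is_weak_gradient U u V" "Lp 2 U V" using u by (auto simp: W12_def)
  show w: "is_weak_gradient U u (weak_grad U u)" by (rule weak_grad_is_weak_gradient[OF V(1)])
  have ae: "AE x in lebesgue. x \<in> U \<longrightarrow> weak_grad U u x = V x" by (rule weak_grad_AE_eq[OF U V(1)])
  have "weak_grad U u \<in> borel_measurable (lebesgue_on U)" using w by (simp add: is_weak_gradient_def Lp_loc_def)
  then have m: "(\<lambda>x. indicator U x *\<^sub>R weak_grad U u x) \<in> borel_measurable lebesgue"
    using Us borel_measurable_restrict_space_iff[of U lebesgue "weak_grad U u"] by simp
  show "sq_int (\<lambda>x. indicator U x *\<^sub>R weak_grad U u x)"
  proof (rule sq_int_dominated(1)[OF _ m, of _ 1])
    show "sq_int (\<lambda>x. indicator U x *\<^sub>R V x)" using V(2) Lp_2_iff_sq_int[OF Us] by blast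
    show "AE x in lebesgue. norm (indicator U x *\<^sub>R weak_grad U u x) \<le> 1 * norm (indicator U x *\<^sub>R V x)"
      using ae by eventually_elim (auto split: split_indicator)
  qed simp
qed

text \<open>On a set of finite measure, approximation in \<open>L\<^sup>2\<close> gives approximation in \<open>L\<^sup>1\<close>, which is what
  Lebesgue points require.\<close>

lemma W12_0_grad_approx:
  fixes u :: "real^'n \<Rightarrow> real"
  assumes U: "open U" "vol U < top" and u: "u \<in> W12_0 U" and e: "0 < e"
  shows "\<exists>\<phi>\<in>test_functions U. (\<integral>\<^sup>+x. ennreal (norm (indicator U x *\<^sub>R weak_grad U u x - grad \<phi> x)) \<partial>lebesgue) \<le> ennreal e"
proof -
  have Us: "U \<in> sets lebesgue" using U by simp
  obtain c where c: "vol U = ennreal c" "0 \<le> c" using U(2) by (cases "vol U") auto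
  define d where "d = e / (c powr (1 / 2) + 1)"
  have d: "0 < d" "d * c powr (1 / 2) \<le> e"
    using e by (auto simp: d_def field_simps add_pos_nonneg)
  have uW: "u \<in> W12 U" using u by (simp add: W12_0_def)
  obtain \<phi> where \<phi>: "\<phi> \<in> test_functions U"
    "Lp_norm 2 U (\<lambda>x. u x - \<phi> x) + Lp_norm 2 U (\<lambda>x. weak_grad U u x - grad \<phi> x) < ennreal d"
    using u d(1) unfolding W12_0_def by blast
  define w where "w x = weak_grad U u x - grad \<phi> x" for x
  have "Lp_norm 2 U w \<le> Lp_norm 2 U (\<lambda>x. u x - \<phi> x) + Lp_norm 2 U w" by simp
  also have "\<dots> \<le> ennreal d" using \<phi>(2) unfolding w_def[abs_def] by (rule less_imp_le)
  finally have le: "Lp_norm 2 U w \<le> ennreal d" .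
  have gz: "x \<notin> U \<Longrightarrow> grad \<phi> x = 0" for x using test_functionsE[OF \<phi>(1)] by (metis subsetD)
  have "weak_grad U u \<in> borel_measurable (lebesgue_on U)"
    using W12_weak_grad(1)[OF U(1) uW] by (simp add: is_weak_gradient_def Lp_loc_def)
  moreover have "grad \<phi> \<in> borel_measurable (lebesgue_on U)"
    by (rule measurable_restrict_space1[OF continuous_measurable_lebesgue[OF test_grad_continuous[OF \<phi>(1)]]])
  ultimately have wm: "w \<in> borel_measurable (lebesgue_on U)" unfolding w_def[abs_def] by simp
  have "(\<integral>\<^sup>+x. ennreal (norm (indicator U x *\<^sub>R weak_grad U u x - grad \<phi> x)) \<partial>lebesgue) =
      (\<integral>\<^sup>+x\<in>U. ennreal (norm (w x)) \<partial>lebesgue)"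
    by (intro nn_integral_cong) (auto simp: w_def gz split: split_indicator)
  also have "\<dots> = (\<integral>\<^sup>+x. ennreal (norm (w x)) * 1 \<partial>lebesgue_on U)" using Us by (simp add: nn_integral_restrict_space)
  also have "\<dots> \<le> epowr (\<integral>\<^sup>+x. epowr (ennreal (norm (w x))) 2 \<partial>lebesgue_on U) (1 / 2) * epowr (\<integral>\<^sup>+x. epowr 1 2 \<partial>lebesgue_on U) (1 / 2)"
    by (rule nn_integral_Hoelder) (use wm in auto)
  also have "(\<integral>\<^sup>+x. epowr (ennreal (norm (w x))) 2 \<partial>lebesgue_on U) = (\<integral>\<^sup>+x\<in>U. ennreal (norm (w x) powr 2) \<partial>lebesgue)"
    using Us by (simp add: nn_integral_restrict_space epowr_ennreal)
  also have "epowr \<dots> (1 / 2) = Lp_norm 2 U w" by (simp add: Lp_norm_def)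
  also have "(\<integral>\<^sup>+x. epowr 1 2 \<partial>lebesgue_on U) = ennreal c"
  proof -
    have "epowr 1 2 = 1" by (simp add: epowr_def)
    then show ?thesis using Us c by (simp add: emeasure_restrict_space)
  qed
  also have "epowr (ennreal c) (1 / 2) = ennreal (c powr (1 / 2))" using c by (simp add: epowr_ennreal)
  also have "Lp_norm 2 U w * ennreal (c powr (1 / 2)) \<le> ennreal d * ennreal (c powr (1 / 2))" by (intro mult_right_mono le) simp
  also have "\<dots> = ennreal (d * c powr (1 / 2))" using d by (simp add: ennreal_mult)
  also have "\<dots> \<le> ennreal e" by (rule ennreal_leI[OF d(2)])
  finally show ?thesis using \<phi>(1) by blast
qed

section \<open>Solving the Dirichlet problem\<close>

text \<open>The superposition operator V \<mapsto> a(\<cdot>, V), extended by zero outside U.\<close>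

definition nemytskii ::
  "(real^'n) set \<Rightarrow> (real^'n \<Rightarrow> real^'n \<Rightarrow> real^'n) \<Rightarrow> (real^'n \<Rightarrow> real^'n) \<Rightarrow> real^'n \<Rightarrow> real^'n" where
  "nemytskii U a V x = indicator U x *\<^sub>R a x (V x)"

lemma elliptic_coeffD:
  assumes "elliptic_coeff lam \<Lambda> D a" "x \<in> D"
  shows "a x 0 = 0" "norm (a x \<xi> - a x \<eta>) \<le> \<Lambda> * norm (\<xi> - \<eta>)"
    "(a x \<xi> - a x \<eta>) \<bullet> (\<xi> - \<eta>) \<ge> lam * (norm (\<xi> - \<eta>))\<^sup>2" "norm (a x \<xi>) \<le> \<Lambda> * norm \<xi>"
proof -
  show 1: "a x 0 = 0" and 2: "norm (a x \<xi> - a x \<eta>) \<le> \<Lambda> * norm (\<xi> - \<eta>)" for \<xi> \<eta>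
    using assms unfolding elliptic_coeff_def by blast+
  show "(a x \<xi> - a x \<eta>) \<bullet> (\<xi> - \<eta>) \<ge> lam * (norm (\<xi> - \<eta>))\<^sup>2"
    using assms unfolding elliptic_coeff_def by blast
  show "norm (a x \<xi>) \<le> \<Lambda> * norm \<xi>" using 2[of \<xi> 0] 1 by simp
qed

text \<open>Composition with the coefficient preserves measurability: approximate V by simple
  functions.\<close>

lemma nemytskii_measurable:
  fixes a :: "real^'n \<Rightarrow> real^'n \<Rightarrow> real^'n"
  assumes a: "elliptic_coeff lam \<Lambda> D a" and U: "U \<in> sets lebesgue" "U \<subseteq> D"
    and V: "V \<in> borel_measurable lebesgue"
  shows "nemytskii U a V \<in> borel_measurable lebesgue"
proof -
  have am: "(\<lambda>x. indicator U x *\<^sub>R a x \<xi>) \<in> borel_measurable lebesgue" for \<xi>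
  proof -
    have "(\<lambda>x. a x \<xi>) \<in> borel_measurable (lebesgue_on D)" using a by (simp add: elliptic_coeff_def)
    then have "(\<lambda>x. a x \<xi>) \<in> borel_measurable (lebesgue_on U)" by (rule measurable_restrict_mono[OF _ U(2)])
    then show ?thesis using borel_measurable_restrict_space_iff[of U lebesgue "\<lambda>x. a x \<xi>"] U by simp
  qed
  obtain S where S: "\<And>i. simple_function lebesgue (S i)" "\<And>x. (\<lambda>i. S i x) \<longlonglongrightarrow> V x"
    using borel_measurable_implies_sequence_metric[OF V, of 0] by auto
  have "(\<lambda>x. indicator U x *\<^sub>R a x (S i x)) \<in> borel_measurable lebesgue" for i
  proof -
    have fin: "finite (range (S i))" using simple_functionD(1)[OF S(1), of i] by simp
    have m: "S i -` {\<xi>} \<in> sets lebesgue" for \<xi> using simple_functionD(2)[OF S(1), of i "{\<xi>}"] by simp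
    have "indicator U x *\<^sub>R a x (S i x) = (\<Sum>\<xi>\<in>range (S i). indicator (S i -` {\<xi>}) x *\<^sub>R (indicator U x *\<^sub>R a x \<xi>))" for x
    proof -
      have "(\<Sum>\<xi>\<in>range (S i). indicator (S i -` {\<xi>}) x *\<^sub>R (indicator U x *\<^sub>R a x \<xi>)) =
        (\<Sum>\<xi>\<in>range (S i). if \<xi> = S i x then indicator U x *\<^sub>R a x (S i x) else 0)"
        by (rule sum.cong) (auto simp: indicator_def)
      then show ?thesis using fin by simp
    qed
    moreover have "(\<lambda>x. \<Sum>\<xi>\<in>range (S i). indicator (S i -` {\<xi>}) x *\<^sub>R (indicator U x *\<^sub>R a x \<xi>)) \<in> borel_measurable lebesgue"
      by (intro borel_measurable_sum borel_measurable_scaleR borel_measurable_indicator m am)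
    ultimately show ?thesis by simp
  qed
  then show ?thesis unfolding nemytskii_def[abs_def]
  proof (rule borel_measurable_LIMSEQ_metric)
    fix x
    show "(\<lambda>i. indicator U x *\<^sub>R a x (S i x)) \<longlonglongrightarrow> indicator U x *\<^sub>R a x (V x)"
    proof (cases "x \<in> U")
      case True
      then have xD: "x \<in> D" using U by blast
      have "(\<lambda>i. a x (S i x) - a x (V x)) \<longlonglongrightarrow> 0"
      proof (rule Lim_null_comparison)
        show "\<forall>\<^sub>F i in sequentially. norm (a x (S i x) - a x (V x)) \<le> \<Lambda> * norm (S i x - V x)"
          using elliptic_coeffD(2)[OF a xD] by simp
        show "(\<lambda>i. \<Lambda> * norm (S i x - V x)) \<longlonglongrightarrow> 0"
          using S(2)[of x] by (intro tendsto_mult_right_zero tendsto_norm_zero) (simp add: LIM_zero)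
      qed
      then show ?thesis using True by (simp add: LIM_zero_iff)
    qed simp
  qed
qed

lemma nemytskii_sq_int:
  fixes a :: "real^'n \<Rightarrow> real^'n \<Rightarrow> real^'n"
  assumes a: "elliptic_coeff lam \<Lambda> D a" and U: "U \<in> sets lebesgue" "U \<subseteq> D" and V: "sq_int V" and L: "0 \<le> \<Lambda>"
  shows "sq_int (nemytskii U a V)"
proof (rule sq_int_dominated(1)[OF V nemytskii_measurable[OF a U sq_int_measurable[OF V]] _ L])
  show "AE x in lebesgue. norm (nemytskii U a V x) \<le> \<Lambda> * norm (V x)"
  proof (rule AE_I2)
    fix x show "norm (nemytskii U a V x) \<le> \<Lambda> * norm (V x)"
      using elliptic_coeffD(4)[OF a, of x "V x"] U(2) L by (cases "x \<in> U") (auto simp: nemytskii_def)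
  qed
qed

lemma nemytskii_Lipschitz:
  fixes a :: "real^'n \<Rightarrow> real^'n \<Rightarrow> real^'n"
  assumes a: "elliptic_coeff lam \<Lambda> D a" and U: "U \<in> sets lebesgue" "U \<subseteq> D"
    and V: "sq_int V" and W: "sq_int W" and L: "0 \<le> \<Lambda>"
  shows "l2_norm (\<lambda>x. nemytskii U a V x - nemytskii U a W x) \<le> \<Lambda> * l2_norm (\<lambda>x. V x - W x)"
proof (rule sq_int_dominated(2)[OF sq_int_diff[OF V W] _ _ L])
  show "(\<lambda>x. nemytskii U a V x - nemytskii U a W x) \<in> borel_measurable lebesgue"
    by (intro sq_int_measurable sq_int_diff nemytskii_sq_int[OF a U _ L] V W)
  show "AE x in lebesgue. norm (nemytskii U a V x - nemytskii U a W x) \<le> \<Lambda> * norm (V x - W x)"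
  proof (rule AE_I2)
    fix x show "norm (nemytskii U a V x - nemytskii U a W x) \<le> \<Lambda> * norm (V x - W x)"
      using elliptic_coeffD(2)[OF a, of x "V x" "W x"] U(2) L by (cases "x \<in> U") (auto simp: nemytskii_def)
  qed
qed

text \<open>At an almost minimiser of the distance from W to the gradients of test functions, the first
  variation is small.\<close>

lemma approx_projection:
  assumes W: "sq_int W" and e: "0 < e"
  shows "\<exists>\<rho>\<in>test_functions U. \<forall>\<psi>\<in>test_functions U.
    \<bar>l2_inner (\<lambda>x. W x - grad \<rho> x) (grad \<psi>)\<bar> \<le> e * l2_norm (grad \<psi>)"
proof -
  define J where "J \<rho> = (l2_norm (\<lambda>x. W x - grad \<rho> x))\<^sup>2" for \<rho>
  define d where "d = Inf (J ` test_functions U)"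
  have ne: "J ` test_functions U \<noteq> {}" using test_zero by blast
  have bdd: "bdd_below (J ` test_functions U)" by (rule bdd_belowI[of _ 0]) (auto simp: J_def)
  have "\<exists>y\<in>J ` test_functions U. y < d + e\<^sup>2" using e by (intro cInf_lessD[OF ne]) (simp add: d_def)
  then obtain \<rho> where \<rho>: "\<rho> \<in> test_functions U" "J \<rho> < d + e\<^sup>2" by blast
  have s\<rho>: "sq_int (\<lambda>x. W x - grad \<rho> x)" by (rule sq_int_diff[OF W test_sq_int(2)[OF \<rho>(1)]])
  have "\<bar>l2_inner (\<lambda>x. W x - grad \<rho> x) (grad \<psi>)\<bar> \<le> e * l2_norm (grad \<psi>)" if \<psi>: "\<psi> \<in> test_functions U" for \<psi>
  proof -
    define p where "p = l2_inner (\<lambda>x. W x - grad \<rho> x) (grad \<psi>)"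
    define m where "m = l2_norm (grad \<psi>)"
    have s\<psi>: "sq_int (grad \<psi>)" by (rule test_sq_int(2)[OF \<psi>])
    have ineq: "2 * s * p \<le> e\<^sup>2 + s\<^sup>2 * m\<^sup>2" for s
    proof -
      have t: "(\<lambda>x. \<rho> x + s * \<psi> x) \<in> test_functions U" by (rule test_linear[OF \<rho>(1) \<psi>])
      have "d \<le> J (\<lambda>x. \<rho> x + s * \<psi> x)" unfolding d_def by (rule cInf_lower[OF imageI[OF t] bdd])
      also have "J (\<lambda>x. \<rho> x + s * \<psi> x) = (l2_norm (\<lambda>x. (W x - grad \<rho> x) + (- s) *\<^sub>R grad \<psi> x))\<^sup>2"
        unfolding J_def test_grad_linear[OF \<rho>(1) \<psi>] by (simp add: algebra_simps)
      also have "\<dots> = J \<rho> + 2 * (- s) * p + (- s)\<^sup>2 * m\<^sup>2"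
        unfolding l2_norm_lin_sq[OF s\<rho> s\<psi>] J_def p_def m_def by simp
      finally show ?thesis using \<rho>(2) by simp
    qed
    show ?thesis
    proof (cases "m = 0")
      case True
      then have "p = 0" using l2_Cauchy_Schwarz[OF s\<rho> s\<psi>] by (simp add: p_def m_def)
      then show ?thesis using True by (simp add: p_def m_def)
    next
      case False
      then have m: "0 < m" by (simp add: m_def less_le)
      have "2 * (e / m) * p \<le> 2 * e\<^sup>2" "2 * (- (e / m)) * p \<le> 2 * e\<^sup>2"
        using ineq[of "e / m"] ineq[of "- (e / m)"] m by (simp_all add: power_divide)
      then have "2 * (e / m) * \<bar>p\<bar> \<le> 2 * e\<^sup>2" by (simp add: abs_if)
      then have "(2 * e) * \<bar>p\<bar> \<le> (2 * e) * (e * m)" using m by (simp add: field_simps power2_eq_square)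
      then have "\<bar>p\<bar> \<le> e * m" using e by (subst (asm) mult_le_cancel_left_pos) auto
      then show ?thesis by (simp add: p_def m_def)
    qed
  qed
  then show ?thesis using \<rho>(1) by blast
qed

text \<open>The contraction behind the theory of strongly monotone operators: the step length
  \<open>lam / \<Lambda>\<^sup>2\<close> minimises the bound that results from expanding the square.\<close>

lemma monotone_contraction:
  fixes Z D :: "'a::real_inner"
  assumes "0 < lam" "0 < \<Lambda>" "norm D \<le> \<Lambda> * norm (\<tau> *\<^sub>R Z)" "D \<bullet> (\<tau> *\<^sub>R Z) \<ge> lam * (norm (\<tau> *\<^sub>R Z))\<^sup>2"
    and \<tau>: "\<tau> = lam / \<Lambda>\<^sup>2"
  shows "(norm (Z - D))\<^sup>2 \<le> (1 - lam\<^sup>2 / \<Lambda>\<^sup>2) * (norm Z)\<^sup>2"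
proof -
  have t: "0 < \<tau>" using assms by (simp add: \<tau>)
  have "\<tau> * (D \<bullet> Z) \<ge> \<tau> * (lam * \<tau> * (norm Z)\<^sup>2)" using assms(4) t by (simp add: power_mult_distrib power2_eq_square mult_ac)
  then have 1: "D \<bullet> Z \<ge> lam * \<tau> * (norm Z)\<^sup>2" using t by (subst (asm) mult_le_cancel_left_pos) auto
  have "(norm D)\<^sup>2 \<le> (\<Lambda> * norm (\<tau> *\<^sub>R Z))\<^sup>2" using assms(3) by (intro power_mono) auto
  then have 2: "(norm D)\<^sup>2 \<le> \<Lambda>\<^sup>2 * \<tau>\<^sup>2 * (norm Z)\<^sup>2" using t by (simp add: power_mult_distrib mult_ac)
  have "(norm (Z - D))\<^sup>2 = (norm Z)\<^sup>2 - 2 * (D \<bullet> Z) + (norm D)\<^sup>2"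
    unfolding power2_norm_eq_inner by (simp add: inner_diff_left inner_diff_right inner_commute)
  also have "\<dots> \<le> (norm Z)\<^sup>2 - 2 * (lam * \<tau> * (norm Z)\<^sup>2) + \<Lambda>\<^sup>2 * \<tau>\<^sup>2 * (norm Z)\<^sup>2"
    using 1 2 by linarith
  also have "\<dots> = (1 - 2 * (lam * \<tau>) + \<Lambda>\<^sup>2 * \<tau>\<^sup>2) * (norm Z)\<^sup>2" by (simp add: algebra_simps)
  also have "1 - 2 * (lam * \<tau>) + \<Lambda>\<^sup>2 * \<tau>\<^sup>2 = 1 - lam\<^sup>2 / \<Lambda>\<^sup>2"
    using assms(2) by (simp add: \<tau> field_simps power2_eq_square)
  finally show ?thesis .
qed

text \<open>The infimum of the achievable residuals is zero: correcting a test function by the damped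
  almost projection of its residual multiplies the residual by \<kappa> < 1, up to an arbitrarily small
  error.\<close>

lemma small_residual:
  fixes a :: "real^'n \<Rightarrow> real^'n \<Rightarrow> real^'n"
  assumes a: "elliptic_coeff lam \<Lambda> D a" and lam: "0 < lam" "lam \<le> \<Lambda>"
    and U: "U \<in> sets lebesgue" "U \<subseteq> D" and G: "sq_int G" and e: "0 < e"
  shows "\<exists>\<phi>\<in>test_functions U. \<forall>\<psi>\<in>test_functions U.
    \<bar>l2_inner (\<lambda>x. nemytskii U a (grad \<phi>) x - G x) (grad \<psi>)\<bar> \<le> e * l2_norm (grad \<psi>)"
proof -
  have L: "0 < \<Lambda>" "0 \<le> \<Lambda>" using lam by auto
  define res where "res r \<phi> \<longleftrightarrow> (\<forall>\<psi>\<in>test_functions U.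
    \<bar>l2_inner (\<lambda>x. nemytskii U a (grad \<phi>) x - G x) (grad \<psi>)\<bar> \<le> r * l2_norm (grad \<psi>))" for r \<phi>
  define X where "X = {r. 0 \<le> r \<and> (\<exists>\<phi>\<in>test_functions U. res r \<phi>)}"
  define R where "R = Inf X"
  define \<tau> where "\<tau> = lam / \<Lambda>\<^sup>2"
  define \<kappa> where "\<kappa> = sqrt (1 - lam\<^sup>2 / \<Lambda>\<^sup>2)"
  have lL: "lam\<^sup>2 / \<Lambda>\<^sup>2 \<le> 1" "0 < lam\<^sup>2 / \<Lambda>\<^sup>2" using lam L by (auto simp: power_mono)
  have \<kappa>: "0 \<le> \<kappa>" "\<kappa> < 1" "\<kappa>\<^sup>2 = 1 - lam\<^sup>2 / \<Lambda>\<^sup>2" using lL by (auto simp: \<kappa>_def)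
  have N: "sq_int (nemytskii U a V)" if "sq_int V" for V by (rule nemytskii_sq_int[OF a U that L(2)])
  have bdd: "bdd_below X" by (rule bdd_belowI[of _ 0]) (auto simp: X_def)
  have ne: "X \<noteq> {}"
  proof -
    have "res (l2_norm (\<lambda>x. nemytskii U a (grad (\<lambda>x. 0)) x - G x)) (\<lambda>x. 0)" unfolding res_def
      by (intro ballI l2_Cauchy_Schwarz sq_int_diff N G test_sq_int(2)[OF test_zero]) (rule test_sq_int(2))
    then show ?thesis using test_zero unfolding X_def by (metis (mono_tags, lifting) empty_iff l2_norm_nonneg mem_Collect_eq)
  qed
  have step: "\<kappa> * (r + \<delta>) + \<delta> \<in> X" if r: "r \<in> X" and \<delta>: "0 < \<delta>" for r \<delta>
  proof -
    obtain \<phi> where \<phi>: "\<phi> \<in> test_functions U" "res r \<phi>" and r0: "0 \<le> r" using r unfolding X_def by blast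
    define E where "E x = nemytskii U a (grad \<phi>) x - G x" for x
    have sE: "sq_int E" unfolding E_def[abs_def] by (intro sq_int_diff N G test_sq_int(2)[OF \<phi>(1)])
    obtain \<rho> where \<rho>: "\<rho> \<in> test_functions U"
      "\<And>\<psi>. \<psi> \<in> test_functions U \<Longrightarrow> \<bar>l2_inner (\<lambda>x. E x - grad \<rho> x) (grad \<psi>)\<bar> \<le> \<delta> * l2_norm (grad \<psi>)"
      using approx_projection[OF sE \<delta>, of U] by blast
    define Z where "Z = grad \<rho>"
    have sZ: "sq_int Z" unfolding Z_def by (rule test_sq_int(2)[OF \<rho>(1)])
    have sEZ: "sq_int (\<lambda>x. E x - Z x)" by (rule sq_int_diff[OF sE sZ])
    have Zle: "l2_norm Z \<le> r + \<delta>"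
    proof -
      have "(l2_norm Z)\<^sup>2 = l2_inner E Z - l2_inner (\<lambda>x. E x - Z x) Z"
        unfolding l2_inner_diff[OF sE sZ sZ] l2_norm_sq_inner by simp
      also have "\<dots> \<le> r * l2_norm Z + \<delta> * l2_norm Z"
      proof -
        have "\<bar>l2_inner E Z\<bar> \<le> r * l2_norm Z"
          using \<phi>(2) \<rho>(1) unfolding res_def E_def[abs_def] Z_def by blast
        moreover have "\<bar>l2_inner (\<lambda>x. E x - Z x) Z\<bar> \<le> \<delta> * l2_norm Z"
          using \<rho>(2)[OF \<rho>(1)] unfolding Z_def .
        ultimately show ?thesis by linarith
      qed
      finally have "l2_norm Z * l2_norm Z \<le> (r + \<delta>) * l2_norm Z" by (simp add: power2_eq_square algebra_simps)
      then show ?thesis using r0 \<delta> by (cases "l2_norm Z = 0") (auto simp: less_le)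
    qed
    define \<phi>' where "\<phi>' x = \<phi> x + (- \<tau>) * \<rho> x" for x
    have \<phi>': "\<phi>' \<in> test_functions U" unfolding \<phi>'_def[abs_def] by (rule test_linear[OF \<phi>(1) \<rho>(1)])
    have g': "grad \<phi>' x = grad \<phi> x - \<tau> *\<^sub>R Z x" for x
      unfolding \<phi>'_def[abs_def] test_grad_linear[OF \<phi>(1) \<rho>(1)] Z_def by simp
    define K where "K x = nemytskii U a (grad \<phi>) x - nemytskii U a (grad \<phi>') x" for x
    have sK: "sq_int K" unfolding K_def[abs_def] by (intro sq_int_diff N test_sq_int(2)[OF \<phi>(1)] test_sq_int(2)[OF \<phi>'])
    have sZK: "sq_int (\<lambda>x. Z x - K x)" by (rule sq_int_diff[OF sZ sK])
    have pt: "norm (Z x - K x) \<le> \<kappa> * norm (Z x)" for x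
    proof (cases "x \<in> U")
      case True
      then have xD: "x \<in> D" using U by blast
      have Kx: "K x = a x (grad \<phi> x) - a x (grad \<phi>' x)" using True by (simp add: K_def nemytskii_def)
      have dx: "grad \<phi> x - grad \<phi>' x = \<tau> *\<^sub>R Z x" by (simp add: g')
      have "(norm (Z x - K x))\<^sup>2 \<le> (1 - lam\<^sup>2 / \<Lambda>\<^sup>2) * (norm (Z x))\<^sup>2"
        by (rule monotone_contraction[OF lam(1) L(1) _ _ \<tau>_def])
          (use elliptic_coeffD(2,3)[OF a xD, of "grad \<phi> x" "grad \<phi>' x"] in \<open>simp_all only: Kx dx\<close>)
      then have "(norm (Z x - K x))\<^sup>2 \<le> (\<kappa> * norm (Z x))\<^sup>2" by (simp add: power_mult_distrib \<kappa>(3))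
      then show ?thesis by (rule power2_le_imp_le) (simp add: \<kappa>(1))
    next
      case False
      then have "Z x = 0" using test_functionsE[OF \<rho>(1)] unfolding Z_def by (metis subsetD)
      then show ?thesis using False by (simp add: K_def nemytskii_def)
    qed
    have ZK: "l2_norm (\<lambda>x. Z x - K x) \<le> \<kappa> * l2_norm Z"
      by (rule sq_int_dominated(2)[OF sZ sq_int_measurable[OF sZK] _ \<kappa>(1)]) (simp add: pt)
    have "res (\<kappa> * (r + \<delta>) + \<delta>) \<phi>'" unfolding res_def
    proof
      fix \<psi> assume \<psi>: "\<psi> \<in> test_functions U"
      have s\<psi>: "sq_int (grad \<psi>)" by (rule test_sq_int(2)[OF \<psi>])
      have eq: "(\<lambda>x. nemytskii U a (grad \<phi>') x - G x) = (\<lambda>x. (E x - Z x) + 1 *\<^sub>R (Z x - K x))"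
        by (simp add: fun_eq_iff E_def K_def)
      have "\<bar>l2_inner (\<lambda>x. nemytskii U a (grad \<phi>') x - G x) (grad \<psi>)\<bar> \<le>
          \<bar>l2_inner (\<lambda>x. E x - Z x) (grad \<psi>)\<bar> + \<bar>l2_inner (\<lambda>x. Z x - K x) (grad \<psi>)\<bar>"
        unfolding eq l2_inner_lin[OF sEZ sZK s\<psi>] by simp
      also have "\<dots> \<le> \<delta> * l2_norm (grad \<psi>) + l2_norm (\<lambda>x. Z x - K x) * l2_norm (grad \<psi>)"
        using \<rho>(2)[OF \<psi>] l2_Cauchy_Schwarz[OF sZK s\<psi>] unfolding Z_def by (rule add_mono)
      also have "\<dots> \<le> \<delta> * l2_norm (grad \<psi>) + (\<kappa> * (r + \<delta>)) * l2_norm (grad \<psi>)"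
        using order_trans[OF ZK mult_left_mono[OF Zle \<kappa>(1)]] by (intro add_left_mono mult_right_mono) auto
      finally show "\<bar>l2_inner (\<lambda>x. nemytskii U a (grad \<phi>') x - G x) (grad \<psi>)\<bar> \<le> (\<kappa> * (r + \<delta>) + \<delta>) * l2_norm (grad \<psi>)"
        by (simp add: algebra_simps)
    qed
    moreover have "0 \<le> \<kappa> * (r + \<delta>) + \<delta>" using \<kappa> r0 \<delta> by simp
    ultimately show ?thesis using \<phi>' unfolding X_def by blast
  qed
  have R0: "0 \<le> R" unfolding R_def by (rule cInf_greatest[OF ne]) (auto simp: X_def)
  have "R \<le> \<kappa> * R"
  proof (rule field_le_epsilon)
    fix \<epsilon> :: real assume \<epsilon>: "0 < \<epsilon>"
    obtain r where r: "r \<in> X" "r < R + \<epsilon> / 3" using cInf_lessD[OF ne, of "R + \<epsilon> / 3"] \<epsilon> by (auto simp: R_def)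
    have "R \<le> \<kappa> * (r + \<epsilon> / 3) + \<epsilon> / 3" unfolding R_def using step[OF r(1)] \<epsilon> by (intro cInf_lower[OF _ bdd]) simp
    also have "\<dots> \<le> \<kappa> * (R + \<epsilon> / 3 + \<epsilon> / 3) + \<epsilon> / 3" using r \<kappa> by (intro add_right_mono mult_left_mono) auto
    also have "\<dots> \<le> \<kappa> * R + \<epsilon>"
    proof -
      have "\<kappa> * (2 * \<epsilon> / 3) \<le> 1 * (2 * \<epsilon> / 3)" using \<kappa> \<epsilon> by (intro mult_right_mono) auto
      moreover have "\<kappa> * (R + \<epsilon> / 3 + \<epsilon> / 3) = \<kappa> * R + \<kappa> * (2 * \<epsilon> / 3)" by (simp add: distrib_left)
      ultimately show ?thesis by linarith
    qed
    finally show "R \<le> \<kappa> * R + \<epsilon>" .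
  qed
  then have "(1 - \<kappa>) * R \<le> 0" by (simp add: algebra_simps)
  then have "R = 0" using \<kappa> R0 by (simp add: mult_le_0_iff)
  then obtain r where r: "r \<in> X" "r < e" using cInf_lessD[OF ne, of e] e by (auto simp: R_def)
  then obtain \<phi> where \<phi>: "\<phi> \<in> test_functions U" "res r \<phi>" unfolding X_def by blast
  have "res e \<phi>" unfolding res_def
  proof
    fix \<psi> assume "\<psi> \<in> test_functions U"
    then have "\<bar>l2_inner (\<lambda>x. nemytskii U a (grad \<phi>) x - G x) (grad \<psi>)\<bar> \<le> r * l2_norm (grad \<psi>)"
      using \<phi>(2) by (simp add: res_def)
    also have "\<dots> \<le> e * l2_norm (grad \<psi>)" using r(2) by (intro mult_right_mono) auto
    finally show "\<bar>l2_inner (\<lambda>x. nemytskii U a (grad \<phi>) x - G x) (grad \<psi>)\<bar> \<le> e * l2_norm (grad \<psi>)" .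
  qed
  then show ?thesis using \<phi>(1) unfolding res_def by blast
qed

lemma l2_Poincare:
  assumes "\<phi> \<in> test_functions U" "\<And>x. x \<in> U \<Longrightarrow> norm x \<le> R" "0 \<le> R"
  shows "l2_norm \<phi> \<le> 2 * R * l2_norm (grad \<phi>)"
proof (rule power2_le_imp_le)
  show "(l2_norm \<phi>)\<^sup>2 \<le> (2 * R * l2_norm (grad \<phi>))\<^sup>2"
    using test_Poincare[OF assms(1,2)] by (simp add: l2_norm_sq power_mult_distrib)
qed (simp add: assms)

text \<open>Functions with small residual form a Cauchy sequence by strong monotonicity.  The solution is a
  limit of test functions in U, hence its extension by zero has zero boundary values in every
  larger open set, and its gradient has mean zero.\<close>

lemma Dirichlet_problem:
  fixes a :: "real^'n \<Rightarrow> real^'n \<Rightarrow> real^'n"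
  assumes a: "elliptic_coeff lam \<Lambda> D a" and lam: "0 < lam" "lam \<le> \<Lambda>"
    and U: "open U" "bounded U" "U \<subseteq> D" and G: "sq_int G"
  obtains v V where "sq_int V" "\<And>x. x \<notin> U \<Longrightarrow> V x = 0"
    "\<And>\<psi>. \<psi> \<in> test_functions U \<Longrightarrow> l2_inner (nemytskii U a V) (grad \<psi>) = l2_inner G (grad \<psi>)"
    "(\<integral>x. indicator U x *\<^sub>R V x \<partial>lebesgue) = 0"
    "\<And>U'. open U' \<Longrightarrow> U \<subseteq> U' \<Longrightarrow> v \<in> W12_0 U'"
    "\<And>U'. open U' \<Longrightarrow> U \<subseteq> U' \<Longrightarrow> AE x in lebesgue. x \<in> U' \<longrightarrow> weak_grad U' v x = V x"
proof -
  have L: "0 \<le> \<Lambda>" using lam by auto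
  have Us: "U \<in> sets lebesgue" using U by simp
  have N: "sq_int (nemytskii U a V)" if "sq_int V" for V by (rule nemytskii_sq_int[OF a Us U(3) that L])
  obtain R where R: "0 < R" "\<And>x. x \<in> U \<Longrightarrow> norm x \<le> R" using U(2) unfolding bounded_pos by blast
  \<comment> \<open>Residuals \<epsilon> k bound the gradients of differences by 2 \<epsilon> k / lam, and Poincare's inequality costs a factor 2 R.\<close>
  define \<epsilon> where "\<epsilon> k = lam / 2 * (1 / (1 + 2 * R)) * (1 / 2) ^ k" for k :: nat
  have \<epsilon>: "0 < \<epsilon> k" for k using lam R by (simp add: \<epsilon>_def)
  have \<epsilon>_mono: "\<epsilon> j \<le> \<epsilon> k" if "k \<le> j" for j k
    unfolding \<epsilon>_def using lam R that by (intro mult_left_mono power_decreasing) auto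
  have "\<forall>k. \<exists>\<phi>. \<phi> \<in> test_functions U \<and> (\<forall>\<psi>\<in>test_functions U.
    \<bar>l2_inner (\<lambda>x. nemytskii U a (grad \<phi>) x - G x) (grad \<psi>)\<bar> \<le> \<epsilon> k * l2_norm (grad \<psi>))"
    using small_residual[OF a lam Us U(3) G \<epsilon>] by blast
  then obtain \<phi> where \<phi>: "\<And>k. \<phi> k \<in> test_functions U"
    "\<And>k \<psi>. \<psi> \<in> test_functions U \<Longrightarrow>
      \<bar>l2_inner (\<lambda>x. nemytskii U a (grad (\<phi> k)) x - G x) (grad \<psi>)\<bar> \<le> \<epsilon> k * l2_norm (grad \<psi>)" by metis
  have sg: "sq_int (grad (\<phi> k))" and s\<phi>: "sq_int (\<phi> k)" for k by (rule test_sq_int[OF \<phi>(1)])+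
  have diff: "l2_norm (\<lambda>x. grad (\<phi> k) x - grad (\<phi> j) x) \<le> (1 / (1 + 2 * R)) * (1 / 2) ^ k \<and>
     l2_norm (\<lambda>x. \<phi> k x - \<phi> j x) \<le> (1 / 2) ^ k" if kj: "k \<le> j" for k j
  proof -
    define \<psi> where "\<psi> x = \<phi> k x + (- 1) * \<phi> j x" for x
    have \<psi>: "\<psi> \<in> test_functions U" unfolding \<psi>_def[abs_def] by (rule test_linear[OF \<phi>(1) \<phi>(1)])
    have g\<psi>: "grad \<psi> x = grad (\<phi> k) x - grad (\<phi> j) x" for x
      unfolding \<psi>_def[abs_def] test_grad_linear[OF \<phi>(1) \<phi>(1)] by simp
    have s\<psi>: "sq_int (grad \<psi>)" by (rule test_sq_int(2)[OF \<psi>])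
    define E where "E i x = nemytskii U a (grad (\<phi> i)) x - G x" for i x
    have sE: "sq_int (E i)" for i unfolding E_def[abs_def] by (intro sq_int_diff N G sg)
    have "lam * (l2_norm (grad \<psi>))\<^sup>2 \<le> l2_inner (\<lambda>x. E k x - E j x) (grad \<psi>)"
      unfolding l2_norm_sq l2_inner_def integral_mult_right_zero[symmetric]
    proof (rule integral_mono)
      show "integrable lebesgue (\<lambda>x. lam * (norm (grad \<psi> x))\<^sup>2)" using s\<psi> by (simp add: sq_int_def)
      show "integrable lebesgue (\<lambda>x. (E k x - E j x) \<bullet> grad \<psi> x)"
        by (rule sq_int_inner_integrable[OF sq_int_diff[OF sE sE] s\<psi>])
      fix x show "lam * (norm (grad \<psi> x))\<^sup>2 \<le> (E k x - E j x) \<bullet> grad \<psi> x"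
      proof (cases "x \<in> U")
        case True
        then have "x \<in> D" using U(3) by blast
        from elliptic_coeffD(3)[OF a this, of "grad (\<phi> k) x" "grad (\<phi> j) x"]
        show ?thesis using True by (simp add: E_def nemytskii_def g\<psi>)
      next
        case False
        then have "grad \<psi> x = 0" using test_functionsE[OF \<psi>] by (metis subsetD)
        then show ?thesis by simp
      qed
    qed
    also have "\<dots> \<le> \<epsilon> k * l2_norm (grad \<psi>) + \<epsilon> j * l2_norm (grad \<psi>)"
      unfolding l2_inner_diff[OF sE sE s\<psi>] using \<phi>(2)[OF \<psi>, of k] \<phi>(2)[OF \<psi>, of j] by (simp add: E_def[abs_def] abs_le_iff)
    also have "\<dots> \<le> (2 * \<epsilon> k) * l2_norm (grad \<psi>)"
      using mult_right_mono[OF \<epsilon>_mono[OF kj] l2_norm_nonneg[of "grad \<psi>"]] by simp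
    finally have "(lam * l2_norm (grad \<psi>)) * l2_norm (grad \<psi>) \<le> (2 * \<epsilon> k) * l2_norm (grad \<psi>)"
      by (simp add: power2_eq_square)
    then have "lam * l2_norm (grad \<psi>) \<le> 2 * \<epsilon> k"
      using \<epsilon>[of k] by (cases "l2_norm (grad \<psi>) = 0") (auto simp: less_le)
    also have "2 * \<epsilon> k = lam * ((1 / (1 + 2 * R)) * (1 / 2) ^ k)"
    proof -
      have "2 * (lam / 2 * b * c) = lam * (b * c)" for b c by simp
      then show ?thesis unfolding \<epsilon>_def .
    qed
    finally have 1: "l2_norm (grad \<psi>) \<le> (1 / (1 + 2 * R)) * (1 / 2) ^ k"
      using lam(1) by (subst (asm) mult_le_cancel_left_pos) auto
    have "l2_norm \<psi> \<le> 2 * R * l2_norm (grad \<psi>)" using R by (intro l2_Poincare[OF \<psi>]) auto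
    also have "\<dots> \<le> 2 * R * ((1 / (1 + 2 * R)) * (1 / 2) ^ k)" using R by (intro mult_left_mono 1) auto
    also have "\<dots> = (2 * R / (1 + 2 * R)) * (1 / 2) ^ k" by simp
    also have "\<dots> \<le> 1 * (1 / 2) ^ k" using R by (intro mult_right_mono) auto
    finally have "l2_norm (\<lambda>x. \<phi> k x - \<phi> j x) \<le> (1 / 2) ^ k" by (simp add: \<psi>_def[abs_def])
    moreover have "grad \<psi> = (\<lambda>x. grad (\<phi> k) x - grad (\<phi> j) x)" by (rule ext) (rule g\<psi>)
    ultimately show ?thesis using 1 by simp
  qed
  obtain v where v: "sq_int v" "(\<lambda>k. l2_norm (\<lambda>x. \<phi> k x - v x)) \<longlonglongrightarrow> 0"
    using l2_complete[of \<phi>] s\<phi> diff by blast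
  have "l2_norm (\<lambda>x. grad (\<phi> k) x - grad (\<phi> j) x) \<le> (1 / 2) ^ k" if "k \<le> j" for k j
  proof -
    have "(1 / (1 + 2 * R)) * (1 / 2) ^ k \<le> 1 * (1 / 2 :: real) ^ k" using R by (intro mult_right_mono) auto
    then show ?thesis using diff[OF that] by linarith
  qed
  then obtain V0 where V0: "sq_int V0" "(\<lambda>k. l2_norm (\<lambda>x. grad (\<phi> k) x - V0 x)) \<longlonglongrightarrow> 0"
    using l2_complete[of "\<lambda>k. grad (\<phi> k)"] sg by blast
  define V where "V x = indicator U x *\<^sub>R V0 x" for x
  have sV: "sq_int V" unfolding V_def[abs_def] by (rule sq_int_indicator[OF V0(1) Us])
  have Vlim: "(\<lambda>k. l2_norm (\<lambda>x. grad (\<phi> k) x - V x)) \<longlonglongrightarrow> 0"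
  proof (rule Lim_null_comparison[OF _ V0(2)])
    have "l2_norm (\<lambda>x. grad (\<phi> k) x - V x) \<le> 1 * l2_norm (\<lambda>x. grad (\<phi> k) x - V0 x)" for k
    proof (rule sq_int_dominated(2)[OF sq_int_diff[OF sg V0(1)] sq_int_measurable[OF sq_int_diff[OF sg sV]]])
      show "AE x in lebesgue. norm (grad (\<phi> k) x - V x) \<le> 1 * norm (grad (\<phi> k) x - V0 x)"
      proof (rule AE_I2)
        fix x show "norm (grad (\<phi> k) x - V x) \<le> 1 * norm (grad (\<phi> k) x - V0 x)"
        proof (cases "x \<in> U")
          case False
          then have "grad (\<phi> k) x = 0" using test_functionsE[OF \<phi>(1)] by (metis subsetD)
          then show ?thesis using False by (simp add: V_def)
        qed (simp add: V_def)
      qed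
    qed simp
    then show "\<forall>\<^sub>F k in sequentially. norm (l2_norm (\<lambda>x. grad (\<phi> k) x - V x)) \<le> l2_norm (\<lambda>x. grad (\<phi> k) x - V0 x)"
      by simp
  qed
  show ?thesis
  proof (rule that[of V v])
    show "sq_int V" by (rule sV)
    show "V x = 0" if "x \<notin> U" for x using that by (simp add: V_def)
    show "v \<in> W12_0 U'" "AE x in lebesgue. x \<in> U' \<longrightarrow> weak_grad U' v x = V x" if "open U'" "U \<subseteq> U'" for U'
      using sobolev_limit(2,3)[OF that(1) _ v(1) sV v(2) Vlim] test_functions_mono[OF that(2)] \<phi>(1) by blast+
    show "l2_inner (nemytskii U a V) (grad \<psi>) = l2_inner G (grad \<psi>)" if \<psi>: "\<psi> \<in> test_functions U" for \<psi>
    proof -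
      have s\<psi>: "sq_int (grad \<psi>)" by (rule test_sq_int(2)[OF \<psi>])
      have "(\<lambda>k. l2_norm (\<lambda>x. nemytskii U a (grad (\<phi> k)) x - nemytskii U a V x)) \<longlonglongrightarrow> 0"
      proof (rule Lim_null_comparison)
        show "\<forall>\<^sub>F k in sequentially. norm (l2_norm (\<lambda>x. nemytskii U a (grad (\<phi> k)) x - nemytskii U a V x)) \<le>
          \<Lambda> * l2_norm (\<lambda>x. grad (\<phi> k) x - V x)"
          using nemytskii_Lipschitz[OF a Us U(3) sg sV L] by simp
        show "(\<lambda>k. \<Lambda> * l2_norm (\<lambda>x. grad (\<phi> k) x - V x)) \<longlonglongrightarrow> 0"
          by (rule tendsto_mult_right_zero[OF Vlim])
      qed
      then have "(\<lambda>k. l2_inner (nemytskii U a (grad (\<phi> k))) (grad \<psi>)) \<longlonglongrightarrow> l2_inner (nemytskii U a V) (grad \<psi>)"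
        by (rule l2_inner_limit[OF N[OF sg] N[OF sV] s\<psi>])
      moreover have "(\<lambda>k. l2_inner (nemytskii U a (grad (\<phi> k))) (grad \<psi>)) \<longlonglongrightarrow> l2_inner G (grad \<psi>)"
      proof -
        have "(\<lambda>k. l2_inner (nemytskii U a (grad (\<phi> k))) (grad \<psi>) - l2_inner G (grad \<psi>)) \<longlonglongrightarrow> 0"
        proof (rule Lim_null_comparison)
          show "\<forall>\<^sub>F k in sequentially. norm (l2_inner (nemytskii U a (grad (\<phi> k))) (grad \<psi>) - l2_inner G (grad \<psi>)) \<le>
             \<epsilon> k * l2_norm (grad \<psi>)"
            using \<phi>(2)[OF \<psi>] unfolding l2_inner_diff[OF N[OF sg] G s\<psi>] by simp
          have "(\<lambda>k. (1 / 2 :: real) ^ k) \<longlonglongrightarrow> 0" by (rule LIMSEQ_realpow_zero) auto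
          then have "\<epsilon> \<longlonglongrightarrow> 0" unfolding \<epsilon>_def[abs_def] by (rule tendsto_mult_right_zero)
          then show "(\<lambda>k. \<epsilon> k * l2_norm (grad \<psi>)) \<longlonglongrightarrow> 0" by (rule tendsto_mult_left_zero)
        qed
        then show ?thesis by (simp add: LIM_zero_iff)
      qed
      ultimately show ?thesis by (rule LIMSEQ_unique)
    qed
    show "(\<integral>x. indicator U x *\<^sub>R V x \<partial>lebesgue) = 0"
    proof -
      have fm: "vol U < top"
        using bounded_set_imp_lmeasurable[OF U(2) Us] fmeasurableD2 less_top by blast
      have "(\<integral>x. indicator U x *\<^sub>R V x \<partial>lebesgue) $ i = 0" for i
      proof -
        define e where "e x = (indicator U x *\<^sub>R axis i 1 :: real^'n)" for x :: "real^'n"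
        have se: "sq_int e"
        proof -
          have m: "e \<in> borel_measurable lebesgue" unfolding e_def[abs_def]
            by (intro borel_measurable_scaleR borel_measurable_indicator Us borel_measurable_const)
          have "(\<integral>\<^sup>+x. ennreal ((norm (e x))\<^sup>2) \<partial>lebesgue) = (\<integral>\<^sup>+x. indicator U x \<partial>lebesgue)"
            by (rule nn_integral_cong) (simp add: e_def indicator_def)
          then show ?thesis using fm Us by (subst sq_int_nn_integral[OF m]) simp
        qed
        have eq: "indicator U x *\<^sub>R V x = V x" for x by (simp add: V_def indicator_def)
        have iV: "integrable lebesgue V"
        proof -
          have "Lp 1 U V" by (rule sq_int_Lp_1[OF sV Us fm])
          moreover have "(\<integral>\<^sup>+x. ennreal (norm (V x)) \<partial>lebesgue) = (\<integral>\<^sup>+x\<in>U. ennreal (norm (V x)) \<partial>lebesgue)"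
            by (rule nn_integral_cong) (simp add: V_def indicator_def)
          ultimately show ?thesis using sq_int_measurable[OF sV] by (simp add: integrable_iff_bounded Lp_def)
        qed
        have dot: "W x \<bullet> e x = W x $ i" if "\<And>x. x \<notin> U \<Longrightarrow> W x = 0" for W :: "real^'n \<Rightarrow> real^'n" and x
          using that[of x] by (cases "x \<in> U") (auto simp: e_def inner_axis)
        have z: "l2_inner (grad (\<phi> k)) e = 0" for k
        proof -
          obtain K where K: "compact K" "K \<subseteq> U" "\<And>x. x \<notin> K \<Longrightarrow> \<phi> k x = 0" "\<And>x. x \<notin> K \<Longrightarrow> grad (\<phi> k) x = 0"
            using test_functionsE[OF \<phi>(1)[of k]] by metis
          have "l2_inner (grad (\<phi> k)) e = (\<integral>x. grad (\<phi> k) x $ i \<partial>lebesgue)"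
            unfolding l2_inner_def by (rule Bochner_Integration.integral_cong[OF refl], rule dot) (use K in blast)
          also have "\<dots> = 0" by (rule integral_grad_zero[OF test_functions_Ck[OF \<phi>(1)] K(1,3)])
          finally show ?thesis .
        qed
        have "(\<lambda>k. l2_inner (grad (\<phi> k)) e) \<longlonglongrightarrow> l2_inner V e" by (rule l2_inner_limit[OF sg sV se Vlim])
        then have "l2_inner V e = 0" using z by (simp add: LIMSEQ_const_iff)
        moreover have "l2_inner V e = (\<integral>x. V x $ i \<partial>lebesgue)"
          unfolding l2_inner_def by (rule Bochner_Integration.integral_cong[OF refl], rule dot) (simp add: V_def)
        ultimately show ?thesis unfolding eq integral_vec_nth[OF iV] by simp
      qed
      then show ?thesis by (simp add: vec_eq_iff)
    qed
  qed
qed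

section \<open>Local solutions and the lower exponent\<close>

lemma sq_int_Lp_loc:
  fixes h :: "real^'n \<Rightarrow> 'b::euclidean_space"
  assumes h: "sq_int h" and p: "0 \<le> p" "p \<le> 2" shows "Lp_loc p U h"
  unfolding Lp_loc_def
proof (intro conjI allI impI)
  have hm: "h \<in> borel_measurable lebesgue" by (rule sq_int_measurable[OF h])
  show "h \<in> borel_measurable (lebesgue_on U)" by (rule measurable_restrict_space1[OF hm])
  fix K assume "compact K \<and> K \<subseteq> U"
  then have K: "K \<in> lmeasurable" by (simp add: lmeasurable_compact)
  have Ks: "K \<in> sets lebesgue" "vol K \<noteq> top" using fmeasurableD[OF K] fmeasurableD2[OF K] by auto
  have "(\<integral>\<^sup>+x\<in>K. ennreal (norm (h x) powr p) \<partial>lebesgue) \<le> (\<integral>\<^sup>+x. indicator K x + ennreal ((norm (h x))\<^sup>2) \<partial>lebesgue)"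
  proof (rule nn_integral_mono)
    fix x
    have "norm (h x) powr p \<le> 1 + (norm (h x))\<^sup>2"
    proof (cases "norm (h x) \<le> 1")
      case True
      then have "norm (h x) powr p \<le> 1" using p powr_mono2[of p "norm (h x)" 1] by simp
      then show ?thesis using zero_le_power2[of "norm (h x)"] by linarith
    next
      case False
      then have "norm (h x) powr p \<le> norm (h x) powr 2" using p by (intro powr_mono) auto
      then show ?thesis by (simp add: powr_2_norm)
    qed
    then have "ennreal (norm (h x) powr p) \<le> ennreal (1 + (norm (h x))\<^sup>2)" by (rule ennreal_leI)
    also have "\<dots> = 1 + ennreal ((norm (h x))\<^sup>2)" by simp
    finally show "ennreal (norm (h x) powr p) * indicator K x \<le> indicator K x + ennreal ((norm (h x))\<^sup>2)"
      by (cases "x \<in> K") auto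
  qed
  also have "\<dots> = vol K + (\<integral>\<^sup>+x. ennreal ((norm (h x))\<^sup>2) \<partial>lebesgue)"
    using Ks hm by (subst nn_integral_add) auto
  also have "\<dots> < top" using Ks h hm by (simp add: sq_int_nn_integral less_top[symmetric])
  finally show "Lp p K h" using hm by (simp add: Lp_def measurable_restrict_space1)
qed

text \<open>The infimum over the admissible constants is admissible, because the other factor is finite.\<close>

lemma N_low_estimate:
  assumes adm: "admissible_lower O0 \<Omega> a q"
    and le: "\<And>N. lower_estimate O0 \<Omega> a q N \<Longrightarrow> X \<le> N * Y" and Y: "Y < top"
  shows "X \<le> N_low O0 \<Omega> a q * Y"
proof -
  obtain N0 where N0: "N0 < top" "lower_estimate O0 \<Omega> a q N0" using adm by (auto simp: admissible_lower_def)
  show ?thesis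
  proof (cases "Y = 0")
    case True
    then show ?thesis using le[OF N0(2)] by simp
  next
    case False
    then obtain y where y: "Y = ennreal y" "0 < y" using Y by (cases Y) (auto simp: less_eq_real_def)
    have "X / Y \<le> N" if "lower_estimate O0 \<Omega> a q N" for N
      using le[OF that] False by (intro divide_le_posI_ennreal) (auto simp: zero_less_iff_neq_zero mult.commute)
    then have "X / Y \<le> N_low O0 \<Omega> a q" unfolding N_low_def by (intro Inf_greatest) auto
    then have "Y * (X / Y) \<le> Y * N_low O0 \<Omega> a q" by (rule mult_left_mono) simp
    then show ?thesis unfolding y(1) ennreal_cancel[OF y(2)] by (simp add: mult.commute)
  qed
qed

text \<open>The domain \<Omega> is the open triple of Q0, written with the centre m and the side s of Q0.\<close>

locale elliptic_setting =
  fixes O0 Q0 \<Omega> :: "(real^'n) set" and a :: "real^'n \<Rightarrow> real^'n \<Rightarrow> real^'n"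
    and lam \<Lambda> q s :: real and m :: "real^'n"
  assumes O0: "open O0" "cbox (\<chi> i. - (299 / 200)) (\<chi> i. 299 / 200) \<subseteq> O0"
      "O0 \<subseteq> cbox (\<chi> i. - (3 / 2)) (\<chi> i. 3 / 2)"
    and Q0: "cube_at Q0 m s"
    and lam: "0 < lam" "lam \<le> \<Lambda>"
    and coeff: "elliptic_coeff lam \<Lambda> (dilate 3 Q0) a"
    and \<Omega>_eq: "\<Omega> = open_cube m (3 * s)"
    and lower: "admissible_lower O0 \<Omega> a q"
begin

lemma s_pos: "0 < s" using Q0 by (simp add: cube_at_def)

lemma \<Lambda>_pos: "0 < \<Lambda>" "0 \<le> \<Lambda>" using lam by auto

lemma q_bounds: "1 < q" "q \<le> 2" "0 < q" using lower by (auto simp: admissible_lower_def)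

lemma cube_\<Omega>: "cube_at \<Omega> m (3 * s)" unfolding \<Omega>_eq using s_pos by (intro cube_at_open_cube) simp

lemma open_\<Omega>: "open \<Omega>" unfolding \<Omega>_eq by (rule open_box)

lemma sets_\<Omega>: "\<Omega> \<in> sets lebesgue" using open_\<Omega> by simp

lemma finite_\<Omega>: "vol \<Omega> < top" using cube_at_emeasure_pos[OF cube_\<Omega>] by simp

lemma \<Omega>_sub: "\<Omega> \<subseteq> dilate 3 Q0"
  using cube_at_dilate[OF Q0, of 3] unfolding \<Omega>_eq cube_at_def by simp

lemma bounded_\<Omega>: "bounded \<Omega>" unfolding \<Omega>_eq by (rule bounded_box)

text \<open>Extension by zero lets gradients of local solutions in different subdomains be compared on the
  whole space.\<close>

definition Gr :: "(real^'n \<Rightarrow> real) \<Rightarrow> real^'n \<Rightarrow> real^'n" where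
  "Gr w x = indicator \<Omega> x *\<^sub>R weak_grad \<Omega> w x"

lemma Gr_sq_int: "w \<in> W12_0 \<Omega> \<Longrightarrow> sq_int (Gr w)"
  using W12_weak_grad(2)[OF open_\<Omega>, of w] unfolding W12_0_def Gr_def[abs_def] by blast

text \<open>Weak equality of div a(x, \<nabla>w) and div a(x, \<nabla>w') in U.\<close>

definition agree :: "(real^'n) set \<Rightarrow> (real^'n \<Rightarrow> real) \<Rightarrow> (real^'n \<Rightarrow> real) \<Rightarrow> bool" where
  "agree U w w' \<longleftrightarrow> (\<forall>\<psi>\<in>test_functions U.
     l2_inner (nemytskii U a (Gr w)) (grad \<psi>) = l2_inner (nemytskii U a (Gr w')) (grad \<psi>))"

lemma agree_sym: "agree U w w' \<Longrightarrow> agree U w' w"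
  by (simp add: agree_def)

lemma agree_trans: "agree U w w' \<Longrightarrow> agree U w' w'' \<Longrightarrow> agree U w w''"
  by (simp add: agree_def)

lemma nemytskii_test:
  assumes \<psi>: "\<psi> \<in> test_functions U" and U: "U \<subseteq> U'"
  shows "l2_inner (nemytskii U' a V) (grad \<psi>) = l2_inner (nemytskii U a V) (grad \<psi>)"
  unfolding l2_inner_def
proof (rule Bochner_Integration.integral_cong[OF refl])
  fix x show "nemytskii U' a V x \<bullet> grad \<psi> x = nemytskii U a V x \<bullet> grad \<psi> x"
  proof (cases "x \<in> U")
    case True then show ?thesis using U by (simp add: nemytskii_def subsetD)
  next
    case False
    then have "grad \<psi> x = 0" using test_functionsE[OF \<psi>] by (metis subsetD)
    then show ?thesis by simp
  qed
qed

lemma agree_mono: "agree U' w w' \<Longrightarrow> U \<subseteq> U' \<Longrightarrow> agree U w w'"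
  unfolding agree_def using nemytskii_test test_functions_mono by (metis subsetD)

lemma nemytskii_integral:
  assumes U: "U \<in> sets lebesgue" "U \<subseteq> \<Omega>"
  shows "(\<integral>x. a x (weak_grad \<Omega> w x) \<bullet> g x \<partial>lebesgue_on U) = l2_inner (nemytskii U a (Gr w)) g"
proof -
  have "(\<integral>x. a x (weak_grad \<Omega> w x) \<bullet> g x \<partial>lebesgue_on U) =
     (\<integral>x. indicator U x *\<^sub>R (a x (weak_grad \<Omega> w x) \<bullet> g x) \<partial>lebesgue)"
    using U by (subst integral_restrict_space) auto
  also have "\<dots> = l2_inner (nemytskii U a (Gr w)) g"
    unfolding l2_inner_def
  proof (rule Bochner_Integration.integral_cong[OF refl])
    fix x show "indicator U x *\<^sub>R (a x (weak_grad \<Omega> w x) \<bullet> g x) = nemytskii U a (Gr w) x \<bullet> g x"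
      using U(2) by (cases "x \<in> U") (auto simp: nemytskii_def Gr_def)
  qed
  finally show ?thesis .
qed

lemma solution_pairs_iff:
  assumes "cube_at P c r"
  shows "(w, w') \<in> solution_pairs O0 \<Omega> a P \<longleftrightarrow> w \<in> W12_0 \<Omega> \<and> w' \<in> W12_0 \<Omega> \<and> agree (smoothened O0 P \<inter> \<Omega>) w w'"
proof -
  have "open (smoothened O0 P)" by (rule smoothened_bounds(1)[OF assms O0])
  then have "smoothened O0 P \<inter> \<Omega> \<in> sets lebesgue" using open_\<Omega> by (simp add: open_Int)
  from nemytskii_integral[OF this Int_lower2]
  show ?thesis unfolding solution_pairs_def agree_def by simp
qed

text \<open>The part of w that solves the same equation in U with zero boundary values; its gradients in
  U and in \<Omega> agree, and its mean gradient is zero.\<close>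

definition local_solution :: "(real^'n) set \<Rightarrow> (real^'n \<Rightarrow> real) \<Rightarrow> (real^'n \<Rightarrow> real) \<Rightarrow> bool" where
  "local_solution U w v \<longleftrightarrow> v \<in> W12_0 \<Omega> \<and> v \<in> W12_0 U \<and> agree U v w \<and>
     (\<integral>x. indicator U x *\<^sub>R Gr v x \<partial>lebesgue) = 0 \<and>
     (AE x in lebesgue. x \<in> U \<longrightarrow> weak_grad U v x = Gr v x) \<and>
     (AE x in lebesgue. x \<notin> U \<longrightarrow> Gr v x = 0)"

lemma local_solution_exists:
  assumes U: "open U" "U \<subseteq> \<Omega>" and w: "w \<in> W12_0 \<Omega>"
  shows "\<exists>v. local_solution U w v"
proof -
  have U': "bounded U" "U \<subseteq> dilate 3 Q0" using U(2) bounded_\<Omega> bounded_subset \<Omega>_sub by auto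
  have Us: "U \<in> sets lebesgue" using U by simp
  have G: "sq_int (nemytskii U a (Gr w))" by (rule nemytskii_sq_int[OF coeff Us U'(2) Gr_sq_int[OF w] \<Lambda>_pos(2)])
  obtain v V where V: "sq_int V" "\<And>x. x \<notin> U \<Longrightarrow> V x = 0"
    "\<And>\<psi>. \<psi> \<in> test_functions U \<Longrightarrow> l2_inner (nemytskii U a V) (grad \<psi>) = l2_inner (nemytskii U a (Gr w)) (grad \<psi>)"
    "(\<integral>x. indicator U x *\<^sub>R V x \<partial>lebesgue) = 0"
    and v: "\<And>U'. open U' \<Longrightarrow> U \<subseteq> U' \<Longrightarrow> v \<in> W12_0 U'"
    "\<And>U'. open U' \<Longrightarrow> U \<subseteq> U' \<Longrightarrow> AE x in lebesgue. x \<in> U' \<longrightarrow> weak_grad U' v x = V x"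
    by (rule Dirichlet_problem[OF coeff lam U(1) U' G]) (rule that)
  have v\<Omega>: "v \<in> W12_0 \<Omega>" by (rule v(1)[OF open_\<Omega> U(2)])
  have eq: "AE x in lebesgue. Gr v x = V x"
    using v(2)[OF open_\<Omega> U(2)]
  proof eventually_elim
    fix x assume "x \<in> \<Omega> \<longrightarrow> weak_grad \<Omega> v x = V x"
    then show "Gr v x = V x" using V(2)[of x] U(2) by (cases "x \<in> \<Omega>") (auto simp: Gr_def)
  qed
  have Vm: "V \<in> borel_measurable lebesgue" "Gr v \<in> borel_measurable lebesgue"
    using V(1) Gr_sq_int[OF v\<Omega>] by (auto intro: sq_int_measurable)
  have "agree U v w" unfolding agree_def
  proof
    fix \<psi> assume \<psi>: "\<psi> \<in> test_functions U"
    have "l2_inner (nemytskii U a (Gr v)) (grad \<psi>) = l2_inner (nemytskii U a V) (grad \<psi>)"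
      unfolding l2_inner_def
    proof (rule integral_cong_AE)
      show "(\<lambda>x. nemytskii U a (Gr v) x \<bullet> grad \<psi> x) \<in> borel_measurable lebesgue"
        "(\<lambda>x. nemytskii U a V x \<bullet> grad \<psi> x) \<in> borel_measurable lebesgue"
        by (intro borel_measurable_inner nemytskii_measurable[OF coeff Us U'(2)] Vm sq_int_measurable[OF test_sq_int(2)[OF \<psi>]])+
      show "AE x in lebesgue. nemytskii U a (Gr v) x \<bullet> grad \<psi> x = nemytskii U a V x \<bullet> grad \<psi> x"
        using eq by eventually_elim (simp add: nemytskii_def)
    qed
    then show "l2_inner (nemytskii U a (Gr v)) (grad \<psi>) = l2_inner (nemytskii U a (Gr w)) (grad \<psi>)"
      using V(3)[OF \<psi>] by simp
  qed
  moreover have "(\<integral>x. indicator U x *\<^sub>R Gr v x \<partial>lebesgue) = 0"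
  proof -
    have "(\<integral>x. indicator U x *\<^sub>R Gr v x \<partial>lebesgue) = (\<integral>x. indicator U x *\<^sub>R V x \<partial>lebesgue)"
    proof (rule integral_cong_AE)
      show "(\<lambda>x. indicator U x *\<^sub>R Gr v x) \<in> borel_measurable lebesgue" "(\<lambda>x. indicator U x *\<^sub>R V x) \<in> borel_measurable lebesgue"
        by (intro borel_measurable_scaleR borel_measurable_indicator Us Vm)+
      show "AE x in lebesgue. indicator U x *\<^sub>R Gr v x = indicator U x *\<^sub>R V x" using eq by eventually_elim simp
    qed
    then show ?thesis using V(4) by simp
  qed
  moreover have "AE x in lebesgue. x \<in> U \<longrightarrow> weak_grad U v x = Gr v x"
    using v(2)[OF U(1) order_refl] eq by eventually_elim simp
  moreover have "AE x in lebesgue. x \<notin> U \<longrightarrow> Gr v x = 0" using eq by eventually_elim (simp add: V(2))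
  ultimately show ?thesis using v\<Omega> v(1)[OF U(1) order_refl] unfolding local_solution_def by blast
qed

text \<open>The two data terms separate because the exponent 1 / q is at most one.\<close>

lemma lower_bound:
  fixes F :: "real^'n \<Rightarrow> real^'n" and f :: "real^'n \<Rightarrow> real"
  defines "q' \<equiv> lower_star TYPE('n) q"
  assumes P: "0 < r" and U: "U = smoothened O0 (open_cube c r) \<inter> \<Omega>"
    and F: "Lp_loc q \<Omega> F" and f: "Lp_loc q' \<Omega> f" "q' \<le> 1 \<Longrightarrow> AE x in lebesgue_on \<Omega>. f x = 0"
    and v: "v \<in> W12_0 U" "solves U a F f v"
    and fin: "(\<integral>\<^sup>+x\<in>U. ennreal (norm (F x) powr q) \<partial>lebesgue) < top" "(\<integral>\<^sup>+x\<in>U. ennreal (\<bar>f x\<bar> powr q') \<partial>lebesgue) < top"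
  shows "Lp_norm q U (weak_grad U v) \<le> N_low O0 \<Omega> a q * (Lp_norm q U F + Lp_norm q' U f)"
proof -
  let ?F = "\<integral>\<^sup>+x\<in>U. ennreal (norm (F x) powr q) \<partial>lebesgue"
  let ?f = "\<integral>\<^sup>+x\<in>U. ennreal (\<bar>f x\<bar> powr q') \<partial>lebesgue"
  have q': "0 < q'" using q_bounds by (simp add: q'_def lower_star_def)
  define Y where "Y = epowr (?F + epowr ?f (q / q')) (1 / q)"
  have "?F + epowr ?f (q / q') < top" using fin by (simp add: less_top[symmetric])
  then have "Y < top" unfolding Y_def by (simp add: less_top[symmetric])
  then have "Lp_norm q U (weak_grad U v) \<le> N_low O0 \<Omega> a q * Y"
  proof (intro N_low_estimate[OF lower])
    fix N assume "lower_estimate O0 \<Omega> a q N"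
    then show "Lp_norm q U (weak_grad U v) \<le> N * Y"
      unfolding lower_estimate_def Y_def U q'_def
      using is_cube_open_cube[OF P] F f v unfolding U q'_def by blast
  qed
  also have "Y \<le> epowr ?F (1 / q) + epowr (epowr ?f (q / q')) (1 / q)"
    unfolding Y_def using q_bounds by (intro epowr_add_le) auto
  also have "\<dots> = Lp_norm q U F + Lp_norm q' U f"
    using q_bounds q' by (simp add: Lp_norm_def epowr_epowr)
  finally show ?thesis by (simp add: mult_left_mono)
qed

text \<open>Testing with functions supported in U turns the equation of u in \<Omega> into one for v in U.\<close>

lemma solves_local:
  assumes U: "open U" "U \<subseteq> \<Omega>" and u: "solves \<Omega> a F f u" and v: "local_solution U u v"
  shows "solves U a F f v"
proof -
  have Us: "U \<in> sets lebesgue" using U by simp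
  have UD: "U \<subseteq> dilate 3 Q0" using U(2) \<Omega>_sub by blast
  have v': "v \<in> W12_0 \<Omega>" "v \<in> W12_0 U" "agree U v u" "AE x in lebesgue. x \<in> U \<longrightarrow> weak_grad U v x = Gr v x"
    using v unfolding local_solution_def by blast+
  have vW: "v \<in> W12 U" using v'(2) by (simp add: W12_0_def)
  have wv: "sq_int (\<lambda>x. indicator U x *\<^sub>R weak_grad U v x)" by (rule W12_weak_grad(2)[OF U(1) vW])
  have LF: "Lp_loc 1 U F" "Lp_loc 1 U f"
    using u U(2) unfolding solves_def Lp_loc_def by (auto intro: measurable_restrict_mono)
  show ?thesis unfolding solves_def
  proof (intro conjI LF vW ballI)
    fix \<phi> assume \<phi>: "\<phi> \<in> test_functions U"
    have z: "\<And>x. x \<notin> U \<Longrightarrow> \<phi> x = 0" "\<And>x. x \<notin> U \<Longrightarrow> grad \<phi> x = 0" using test_functionsE[OF \<phi>] by (metis subsetD)+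
    have res: "(\<integral>x. h x \<partial>lebesgue_on U) = (\<integral>x. h x \<partial>lebesgue_on \<Omega>)" if "\<And>x. x \<notin> U \<Longrightarrow> h x = 0" for h :: "real^'n \<Rightarrow> real"
    proof -
      have "(\<integral>x. h x \<partial>lebesgue_on U) = (\<integral>x. indicator U x *\<^sub>R h x \<partial>lebesgue)" using Us by (subst integral_restrict_space) auto
      also have "(\<lambda>x. indicator U x *\<^sub>R h x) = (\<lambda>x. indicator \<Omega> x *\<^sub>R h x)"
        using that U(2) by (auto simp: fun_eq_iff indicator_def)
      also have "(\<integral>x. indicator \<Omega> x *\<^sub>R h x \<partial>lebesgue) = (\<integral>x. h x \<partial>lebesgue_on \<Omega>)" using sets_\<Omega> by (subst integral_restrict_space) auto
      finally show ?thesis .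
    qed
    have "(\<integral>x. a x (weak_grad U v x) \<bullet> grad \<phi> x \<partial>lebesgue_on U) = (\<integral>x. indicator U x *\<^sub>R (a x (weak_grad U v x) \<bullet> grad \<phi> x) \<partial>lebesgue)"
      using Us by (subst integral_restrict_space) auto
    also have "\<dots> = l2_inner (nemytskii U a (\<lambda>x. indicator U x *\<^sub>R weak_grad U v x)) (grad \<phi>)"
      unfolding l2_inner_def by (rule Bochner_Integration.integral_cong[OF refl]) (simp add: nemytskii_def indicator_def)
    also have "\<dots> = l2_inner (nemytskii U a (Gr v)) (grad \<phi>)"
      unfolding l2_inner_def
    proof (rule integral_cong_AE)
      show "(\<lambda>x. nemytskii U a (\<lambda>x. indicator U x *\<^sub>R weak_grad U v x) x \<bullet> grad \<phi> x) \<in> borel_measurable lebesgue"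
        "(\<lambda>x. nemytskii U a (Gr v) x \<bullet> grad \<phi> x) \<in> borel_measurable lebesgue"
        by (intro borel_measurable_inner nemytskii_measurable[OF coeff Us UD] sq_int_measurable wv Gr_sq_int v' test_sq_int(2)[OF \<phi>])+
      show "AE x in lebesgue. nemytskii U a (\<lambda>x. indicator U x *\<^sub>R weak_grad U v x) x \<bullet> grad \<phi> x = nemytskii U a (Gr v) x \<bullet> grad \<phi> x"
        using v'(4)
      proof eventually_elim
        fix x assume "x \<in> U \<longrightarrow> weak_grad U v x = Gr v x"
        then show "nemytskii U a (\<lambda>x. indicator U x *\<^sub>R weak_grad U v x) x \<bullet> grad \<phi> x = nemytskii U a (Gr v) x \<bullet> grad \<phi> x"
          by (cases "x \<in> U") (simp_all add: nemytskii_def)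
      qed
    qed
    also have "\<dots> = l2_inner (nemytskii U a (Gr u)) (grad \<phi>)" using v'(3) \<phi> by (simp add: agree_def)
    also have "\<dots> = l2_inner (nemytskii \<Omega> a (Gr u)) (grad \<phi>)" by (rule nemytskii_test[OF \<phi> U(2), symmetric])
    also have "\<dots> = (\<integral>x. a x (weak_grad \<Omega> u x) \<bullet> grad \<phi> x \<partial>lebesgue_on \<Omega>)"
      by (rule nemytskii_integral[OF sets_\<Omega> order_refl, symmetric])
    also have "\<dots> = (\<integral>x. F x \<bullet> grad \<phi> x \<partial>lebesgue_on \<Omega>) + (\<integral>x. f x * \<phi> x \<partial>lebesgue_on \<Omega>)"
      using u test_functions_mono[OF U(2)] \<phi> unfolding solves_def by blast
    also have "\<dots> = (\<integral>x. F x \<bullet> grad \<phi> x \<partial>lebesgue_on U) + (\<integral>x. f x * \<phi> x \<partial>lebesgue_on U)"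
      using z by (subst (1 2) res) auto
    finally show "(\<integral>x. a x (weak_grad U v x) \<bullet> grad \<phi> x \<partial>lebesgue_on U) =
      (\<integral>x. F x \<bullet> grad \<phi> x \<partial>lebesgue_on U) + (\<integral>x. f x * \<phi> x \<partial>lebesgue_on U)" .
  qed
qed

lemma Lp_norm_cong_AE:
  assumes "AE x in lebesgue. x \<in> U \<longrightarrow> norm (h x) = norm (k x)" shows "Lp_norm p U h = Lp_norm p U k"
proof -
  have "(\<integral>\<^sup>+x\<in>U. ennreal (norm (h x) powr p) \<partial>lebesgue) = (\<integral>\<^sup>+x\<in>U. ennreal (norm (k x) powr p) \<partial>lebesgue)"
    by (rule nn_integral_cong_AE) (use assms in \<open>eventually_elim, auto split: split_indicator\<close>)
  then show ?thesis by (simp add: Lp_norm_def)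
qed

lemma finite_Lp_Gr:
  assumes "w \<in> W12_0 \<Omega>" shows "(\<integral>\<^sup>+x. ennreal (norm (Gr w x) powr q) \<partial>lebesgue) < top"
proof -
  have "Lp_loc q UNIV (Gr w)" using q_bounds by (intro sq_int_Lp_loc[OF Gr_sq_int[OF assms]]) auto
  then have "Lp q (closed_cube m (3 * s)) (Gr w)" unfolding Lp_loc_def using compact_cbox by blast
  then have "(\<integral>\<^sup>+x\<in>closed_cube m (3 * s). ennreal (norm (Gr w x) powr q) \<partial>lebesgue) < top" by (simp add: Lp_def)
  also have "(\<integral>\<^sup>+x\<in>closed_cube m (3 * s). ennreal (norm (Gr w x) powr q) \<partial>lebesgue) = (\<integral>\<^sup>+x. ennreal (norm (Gr w x) powr q) \<partial>lebesgue)"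
  proof (rule nn_integral_cong)
    fix x show "ennreal (norm (Gr w x) powr q) * indicator (closed_cube m (3 * s)) x = ennreal (norm (Gr w x) powr q)"
      using box_subset_cbox[of "m - vec (3 * s / 2)" "m + vec (3 * s / 2)"]
      by (cases "x \<in> \<Omega>") (auto simp: \<Omega>_eq[symmetric] Gr_def[of w x])
  qed
  finally show ?thesis .
qed

lemma finite_Lp_Gr_on: "w \<in> W12_0 \<Omega> \<Longrightarrow> (\<integral>\<^sup>+x\<in>U. ennreal (norm (Gr w x) powr q) \<partial>lebesgue) < top"
  by (rule le_less_trans[OF _ finite_Lp_Gr]) (auto intro!: nn_integral_mono split: split_indicator)

text \<open>Localisation is bounded on gradients, since a(x, Gr w) is an admissible right-hand
  side for the local problem.\<close>

lemma local_solution_bound: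
  assumes P: "0 < r" and U: "U = smoothened O0 (open_cube c r)" "U \<subseteq> \<Omega>"
    and w: "w \<in> W12_0 \<Omega>" and v: "local_solution U u v" and vw: "agree U v w"
  shows "Lp_norm q U (Gr v) \<le> N_low O0 \<Omega> a q * ennreal \<Lambda> * Lp_norm q U (Gr w)"
proof -
  have oU: "open U" unfolding U by (rule smoothened_bounds(1)[OF cube_at_open_cube[OF P] O0])
  have U\<Omega>: "U = smoothened O0 (open_cube c r) \<inter> \<Omega>" using U by blast
  have vl: "local_solution U w v" using v vw unfolding local_solution_def by blast
  define H where "H = nemytskii \<Omega> a (Gr w)"
  have sH: "sq_int H" unfolding H_def by (rule nemytskii_sq_int[OF coeff sets_\<Omega> \<Omega>_sub Gr_sq_int[OF w] \<Lambda>_pos(2)])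
  have Hle: "norm (H x) \<le> \<Lambda> * norm (Gr w x)" for x
    using elliptic_coeffD(4)[OF coeff, of x "Gr w x"] \<Omega>_sub \<Lambda>_pos(2) unfolding H_def nemytskii_def
    by (cases "x \<in> \<Omega>") auto
  have int_le: "(\<integral>\<^sup>+x\<in>U. ennreal (norm (H x) powr q) \<partial>lebesgue) \<le>
      ennreal (\<Lambda> powr q) * (\<integral>\<^sup>+x\<in>U. ennreal (norm (Gr w x) powr q) \<partial>lebesgue)"
  proof -
    have "(\<integral>\<^sup>+x\<in>U. ennreal (norm (H x) powr q) \<partial>lebesgue) \<le>
      (\<integral>\<^sup>+x. ennreal (\<Lambda> powr q) * (ennreal (norm (Gr w x) powr q) * indicator U x) \<partial>lebesgue)"
    proof (rule nn_integral_mono)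
      fix x
      have "norm (H x) powr q \<le> \<Lambda> powr q * norm (Gr w x) powr q"
        using powr_mono2[of q "norm (H x)" "\<Lambda> * norm (Gr w x)"] Hle[of x] q_bounds \<Lambda>_pos by (simp add: powr_mult)
      then show "ennreal (norm (H x) powr q) * indicator U x \<le> ennreal (\<Lambda> powr q) * (ennreal (norm (Gr w x) powr q) * indicator U x)"
        by (cases "x \<in> U") (auto simp: ennreal_mult[symmetric] intro!: ennreal_leI)
    qed
    also have "\<dots> = ennreal (\<Lambda> powr q) * (\<integral>\<^sup>+x\<in>U. ennreal (norm (Gr w x) powr q) \<partial>lebesgue)"
    proof (rule nn_integral_cmult)
      have [measurable]: "Gr w \<in> borel_measurable lebesgue" "U \<in> sets lebesgue"
        using sq_int_measurable[OF Gr_sq_int[OF w]] oU by auto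
      show "(\<lambda>x. ennreal (norm (Gr w x) powr q) * indicator U x) \<in> borel_measurable lebesgue" by measurable
    qed
    finally show ?thesis .
  qed
  have sol: "solves \<Omega> a H (\<lambda>x. 0) w" unfolding solves_def
  proof (intro conjI ballI)
    show "Lp_loc 1 \<Omega> H" by (rule sq_int_Lp_loc_1[OF sH])
    show "Lp_loc 1 \<Omega> (\<lambda>x. 0 :: real)" by (rule sq_int_Lp_loc_1) simp
    show "w \<in> W12 \<Omega>" using w by (simp add: W12_0_def)
    fix \<phi> assume \<phi>: "\<phi> \<in> test_functions \<Omega>"
    have "(\<integral>x. a x (weak_grad \<Omega> w x) \<bullet> grad \<phi> x \<partial>lebesgue_on \<Omega>) = l2_inner H (grad \<phi>)"
      unfolding H_def by (rule nemytskii_integral[OF sets_\<Omega> order_refl])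
    also have "\<dots> = (\<integral>x. indicator \<Omega> x *\<^sub>R (H x \<bullet> grad \<phi> x) \<partial>lebesgue)"
      unfolding l2_inner_def by (rule Bochner_Integration.integral_cong[OF refl]) (simp add: H_def nemytskii_def indicator_def)
    also have "\<dots> = (\<integral>x. H x \<bullet> grad \<phi> x \<partial>lebesgue_on \<Omega>)" using sets_\<Omega> by (subst integral_restrict_space) auto
    finally show "(\<integral>x. a x (weak_grad \<Omega> w x) \<bullet> grad \<phi> x \<partial>lebesgue_on \<Omega>) =
      (\<integral>x. H x \<bullet> grad \<phi> x \<partial>lebesgue_on \<Omega>) + (\<integral>x. 0 * \<phi> x \<partial>lebesgue_on \<Omega>)" by simp
  qed
  have lf: "Lp_norm q U (Gr v) = Lp_norm q U (weak_grad U v)"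
    by (rule Lp_norm_cong_AE) (use v in \<open>auto simp: local_solution_def elim: AE_mp\<close>)
  have "Lp_norm q U (weak_grad U v) \<le>
     N_low O0 \<Omega> a q * (Lp_norm q U H + Lp_norm (lower_star TYPE('n) q) U (\<lambda>x. 0 :: real))"
  proof (rule lower_bound[OF P U\<Omega>])
    show "Lp_loc q \<Omega> H" using q_bounds by (intro sq_int_Lp_loc[OF sH]) auto
    show "Lp_loc (lower_star TYPE('n) q) \<Omega> (\<lambda>x. 0 :: real)" by (simp add: Lp_loc_def Lp_def)
    show "v \<in> W12_0 U" using v by (simp add: local_solution_def)
    show "solves U a H (\<lambda>x. 0) v" by (rule solves_local[OF oU U(2) sol vl])
    show "(\<integral>\<^sup>+x\<in>U. ennreal (norm (H x) powr q) \<partial>lebesgue) < top"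
      by (rule le_less_trans[OF int_le]) (use finite_Lp_Gr_on[OF w, of U] in \<open>simp add: ennreal_mult_less_top\<close>)
  qed simp_all
  also have "Lp_norm (lower_star TYPE('n) q) U (\<lambda>x. 0 :: real) = 0" by (simp add: Lp_norm_def)
  also have "Lp_norm q U H \<le> epowr (ennreal (\<Lambda> powr q) * (\<integral>\<^sup>+x\<in>U. ennreal (norm (Gr w x) powr q) \<partial>lebesgue)) (1 / q)"
    unfolding Lp_norm_def using q_bounds by (intro epowr_mono int_le) auto
  also have "\<dots> = ennreal \<Lambda> * Lp_norm q U (Gr w)"
    using q_bounds \<Lambda>_pos by (simp add: epowr_mult epowr_ennreal powr_powr Lp_norm_def)
  finally show ?thesis unfolding lf by (simp add: mult.assoc mult_left_mono)
qed

end

section \<open>Stopping cubes\<close>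

definition dyads :: "real^'n \<Rightarrow> real \<Rightarrow> (real^'n) set set" where
  "dyads m s = {dyad m s k x | k x. x \<in> dyad m s 0 m}"

text \<open>The maximal bad subcubes of Q.\<close>

definition stopping :: "(real^'n) set set \<Rightarrow> ((real^'n) set \<Rightarrow> bool) \<Rightarrow> (real^'n) set \<Rightarrow> (real^'n) set set" where
  "stopping \<D> bad Q = {P \<in> \<D>. P \<subseteq> Q \<and> bad P \<and> (\<forall>P'\<in>\<D>. P \<subset> P' \<longrightarrow> P' \<subseteq> Q \<longrightarrow> \<not> bad P')}"

lemma dyadsE:
  assumes "P \<in> dyads m s" obtains k x where "P = dyad m s k x" "x \<in> dyad m s 0 m"
  using assms by (auto simp: dyads_def)

lemma dyad_sub_root:
  assumes "x \<in> dyad m s 0 m" shows "dyad m s k x \<subseteq> dyad m s 0 m"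
  using dyad_mono[of 0 k m s x] dyad_eq[OF assms] by simp

lemma countable_dyads_set: "countable (dyads m s)"
  by (rule countable_subset[OF _ countable_dyads[of m s]]) (auto simp: dyads_def)

lemma dyads_nested_or_disjoint:
  assumes "P \<in> dyads m s" "P' \<in> dyads m s" "P \<inter> P' \<noteq> {}" shows "P \<subseteq> P' \<or> P' \<subseteq> P"
proof -
  obtain k x where P: "P = dyad m s k x" using assms(1) by (rule dyadsE)
  obtain j y where P': "P' = dyad m s j y" using assms(2) by (rule dyadsE)
  show ?thesis
  proof (cases "j \<le> k")
    case True then show ?thesis using dyad_nested[OF True, of m s x y] assms(3) P P' by auto
  next
    case False
    then show ?thesis using dyad_nested[of k j m s y x] assms(3) P P' by auto
  qed
qed

lemma dyad_root_center: "0 < s \<Longrightarrow> dyad_center m s 0 m = m"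
proof -
  have "\<lfloor>1 / 2 :: real\<rfloor> = 0" by linarith
  then show "0 < s \<Longrightarrow> dyad_center m s 0 m = m" by (simp add: dyad_center_def vec_eq_iff)
qed

lemma cube_at_root: "0 < s \<Longrightarrow> cube_at (dyad m s 0 m) m s"
  using cube_at_dyad[of s m 0 m] by (simp add: dyad_root_center)

lemma stopping_disjoint:
  assumes "P \<in> stopping (dyads m s) bad Q" "P' \<in> stopping (dyads m s) bad Q" "P \<noteq> P'"
  shows "P \<inter> P' = {}"
proof (rule ccontr)
  assume "P \<inter> P' \<noteq> {}"
  then have "P \<subset> P' \<or> P' \<subset> P" using dyads_nested_or_disjoint[of P m s P'] assms by (auto simp: stopping_def)
  then show False using assms unfolding stopping_def by blast
qed

text \<open>Only finitely many dyadic cubes lie above a given one, so a maximal bad cube exists.\<close>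

lemma stopping_covers:
  assumes P: "P \<in> dyads m s" "P \<subseteq> Q" "bad P"
  shows "\<exists>P'\<in>stopping (dyads m s) bad Q. P \<subseteq> P'"
proof -
  obtain k x where kx: "P = dyad m s k x" "x \<in> dyad m s 0 m" using P(1) by (rule dyadsE)
  define good where "good i \<longleftrightarrow> dyad m s i x \<subseteq> Q \<and> bad (dyad m s i x)" for i
  define i where "i = (LEAST i. good i)"
  have gk: "good k" using P kx by (simp add: good_def)
  have gi: "good i" unfolding i_def by (rule LeastI[of good, OF gk])
  have ik: "i \<le> k" unfolding i_def by (rule Least_le[of good, OF gk])
  have "dyad m s i x \<in> stopping (dyads m s) bad Q"
    unfolding stopping_def
  proof (intro CollectI conjI ballI impI notI)
    show "dyad m s i x \<in> dyads m s" using kx by (auto simp: dyads_def)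
    show "dyad m s i x \<subseteq> Q" "bad (dyad m s i x)" using gi by (auto simp: good_def)
    fix P' assume P': "P' \<in> dyads m s" "dyad m s i x \<subset> P'" "P' \<subseteq> Q" "bad P'"
    obtain j y where "P' = dyad m s j y" using P'(1) by (rule dyadsE)
    moreover have "x \<in> P'" using P'(2) dyad_self by blast
    ultimately have Pj: "P' = dyad m s j x" using dyad_eq by metis
    then have "good j" using P' by (simp add: good_def)
    then have "i \<le> j" unfolding i_def by (rule Least_le)
    then have "P' \<subseteq> dyad m s i x" unfolding Pj by (rule dyad_mono)
    then show False using P'(2) by blast
  qed
  moreover have "P \<subseteq> dyad m s i x" unfolding kx by (rule dyad_mono[OF ik])
  ultimately show ?thesis by blast
qed

lemma dyad_strict:
  assumes s: "0 < s" shows "dyad m s (Suc k) x \<subset> dyad m s k x"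
proof
  show "dyad m s (Suc k) x \<subseteq> dyad m s k x" by (rule dyad_mono) simp
  show "dyad m s (Suc k) x \<noteq> dyad m s k x"
  proof
    assume "dyad m s (Suc k) x = dyad m s k x"
    then have "s / 2 ^ Suc k = s / 2 ^ k"
      using cube_at_side[OF cube_at_dyad[OF s, of m "Suc k" x]] cube_at_side[OF cube_at_dyad[OF s, of m k x]] by metis
    then show False using s by (simp add: field_simps)
  qed
qed

text \<open>By maximality, applied to the dyadic parent, which still lies in Q.\<close>

lemma stopping_parent:
  assumes s: "0 < s" and Q: "Q \<in> dyads m s" "\<not> bad Q" and P: "P \<in> stopping (dyads m s) bad Q"
  obtains k x where "x \<in> dyad m s 0 m" "P = dyad m s (Suc k) x" "dyad m s k x \<subseteq> Q" "\<not> bad (dyad m s k x)"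
proof -
  have P': "P \<in> dyads m s" "P \<subseteq> Q" "bad P" using P by (auto simp: stopping_def)
  obtain k x where kx: "P = dyad m s k x" "x \<in> dyad m s 0 m" using P'(1) by (rule dyadsE)
  obtain j y where jy: "Q = dyad m s j y" using Q(1) by (rule dyadsE)
  have "x \<in> Q" using kx P'(2) dyad_self by blast
  then have Qj: "Q = dyad m s j x" unfolding jy using dyad_eq by metis
  have "j < k"
  proof (rule ccontr)
    assume "\<not> j < k"
    then have "Q \<subseteq> P" unfolding Qj kx by (intro dyad_mono) simp
    then show False using P' Q by auto
  qed
  then obtain k' where k': "k = Suc k'" "j \<le> k'" by (cases k) auto
  have sub: "dyad m s k' x \<subseteq> Q" unfolding Qj by (rule dyad_mono[OF k'(2)])
  have "dyad m s k' x \<in> dyads m s" using kx by (auto simp: dyads_def)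
  moreover have "P \<subset> dyad m s k' x" unfolding kx k' by (rule dyad_strict[OF s])
  ultimately have "\<not> bad (dyad m s k' x)" using P sub unfolding stopping_def by blast
  then show ?thesis using that kx k' sub by blast
qed

lemma nn_integral_count_space_disjoint:
  assumes "P0 \<in> C" "x \<in> P0" "\<And>P. P \<in> C \<Longrightarrow> P \<noteq> P0 \<Longrightarrow> x \<notin> P"
  shows "(\<integral>\<^sup>+P. \<phi> P * indicator P x \<partial>count_space C) = \<phi> P0"
proof -
  have "(\<integral>\<^sup>+P. \<phi> P * indicator P x \<partial>count_space C) = (\<integral>\<^sup>+P. \<phi> P0 * indicator {P0} P \<partial>count_space C)"
    using assms by (intro nn_integral_cong) (auto simp: indicator_def)
  also have "\<dots> = \<phi> P0 * emeasure (count_space C) {P0}" using assms(1) by (intro nn_integral_cmult_indicator) simp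
  also have "\<dots> = \<phi> P0" using assms(1) by (subst emeasure_count_space_finite) auto
  finally show ?thesis .
qed

text \<open>Replacing g by its average with exponent p on each of the disjoint cubes keeps the p-norm over Q.
  Hoelder's inequality then bounds the left-hand side, which is the integral of the new function.\<close>

lemma stopping_packing:
  fixes g :: "real^'n \<Rightarrow> real"
  assumes C: "countable C" "\<And>P. P \<in> C \<Longrightarrow> P \<in> sets lebesgue" "\<And>P. P \<in> C \<Longrightarrow> P \<subseteq> Q"
      "\<And>P. P \<in> C \<Longrightarrow> 0 < vol P" "\<And>P P'. P \<in> C \<Longrightarrow> P' \<in> C \<Longrightarrow> P \<noteq> P' \<Longrightarrow> P \<inter> P' = {}"
    and Q: "Q \<in> sets lebesgue" "0 < vol Q" "vol Q < top"
    and g: "g \<in> borel_measurable lebesgue" and p: "1 < p"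
  shows "(\<integral>\<^sup>+x\<in>Q - \<Union>C. ennreal \<bar>g x\<bar> \<partial>lebesgue) + (\<integral>\<^sup>+P. vol P * avg P p g \<partial>count_space C)
    \<le> vol Q * avg Q p g"
proof -
  define R where "R = Q - \<Union>C"
  have Us: "\<Union>C \<in> sets lebesgue" using C by (intro sets.countable_Union) auto
  have Rs: "R \<in> sets lebesgue" unfolding R_def using Q Us by auto
  have Pfin: "vol P < top" if "P \<in> C" for P
    using emeasure_mono[OF C(3)[OF that] Q(1)] Q(3) by (rule le_less_trans)
  \<comment> \<open>On each cube, G is the average of g with exponent p; elsewhere in Q it is |g|.  So the p-th powers of G and |g| have equal integrals over Q.\<close>
  define G where "G x = (\<integral>\<^sup>+P. avg P p g * indicator P x \<partial>count_space C) + ennreal \<bar>g x\<bar> * indicator R x" for x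
  have sum_m: "(\<lambda>x. \<integral>\<^sup>+P. \<phi> P * indicator P x \<partial>count_space C) \<in> borel_measurable lebesgue" for \<phi> :: "(real^'n) set \<Rightarrow> ennreal"
  proof (rule sigma_finite_measure.borel_measurable_nn_integral[OF sigma_finite_measure_count_space_countable[OF C(1)]])
    have "(\<lambda>z. \<phi> P * indicator P (fst z)) \<in> borel_measurable (lebesgue \<Otimes>\<^sub>M count_space C)" if "P \<in> C" for P
      by (rule measurable_compose[OF measurable_fst, of "\<lambda>x. \<phi> P * indicator P x"]) (use C(2)[OF that] in simp)
    then have "(\<lambda>z. (\<lambda>P z. \<phi> P * indicator P (fst z)) (snd z) z) \<in> borel_measurable (lebesgue \<Otimes>\<^sub>M count_space C)"
      by (rule measurable_compose_countable'[OF _ measurable_snd C(1)])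
    then show "(\<lambda>(x, P). \<phi> P * indicator P x) \<in> borel_measurable (lebesgue \<Otimes>\<^sub>M count_space C)"
      by (simp add: case_prod_beta')
  qed
  have sum_i: "(\<integral>\<^sup>+x. (\<integral>\<^sup>+P. \<phi> P * indicator P x \<partial>count_space C) \<partial>lebesgue) =
      (\<integral>\<^sup>+P. \<phi> P * vol P \<partial>count_space C)" for \<phi> :: "(real^'n) set \<Rightarrow> ennreal"
  proof -
    have "(\<integral>\<^sup>+x. (\<integral>\<^sup>+P. \<phi> P * indicator P x \<partial>count_space C) \<partial>lebesgue) =
      (\<integral>\<^sup>+P. (\<integral>\<^sup>+x. \<phi> P * indicator P x \<partial>lebesgue) \<partial>count_space C)"
      by (rule nn_integral_count_space_nn_integral[OF C(1)]) (use C(2) in auto)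
    also have "\<dots> = (\<integral>\<^sup>+P. \<phi> P * vol P \<partial>count_space C)"
      using C(2) by (intro nn_integral_cong) (simp add: nn_integral_cmult_indicator)
    finally show ?thesis .
  qed
  have [measurable]: "R \<in> sets lebesgue" "g \<in> borel_measurable lebesgue" by fact+
  have gR: "(\<lambda>x. ennreal (\<bar>g x\<bar> powr r) * indicator R x) \<in> borel_measurable lebesgue" for r using g Rs by measurable
  have gR1: "(\<lambda>x. ennreal \<bar>g x\<bar> * indicator R x) \<in> borel_measurable lebesgue" using g Rs by measurable
  have Gm: "G \<in> borel_measurable lebesgue" unfolding G_def[abs_def] by (rule borel_measurable_add[OF sum_m gR1])
  have inP: "G x = avg P p g" if "P \<in> C" "x \<in> P" for x P
  proof -
    have "(\<integral>\<^sup>+P. avg P p g * indicator P x \<partial>count_space C) = avg P p g"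
      by (rule nn_integral_count_space_disjoint) (use that C(5) in auto)
    moreover have "x \<notin> R" using that by (auto simp: R_def)
    ultimately show ?thesis by (simp add: G_def)
  qed
  have outP: "(\<integral>\<^sup>+P. \<phi> P * indicator P x \<partial>count_space C) = 0" if "x \<notin> \<Union>C" for x and \<phi> :: "(real^'n) set \<Rightarrow> ennreal"
  proof -
    have "(\<integral>\<^sup>+P. \<phi> P * indicator P x \<partial>count_space C) = (\<integral>\<^sup>+P. 0 \<partial>count_space C)"
      using that by (intro nn_integral_cong) (auto simp: indicator_def)
    then show ?thesis by simp
  qed
  have G0: "G x = 0" if "x \<notin> Q" for x
    using that C(3) outP[of x "\<lambda>P. avg P p g"] by (auto simp: G_def R_def)
  have L: "(\<integral>\<^sup>+x. G x \<partial>lebesgue) = (\<integral>\<^sup>+P. vol P * avg P p g \<partial>count_space C) + (\<integral>\<^sup>+x\<in>R. ennreal \<bar>g x\<bar> \<partial>lebesgue)"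
    unfolding G_def nn_integral_add[OF sum_m gR1] sum_i by (simp add: mult.commute)
  have Gp: "epowr (G x) p = (\<integral>\<^sup>+P. epowr (avg P p g) p * indicator P x \<partial>count_space C) + ennreal (\<bar>g x\<bar> powr p) * indicator R x" for x
  proof (cases "x \<in> \<Union>C")
    case True
    then obtain P where P: "P \<in> C" "x \<in> P" by blast
    have "(\<integral>\<^sup>+P. epowr (avg P p g) p * indicator P x \<partial>count_space C) = epowr (avg P p g) p"
      by (rule nn_integral_count_space_disjoint) (use P C(5) in auto)
    moreover have "x \<notin> R" using P by (auto simp: R_def)
    ultimately show ?thesis by (simp add: inP[OF P])
  next
    case False
    then show ?thesis unfolding G_def outP[OF False] by (simp add: epowr_ennreal indicator_def)
  qed
  have Pp: "epowr (avg P p g) p * vol P = (\<integral>\<^sup>+x\<in>P. ennreal (\<bar>g x\<bar> powr p) \<partial>lebesgue)" if P: "P \<in> C" for P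
  proof -
    obtain e where e: "vol P = ennreal e" "0 < e"
      using C(4)[OF P] Pfin[OF P] by (cases "vol P") auto
    show ?thesis using p unfolding avg_epowr[OF less_trans[OF zero_less_one p]] e(1)
      by (subst mult.commute) (rule ennreal_cancel[OF e(2)])
  qed
  have "(\<integral>\<^sup>+x. epowr (G x) p \<partial>lebesgue) = (\<integral>\<^sup>+P. (\<integral>\<^sup>+x\<in>P. ennreal (\<bar>g x\<bar> powr p) \<partial>lebesgue) \<partial>count_space C) +
      (\<integral>\<^sup>+x\<in>R. ennreal (\<bar>g x\<bar> powr p) \<partial>lebesgue)"
    unfolding Gp nn_integral_add[OF sum_m gR] sum_i using Pp
    by (intro arg_cong2[of _ _ _ _ "(+)"] nn_integral_cong) auto
  also have "(\<integral>\<^sup>+P. (\<integral>\<^sup>+x\<in>P. ennreal (\<bar>g x\<bar> powr p) \<partial>lebesgue) \<partial>count_space C) =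
      (\<integral>\<^sup>+x\<in>\<Union>C. ennreal (\<bar>g x\<bar> powr p) \<partial>lebesgue)"
  proof -
    have "(\<integral>\<^sup>+P. (\<integral>\<^sup>+x\<in>P. ennreal (\<bar>g x\<bar> powr p) \<partial>lebesgue) \<partial>count_space C) =
      (\<integral>\<^sup>+P. emeasure (density lebesgue (\<lambda>x. ennreal (\<bar>g x\<bar> powr p))) P \<partial>count_space C)"
      using C(2) g by (intro nn_integral_cong) (auto simp: emeasure_density)
    also have "\<dots> = emeasure (density lebesgue (\<lambda>x. ennreal (\<bar>g x\<bar> powr p))) (\<Union>P\<in>C. P)"
      by (rule emeasure_UN_countable[symmetric]) (use C in \<open>auto simp: disjoint_family_on_def\<close>)
    also have "\<dots> = (\<integral>\<^sup>+x\<in>\<Union>C. ennreal (\<bar>g x\<bar> powr p) \<partial>lebesgue)"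
      using Us g by (subst emeasure_density) auto
    finally show ?thesis .
  qed
  also have "(\<integral>\<^sup>+x\<in>\<Union>C. ennreal (\<bar>g x\<bar> powr p) \<partial>lebesgue) + (\<integral>\<^sup>+x\<in>R. ennreal (\<bar>g x\<bar> powr p) \<partial>lebesgue) =
     (\<integral>\<^sup>+x\<in>Q. ennreal (\<bar>g x\<bar> powr p) \<partial>lebesgue)"
  proof -
    have [measurable]: "\<Union>C \<in> sets lebesgue" "g \<in> borel_measurable lebesgue" by fact+
    have "(\<integral>\<^sup>+x\<in>\<Union>C. ennreal (\<bar>g x\<bar> powr p) \<partial>lebesgue) + (\<integral>\<^sup>+x\<in>R. ennreal (\<bar>g x\<bar> powr p) \<partial>lebesgue) =
      (\<integral>\<^sup>+x. ennreal (\<bar>g x\<bar> powr p) * indicator (\<Union>C) x + ennreal (\<bar>g x\<bar> powr p) * indicator R x \<partial>lebesgue)"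
      by (rule nn_integral_add[symmetric, OF _ gR]) measurable
    also have "\<dots> = (\<integral>\<^sup>+x\<in>Q. ennreal (\<bar>g x\<bar> powr p) \<partial>lebesgue)"
    proof (rule nn_integral_cong)
      fix x show "ennreal (\<bar>g x\<bar> powr p) * indicator (\<Union>C) x + ennreal (\<bar>g x\<bar> powr p) * indicator R x = ennreal (\<bar>g x\<bar> powr p) * indicator Q x"
        using C(3) by (cases "x \<in> \<Union>C") (auto simp: R_def indicator_def)
    qed
    finally show ?thesis .
  qed
  finally have Gpi: "(\<integral>\<^sup>+x. epowr (G x) p \<partial>lebesgue) = (\<integral>\<^sup>+x\<in>Q. ennreal (\<bar>g x\<bar> powr p) \<partial>lebesgue)" .
  define p' where "p' = p / (p - 1)"
  have p': "1 < p'" "1 / p + 1 / p' = 1" using p by (auto simp: p'_def divide_simps)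
  obtain e where e: "vol Q = ennreal e" "0 < e" using Q by (cases "vol Q") auto
  have "(\<integral>\<^sup>+x. G x \<partial>lebesgue) = (\<integral>\<^sup>+x. G x * indicator Q x \<partial>lebesgue)"
    using G0 by (intro nn_integral_cong) (auto simp: indicator_def)
  also have "\<dots> \<le> epowr (\<integral>\<^sup>+x. epowr (G x) p \<partial>lebesgue) (1 / p) * epowr (\<integral>\<^sup>+x. epowr (indicator Q x) p' \<partial>lebesgue) (1 / p')"
    by (rule nn_integral_Hoelder[OF Gm _ p p']) (use Q in simp)
  also have "(\<integral>\<^sup>+x. epowr (indicator Q x) p' \<partial>lebesgue) = ennreal e"
  proof -
    have "epowr 1 p' = 1" by (simp add: epowr_def)
    then have "(\<integral>\<^sup>+x. epowr (indicator Q x) p' \<partial>lebesgue) = (\<integral>\<^sup>+x. indicator Q x \<partial>lebesgue)"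
      by (intro nn_integral_cong) (simp add: indicator_def)
    then show ?thesis using Q e by simp
  qed
  also have "epowr (\<integral>\<^sup>+x. epowr (G x) p \<partial>lebesgue) (1 / p) * epowr (ennreal e) (1 / p') = ennreal e * avg Q p g"
  proof -
    have 1: "epowr (\<integral>\<^sup>+x\<in>Q. ennreal (\<bar>g x\<bar> powr p) \<partial>lebesgue) (1 / p) = ennreal (e powr (1 / p)) * avg Q p g"
      unfolding avg_def e(1) epowr_divide[OF e(2)] using e(2) by (simp add: ennreal_cancel)
    have "e powr (1 / p') * e powr (1 / p) = e" using e(2) p'(2) by (simp add: powr_add[symmetric] add.commute)
    then have "ennreal (e powr (1 / p')) * ennreal (e powr (1 / p)) = ennreal e" by (metis ennreal_mult powr_ge_zero)
    moreover have "epowr (ennreal e) (1 / p') = ennreal (e powr (1 / p'))" using e(2) by (simp add: epowr_ennreal)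
    ultimately have "ennreal e * avg Q p g = epowr (ennreal e) (1 / p') * ennreal (e powr (1 / p)) * avg Q p g" by simp
    then show ?thesis unfolding Gpi 1 by (simp only: mult_ac)
  qed
  finally show ?thesis unfolding L e(1)[symmetric] R_def by (simp add: add.commute)
qed

lemma avg_1_cube_subset:
  fixes h :: "real^'n \<Rightarrow> real"
  assumes P: "cube_at P c r" and P': "cube_at P' c' r'"
    and near: "\<And>i. \<bar>c $ i - c' $ i\<bar> \<le> (r' - r) / 2"
  shows "avg P 1 h \<le> ennreal ((r' / r) ^ CARD('n)) * avg P' 1 h"
proof -
  have r: "0 < r" "0 < r'" using P P' by (auto simp: cube_at_def)
  have e: "vol (open_cube c r) = ennreal (r ^ CARD('n))" "vol (open_cube c' r') = ennreal (r' ^ CARD('n))"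
    using cube_at_emeasure[OF cube_at_open_cube[OF r(1)]] cube_at_emeasure[OF cube_at_open_cube[OF r(2)]] by simp_all
  have sub: "open_cube c r \<subseteq> open_cube c' r'" by (rule open_cube_mono(1)[OF near])
  have le: "(\<integral>\<^sup>+x\<in>open_cube c r. ennreal \<bar>h x\<bar> \<partial>lebesgue) \<le> (\<integral>\<^sup>+x\<in>open_cube c' r'. ennreal \<bar>h x\<bar> \<partial>lebesgue)"
    using sub by (intro nn_integral_mono mult_left_mono) (auto simp: indicator_def)
  have rn: "0 < r ^ CARD('n)" "0 < r' ^ CARD('n)" using r by auto
  have "avg P 1 h = avg (open_cube c r) 1 h" by (rule cube_at_avg[OF P])
  also have "\<dots> = (\<integral>\<^sup>+x\<in>open_cube c r. ennreal \<bar>h x\<bar> \<partial>lebesgue) / ennreal (r ^ CARD('n))"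
    unfolding avg_1_eq e ..
  also have "\<dots> \<le> (\<integral>\<^sup>+x\<in>open_cube c' r'. ennreal \<bar>h x\<bar> \<partial>lebesgue) / ennreal (r ^ CARD('n))"
    by (rule divide_right_mono_ennreal[OF le])
  also have "(\<integral>\<^sup>+x\<in>open_cube c' r'. ennreal \<bar>h x\<bar> \<partial>lebesgue) = ennreal (r' ^ CARD('n)) * avg P' 1 h"
  proof -
    have "avg P' 1 h = avg (open_cube c' r') 1 h" by (rule cube_at_avg[OF P'])
    also have "ennreal (r' ^ CARD('n)) * \<dots> = (\<integral>\<^sup>+x\<in>open_cube c' r'. ennreal \<bar>h x\<bar> \<partial>lebesgue)"
      unfolding avg_1_eq e by (rule ennreal_cancel[OF rn(2)])
    finally show ?thesis ..
  qed
  also have "ennreal (r' ^ CARD('n)) * avg P' 1 h / ennreal (r ^ CARD('n)) = ennreal ((r' / r) ^ CARD('n)) * avg P' 1 h"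
  proof -
    have "ennreal ((r' / r) ^ CARD('n)) = ennreal (r' ^ CARD('n)) / ennreal (r ^ CARD('n))"
      using rn by (simp add: power_divide divide_ennreal)
    then show ?thesis by (simp only: divide_ennreal_def mult_ac)
  qed
  finally show ?thesis .
qed

lemma avg_eq_epowr_avg_1:
  "avg P p h = epowr (avg P 1 (\<lambda>x. \<bar>h x\<bar> powr p)) (1 / p)"
  by (simp add: avg_def)

lemma avg_cube_subset:
  fixes h :: "real^'n \<Rightarrow> real"
  assumes "cube_at P c r" "cube_at P' c' r'" "\<And>i. \<bar>c $ i - c' $ i\<bar> \<le> (r' - r) / 2" and p: "0 < p"
  shows "avg P p h \<le> ennreal ((r' / r) powr (CARD('n) / p)) * avg P' p h"
proof -
  have r: "0 < r" "0 < r'" using assms by (auto simp: cube_at_def)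
  have "avg P p h \<le> epowr (ennreal ((r' / r) ^ CARD('n)) * avg P' 1 (\<lambda>x. \<bar>h x\<bar> powr p)) (1 / p)"
    unfolding avg_eq_epowr_avg_1[of P p h] using p
    by (intro epowr_mono avg_1_cube_subset[OF assms(1-3)]) auto
  also have "\<dots> = ennreal ((r' / r) powr (CARD('n) / p)) * avg P' p h"
    using r by (simp add: epowr_mult epowr_ennreal avg_eq_epowr_avg_1[of P' p] powr_realpow[symmetric] powr_powr)
  finally show ?thesis .
qed

section \<open>The stopping cubes of the local solutions\<close>

lemma avg_finite:
  assumes E: "0 < vol E" and fin: "(\<integral>\<^sup>+x\<in>E. ennreal (\<bar>h x\<bar> powr p) \<partial>lebesgue) < top"
  shows "avg E p h < top"
  using assms by (simp add: avg_def less_top[symmetric] ennreal_divide_eq_top_iff zero_less_iff_neq_zero)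

lemma avg_1_add:
  assumes "E \<in> sets lebesgue" "a \<in> borel_measurable lebesgue" "b \<in> borel_measurable lebesgue"
  shows "avg E 1 (\<lambda>y. norm (a y - b y)) \<le> avg E 1 (\<lambda>y. norm (a y)) + avg E 1 (\<lambda>y. norm (b y :: real^'n))"
  using assms by (intro avg_1_triangle) (auto simp: norm_triangle_ineq4)

text \<open>The norms of F and f over all of \<Omega> are finite, so that roots of the maximal functions of the data
  are integrable.\<close>

locale sparse_setting = elliptic_setting O0 Q0 \<Omega> a lam \<Lambda> q s m
  for O0 Q0 \<Omega> :: "(real^'n) set" and a :: "real^'n \<Rightarrow> real^'n \<Rightarrow> real^'n"
    and lam \<Lambda> q s :: real and m :: "real^'n" +
  fixes u f g :: "real^'n \<Rightarrow> real" and F :: "real^'n \<Rightarrow> real^'n" and qh \<theta> q' :: real and A B :: ennreal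
  assumes u: "u \<in> W12_0 \<Omega>" and sol: "solves \<Omega> a F f u"
    and q'_def: "q' = lower_star TYPE('n) q"
    and F: "Lp_loc q \<Omega> F" "(\<integral>\<^sup>+x\<in>\<Omega>. ennreal (norm (F x) powr q) \<partial>lebesgue) < top"
    and f: "Lp_loc q' \<Omega> f" "(\<integral>\<^sup>+x\<in>\<Omega>. ennreal (\<bar>f x\<bar> powr q') \<partial>lebesgue) < top"
      "q' \<le> 1 \<Longrightarrow> AE x in lebesgue_on \<Omega>. f x = 0"
    and qh: "2 < qh" and \<theta>: "0 < \<theta>" "\<theta> < 1"
    and g: "g \<in> borel_measurable lebesgue"
    and A_def: "A = N_low O0 \<Omega> a q" and B_def: "B = N_high_loc O0 \<Omega> a qh"
begin

abbreviation "T \<equiv> dyad m s 0 m"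
abbreviation "\<D> \<equiv> dyads m s"

text \<open>At the root T, the local problem is the given problem in \<Omega>, which is larger than the
  smoothened cube.\<close>

definition loc_dom :: "(real^'n) set \<Rightarrow> (real^'n) set" where
  "loc_dom Q = (if Q = T then \<Omega> else smoothened O0 Q)"

definition loc_sol :: "(real^'n) set \<Rightarrow> real^'n \<Rightarrow> real" where
  "loc_sol Q = (if Q = T then u else SOME v. local_solution (smoothened O0 Q) u v)"

definition loc_grad :: "(real^'n) set \<Rightarrow> real^'n \<Rightarrow> real" where
  "loc_grad Q x = norm (Gr (loc_sol Q) x)"

definition weak_const :: real where "weak_const = enn2real (maximal_weak_norm Q0)"

definition energy :: "(real^'n) set \<Rightarrow> real" where
  "energy Q = enn2real (\<integral>\<^sup>+x. ennreal (loc_grad Q x powr q) \<partial>lebesgue)"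

text \<open>The threshold for which the weak type inequality bounds the superlevel set of the maximal function
  of \<open>|\<nabla>v\<^sub>Q|\<^sup>q\<close> by \<theta> |Q|.\<close>

definition level :: "(real^'n) set \<Rightarrow> real" where
  "level Q = weak_const * energy Q / (\<theta> * measure lebesgue Q)"

definition bad :: "(real^'n) set \<Rightarrow> (real^'n) set \<Rightarrow> bool" where
  "bad Q P \<longleftrightarrow> ennreal (level Q) < avg (dilate 3 P) 1 (\<lambda>x. loc_grad Q x powr q)"

definition children :: "(real^'n) set \<Rightarrow> (real^'n) set set" where
  "children Q = stopping \<D> (bad Q) Q"

lemma \<D>_cube:
  assumes "P \<in> \<D>"
  obtains k x where "x \<in> T" "P = dyad m s k x" "cube_at P (center P) (side P)" "side P = s / 2 ^ k"
proof -
  obtain k x where kx: "P = dyad m s k x" "x \<in> T" using assms by (rule dyadsE)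
  have c: "cube_at P (dyad_center m s k x) (s / 2 ^ k)" unfolding kx by (rule cube_at_dyad[OF s_pos])
  then have "center P = dyad_center m s k x" "side P = s / 2 ^ k" by (rule cube_at_center, rule cube_at_side)
  then show ?thesis using that kx c by metis
qed

lemma \<D>_cube_at: "P \<in> \<D> \<Longrightarrow> cube_at P (center P) (side P)"
  by (elim \<D>_cube)

lemma \<D>_side_pos: "P \<in> \<D> \<Longrightarrow> 0 < side P"
  using \<D>_cube_at by (auto simp: cube_at_def)

lemma \<D>_sets: "P \<in> \<D> \<Longrightarrow> P \<in> sets lebesgue"
  by (rule cube_at_sets[OF \<D>_cube_at])

lemma \<D>_emeasure_pos: "P \<in> \<D> \<Longrightarrow> 0 < vol P" "P \<in> \<D> \<Longrightarrow> vol P < top"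
  using cube_at_emeasure_pos[OF \<D>_cube_at] by auto

lemma T_cube: "cube_at T m s" by (rule cube_at_root[OF s_pos])

lemma T_in_\<D>: "T \<in> \<D>"
proof -
  have "m \<in> T" by simp
  then show ?thesis unfolding dyads_def by blast
qed

lemma \<D>_sub_T: "P \<in> \<D> \<Longrightarrow> P \<subseteq> T"
  by (elim dyadsE) (auto dest: subsetD[OF dyad_sub_root])

lemma \<D>_near_m: "P \<in> \<D> \<Longrightarrow> \<bar>center P $ i - m $ i\<bar> \<le> (s - side P) / 2"
  by (rule cube_at_subset_centers[OF \<D>_cube_at T_cube \<D>_sub_T])

lemma dilate_3_open: "P \<in> \<D> \<Longrightarrow> open_cube (center P) (3 * side P) \<subseteq> \<Omega>"
  unfolding \<Omega>_eq
proof (rule open_cube_mono(1))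
  fix i assume P: "P \<in> \<D>"
  show "\<bar>center P $ i - m $ i\<bar> \<le> (3 * s - 3 * side P) / 2"
  proof -
    have "\<bar>center P $ i - m $ i\<bar> \<le> (s - side P) / 2" by (rule \<D>_near_m[OF P])
    moreover from this have "0 \<le> (s - side P) / 2" by (rule order_trans[OF abs_ge_zero])
    ultimately show ?thesis by (simp add: field_simps)
  qed
qed

lemma dilate_2_sub: "P \<in> \<D> \<Longrightarrow> dilate 2 P \<subseteq> \<Omega>"
proof -
  assume P: "P \<in> \<D>"
  have "dilate 2 P \<subseteq> closed_cube (center P) (2 * side P)"
    using cube_at_dilate[OF \<D>_cube_at[OF P], of 2] by (simp add: cube_at_def)
  also have "\<dots> \<subseteq> open_cube (center P) (3 * side P)"
  proof
    fix x assume x: "x \<in> closed_cube (center P) (2 * side P)"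
    show "x \<in> open_cube (center P) (3 * side P)" unfolding mem_open_cube
    proof
      fix i
      have "center P $ i - 2 * side P / 2 \<le> x $ i \<and> x $ i \<le> center P $ i + 2 * side P / 2"
        using x unfolding mem_closed_cube by blast
      then show "center P $ i - 3 * side P / 2 < x $ i \<and> x $ i < center P $ i + 3 * side P / 2"
        using \<D>_side_pos[OF P] by linarith
    qed
  qed
  also have "\<dots> \<subseteq> \<Omega>" by (rule dilate_3_open[OF P])
  finally show ?thesis .
qed

lemma smoothened_sub:
  assumes "P \<in> \<D>"
  shows "open (smoothened O0 P)" "smoothened O0 P \<subseteq> open_cube (center P) (3 * side P)"
    "open_cube (center P) (299 / 100 * side P) \<subseteq> smoothened O0 P" "smoothened O0 P \<subseteq> \<Omega>"
  using smoothened_bounds[OF \<D>_cube_at[OF assms] O0] dilate_3_open[OF assms] by auto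

lemma smoothened_open_cube: "P \<in> \<D> \<Longrightarrow> smoothened O0 P = smoothened O0 (open_cube (center P) (side P))"
  using smoothened_eq[OF \<D>_cube_at, of P O0] smoothened_eq[OF cube_at_open_cube[OF \<D>_side_pos], of P O0 "center P"] by simp

lemma loc_dom_sub:
  assumes "P \<in> \<D>" shows "open (loc_dom P)" "loc_dom P \<subseteq> \<Omega>" "loc_dom P \<subseteq> open_cube (center P) (3 * side P)"
proof -
  have "open (loc_dom P) \<and> loc_dom P \<subseteq> \<Omega> \<and> loc_dom P \<subseteq> open_cube (center P) (3 * side P)"
  proof (cases "P = T")
    case True
    have "\<Omega> = open_cube (center T) (3 * side T)"
      unfolding cube_at_center[OF T_cube] cube_at_side[OF T_cube] by (rule \<Omega>_eq)
    then show ?thesis using True open_\<Omega> unfolding loc_dom_def by simp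
  next
    case False
    then show ?thesis using smoothened_sub[OF assms] unfolding loc_dom_def by simp
  qed
  then show "open (loc_dom P)" "loc_dom P \<subseteq> \<Omega>" "loc_dom P \<subseteq> open_cube (center P) (3 * side P)" by blast+
qed

lemma strict_sub_side:
  assumes P: "P \<in> \<D>" and Q: "Q \<in> \<D>" and PQ: "P \<subset> Q" shows "2 * side P \<le> side Q"
proof -
  obtain k x where kx: "x \<in> T" "P = dyad m s k x" "side P = s / 2 ^ k" using P by (rule \<D>_cube)
  obtain j y where jy: "y \<in> T" "Q = dyad m s j y" "side Q = s / 2 ^ j" using Q by (rule \<D>_cube)
  have "x \<in> Q" using kx PQ by (metis dyad_self psubsetE subsetD)
  then have Qj: "Q = dyad m s j x" unfolding jy using dyad_eq by metis
  have "j < k"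
  proof (rule ccontr)
    assume "\<not> j < k"
    then have "Q \<subseteq> P" unfolding Qj kx by (intro dyad_mono) simp
    then show False using PQ by blast
  qed
  then have "(2::real) * 2 ^ j \<le> 2 ^ k" using power_increasing[of "Suc j" k "2::real"] by simp
  then show ?thesis using s_pos by (simp add: kx(3) jy(3) field_simps mult_left_mono)
qed

text \<open>A proper dyadic subcube has at most half the side length, so its triple fits into the dilate by
  299/100, which the smoothened cube contains.\<close>

lemma loc_dom_nested:
  assumes P: "P \<in> \<D>" and Q: "Q \<in> \<D>" and PQ: "P \<subset> Q" shows "loc_dom P \<subseteq> loc_dom Q"
proof (cases "Q = T")
  case True
  then show ?thesis using loc_dom_sub(2)[OF P] by (simp add: loc_dom_def)
next
  case False
  have "loc_dom P \<subseteq> open_cube (center P) (3 * side P)" by (rule loc_dom_sub(3)[OF P])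
  also have "\<dots> \<subseteq> open_cube (center Q) (299 / 100 * side Q)"
  proof (rule open_cube_mono(1))
    fix i
    have "\<bar>center P $ i - center Q $ i\<bar> \<le> (side Q - side P) / 2"
      by (rule cube_at_subset_centers[OF \<D>_cube_at[OF P] \<D>_cube_at[OF Q]]) (use PQ in blast)
    then show "\<bar>center P $ i - center Q $ i\<bar> \<le> (299 / 100 * side Q - 3 * side P) / 2"
      using strict_sub_side[OF P Q PQ] \<D>_side_pos[OF Q] by (simp add: field_simps)
  qed
  also have "\<dots> \<subseteq> smoothened O0 Q" by (rule smoothened_sub(3)[OF Q])
  also have "\<dots> = loc_dom Q" using False by (simp add: loc_dom_def)
  finally show ?thesis .
qed

lemma loc_sol_local: "P \<in> \<D> \<Longrightarrow> P \<noteq> T \<Longrightarrow> local_solution (smoothened O0 P) u (loc_sol P)"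
  using someI_ex[OF local_solution_exists[OF smoothened_sub(1,4) u, of P]] by (simp add: loc_sol_def)

lemma loc_sol_facts:
  assumes "P \<in> \<D>"
  shows "loc_sol P \<in> W12_0 \<Omega>" "agree (loc_dom P) (loc_sol P) u" "AE x in lebesgue. x \<notin> loc_dom P \<longrightarrow> Gr (loc_sol P) x = 0"
proof -
  show "loc_sol P \<in> W12_0 \<Omega>"
    using loc_sol_local[OF assms] u by (cases "P = T") (auto simp: local_solution_def loc_sol_def[of T])
  show "agree (loc_dom P) (loc_sol P) u"
    using loc_sol_local[OF assms] by (cases "P = T") (auto simp: local_solution_def agree_def loc_sol_def[of T] loc_dom_def)
  show "AE x in lebesgue. x \<notin> loc_dom P \<longrightarrow> Gr (loc_sol P) x = 0"
    using loc_sol_local[OF assms] by (cases "P = T") (auto simp: local_solution_def loc_dom_def Gr_def)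
qed

lemma loc_sol_measurable: "P \<in> \<D> \<Longrightarrow> Gr (loc_sol P) \<in> borel_measurable lebesgue"
  using sq_int_measurable[OF Gr_sq_int[OF loc_sol_facts(1)]] .

lemma loc_grad_measurable: "P \<in> \<D> \<Longrightarrow> loc_grad P \<in> borel_measurable lebesgue"
  unfolding loc_grad_def[abs_def] using loc_sol_measurable by simp

lemma loc_grad_finite: "P \<in> \<D> \<Longrightarrow> (\<integral>\<^sup>+x. ennreal (loc_grad P x powr q) \<partial>lebesgue) < top"
  unfolding loc_grad_def by (rule finite_Lp_Gr[OF loc_sol_facts(1)])

lemma loc_grad_nonneg: "0 \<le> loc_grad P x" by (simp add: loc_grad_def)

lemma loc_grad_integral:
  assumes P: "P \<in> \<D>" and E: "loc_dom P \<subseteq> E"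
  shows "(\<integral>\<^sup>+x\<in>E. ennreal (loc_grad P x powr q) \<partial>lebesgue) = (\<integral>\<^sup>+x. ennreal (loc_grad P x powr q) \<partial>lebesgue)"
proof (rule nn_integral_cong_AE)
  show "AE x in lebesgue. ennreal (loc_grad P x powr q) * indicator E x = ennreal (loc_grad P x powr q)"
    using loc_sol_facts(3)[OF P]
  proof eventually_elim
    fix x assume "x \<notin> loc_dom P \<longrightarrow> Gr (loc_sol P) x = 0"
    then show "ennreal (loc_grad P x powr q) * indicator E x = ennreal (loc_grad P x powr q)"
      using E by (cases "x \<in> E") (auto simp: loc_grad_def)
  qed
qed

lemma energy_eq: "P \<in> \<D> \<Longrightarrow> (\<integral>\<^sup>+x. ennreal (loc_grad P x powr q) \<partial>lebesgue) = ennreal (energy P)"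
  using loc_grad_finite[of P] by (simp add: energy_def)

lemma energy_nonneg [simp]: "0 \<le> energy P" by (simp add: energy_def)

lemma energy_powr: "P \<in> \<D> \<Longrightarrow> Lp_norm q (loc_dom P) (Gr (loc_sol P)) = ennreal (energy P powr (1 / q))"
  using loc_grad_integral[of P "loc_dom P"] energy_eq[of P] by (simp add: Lp_norm_def loc_grad_def epowr_ennreal)

lemma weak_const_eq: "maximal_weak_norm Q0 = ennreal weak_const" "0 \<le> weak_const"
  using maximal_weak_norm_finite[OF Q0] by (simp_all add: weak_const_def)

lemma measure_\<D>_pos: "P \<in> \<D> \<Longrightarrow> 0 < measure lebesgue P"
  using \<D>_emeasure_pos[of P] by (simp add: measure_def enn2real_positive_iff)

lemma emeasure_measure: "P \<in> \<D> \<Longrightarrow> vol P = ennreal (measure lebesgue P)"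
  using \<D>_emeasure_pos[of P] by (simp add: measure_def)

lemma level_nonneg: "P \<in> \<D> \<Longrightarrow> 0 \<le> level P"
  using weak_const_eq(2) \<theta> by (simp add: level_def)

text \<open>At the root, \<Omega> is its intersection with the smoothened cube of a twice larger cube, so the lower
  exponent applies there too.\<close>

lemma loc_sol_bound:
  assumes P: "P \<in> \<D>"
  shows "ennreal (energy P powr (1 / q)) \<le> A * (Lp_norm q (loc_dom P) F + Lp_norm q' (loc_dom P) f)"
proof -
  have fin: "(\<integral>\<^sup>+x\<in>U. ennreal (norm (F x) powr q) \<partial>lebesgue) < top" "(\<integral>\<^sup>+x\<in>U. ennreal (\<bar>f x\<bar> powr q') \<partial>lebesgue) < top"
    if "U \<subseteq> \<Omega>" for U
  proof -
    have "(\<integral>\<^sup>+x\<in>U. ennreal (norm (F x) powr q) \<partial>lebesgue) \<le> (\<integral>\<^sup>+x\<in>\<Omega>. ennreal (norm (F x) powr q) \<partial>lebesgue)"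
      "(\<integral>\<^sup>+x\<in>U. ennreal (\<bar>f x\<bar> powr q') \<partial>lebesgue) \<le> (\<integral>\<^sup>+x\<in>\<Omega>. ennreal (\<bar>f x\<bar> powr q') \<partial>lebesgue)"
      using that by (auto intro!: nn_integral_mono mult_left_mono simp: indicator_def)
    then show "(\<integral>\<^sup>+x\<in>U. ennreal (norm (F x) powr q) \<partial>lebesgue) < top" "(\<integral>\<^sup>+x\<in>U. ennreal (\<bar>f x\<bar> powr q') \<partial>lebesgue) < top"
      using F(2) f(2) by (auto intro: le_less_trans)
  qed
  have main: "Lp_norm q U (weak_grad U v) \<le> A * (Lp_norm q U F + Lp_norm q' U f)"
    if "0 < r" "U = smoothened O0 (open_cube c r) \<inter> \<Omega>" "v \<in> W12_0 U" "solves U a F f v" for U v c r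
    unfolding A_def q'_def
    by (rule lower_bound[OF that(1,2) F(1) _ _ that(3,4)])
       (use f(1,3) fin[of U] that(2) in \<open>auto simp: q'_def\<close>)
  show ?thesis
  proof (cases "P = T")
    case True
    have "\<Omega> \<subseteq> open_cube m (299 / 100 * (2 * s))" unfolding \<Omega>_eq
      using s_pos by (intro open_cube_mono(1)) simp
    also have "\<dots> \<subseteq> smoothened O0 (open_cube m (2 * s))"
      using s_pos by (intro smoothened_bounds(2)[OF cube_at_open_cube O0]) simp
    finally have "\<Omega> = smoothened O0 (open_cube m (2 * s)) \<inter> \<Omega>" by blast
    from main[OF _ this u sol] have "Lp_norm q \<Omega> (weak_grad \<Omega> u) \<le> A * (Lp_norm q \<Omega> F + Lp_norm q' \<Omega> f)"
      using s_pos by simp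
    moreover have "Lp_norm q \<Omega> (weak_grad \<Omega> u) = Lp_norm q \<Omega> (Gr u)"
      by (rule Lp_norm_cong_AE) (simp add: Gr_def)
    ultimately show ?thesis using energy_powr[OF P] True by (simp add: loc_dom_def loc_sol_def)
  next
    case False
    then have UP: "loc_dom P = smoothened O0 P" by (simp add: loc_dom_def)
    have loc: "local_solution (loc_dom P) u (loc_sol P)" using loc_sol_local[OF P False] UP by simp
    have "loc_dom P = smoothened O0 (open_cube (center P) (side P)) \<inter> \<Omega>"
      using loc_dom_sub(2)[OF P] smoothened_open_cube[OF P] UP by auto
    from main[OF \<D>_side_pos[OF P] this]
    have "Lp_norm q (loc_dom P) (weak_grad (loc_dom P) (loc_sol P)) \<le> A * (Lp_norm q (loc_dom P) F + Lp_norm q' (loc_dom P) f)"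
      using loc solves_local[OF loc_dom_sub(1,2)[OF P] sol loc] by (simp add: local_solution_def)
    moreover have "Lp_norm q (loc_dom P) (weak_grad (loc_dom P) (loc_sol P)) = Lp_norm q (loc_dom P) (Gr (loc_sol P))"
      by (rule Lp_norm_cong_AE) (use loc in \<open>auto simp: local_solution_def elim: AE_mp\<close>)
    ultimately show ?thesis using energy_powr[OF P] by simp
  qed
qed

lemma bad_sub_superlevel:
  assumes P: "P \<in> \<D>" "bad Q P"
  shows "P \<subseteq> {x. ennreal (level Q) < dyadic_maximal Q0 (\<lambda>x. loc_grad Q x powr q) x}"
proof
  fix y assume y: "y \<in> P"
  obtain k x where kx: "P = dyad m s k x" "x \<in> T" using P(1) by (rule dyadsE)
  have "avg (dilate 3 P) 1 (\<lambda>x. loc_grad Q x powr q) \<le> dyadic_maximal Q0 (\<lambda>x. loc_grad Q x powr q) y"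
    unfolding kx by (rule avg_le_dyadic_maximal[OF Q0 kx(2)]) (use y kx in simp)
  then show "y \<in> {x. ennreal (level Q) < dyadic_maximal Q0 (\<lambda>x. loc_grad Q x powr q) x}"
    using P(2) unfolding bad_def by (auto intro: less_le_trans)
qed

lemma superlevel_small:
  assumes Q: "Q \<in> \<D>"
  shows "vol {x. ennreal (level Q) < dyadic_maximal Q0 (\<lambda>x. loc_grad Q x powr q) x} \<le> ennreal \<theta> * vol Q"
proof (rule maximal_weak_type_threshold[OF Q0])
  show "(\<lambda>x. loc_grad Q x powr q) \<in> borel_measurable lebesgue" using loc_grad_measurable[OF Q] by measurable
  have i: "(\<integral>\<^sup>+x. ennreal \<bar>loc_grad Q x powr q\<bar> \<partial>lebesgue) = ennreal (energy Q)" using energy_eq[OF Q] by simp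
  then show "(\<integral>\<^sup>+x. ennreal \<bar>loc_grad Q x powr q\<bar> \<partial>lebesgue) < top" by simp
  show "0 \<le> level Q" by (rule level_nonneg[OF Q])
  have "level Q * (\<theta> * measure lebesgue Q) = weak_const * energy Q" using \<theta> measure_\<D>_pos[OF Q] by (simp add: level_def)
  then have "ennreal weak_const * ennreal (energy Q) = ennreal (level Q) * (ennreal \<theta> * ennreal (measure lebesgue Q))"
    using \<theta> weak_const_eq(2) level_nonneg[OF Q] by (simp add: ennreal_mult[symmetric])
  then show "maximal_weak_norm Q0 * (\<integral>\<^sup>+x. ennreal \<bar>loc_grad Q x powr q\<bar> \<partial>lebesgue) \<le> ennreal (level Q) * (ennreal \<theta> * vol Q)"
    unfolding i weak_const_eq(1) emeasure_measure[OF Q] by simp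
qed

lemma not_bad_self: "Q \<in> \<D> \<Longrightarrow> \<not> bad Q Q"
proof
  assume Q: "Q \<in> \<D>" and b: "bad Q Q"
  have "vol Q \<le> vol {x. ennreal (level Q) < dyadic_maximal Q0 (\<lambda>x. loc_grad Q x powr q) x}"
    by (rule emeasure_mono[OF bad_sub_superlevel[OF Q b] dyadic_maximal_superlevel_sets[OF Q0]])
  also note superlevel_small[OF Q]
  finally have "ennreal (measure lebesgue Q) \<le> ennreal (\<theta> * measure lebesgue Q)"
    using \<theta> by (simp add: emeasure_measure[OF Q] ennreal_mult)
  then have "measure lebesgue Q \<le> \<theta> * measure lebesgue Q" using \<theta> by (simp add: ennreal_le_iff)
  then show False using \<theta> measure_\<D>_pos[OF Q] by simp
qed

lemma children_sub: "P \<in> children Q \<Longrightarrow> P \<in> \<D>" "P \<in> children Q \<Longrightarrow> P \<subseteq> Q" "P \<in> children Q \<Longrightarrow> bad Q P"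
  by (auto simp: children_def stopping_def)

lemma children_strict: "Q \<in> \<D> \<Longrightarrow> P \<in> children Q \<Longrightarrow> P \<subset> Q"
  using children_sub not_bad_self by blast

lemma children_countable: "countable (children Q)"
  by (rule countable_subset[OF _ countable_dyads_set[of m s]]) (auto simp: children_def stopping_def)

lemma children_disjoint: "P \<in> children Q \<Longrightarrow> P' \<in> children Q \<Longrightarrow> P \<noteq> P' \<Longrightarrow> P \<inter> P' = {}"
  unfolding children_def by (rule stopping_disjoint)

lemma children_small: "Q \<in> \<D> \<Longrightarrow> vol (\<Union>(children Q)) \<le> ennreal \<theta> * vol Q"
proof -
  assume Q: "Q \<in> \<D>"
  have "\<Union>(children Q) \<subseteq> {x. ennreal (level Q) < dyadic_maximal Q0 (\<lambda>x. loc_grad Q x powr q) x}"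
    using bad_sub_superlevel children_sub by blast
  then have "vol (\<Union>(children Q)) \<le> vol {x. ennreal (level Q) < dyadic_maximal Q0 (\<lambda>x. loc_grad Q x powr q) x}"
    by (rule emeasure_mono[OF _ dyadic_maximal_superlevel_sets[OF Q0]])
  also note superlevel_small[OF Q]
  finally show ?thesis .
qed

lemma dilate_\<D>:
  assumes "P \<in> \<D>" "0 < c"
  shows "dilate c P \<in> sets lebesgue" "0 < vol (dilate c P)" "vol (dilate c P) < \<infinity>"
  using cube_at_sets[OF cube_at_dilate[OF \<D>_cube_at[OF assms(1)] assms(2)]]
    cube_at_emeasure_pos[OF cube_at_dilate[OF \<D>_cube_at[OF assms(1)] assms(2)]] by auto

text \<open>A stopping cube inherits the bound at its parent up to the doubling constant.\<close>

lemma children_avg_bound: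
  assumes Q: "Q \<in> \<D>" and P: "P \<in> children Q"
  shows "avg (dilate 3 P) q (loc_grad Q) \<le> ennreal (2 powr (CARD('n) / q) * level Q powr (1 / q))"
proof -
  have PD: "P \<in> \<D>" by (rule children_sub(1)[OF P])
  obtain k x where kx: "x \<in> T" "P = dyad m s (Suc k) x" "\<not> bad Q (dyad m s k x)"
    using stopping_parent[where bad = "bad Q", OF s_pos Q not_bad_self[OF Q]] P unfolding children_def by metis
  define P' where "P' = dyad m s k x"
  have P'D: "P' \<in> \<D>" using kx(1) unfolding P'_def dyads_def by blast
  have side: "side P' = 2 * side P"
    using cube_at_side[OF cube_at_dyad[OF s_pos, of m "Suc k" x]] cube_at_side[OF cube_at_dyad[OF s_pos, of m k x]]
    by (simp add: kx(2) P'_def)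
  have sub: "P \<subseteq> P'" unfolding kx(2) P'_def by (rule dyad_mono) simp
  have near: "\<bar>center P $ i - center P' $ i\<bar> \<le> (3 * side P' - 3 * side P) / 2" for i
  proof -
    have "(side P' - side P) / 2 \<le> (3 * side P' - 3 * side P) / 2" using \<D>_side_pos[OF PD] side by simp
    then show ?thesis
      using cube_at_subset_centers[OF \<D>_cube_at[OF PD] \<D>_cube_at[OF P'D] sub, of i] by (rule order_trans[rotated])
  qed
  have "avg (dilate 3 P) q (loc_grad Q) \<le> ennreal ((3 * side P' / (3 * side P)) powr (CARD('n) / q)) * avg (dilate 3 P') q (loc_grad Q)"
    by (rule avg_cube_subset[OF cube_at_dilate[OF \<D>_cube_at[OF PD]] cube_at_dilate[OF \<D>_cube_at[OF P'D]] near])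
       (use q_bounds in simp_all)
  also have "3 * side P' / (3 * side P) = 2" using \<D>_side_pos[OF PD] side by simp
  also have "avg (dilate 3 P') q (loc_grad Q) \<le> ennreal (level Q powr (1 / q))"
  proof -
    have "avg (dilate 3 P') 1 (\<lambda>x. loc_grad Q x powr q) \<le> ennreal (level Q)" using kx(3) by (simp add: bad_def P'_def not_less)
    then have "epowr (avg (dilate 3 P') 1 (\<lambda>x. loc_grad Q x powr q)) (1 / q) \<le> epowr (ennreal (level Q)) (1 / q)"
      using q_bounds by (intro epowr_mono) auto
    then show ?thesis using avg_eq_epowr_avg_1[of "dilate 3 P'" q "loc_grad Q"] level_nonneg[OF Q] by (simp add: epowr_ennreal loc_grad_nonneg)
  qed
  finally show ?thesis by (simp add: ennreal_mult mult_left_mono)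
qed

text \<open>If the average over 2P vanishes, then the gradients agree on P and both sides are zero;
  otherwise the ratio is one of those in the supremum.\<close>

lemma N_high_estimate:
  assumes P: "cube_at P c r" "dilate 2 P \<subseteq> \<Omega>" and w: "w \<in> W12_0 \<Omega>" "w' \<in> W12_0 \<Omega>"
    and ag: "agree (smoothened O0 P \<inter> \<Omega>) w w'"
  shows "avg P qh (\<lambda>x. norm (Gr w x - Gr w' x)) \<le> B * avg (dilate 2 P) (1 / 2) (\<lambda>x. norm (Gr w x - Gr w' x))"
proof -
  have r: "0 < r" using P(1) by (simp add: cube_at_def)
  \<comment> \<open>The set P may have arbitrary faces; the open cube is a product of intervals with the same averages and smoothened cube.\<close>
  define P0 where "P0 = open_cube c r"
  define d where "d x = norm (Gr w x - Gr w' x)" for x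
  have c0: "cube_at P0 c r" unfolding P0_def by (rule cube_at_open_cube[OF r])
  have c2: "cube_at (dilate 2 P) c (2 * r)" "cube_at (dilate 2 P0) c (2 * r)"
    using cube_at_dilate[OF P(1), of 2] cube_at_dilate[OF c0, of 2] by auto
  have P02: "dilate 2 P0 = open_cube c (2 * r)" unfolding P0_def by (rule dilate_open_cube[OF r]) simp
  have P02\<Omega>: "dilate 2 P0 \<subseteq> \<Omega>" using P(2) c2(1) unfolding P02 cube_at_def by blast
  have P0sub: "P0 \<subseteq> dilate 2 P0" unfolding P02 unfolding P0_def using r by (intro open_cube_mono(1)) simp
  have sm: "smoothened O0 P0 = smoothened O0 P" using smoothened_eq[OF c0] smoothened_eq[OF P(1)] by simp
  have dm: "d \<in> borel_measurable lebesgue" unfolding d_def[abs_def]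
    using sq_int_measurable[OF Gr_sq_int[OF w(1)]] sq_int_measurable[OF Gr_sq_int[OF w(2)]] by simp
  have dsq: "sq_int d"
    using sq_int_dominated(1)[OF sq_int_diff[OF Gr_sq_int[OF w(1)] Gr_sq_int[OF w(2)]] dm, of 1] by (simp add: d_def)
  define X where "X = avg P0 qh d"
  define Y where "Y = avg (dilate 2 P0) (1 / 2) d"
  have s2: "dilate 2 P0 \<in> sets lebesgue" "0 < vol (dilate 2 P0)" "vol (dilate 2 P0) < \<infinity>"
    using cube_at_sets[OF c2(2)] cube_at_emeasure_pos[OF c2(2)] by auto
  have s0: "P0 \<in> sets lebesgue" "0 < vol P0" "vol P0 < \<infinity>"
    using cube_at_sets[OF c0] cube_at_emeasure_pos[OF c0] by auto
  have ratio: "X / Y \<le> B"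
  proof -
    have pair: "(w, w') \<in> solution_pairs O0 \<Omega> a P0"
      unfolding solution_pairs_iff[OF c0] sm using w ag by blast
    have eq: "avg E p (\<lambda>x. norm (weak_grad \<Omega> w x - weak_grad \<Omega> w' x)) = avg E p d" if "E \<subseteq> \<Omega>" for E p
      by (rule avg_cong_AE, rule AE_I2) (use that in \<open>auto simp: d_def Gr_def subset_iff\<close>)
    have "X / Y = avg P0 qh (\<lambda>x. norm (weak_grad \<Omega> w x - weak_grad \<Omega> w' x)) /
        avg (dilate 2 P0) (1 / 2) (\<lambda>x. norm (weak_grad \<Omega> w x - weak_grad \<Omega> w' x))"
      unfolding X_def Y_def using P0sub P02\<Omega> by (subst (1 2) eq) auto
    also have "\<dots> \<le> (SUP P\<in>{P. is_cube P \<and> P \<subseteq> dilate 2 P0 \<and> dilate 2 P \<subseteq> \<Omega>}.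
          avg P qh (\<lambda>x. norm (weak_grad \<Omega> w x - weak_grad \<Omega> w' x)) /
          avg (dilate 2 P) (1 / 2) (\<lambda>x. norm (weak_grad \<Omega> w x - weak_grad \<Omega> w' x)))"
      by (rule SUP_upper) (use P0sub P02\<Omega> is_cube_open_cube[OF r] in \<open>simp add: P0_def\<close>)
    also have "\<dots> \<le> (SUP (w, w')\<in>solution_pairs O0 \<Omega> a P0. SUP P\<in>{P. is_cube P \<and> P \<subseteq> dilate 2 P0 \<and> dilate 2 P \<subseteq> \<Omega>}.
          avg P qh (\<lambda>x. norm (weak_grad \<Omega> w x - weak_grad \<Omega> w' x)) /
          avg (dilate 2 P) (1 / 2) (\<lambda>x. norm (weak_grad \<Omega> w x - weak_grad \<Omega> w' x)))"
      by (rule SUP_upper2[OF pair]) simp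
    also have "\<dots> \<le> B" unfolding B_def N_high_loc_def
      by (rule SUP_upper) (use is_cube_open_cube[OF r] in \<open>simp add: P0_def\<close>)
    finally show ?thesis .
  qed
  have "X \<le> B * Y"
  proof (cases "Y = 0")
    case True
    then have "AE x in lebesgue_on (dilate 2 P0). d x = 0"
      unfolding Y_def by (subst (asm) avg_eq_0_iff) (use s2 dm in \<open>auto intro: measurable_restrict_space1\<close>)
    then have ae: "AE x in lebesgue. x \<in> dilate 2 P0 \<longrightarrow> d x = 0"
      using s2 by (simp add: AE_restrict_space_iff)
    have "AE x in lebesgue_on P0. d x = 0"
      using ae s0 P0sub by (simp add: AE_restrict_space_iff) (auto elim: AE_mp)
    then have "X = 0" unfolding X_def
      by (subst avg_eq_0_iff) (use s0 dm qh in \<open>auto intro: measurable_restrict_space1\<close>)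
    then show ?thesis by simp
  next
    case False
    have "Y \<le> avg (dilate 2 P0) 1 d" unfolding Y_def
      by (rule avg_mono_exp) (use s2 dm in \<open>auto intro: measurable_restrict_space1\<close>)
    also have "\<dots> < top"
    proof (rule avg_finite[OF s2(2)])
      have "Lp 1 (dilate 2 P0) d" by (rule sq_int_Lp_1[OF dsq s2(1)]) (use s2 in simp)
      then show "(\<integral>\<^sup>+x\<in>dilate 2 P0. ennreal (\<bar>d x\<bar> powr 1) \<partial>lebesgue) < top" by (simp add: Lp_def)
    qed
    finally obtain y where y: "Y = ennreal y" "0 < y" using False by (cases Y) (auto simp: less_le)
    from mult_left_mono[OF ratio, of Y] show ?thesis
      unfolding y(1) ennreal_cancel[OF y(2)] by (simp add: mult.commute)
  qed
  moreover have "avg P qh d = X" unfolding X_def P0_def by (rule cube_at_avg[OF P(1)])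
  moreover have "avg (dilate 2 P) (1 / 2) d = Y" unfolding Y_def P02 by (rule cube_at_avg[OF c2(1)])
  ultimately show ?thesis by (simp add: d_def[abs_def])
qed

end

section \<open>One stopping step\<close>

lemma ennreal_cancel_left: "0 < c \<Longrightarrow> ennreal c * x / ennreal c = x"
  using ennreal_cancel[of c x] by (simp add: divide_ennreal_def mult.assoc)

lemma avg_Lp_norm:
  fixes h :: "real^'n \<Rightarrow> 'b::real_normed_vector"
  assumes "vol E = ennreal e" "0 < e"
  shows "Lp_norm p E h = ennreal (e powr (1 / p)) * avg E p (\<lambda>x. norm (h x))"
  using assms unfolding avg_def assms(1) epowr_divide[OF assms(2)]
  by (simp add: Lp_norm_def ennreal_cancel)

lemma Lp_norm_mono_set:
  assumes "E \<subseteq> E'" "0 \<le> p" shows "Lp_norm p E h \<le> Lp_norm p E' h"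
  unfolding Lp_norm_def using assms
  by (intro epowr_mono nn_integral_mono mult_left_mono) (auto simp: indicator_def)

lemma nn_integral_stopping_split:
  assumes C: "countable C" "\<And>P. P \<in> C \<Longrightarrow> P \<in> sets lebesgue" "\<And>P. P \<in> C \<Longrightarrow> P \<subseteq> Q"
      "\<And>P P'. P \<in> C \<Longrightarrow> P' \<in> C \<Longrightarrow> P \<noteq> P' \<Longrightarrow> P \<inter> P' = {}"
    and Q: "Q \<in> sets lebesgue" and k: "k \<in> borel_measurable lebesgue"
  shows "(\<integral>\<^sup>+x\<in>Q. k x \<partial>lebesgue) = (\<integral>\<^sup>+x\<in>Q - \<Union>C. k x \<partial>lebesgue) + (\<integral>\<^sup>+P. (\<integral>\<^sup>+x\<in>P. k x \<partial>lebesgue) \<partial>count_space C)"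
proof -
  have Us: "\<Union>C \<in> sets lebesgue" using C by (intro sets.countable_Union) auto
  define \<mu> where "\<mu> = density lebesgue k"
  have d: "emeasure \<mu> E = (\<integral>\<^sup>+x\<in>E. k x \<partial>lebesgue)" if "E \<in> sets lebesgue" for E
    unfolding \<mu>_def using that k by (rule emeasure_density[rotated])
  have s: "sets \<mu> = sets lebesgue" by (simp add: \<mu>_def)
  have "Q = (Q - \<Union>C) \<union> \<Union>C" using C(3) by blast
  then have "emeasure \<mu> Q = emeasure \<mu> ((Q - \<Union>C) \<union> \<Union>C)" by simp
  also have "\<dots> = emeasure \<mu> (Q - \<Union>C) + emeasure \<mu> (\<Union>C)"
    by (rule plus_emeasure[symmetric]) (use Q Us s in auto)
  also have "emeasure \<mu> (\<Union>C) = emeasure \<mu> (\<Union>P\<in>C. P)" by simp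
  also have "\<dots> = (\<integral>\<^sup>+P. emeasure \<mu> P \<partial>count_space C)"
    by (rule emeasure_UN_countable) (use C s in \<open>auto simp: disjoint_family_on_def\<close>)
  also have "\<dots> = (\<integral>\<^sup>+P. (\<integral>\<^sup>+x\<in>P. k x \<partial>lebesgue) \<partial>count_space C)"
    using C(2) d by (intro nn_integral_cong) simp
  finally show ?thesis using d Q Us by auto
qed

context sparse_setting
begin

lemma dilate_3_measure:
  assumes "P \<in> \<D>"
  shows "vol (dilate 3 P) = ennreal (3 ^ CARD('n) * measure lebesgue P)"
  using cube_at_emeasure[OF cube_at_dilate[OF \<D>_cube_at[OF assms], of 3]] cube_at_measure[OF \<D>_cube_at[OF assms]]
  by (simp add: power_mult_distrib)

lemma loc_dom_sub_dilate: "P \<in> \<D> \<Longrightarrow> loc_dom P \<subseteq> dilate 3 P"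
  using loc_dom_sub(3)[of P] cube_at_dilate[OF \<D>_cube_at, of P 3] by (auto simp: cube_at_def)

text \<open>The upper exponent reduces the claim to averages over 2P, where the two gradients are bounded
  separately: \<open>\<nabla>v\<^sub>P\<close> by \<open>\<nabla>v\<^sub>Q\<close>, and \<open>\<nabla>v\<^sub>Q\<close> by the threshold.\<close>

lemma children_difference:
  assumes Q: "Q \<in> \<D>" and P: "P \<in> children Q"
  shows "avg P qh (\<lambda>x. norm (Gr (loc_sol Q) x - Gr (loc_sol P) x)) \<le>
    B * ((1 + A * ennreal \<Lambda>) * ennreal (3 powr (CARD('n) / q) * level Q powr (1 / q)))"
proof -
  have PD: "P \<in> \<D>" by (rule children_sub(1)[OF P])
  have PQ: "P \<subset> Q" by (rule children_strict[OF Q P])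
  have PT: "P \<noteq> T" using PQ \<D>_sub_T[OF Q] by blast
  have UP: "loc_dom P = smoothened O0 P" using PT by (simp add: loc_dom_def)
  define d where "d x = norm (Gr (loc_sol Q) x - Gr (loc_sol P) x)" for x
  note wQ = loc_sol_facts[OF Q] and wP = loc_sol_facts[OF PD]
  have agP: "agree (loc_dom P) (loc_sol P) (loc_sol Q)"
    using agree_trans[OF wP(2) agree_sym[OF agree_mono[OF wQ(2)]]] loc_dom_nested[OF PD Q PQ] by blast
  have "agree (smoothened O0 P \<inter> \<Omega>) (loc_sol Q) (loc_sol P)"
    by (rule agree_mono[OF agree_sym[OF agP]]) (simp add: UP)
  from N_high_estimate[OF \<D>_cube_at[OF PD] dilate_2_sub[OF PD] wQ(1) wP(1) this]
  have 1: "avg P qh d \<le> B * avg (dilate 2 P) (1 / 2) d" by (simp add: d_def[abs_def])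
  have m: "Gr (loc_sol Q) \<in> borel_measurable lebesgue" "Gr (loc_sol P) \<in> borel_measurable lebesgue"
    by (rule loc_sol_measurable[OF Q], rule loc_sol_measurable[OF PD])
  have dm: "d \<in> borel_measurable lebesgue" unfolding d_def[abs_def] using m by simp
  have D2: "dilate 2 P \<in> sets lebesgue" "0 < vol (dilate 2 P)" "vol (dilate 2 P) < \<infinity>"
    by (rule dilate_\<D>[OF PD]; simp)+
  \<comment> \<open>Passing from 2P to 3P costs 3/2, and passing to the parent costs 2; the product is the 3 in the claim.\<close>
  have up: "avg (dilate 2 P) 1 (loc_grad R) \<le> ennreal ((3 / 2) powr (CARD('n) / q)) * avg (dilate 3 P) q (loc_grad R)" if R: "R \<in> \<D>" for R
  proof -
    have "avg (dilate 2 P) 1 (loc_grad R) \<le> avg (dilate 2 P) q (loc_grad R)"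
      using q_bounds by (intro avg_mono_exp D2 measurable_restrict_space1[OF loc_grad_measurable[OF R]]) auto
    also have "\<dots> \<le> ennreal ((3 * side P / (2 * side P)) powr (CARD('n) / q)) * avg (dilate 3 P) q (loc_grad R)"
      by (rule avg_cube_subset[OF cube_at_dilate[OF \<D>_cube_at[OF PD]] cube_at_dilate[OF \<D>_cube_at[OF PD]]])
         (use q_bounds \<D>_side_pos[OF PD] in simp_all)
    also have "3 * side P / (2 * side P) = 3 / 2" using \<D>_side_pos[OF PD] by simp
    finally show ?thesis .
  qed
  have hP: "avg (dilate 3 P) q (loc_grad P) \<le> A * ennreal \<Lambda> * avg (dilate 3 P) q (loc_grad Q)"
  proof -
    define e where "e = 3 ^ CARD('n) * measure lebesgue P"
    have e: "0 < e" using measure_\<D>_pos[OF PD] by (simp add: e_def)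
    have em: "vol (dilate 3 P) = ennreal e" using dilate_3_measure[OF PD] by (simp add: e_def)
    have "Lp_norm q (dilate 3 P) (Gr (loc_sol P)) = Lp_norm q (loc_dom P) (Gr (loc_sol P))"
      using loc_grad_integral[OF PD loc_dom_sub_dilate[OF PD]] loc_grad_integral[OF PD order_refl] by (simp add: Lp_norm_def loc_grad_def)
    also have "\<dots> \<le> A * ennreal \<Lambda> * Lp_norm q (loc_dom P) (Gr (loc_sol Q))"
      unfolding A_def
    proof (rule local_solution_bound[OF \<D>_side_pos[OF PD] _ loc_dom_sub(2)[OF PD] wQ(1) _ agP])
      show "loc_dom P = smoothened O0 (open_cube (center P) (side P))" using UP smoothened_open_cube[OF PD] by simp
      show "local_solution (loc_dom P) u (loc_sol P)" using loc_sol_local[OF PD PT] UP by simp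
    qed
    also have "\<dots> \<le> A * ennreal \<Lambda> * Lp_norm q (dilate 3 P) (Gr (loc_sol Q))"
      using q_bounds by (intro mult_left_mono Lp_norm_mono_set loc_dom_sub_dilate[OF PD]) auto
    finally have "ennreal (e powr (1 / q)) * avg (dilate 3 P) q (loc_grad P) \<le>
        A * ennreal \<Lambda> * (ennreal (e powr (1 / q)) * avg (dilate 3 P) q (loc_grad Q))"
      unfolding avg_Lp_norm[OF em e] by (simp add: loc_grad_def[abs_def])
    then have "ennreal (e powr (1 / q)) * avg (dilate 3 P) q (loc_grad P) \<le>
        ennreal (e powr (1 / q)) * (A * ennreal \<Lambda> * avg (dilate 3 P) q (loc_grad Q))" by (simp only: mult_ac)
    then show ?thesis using e by (subst (asm) ennreal_mult_le_mult_iff) auto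
  qed
  have "avg (dilate 2 P) (1 / 2) d \<le> avg (dilate 2 P) 1 d"
    by (intro avg_mono_exp D2 measurable_restrict_space1[OF dm]) auto
  also have "\<dots> \<le> avg (dilate 2 P) 1 (loc_grad Q) + avg (dilate 2 P) 1 (loc_grad P)"
    unfolding d_def[abs_def] loc_grad_def[abs_def] by (rule avg_1_add[OF D2(1) m])
  also have "\<dots> \<le> ennreal ((3 / 2) powr (CARD('n) / q)) * avg (dilate 3 P) q (loc_grad Q) +
      ennreal ((3 / 2) powr (CARD('n) / q)) * (A * ennreal \<Lambda> * avg (dilate 3 P) q (loc_grad Q))"
    using up[OF Q] order_trans[OF up[OF PD] mult_left_mono[OF hP]] by (intro add_mono) auto
  also have "\<dots> = (1 + A * ennreal \<Lambda>) * (ennreal ((3 / 2) powr (CARD('n) / q)) * avg (dilate 3 P) q (loc_grad Q))"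
    by (simp add: distrib_left distrib_right mult_ac)
  also have "\<dots> \<le> (1 + A * ennreal \<Lambda>) * (ennreal ((3 / 2) powr (CARD('n) / q)) * ennreal (2 powr (CARD('n) / q) * level Q powr (1 / q)))"
    by (intro mult_left_mono children_avg_bound[OF Q P]) auto
  also have "ennreal ((3 / 2) powr (CARD('n) / q)) * ennreal (2 powr (CARD('n) / q) * level Q powr (1 / q)) =
      ennreal (3 powr (CARD('n) / q) * level Q powr (1 / q))"
    by (subst ennreal_mult[symmetric]) (simp_all add: powr_mult[symmetric] mult.assoc[symmetric])
  finally have 2: "avg (dilate 2 P) (1 / 2) d \<le> (1 + A * ennreal \<Lambda>) * ennreal (3 powr (CARD('n) / q) * level Q powr (1 / q))" .
  have "avg P qh d \<le> B * ((1 + A * ennreal \<Lambda>) * ennreal (3 powr (CARD('n) / q) * level Q powr (1 / q)))"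
    by (rule order_trans[OF 1 mult_left_mono[OF 2]]) simp
  then show ?thesis by (simp add: d_def[abs_def])
qed

lemma Gr_Lebesgue_point:
  assumes w: "w \<in> W12_0 \<Omega>"
  shows "AE x in lebesgue. x \<in> T \<longrightarrow>
    (\<forall>e>0. \<exists>K. \<forall>k\<ge>K. avg (dilate 3 (dyad m s k x)) 1 (\<lambda>y. norm (Gr w y - Gr w x)) \<le> ennreal e)"
proof (rule AE_dyadic_Lebesgue_point[OF Q0 sq_int_measurable[OF Gr_sq_int[OF w]]])
  fix e :: real assume e: "0 < e"
  from W12_0_grad_approx[OF open_\<Omega> finite_\<Omega> w e]
  obtain \<phi> where "\<phi> \<in> test_functions \<Omega>" "(\<integral>\<^sup>+x. ennreal (norm (indicator \<Omega> x *\<^sub>R weak_grad \<Omega> w x - grad \<phi> x)) \<partial>lebesgue) \<le> ennreal e"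
    by blast
  then show "\<exists>\<phi>. continuous_on UNIV \<phi> \<and> (\<integral>\<^sup>+x. ennreal (norm (Gr w x - \<phi> x)) \<partial>lebesgue) \<le> ennreal e"
    unfolding Gr_def by (intro exI[of _ "grad \<phi>"] conjI test_grad_continuous)
qed

lemma avg_const_norm:
  assumes "E \<in> sets lebesgue" "0 < vol E" "vol E < \<infinity>"
  shows "avg E 1 (\<lambda>y. c) = ennreal \<bar>c\<bar>"
proof -
  obtain e where e: "vol E = ennreal e" "0 < e" using assms by (cases "vol E") auto
  have "(\<integral>\<^sup>+y\<in>E. ennreal \<bar>c\<bar> \<partial>lebesgue) = ennreal e * ennreal \<bar>c\<bar>"
    using assms(1) e(1) by (subst nn_integral_cmult_indicator) (simp_all add: mult.commute)
  then show ?thesis unfolding avg_1_eq e(1) using ennreal_cancel_left[OF e(2)] by simp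
qed

text \<open>Off the stopping cubes every Lebesgue point sees only small averages.\<close>

lemma off_stopping_bound:
  assumes Q: "Q \<in> \<D>"
  shows "AE x in lebesgue. x \<in> Q - \<Union>(children Q) \<longrightarrow> loc_grad Q x \<le> level Q powr (1 / q)"
  using Gr_Lebesgue_point[OF loc_sol_facts(1)[OF Q]]
proof eventually_elim
  fix x assume leb: "x \<in> T \<longrightarrow> (\<forall>e>0. \<exists>K. \<forall>k\<ge>K. avg (dilate 3 (dyad m s k x)) 1 (\<lambda>y. norm (Gr (loc_sol Q) y - Gr (loc_sol Q) x)) \<le> ennreal e)"
  show "x \<in> Q - \<Union>(children Q) \<longrightarrow> loc_grad Q x \<le> level Q powr (1 / q)"
  proof
    assume x: "x \<in> Q - \<Union>(children Q)"
    then have xT: "x \<in> T" using \<D>_sub_T[OF Q] by blast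
    obtain j z where jz: "Q = dyad m s j z" using Q by (rule dyadsE)
    then have Qj: "Q = dyad m s j x" using x dyad_eq by (metis DiffD1)
    show "loc_grad Q x \<le> level Q powr (1 / q)"
    proof (rule field_le_epsilon)
      fix e :: real assume e: "0 < e"
      obtain K where K: "\<And>k. K \<le> k \<Longrightarrow> avg (dilate 3 (dyad m s k x)) 1 (\<lambda>y. norm (Gr (loc_sol Q) y - Gr (loc_sol Q) x)) \<le> ennreal e"
        using leb xT e by blast
      define k where "k = max K j"
      define P where "P = dyad m s k x"
      have PD: "P \<in> \<D>" using xT unfolding P_def dyads_def by blast
      have PQ: "P \<subseteq> Q" unfolding P_def Qj by (rule dyad_mono) (simp add: k_def)
      have D3: "dilate 3 P \<in> sets lebesgue" "0 < vol (dilate 3 P)" "vol (dilate 3 P) < \<infinity>"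
        by (rule dilate_\<D>[OF PD]; simp)+
      have "\<not> bad Q P"
      proof
        assume "bad Q P"
        then obtain P' where "P' \<in> children Q" "P \<subseteq> P'" using stopping_covers[OF PD PQ, of "bad Q"] unfolding children_def by blast
        then show False using x unfolding P_def using dyad_self by blast
      qed
      then have "avg (dilate 3 P) 1 (\<lambda>x. loc_grad Q x powr q) \<le> ennreal (level Q)" by (simp add: bad_def not_less)
      then have "epowr (avg (dilate 3 P) 1 (\<lambda>x. loc_grad Q x powr q)) (1 / q) \<le> epowr (ennreal (level Q)) (1 / q)"
        using q_bounds by (intro epowr_mono) auto
      then have "avg (dilate 3 P) q (loc_grad Q) \<le> ennreal (level Q powr (1 / q))"
        using avg_eq_epowr_avg_1[of "dilate 3 P" q "loc_grad Q"] level_nonneg[OF Q] by (simp add: epowr_ennreal loc_grad_nonneg)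
      moreover have "avg (dilate 3 P) 1 (loc_grad Q) \<le> avg (dilate 3 P) q (loc_grad Q)"
        using q_bounds by (intro avg_mono_exp D3 measurable_restrict_space1[OF loc_grad_measurable[OF Q]]) auto
      ultimately have a1: "avg (dilate 3 P) 1 (loc_grad Q) \<le> ennreal (level Q powr (1 / q))" by (rule order_trans[rotated])
      have a2: "avg (dilate 3 P) 1 (\<lambda>y. norm (Gr (loc_sol Q) y - Gr (loc_sol Q) x)) \<le> ennreal e"
        unfolding P_def by (rule K) (simp add: k_def)
      have m: "Gr (loc_sol Q) \<in> borel_measurable lebesgue" by (rule loc_sol_measurable[OF Q])
      have "ennreal (loc_grad Q x) = avg (dilate 3 P) 1 (\<lambda>y. loc_grad Q x)"
        unfolding avg_const_norm[OF D3] by (simp add: loc_grad_nonneg)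
      also have "\<dots> \<le> avg (dilate 3 P) 1 (\<lambda>y. norm (Gr (loc_sol Q) y - Gr (loc_sol Q) x)) + avg (dilate 3 P) 1 (loc_grad Q)"
      proof (rule avg_1_triangle[OF D3(1)])
        show "(\<lambda>y. norm (Gr (loc_sol Q) y - Gr (loc_sol Q) x)) \<in> borel_measurable lebesgue" using m by simp
        show "loc_grad Q \<in> borel_measurable lebesgue" by (rule loc_grad_measurable[OF Q])
        fix y show "\<bar>loc_grad Q x\<bar> \<le> \<bar>norm (Gr (loc_sol Q) y - Gr (loc_sol Q) x)\<bar> + \<bar>loc_grad Q y\<bar>"
          using norm_triangle_sub[of "Gr (loc_sol Q) x" "Gr (loc_sol Q) y"] by (simp add: loc_grad_def norm_minus_commute)
      qed
      also have "\<dots> \<le> ennreal e + ennreal (level Q powr (1 / q))" by (rule add_mono[OF a2 a1])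
      also have "\<dots> = ennreal (level Q powr (1 / q) + e)" using e by (simp add: add.commute)
      finally show "loc_grad Q x \<le> level Q powr (1 / q) + e" using e by (simp add: ennreal_le_iff del: ennreal_plus)
    qed
  qed
qed

definition dual_exp :: real where "dual_exp = conj_exp qh"

lemma dual_exp: "1 < dual_exp" "1 / qh + 1 / dual_exp = 1"
proof -
  show "1 < dual_exp" using qh by (simp add: dual_exp_def conj_exp_def less_divide_eq)
  show "1 / qh + 1 / dual_exp = 1" using qh by (simp add: dual_exp_def conj_exp_def add_divide_distrib[symmetric])
qed

definition pairing :: "(real^'n) set \<Rightarrow> ennreal" where
  "pairing Q = (\<integral>\<^sup>+x\<in>Q. ennreal (loc_grad Q x * \<bar>g x\<bar>) \<partial>lebesgue)"

text \<open>Off the children the gradient is bounded pointwise; on a child it is compared with the gradient of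
  the local solution there.  All averages of g that arise are absorbed by the average over Q.\<close>

lemma stopping_step:
  assumes B: "1 \<le> B" and Q: "Q \<in> \<D>"
  shows "pairing Q \<le> B * (1 + A * ennreal \<Lambda>) * ennreal (3 powr (CARD('n) / q) * level Q powr (1 / q)) *
      (vol Q * avg Q dual_exp g) + (\<integral>\<^sup>+P. pairing P \<partial>count_space (children Q))"
proof -
  define \<tau> where "\<tau> = B * (1 + A * ennreal \<Lambda>) * ennreal (3 powr (CARD('n) / q) * level Q powr (1 / q))"
  have [measurable]: "g \<in> borel_measurable lebesgue" "loc_grad Q \<in> borel_measurable lebesgue" by (rule g, rule loc_grad_measurable[OF Q])
  have chs: "P \<in> sets lebesgue" "P \<subseteq> Q" if "P \<in> children Q" for P using children_sub[OF that] \<D>_sets by auto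
  have UC: "\<Union>(children Q) \<in> sets lebesgue" using children_countable chs by (intro sets.countable_Union) auto
  have R: "Q - \<Union>(children Q) \<in> sets lebesgue" using UC \<D>_sets[OF Q] by auto
  \<comment> \<open>Here 1 \<le> B makes the bound off the children no worse than the bound on them.\<close>
  have ge1: "ennreal (level Q powr (1 / q)) \<le> \<tau>"
  proof -
    have "1 * 1 \<le> B * (1 + A * ennreal \<Lambda>)" by (rule mult_mono[OF B]) simp_all
    then have "1 \<le> B * (1 + A * ennreal \<Lambda>)" by simp
    moreover have "ennreal (level Q powr (1 / q)) \<le> ennreal (3 powr (CARD('n) / q) * level Q powr (1 / q))"
    proof (rule ennreal_leI)
      have "1 \<le> 3 powr (CARD('n) / q)" using q_bounds by (intro ge_one_powr_ge_zero) auto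
      from mult_right_mono[OF this, of "level Q powr (1 / q)"]
      show "level Q powr (1 / q) \<le> 3 powr (CARD('n) / q) * level Q powr (1 / q)" by simp
    qed
    ultimately have "1 * ennreal (level Q powr (1 / q)) \<le> \<tau>" unfolding \<tau>_def by (intro mult_mono) simp_all
    then show ?thesis by simp
  qed
  have "pairing Q = (\<integral>\<^sup>+x\<in>Q - \<Union>(children Q). ennreal (loc_grad Q x * \<bar>g x\<bar>) \<partial>lebesgue) +
     (\<integral>\<^sup>+P. (\<integral>\<^sup>+x\<in>P. ennreal (loc_grad Q x * \<bar>g x\<bar>) \<partial>lebesgue) \<partial>count_space (children Q))"
    unfolding pairing_def by (rule nn_integral_stopping_split[OF children_countable chs children_disjoint \<D>_sets[OF Q]]) auto
  also have "(\<integral>\<^sup>+x\<in>Q - \<Union>(children Q). ennreal (loc_grad Q x * \<bar>g x\<bar>) \<partial>lebesgue) \<le>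
      \<tau> * (\<integral>\<^sup>+x\<in>Q - \<Union>(children Q). ennreal \<bar>g x\<bar> \<partial>lebesgue)"
  proof -
    have "(\<integral>\<^sup>+x\<in>Q - \<Union>(children Q). ennreal (loc_grad Q x * \<bar>g x\<bar>) \<partial>lebesgue) \<le>
      (\<integral>\<^sup>+x. \<tau> * (ennreal \<bar>g x\<bar> * indicator (Q - \<Union>(children Q)) x) \<partial>lebesgue)"
    proof (rule nn_integral_mono_AE)
      show "AE x in lebesgue. ennreal (loc_grad Q x * \<bar>g x\<bar>) * indicator (Q - \<Union>(children Q)) x \<le>
          \<tau> * (ennreal \<bar>g x\<bar> * indicator (Q - \<Union>(children Q)) x)"
        using off_stopping_bound[OF Q]
      proof eventually_elim
        fix x assume *: "x \<in> Q - \<Union>(children Q) \<longrightarrow> loc_grad Q x \<le> level Q powr (1 / q)"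
        show "ennreal (loc_grad Q x * \<bar>g x\<bar>) * indicator (Q - \<Union>(children Q)) x \<le> \<tau> * (ennreal \<bar>g x\<bar> * indicator (Q - \<Union>(children Q)) x)"
        proof (cases "x \<in> Q - \<Union>(children Q)")
          case True
          then have "ennreal (loc_grad Q x) \<le> \<tau>" using * ge1 order_trans[OF ennreal_leI] by blast
          then have "ennreal (loc_grad Q x) * ennreal \<bar>g x\<bar> \<le> \<tau> * ennreal \<bar>g x\<bar>" by (rule mult_right_mono) simp
          then show ?thesis using True by (simp add: ennreal_mult loc_grad_nonneg)
        qed simp
      qed
    qed
    also have "\<dots> = \<tau> * (\<integral>\<^sup>+x\<in>Q - \<Union>(children Q). ennreal \<bar>g x\<bar> \<partial>lebesgue)"
    proof (rule nn_integral_cmult)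
      show "(\<lambda>x. ennreal \<bar>g x\<bar> * indicator (Q - \<Union>(children Q)) x) \<in> borel_measurable lebesgue"
        by (rule borel_measurable_times_ennreal[OF _ borel_measurable_indicator[OF R]]) measurable
    qed
    finally show ?thesis .
  qed
  also have "(\<integral>\<^sup>+P. (\<integral>\<^sup>+x\<in>P. ennreal (loc_grad Q x * \<bar>g x\<bar>) \<partial>lebesgue) \<partial>count_space (children Q)) \<le>
      (\<integral>\<^sup>+P. \<tau> * (vol P * avg P dual_exp g) + pairing P \<partial>count_space (children Q))"
  proof (rule nn_integral_mono)
    fix P assume "P \<in> space (count_space (children Q))"
    then have P: "P \<in> children Q" by simp
    have PD: "P \<in> \<D>" by (rule children_sub(1)[OF P])
    have [measurable]: "loc_grad P \<in> borel_measurable lebesgue" "P \<in> sets lebesgue"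
      "Gr (loc_sol Q) \<in> borel_measurable lebesgue" "Gr (loc_sol P) \<in> borel_measurable lebesgue"
      by (rule loc_grad_measurable[OF PD], rule \<D>_sets[OF PD], rule loc_sol_measurable[OF Q], rule loc_sol_measurable[OF PD])
    define d where "d x = norm (Gr (loc_sol Q) x - Gr (loc_sol P) x)" for x
    have [measurable]: "d \<in> borel_measurable lebesgue" unfolding d_def[abs_def] by measurable
    have "(\<integral>\<^sup>+x\<in>P. ennreal (loc_grad Q x * \<bar>g x\<bar>) \<partial>lebesgue) \<le>
      (\<integral>\<^sup>+x. ennreal (\<bar>d x\<bar> * \<bar>g x\<bar>) * indicator P x + ennreal (loc_grad P x * \<bar>g x\<bar>) * indicator P x \<partial>lebesgue)"
    proof (rule nn_integral_mono)
      fix x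
      have "loc_grad Q x \<le> d x + loc_grad P x"
        using norm_triangle_sub[of "Gr (loc_sol Q) x" "Gr (loc_sol P) x"] by (simp add: loc_grad_def d_def)
      then have "loc_grad Q x * \<bar>g x\<bar> \<le> d x * \<bar>g x\<bar> + loc_grad P x * \<bar>g x\<bar>"
        unfolding distrib_right[symmetric] by (rule mult_right_mono) simp
      then have "ennreal (loc_grad Q x * \<bar>g x\<bar>) \<le> ennreal (d x * \<bar>g x\<bar>) + ennreal (loc_grad P x * \<bar>g x\<bar>)"
        by (simp add: ennreal_plus[symmetric] loc_grad_nonneg d_def ennreal_leI del: ennreal_plus)
      then show "ennreal (loc_grad Q x * \<bar>g x\<bar>) * indicator P x \<le>
          ennreal (\<bar>d x\<bar> * \<bar>g x\<bar>) * indicator P x + ennreal (loc_grad P x * \<bar>g x\<bar>) * indicator P x"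
        by (cases "x \<in> P") (simp_all add: d_def)
    qed
    also have "\<dots> = (\<integral>\<^sup>+x\<in>P. ennreal (\<bar>d x\<bar> * \<bar>g x\<bar>) \<partial>lebesgue) + pairing P"
      unfolding pairing_def by (rule nn_integral_add) measurable
    also have "(\<integral>\<^sup>+x\<in>P. ennreal (\<bar>d x\<bar> * \<bar>g x\<bar>) \<partial>lebesgue) \<le> vol P * avg P qh d * avg P dual_exp g"
      using \<D>_emeasure_pos[OF PD] qh dual_exp by (intro avg_Hoelder measurable_restrict_space1) auto
    also have "\<dots> \<le> vol P * \<tau> * avg P dual_exp g"
      using children_difference[OF Q P] unfolding \<tau>_def d_def[abs_def] by (intro mult_left_mono mult_right_mono) (auto simp: mult.assoc)
    finally show "(\<integral>\<^sup>+x\<in>P. ennreal (loc_grad Q x * \<bar>g x\<bar>) \<partial>lebesgue) \<le> \<tau> * (vol P * avg P dual_exp g) + pairing P"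
      by (simp add: add_right_mono mult_ac)
  qed
  also have "\<dots> = \<tau> * (\<integral>\<^sup>+P. vol P * avg P dual_exp g \<partial>count_space (children Q)) + (\<integral>\<^sup>+P. pairing P \<partial>count_space (children Q))"
    by (subst nn_integral_add) (auto simp: nn_integral_cmult)
  finally have "pairing Q \<le> \<tau> * ((\<integral>\<^sup>+x\<in>Q - \<Union>(children Q). ennreal \<bar>g x\<bar> \<partial>lebesgue) +
      (\<integral>\<^sup>+P. vol P * avg P dual_exp g \<partial>count_space (children Q))) + (\<integral>\<^sup>+P. pairing P \<partial>count_space (children Q))"
    by (simp add: distrib_left add.assoc add_mono)
  also have "\<dots> \<le> \<tau> * (vol Q * avg Q dual_exp g) + (\<integral>\<^sup>+P. pairing P \<partial>count_space (children Q))"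
    using \<D>_emeasure_pos[OF Q] \<D>_emeasure_pos(1)[OF children_sub(1)] dual_exp(1)
    by (intro add_right_mono mult_left_mono stopping_packing children_countable chs children_disjoint \<D>_sets[OF Q] g) auto
  finally show ?thesis unfolding \<tau>_def .
qed

definition data_avg :: "(real^'n) set \<Rightarrow> ennreal" where
  "data_avg Q = avg (dilate 3 Q) q (\<lambda>x. norm (F x)) + ennreal (3 * side Q) * avg (dilate 3 Q) q' (\<lambda>x. \<bar>f x\<bar>)"

text \<open>The threshold in terms of the data; 1 / q' = 1 / q + 1 / n turns the norm of f into
  an average times the side length.\<close>

lemma data_bound:
  assumes Q: "Q \<in> \<D>"
  shows "ennreal (energy Q powr (1 / q)) \<le> A * (ennreal (3 powr (CARD('n) / q) * measure lebesgue Q powr (1 / q)) * data_avg Q)"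
proof -
  let ?n = "real CARD('n)"
  define e where "e = 3 ^ CARD('n) * measure lebesgue Q"
  have \<mu>: "0 < measure lebesgue Q" by (rule measure_\<D>_pos[OF Q])
  have e: "0 < e" using \<mu> by (simp add: e_def)
  have em: "vol (dilate 3 Q) = ennreal e" using dilate_3_measure[OF Q] by (simp add: e_def)
  have q'0: "0 < q'" using q_bounds by (simp add: q'_def lower_star_def)
  have eq1: "e powr (1 / q) = 3 powr (?n / q) * measure lebesgue Q powr (1 / q)"
    by (simp add: e_def powr_mult powr_realpow[symmetric] powr_powr)
  have eq2: "e powr (1 / q') = e powr (1 / q) * (3 * side Q)"
  proof -
    have "1 / q' = 1 / q + 1 / ?n" using q_bounds by (simp add: q'_def lower_star_def field_simps)
    moreover have "e powr (1 / ?n) = 3 * side Q"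
    proof -
      have "e = (3 * side Q) ^ CARD('n)" using cube_at_measure[OF \<D>_cube_at[OF Q]] by (simp add: e_def power_mult_distrib)
      moreover have b: "0 < 3 * side Q" using \<D>_side_pos[OF Q] by simp
      ultimately have "e powr (1 / ?n) = ((3 * side Q) powr ?n) powr (1 / ?n)" by (simp only: powr_realpow)
      then show ?thesis using b by (simp add: powr_powr)
    qed
    ultimately show ?thesis by (simp add: powr_add)
  qed
  have "ennreal (energy Q powr (1 / q)) \<le> A * (Lp_norm q (loc_dom Q) F + Lp_norm q' (loc_dom Q) f)" by (rule loc_sol_bound[OF Q])
  also have "\<dots> \<le> A * (Lp_norm q (dilate 3 Q) F + Lp_norm q' (dilate 3 Q) f)"
    using q_bounds q'0 by (intro mult_left_mono add_mono Lp_norm_mono_set loc_dom_sub_dilate[OF Q]) auto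
  also have "Lp_norm q (dilate 3 Q) F + Lp_norm q' (dilate 3 Q) f = ennreal (e powr (1 / q)) * data_avg Q"
    unfolding avg_Lp_norm[OF em e] eq2 data_avg_def using \<D>_side_pos[OF Q] by (simp add: ennreal_mult distrib_left mult.assoc)
  finally show ?thesis unfolding eq1 .
qed

lemma threshold_bound:
  assumes Q: "Q \<in> \<D>"
  shows "ennreal (level Q powr (1 / q)) \<le> epowr (maximal_weak_norm Q0 / ennreal \<theta>) (1 / q) * 
    (A * (ennreal (3 powr (CARD('n) / q)) * data_avg Q))"
proof -
  define \<mu> where "\<mu> = measure lebesgue Q"
  have \<mu>: "0 < \<mu>" unfolding \<mu>_def by (rule measure_\<D>_pos[OF Q])
  have N: "epowr (maximal_weak_norm Q0 / ennreal \<theta>) (1 / q) = ennreal ((weak_const / \<theta>) powr (1 / q))"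
    using weak_const_eq \<theta> by (simp add: divide_ennreal epowr_ennreal)
  have "level Q powr (1 / q) = (weak_const / \<theta>) powr (1 / q) * (energy Q powr (1 / q) / \<mu> powr (1 / q))"
  proof -
    have "level Q = (weak_const / \<theta>) * (energy Q / \<mu>)" by (simp add: level_def \<mu>_def)
    then show ?thesis using weak_const_eq(2) \<theta> \<mu> by (simp add: powr_mult powr_divide)
  qed
  then have "ennreal (level Q powr (1 / q)) = ennreal ((weak_const / \<theta>) powr (1 / q)) * (ennreal (energy Q powr (1 / q)) / ennreal (\<mu> powr (1 / q)))"
    using \<mu> by (simp add: divide_ennreal ennreal_mult[symmetric])
  also have "\<dots> \<le> ennreal ((weak_const / \<theta>) powr (1 / q)) *
     (A * (ennreal (3 powr (CARD('n) / q) * \<mu> powr (1 / q)) * data_avg Q) / ennreal (\<mu> powr (1 / q)))"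
    using data_bound[OF Q] unfolding \<mu>_def by (intro mult_left_mono divide_right_mono_ennreal) auto
  also have "A * (ennreal (3 powr (CARD('n) / q) * \<mu> powr (1 / q)) * data_avg Q) / ennreal (\<mu> powr (1 / q)) =
      A * (ennreal (3 powr (CARD('n) / q)) * data_avg Q)"
  proof -
    have "A * (ennreal (3 powr (CARD('n) / q) * \<mu> powr (1 / q)) * data_avg Q) =
        ennreal (\<mu> powr (1 / q)) * (A * (ennreal (3 powr (CARD('n) / q)) * data_avg Q))" by (simp add: ennreal_mult mult_ac)
    moreover have "0 < \<mu> powr (1 / q)" using \<mu> by simp
    ultimately show ?thesis by (simp only: ennreal_cancel_left)
  qed
  finally show ?thesis unfolding N .
qed

end

section \<open>Sums over families of cubes\<close>

lemma nn_integral_count_space_UN: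
  fixes \<phi> :: "'b \<Rightarrow> ennreal"
  assumes A: "countable A" and C: "\<And>i. i \<in> A \<Longrightarrow> countable (C i)"
    and disj: "\<And>i j. i \<in> A \<Longrightarrow> j \<in> A \<Longrightarrow> i \<noteq> j \<Longrightarrow> C i \<inter> C j = {}"
  shows "(\<integral>\<^sup>+i. (\<integral>\<^sup>+P. \<phi> P \<partial>count_space (C i)) \<partial>count_space A) = (\<integral>\<^sup>+P. \<phi> P \<partial>count_space (\<Union>i\<in>A. C i))"
proof -
  let ?U = "\<Union>i\<in>A. C i"
  have U: "countable ?U" using A C by (intro countable_UN)
  have "(\<integral>\<^sup>+P. \<phi> P \<partial>count_space ?U) = (\<integral>\<^sup>+P. (\<integral>\<^sup>+i. \<phi> P * indicator (C i) P \<partial>count_space A) \<partial>count_space ?U)"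
  proof (rule nn_integral_cong)
    fix P assume "P \<in> space (count_space ?U)"
    then obtain i where i: "i \<in> A" "P \<in> C i" by auto
    have "(\<integral>\<^sup>+j. \<phi> P * indicator (C j) P \<partial>count_space A) = (\<integral>\<^sup>+j. \<phi> P * indicator {i} j \<partial>count_space A)"
      using i disj[OF i(1)] by (intro nn_integral_cong) (auto simp: indicator_def)
    also have "\<dots> = \<phi> P * emeasure (count_space A) {i}" using i(1) by (intro nn_integral_cmult_indicator) simp
    also have "\<dots> = \<phi> P" using i(1) by (subst emeasure_count_space_finite) auto
    finally show "\<phi> P = (\<integral>\<^sup>+i. \<phi> P * indicator (C i) P \<partial>count_space A)" by simp
  qed
  also have "\<dots> = (\<integral>\<^sup>+i. (\<integral>\<^sup>+P. \<phi> P * indicator (C i) P \<partial>count_space ?U) \<partial>count_space A)"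
    by (rule nn_integral_count_space_nn_integral[OF A]) simp
  also have "\<dots> = (\<integral>\<^sup>+i. (\<integral>\<^sup>+P. \<phi> P \<partial>count_space (C i)) \<partial>count_space A)"
  proof (rule nn_integral_cong)
    fix i assume "i \<in> space (count_space A)"
    then have i: "i \<in> A" by simp
    have "(\<integral>\<^sup>+P. \<phi> P * indicator (C i) P \<partial>count_space ?U) = (\<integral>\<^sup>+P. \<phi> P * indicator (C i) P \<partial>count_space (C i))"
      using i by (intro nn_integral_count_space_eq) auto
    also have "\<dots> = (\<integral>\<^sup>+P. \<phi> P \<partial>count_space (C i))" by (intro nn_integral_cong) simp
    finally show "(\<integral>\<^sup>+P. \<phi> P * indicator (C i) P \<partial>count_space ?U) = (\<integral>\<^sup>+P. \<phi> P \<partial>count_space (C i))" .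
  qed
  finally show ?thesis ..
qed

lemma nn_integral_count_space_mono_set:
  fixes \<phi> :: "'b \<Rightarrow> ennreal"
  assumes "X \<subseteq> Y" shows "(\<integral>\<^sup>+P. \<phi> P \<partial>count_space X) \<le> (\<integral>\<^sup>+P. \<phi> P \<partial>count_space Y)"
proof -
  have "(\<integral>\<^sup>+P. \<phi> P \<partial>count_space X) = (\<integral>\<^sup>+P. \<phi> P * indicator X P \<partial>count_space X)" by (intro nn_integral_cong) simp
  also have "\<dots> = (\<integral>\<^sup>+P. \<phi> P * indicator X P \<partial>count_space Y)"
    using assms by (intro nn_integral_count_space_eq) auto
  also have "\<dots> \<le> (\<integral>\<^sup>+P. \<phi> P \<partial>count_space Y)" by (intro nn_integral_mono) (auto split: split_indicator)
  finally show ?thesis .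
qed

text \<open>Sums are computed as integrals for the counting measure, where iterated sums can be exchanged, and
  converted at the end.\<close>

lemma nn_integral_count_space_le_infsum:
  fixes \<phi> :: "'b \<Rightarrow> ennreal"
  assumes "countable X" shows "(\<integral>\<^sup>+P. \<phi> P \<partial>count_space X) \<le> (\<Sum>\<^sub>\<infinity>P\<in>X. \<phi> P)"
proof (cases "finite X")
  case True
  then show ?thesis by (simp add: nn_integral_count_space_finite)
next
  case False
  have bij: "bij_betw (from_nat_into X) UNIV X" using bij_betw_from_nat_into[OF assms False] .
  have "(\<integral>\<^sup>+P. \<phi> P \<partial>count_space X) = (\<integral>\<^sup>+k. \<phi> (from_nat_into X k) \<partial>count_space UNIV)"
    by (rule nn_integral_bij_count_space[OF bij, symmetric])
  also have "\<dots> = (\<Sum>k. \<phi> (from_nat_into X k))" by (rule nn_integral_count_space_nat)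
  also have "\<dots> \<le> (\<Sum>\<^sub>\<infinity>P\<in>X. \<phi> P)"
  proof (rule suminf_le_const)
    show "summable (\<lambda>k. \<phi> (from_nat_into X k))" by simp
    fix n
    have inj: "inj_on (from_nat_into X) {..<n}" using bij by (meson bij_betw_imp_inj_on inj_on_subset subset_UNIV)
    have sub: "from_nat_into X ` {..<n} \<subseteq> X" using bij by (auto simp: bij_betw_def)
    have "(\<Sum>k<n. \<phi> (from_nat_into X k)) = sum \<phi> (from_nat_into X ` {..<n})" by (simp add: sum.reindex[OF inj])
    also have "\<dots> \<le> (SUP S\<in>{S. finite S \<and> S \<subseteq> X}. sum \<phi> S)" using sub by (intro SUP_upper) auto
    also have "\<dots> = (\<Sum>\<^sub>\<infinity>P\<in>X. \<phi> P)" by (subst nonneg_infsum_complete) simp_all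
    finally show "(\<Sum>k<n. \<phi> (from_nat_into X k)) \<le> (\<Sum>\<^sub>\<infinity>P\<in>X. \<phi> P)" .
  qed
  finally show ?thesis .
qed

context sparse_setting
begin

section \<open>The constant of the upper exponent\<close>

lemma avg_1_dyad_dilate:
  assumes P: "P \<in> \<D>" and c: "1 \<le> c" "c \<le> 3"
  shows "avg (dilate c P) 1 h \<le> ennreal (3 ^ CARD('n)) * avg (dilate 3 P) 1 h"
proof -
  have c0: "0 < c" using c by simp
  have "avg (dilate c P) 1 h \<le> ennreal ((3 * side P / (c * side P)) ^ CARD('n)) * avg (dilate 3 P) 1 h"
    using c \<D>_side_pos[OF P]
    by (intro avg_1_cube_subset[OF cube_at_dilate[OF \<D>_cube_at[OF P] c0] cube_at_dilate[OF \<D>_cube_at[OF P]]]) auto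
  also have "\<dots> \<le> ennreal (3 ^ CARD('n)) * avg (dilate 3 P) 1 h"
  proof (intro mult_right_mono ennreal_leI power_mono)
    show "3 * side P / (c * side P) \<le> 3" using c \<D>_side_pos[OF P] by (simp add: divide_le_eq)
  qed (use c0 \<D>_side_pos[OF P] in auto)
  finally show ?thesis .
qed

lemma dilate_1: "P \<in> \<D> \<Longrightarrow> dilate 1 P = P"
  by (auto simp: dilate_def)

text \<open>At a common Lebesgue point, the averages over small cubes tend to the value \<delta> of the difference;
  the reverse Hoelder inequality in the limit reads \<delta> \<le> B \<delta>.\<close>

lemma small_B_imp_gradients_equal:
  assumes B: "B < 1" and P: "P \<in> \<D>" "P \<noteq> T"
  shows "AE x in lebesgue. x \<in> T \<longrightarrow> x \<in> loc_dom P \<longrightarrow> Gr u x = Gr (loc_sol P) x"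
  using Gr_Lebesgue_point[OF u] Gr_Lebesgue_point[OF loc_sol_facts(1)[OF P(1)]]
proof eventually_elim
  fix x
  assume Lu: "x \<in> T \<longrightarrow> (\<forall>e>0. \<exists>K. \<forall>k\<ge>K. avg (dilate 3 (dyad m s k x)) 1 (\<lambda>y. norm (Gr u y - Gr u x)) \<le> ennreal e)"
    and Lw: "x \<in> T \<longrightarrow> (\<forall>e>0. \<exists>K. \<forall>k\<ge>K. avg (dilate 3 (dyad m s k x)) 1 (\<lambda>y. norm (Gr (loc_sol P) y - Gr (loc_sol P) x)) \<le> ennreal e)"
  show "x \<in> T \<longrightarrow> x \<in> loc_dom P \<longrightarrow> Gr u x = Gr (loc_sol P) x"
  proof (intro impI)
    assume xT: "x \<in> T" and xU: "x \<in> loc_dom P"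
    obtain b where b: "B = ennreal b" "0 \<le> b" "b < 1" using B by (cases B) (auto simp: ennreal_less_one_iff)
    define d where "d y = norm (Gr u y - Gr (loc_sol P) y)" for y
    define \<delta> where "\<delta> = d x"
    define N where "N = (3 :: real) ^ CARD('n)"
    have N: "0 < N" by (simp add: N_def)
    have [measurable]: "Gr u \<in> borel_measurable lebesgue" "Gr (loc_sol P) \<in> borel_measurable lebesgue"
      using sq_int_measurable[OF Gr_sq_int[OF u]] loc_sol_measurable[OF P(1)] by auto
    have [measurable]: "d \<in> borel_measurable lebesgue" unfolding d_def[abs_def] by measurable
    have "\<delta> \<le> b * \<delta> + e" if e: "0 < e" for e
    proof -
      define e' where "e' = e / (4 * N)"
      have e': "0 < e'" using e N by (simp add: e'_def)
      obtain K1 where K1: "\<And>k. K1 \<le> k \<Longrightarrow> avg (dilate 3 (dyad m s k x)) 1 (\<lambda>y. norm (Gr u y - Gr u x)) \<le> ennreal e'"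
        using Lu xT e' by blast
      obtain K2 where K2: "\<And>k. K2 \<le> k \<Longrightarrow> avg (dilate 3 (dyad m s k x)) 1 (\<lambda>y. norm (Gr (loc_sol P) y - Gr (loc_sol P) x)) \<le> ennreal e'"
        using Lw xT e' by blast
      obtain K3 where K3: "\<And>k. K3 \<le> k \<Longrightarrow> dilate 3 (dyad m s k x) \<subseteq> loc_dom P"
        by (rule dyads_shrink[where m = m and x = x, OF s_pos loc_dom_sub(1)[OF P(1)] xU]) (rule that)
      define k where "k = max K1 (max K2 K3)"
      define R where "R = dyad m s k x"
      have RD: "R \<in> \<D>" using xT unfolding R_def dyads_def by blast
      have R3: "dilate 3 R \<subseteq> loc_dom P" unfolding R_def by (rule K3) (simp add: k_def)
      have "smoothened O0 R \<subseteq> open_cube (center R) (3 * side R)" by (rule smoothened_sub(2)[OF RD])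
      also have "\<dots> \<subseteq> dilate 3 R" using cube_at_dilate[OF \<D>_cube_at[OF RD], of 3] by (simp add: cube_at_def)
      finally have "smoothened O0 R \<inter> \<Omega> \<subseteq> loc_dom P" using R3 by blast
      then have ag: "agree (smoothened O0 R \<inter> \<Omega>) u (loc_sol P)"
        by (rule agree_mono[OF agree_sym[OF loc_sol_facts(2)[OF P(1)]]])
      have D1: "dilate c R \<in> sets lebesgue" "0 < vol (dilate c R)" "vol (dilate c R) < \<infinity>" if "0 < c" for c
        by (rule dilate_\<D>[OF RD that])+
      define dd where "dd y = d y - \<delta>" for y
      have [measurable]: "dd \<in> borel_measurable lebesgue" unfolding dd_def[abs_def] by measurable
      have "avg (dilate 3 R) 1 dd \<le> avg (dilate 3 R) 1 (\<lambda>y. norm (Gr u y - Gr u x)) + avg (dilate 3 R) 1 (\<lambda>y. norm (Gr (loc_sol P) y - Gr (loc_sol P) x))"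
      proof (rule avg_1_triangle[OF D1(1)])
        fix y
        have "\<bar>d y - d x\<bar> \<le> norm ((Gr u y - Gr (loc_sol P) y) - (Gr u x - Gr (loc_sol P) x))"
          unfolding d_def by (rule norm_triangle_ineq3)
        also have "(Gr u y - Gr (loc_sol P) y) - (Gr u x - Gr (loc_sol P) x) = (Gr u y - Gr u x) - (Gr (loc_sol P) y - Gr (loc_sol P) x)" by simp
        also have "norm \<dots> \<le> norm (Gr u y - Gr u x) + norm (Gr (loc_sol P) y - Gr (loc_sol P) x)" by (rule norm_triangle_ineq4)
        finally show "\<bar>dd y\<bar> \<le> \<bar>norm (Gr u y - Gr u x)\<bar> + \<bar>norm (Gr (loc_sol P) y - Gr (loc_sol P) x)\<bar>"
          by (simp add: dd_def \<delta>_def)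
      qed (simp_all)
      also have "\<dots> \<le> ennreal e' + ennreal e'" unfolding R_def by (intro add_mono K1 K2) (simp_all add: k_def)
      also have "\<dots> = ennreal (2 * e')" using e' by (simp add: ennreal_plus[symmetric] del: ennreal_plus)
      finally have dd3: "avg (dilate 3 R) 1 dd \<le> ennreal (2 * e')" .
      \<comment> \<open>The cubes R and 2R both lie in 3R, where the oscillation is small.\<close>
      have dd_c: "avg (dilate c R) 1 dd \<le> ennreal (e / 2)" if "1 \<le> c" "c \<le> 3" for c
      proof -
        have "avg (dilate c R) 1 dd \<le> ennreal N * avg (dilate 3 R) 1 dd" unfolding N_def by (rule avg_1_dyad_dilate[OF RD that])
        also have "\<dots> \<le> ennreal N * ennreal (2 * e')" by (intro mult_left_mono dd3) simp
        also have "\<dots> = ennreal (e / 2)" using N e by (simp add: ennreal_mult[symmetric] e'_def)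
        finally show ?thesis .
      qed
      have \<delta>0: "0 \<le> \<delta>" by (simp add: \<delta>_def d_def)
      have R1: "R \<in> sets lebesgue" "0 < vol R" "vol R < \<infinity>"
        using \<D>_sets[OF RD] \<D>_emeasure_pos[OF RD] by auto
      have "ennreal \<delta> = avg R 1 (\<lambda>y. \<delta>)" unfolding avg_const_norm[OF R1] using \<delta>0 by simp
      also have "\<dots> \<le> avg R 1 d + avg R 1 dd" by (rule avg_1_triangle[OF R1(1)]) (auto simp: dd_def)
      also have "avg R 1 d \<le> avg R qh d"
        using qh by (intro avg_mono_exp R1 measurable_restrict_space1) auto
      also have "avg R qh d \<le> B * avg (dilate 2 R) (1 / 2) d"
        using N_high_estimate[OF \<D>_cube_at[OF RD] dilate_2_sub[OF RD] u loc_sol_facts(1)[OF P(1)] ag] by (simp add: d_def[abs_def])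
      also have "avg (dilate 2 R) (1 / 2) d \<le> avg (dilate 2 R) 1 d"
        by (intro avg_mono_exp D1 measurable_restrict_space1) auto
      also have "avg (dilate 2 R) 1 d \<le> avg (dilate 2 R) 1 (\<lambda>y. \<delta>) + avg (dilate 2 R) 1 dd"
        by (rule avg_1_triangle[OF D1(1)]) (auto simp: dd_def)
      also have "avg (dilate 2 R) 1 (\<lambda>y. \<delta>) = ennreal \<delta>" using avg_const_norm[OF D1, of 2] \<delta>0 by simp
      also have "avg (dilate 2 R) 1 dd \<le> ennreal (e / 2)" by (rule dd_c) auto
      also have "avg R 1 dd \<le> ennreal (e / 2)" using dd_c[of 1] dilate_1[OF RD] by simp
      finally have "ennreal \<delta> \<le> B * (ennreal \<delta> + ennreal (e / 2)) + ennreal (e / 2)"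
        by (simp add: add_mono mult_left_mono)
      also have "\<dots> = ennreal (b * (\<delta> + e / 2) + e / 2)"
        unfolding b(1) using b(2) \<delta>0 e by (simp add: ennreal_mult ennreal_plus)
      finally have "\<delta> \<le> b * (\<delta> + e / 2) + e / 2" using b(2) \<delta>0 e by (subst (asm) ennreal_le_iff) auto
      also have "\<dots> = b * \<delta> + b * (e / 2) + e / 2" by (simp add: distrib_left)
      also have "\<dots> \<le> b * \<delta> + e"
      proof -
        have "b * (e / 2) \<le> 1 * (e / 2)" using b e by (intro mult_right_mono) simp_all
        then show ?thesis by linarith
      qed
      finally show ?thesis .
    qed
    then have "\<delta> \<le> b * \<delta>" by (rule field_le_epsilon)
    then have "(1 - b) * \<delta> \<le> 0" by (simp add: algebra_simps)
    moreover have "0 \<le> \<delta>" by (simp add: \<delta>_def d_def)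
    ultimately have "\<delta> = 0" using b(3) by (simp add: mult_le_0_iff)
    then show "Gr u x = Gr (loc_sol P) x" by (simp add: \<delta>_def d_def)
  qed
qed

text \<open>The gradient of a local solution has mean zero.  If \<nabla>u equals it near small cubes around a
  Lebesgue point, then the value of \<nabla>u at this point is zero.\<close>

lemma small_B_imp_zero:
  assumes B: "B < 1" shows "AE x in lebesgue. x \<in> T \<longrightarrow> Gr u x = 0"
proof -
  have "AE x in lebesgue. \<forall>P\<in>\<D> - {T}. x \<in> T \<longrightarrow> x \<in> loc_dom P \<longrightarrow> Gr u x = Gr (loc_sol P) x"
  proof (subst AE_ball_countable)
    show "countable (\<D> - {T})" using countable_dyads_set by blast
  qed (use small_B_imp_gradients_equal[OF B] in blast)
  then have eq: "AE x in lebesgue. x \<in> T \<longrightarrow> x \<in> loc_dom P \<longrightarrow> Gr u x = Gr (loc_sol P) x" if "P \<in> \<D>" "P \<noteq> T" for P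
    by (rule AE_mp) (use that in auto)
  show ?thesis
    using cube_at_AE_open[OF T_cube] Gr_Lebesgue_point[OF u]
  proof eventually_elim
    fix x assume xo: "x \<in> T \<longleftrightarrow> x \<in> open_cube m s"
      and Lu: "x \<in> T \<longrightarrow> (\<forall>e>0. \<exists>K. \<forall>k\<ge>K. avg (dilate 3 (dyad m s k x)) 1 (\<lambda>y. norm (Gr u y - Gr u x)) \<le> ennreal e)"
    show "x \<in> T \<longrightarrow> Gr u x = 0"
    proof
      assume xT: "x \<in> T"
      define N where "N = (3 :: real) ^ CARD('n)"
      have N: "0 < N" by (simp add: N_def)
      have xO: "x \<in> open_cube m s" using xo xT by blast
      have "norm (Gr u x) \<le> 0 + e" if e: "0 < e" for e
      proof -
        obtain K1 where K1: "\<And>k. K1 \<le> k \<Longrightarrow> avg (dilate 3 (dyad m s k x)) 1 (\<lambda>y. norm (Gr u y - Gr u x)) \<le> ennreal (e / N)"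
          using Lu xT e N by (meson divide_pos_pos)
        obtain K3 where K3: "\<And>k. K3 \<le> k \<Longrightarrow> dilate 3 (dyad m s k x) \<subseteq> open_cube m s"
          by (rule dyads_shrink[where m = m and x = x, OF s_pos open_box xO]) (rule that)
        \<comment> \<open>The successor keeps the cube away from the root, where the local solution would be u.\<close>
        define k where "k = Suc (max K1 K3)"
        define P where "P = dyad m s k x"
        have PD: "P \<in> \<D>" using xT unfolding P_def dyads_def by blast
        have PT: "P \<noteq> T"
        proof
          assume "P = T"
          then have "s / 2 ^ k = s" using cube_at_side[OF cube_at_dyad[OF s_pos, of m k x]] cube_at_side[OF T_cube] by (simp add: P_def)
          then have "(2::real) ^ k = 1" using s_pos by (simp add: field_simps)
          moreover have "1 < (2::real) ^ k" by (rule one_less_power) (simp_all add: k_def)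
          ultimately show False by simp
        qed
        have "dilate 3 P \<subseteq> open_cube m s" unfolding P_def by (rule K3) (simp add: k_def)
        then have P3: "dilate 3 P \<subseteq> T" using T_cube unfolding cube_at_def by blast
        have U3: "loc_dom P \<subseteq> dilate 3 P" by (rule loc_dom_sub_dilate[OF PD])
        have UP: "loc_dom P = smoothened O0 P" using PT by (simp add: loc_dom_def)
        have Us: "loc_dom P \<in> sets lebesgue" using loc_dom_sub(1)[OF PD] by simp
        have D3: "dilate 3 P \<in> sets lebesgue" "0 < vol (dilate 3 P)" "vol (dilate 3 P) < \<infinity>"
          by (rule dilate_\<D>[OF PD]; simp)+
        have Ufin: "vol (loc_dom P) < top"
          using emeasure_mono[OF U3 D3(1)] D3(3) by (simp add: le_less_trans)
        have [measurable]: "Gr u \<in> borel_measurable lebesgue" "Gr (loc_sol P) \<in> borel_measurable lebesgue" "loc_dom P \<in> sets lebesgue"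
          using sq_int_measurable[OF Gr_sq_int[OF u]] loc_sol_measurable[OF PD] Us by auto
        have "(\<integral>y. indicator (loc_dom P) y *\<^sub>R Gr u y \<partial>lebesgue) = (\<integral>y. indicator (loc_dom P) y *\<^sub>R Gr (loc_sol P) y \<partial>lebesgue)"
        proof (rule integral_cong_AE)
          show "AE y in lebesgue. indicator (loc_dom P) y *\<^sub>R Gr u y = indicator (loc_dom P) y *\<^sub>R Gr (loc_sol P) y"
            using eq[OF PD PT]
          proof eventually_elim
            fix y assume "y \<in> T \<longrightarrow> y \<in> loc_dom P \<longrightarrow> Gr u y = Gr (loc_sol P) y"
            then show "indicator (loc_dom P) y *\<^sub>R Gr u y = indicator (loc_dom P) y *\<^sub>R Gr (loc_sol P) y"
              using U3 P3 by (cases "y \<in> loc_dom P") auto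
          qed
        qed (auto intro!: borel_measurable_scaleR borel_measurable_indicator)
        also have "\<dots> = 0" using loc_sol_local[OF PD PT] UP by (simp add: local_solution_def)
        finally have mean: "(\<integral>y. indicator (loc_dom P) y *\<^sub>R Gr u y \<partial>lebesgue) = 0" .
        have Lu1: "Lp 1 (loc_dom P) (Gr u)" by (rule sq_int_Lp_1[OF Gr_sq_int[OF u] Us Ufin])
        have i1: "integrable lebesgue (\<lambda>y. indicator (loc_dom P) y *\<^sub>R Gr u y)"
        proof (rule integrableI_bounded)
          have "(\<integral>\<^sup>+y. ennreal (norm (indicator (loc_dom P) y *\<^sub>R Gr u y)) \<partial>lebesgue) = (\<integral>\<^sup>+y\<in>loc_dom P. ennreal (norm (Gr u y)) \<partial>lebesgue)"
            by (intro nn_integral_cong) (simp add: indicator_def)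
          then show "(\<integral>\<^sup>+y. ennreal (norm (indicator (loc_dom P) y *\<^sub>R Gr u y)) \<partial>lebesgue) < \<infinity>" using Lu1 by (simp add: Lp_def)
        qed (auto intro!: borel_measurable_scaleR borel_measurable_indicator)
        have i2: "integrable lebesgue (\<lambda>y. indicator (loc_dom P) y *\<^sub>R Gr u x)"
          using Ufin by (intro integrable_scaleR_left integrable_real_indicator) auto
        define \<mu> where "\<mu> = measure lebesgue (loc_dom P)"
        have "(\<integral>y. indicator (loc_dom P) y *\<^sub>R Gr u x \<partial>lebesgue) = \<mu> *\<^sub>R Gr u x"
          using Ufin by (simp add: \<mu>_def)
        moreover have "(\<integral>y. indicator (loc_dom P) y *\<^sub>R Gr u y - indicator (loc_dom P) y *\<^sub>R Gr u x \<partial>lebesgue) =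
          0 - (\<integral>y. indicator (loc_dom P) y *\<^sub>R Gr u x \<partial>lebesgue)"
          unfolding Bochner_Integration.integral_diff[OF i1 i2] mean ..
        ultimately have "norm (\<mu> *\<^sub>R Gr u x) = norm (\<integral>y. indicator (loc_dom P) y *\<^sub>R Gr u y - indicator (loc_dom P) y *\<^sub>R Gr u x \<partial>lebesgue)"
          by simp
        then have "ennreal (norm (\<mu> *\<^sub>R Gr u x)) \<le> (\<integral>\<^sup>+y. ennreal (norm (indicator (loc_dom P) y *\<^sub>R Gr u y - indicator (loc_dom P) y *\<^sub>R Gr u x)) \<partial>lebesgue)"
          using integral_norm_bound_ennreal[OF Bochner_Integration.integrable_diff[OF i1 i2]] by simp
        also have "\<dots> \<le> (\<integral>\<^sup>+y\<in>dilate 3 P. ennreal \<bar>norm (Gr u y - Gr u x)\<bar> \<partial>lebesgue)"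
          using U3 by (intro nn_integral_mono) (auto simp: indicator_def)
        also have "\<dots> = vol (dilate 3 P) * avg (dilate 3 P) 1 (\<lambda>y. norm (Gr u y - Gr u x))"
        proof -
          have "0 < 3 ^ CARD('n) * measure lebesgue P" using measure_\<D>_pos[OF PD] by simp
          then show ?thesis unfolding avg_1_eq dilate_3_measure[OF PD] by (rule ennreal_cancel[symmetric])
        qed
        also have "\<dots> \<le> vol (dilate 3 P) * ennreal (e / N)"
          unfolding P_def by (intro mult_left_mono K1) (simp_all add: k_def)
        also have "\<dots> = ennreal (measure lebesgue P * e)"
          using N e measure_\<D>_pos[OF PD] by (simp add: dilate_3_measure[OF PD] ennreal_mult[symmetric] N_def[symmetric])
        finally have "\<mu> * norm (Gr u x) \<le> measure lebesgue P * e"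
          using e measure_\<D>_pos[OF PD] by (subst (asm) ennreal_le_iff) (auto simp: \<mu>_def)
        moreover have "measure lebesgue P \<le> \<mu>"
        proof -
          have "cube_at (open_cube (center P) (side P)) (center P) (side P)" by (rule cube_at_open_cube[OF \<D>_side_pos[OF PD]])
          then have "measure lebesgue P = measure lebesgue (open_cube (center P) (side P))"
            using cube_at_measure[OF \<D>_cube_at[OF PD]] cube_at_measure by metis
          also have "\<dots> \<le> \<mu>" unfolding \<mu>_def
          proof (rule measure_mono_fmeasurable)
            have "open_cube (center P) (side P) \<subseteq> open_cube (center P) (299 / 100 * side P)"
              using \<D>_side_pos[OF PD] by (intro open_cube_mono(1)) simp
            then show "open_cube (center P) (side P) \<subseteq> loc_dom P" using smoothened_sub(3)[OF PD] UP by blast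
            show "loc_dom P \<in> lmeasurable" using Us Ufin by (intro fmeasurableI) auto
          qed simp
          finally show ?thesis .
        qed
        ultimately have "measure lebesgue P * norm (Gr u x) \<le> measure lebesgue P * e"
          using mult_right_mono[of "measure lebesgue P" \<mu> "norm (Gr u x)"] by simp
        then show ?thesis using measure_\<D>_pos[OF PD] by simp
      qed
      then have "norm (Gr u x) \<le> 0" by (rule field_le_epsilon)
      then show "Gr u x = 0" by simp
    qed
  qed
qed

section \<open>Generations of stopping cubes\<close>

primrec gen :: "nat \<Rightarrow> (real^'n) set set" where
  "gen 0 = {T}"
| "gen (Suc k) = (\<Union>Q\<in>gen k. children Q)"

definition \<G> :: "(real^'n) set set" where "\<G> = (\<Union>k. gen k)"

definition cover :: "nat \<Rightarrow> (real^'n) set" where "cover k = \<Union>(gen k)"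

lemma gen_\<D>: "P \<in> gen k \<Longrightarrow> P \<in> \<D>"
  by (cases k) (auto simp: T_in_\<D> intro: children_sub(1))

lemma \<D>_nonempty: "P \<in> \<D> \<Longrightarrow> P \<noteq> {}"
  using \<D>_emeasure_pos(1)[of P] by auto

lemma gen_countable: "countable (gen k)"
  by (induction k) (simp_all add: children_countable)

lemma gen_disjoint: "P \<in> gen k \<Longrightarrow> P' \<in> gen k \<Longrightarrow> P \<noteq> P' \<Longrightarrow> P \<inter> P' = {}"
proof (induction k arbitrary: P P')
  case (Suc k)
  then obtain Q Q' where Q: "Q \<in> gen k" "P \<in> children Q" "Q' \<in> gen k" "P' \<in> children Q'" by auto
  show ?case
  proof (cases "Q = Q'")
    case True
    then show ?thesis using Q Suc.prems(3) children_disjoint by blast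
  next
    case False
    then have "Q \<inter> Q' = {}" by (rule Suc.IH[OF Q(1,3)])
    then show ?thesis using children_sub(2)[OF Q(2)] children_sub(2)[OF Q(4)] by blast
  qed
qed simp

lemma gen_ancestor:
  "P \<in> gen k \<Longrightarrow> j < k \<Longrightarrow> \<exists>R\<in>gen j. \<exists>C\<in>children R. P \<subseteq> C"
proof (induction k arbitrary: P)
  case (Suc k)
  then obtain Q where Q: "Q \<in> gen k" "P \<in> children Q" by auto
  show ?case
  proof (cases "j = k")
    case True
    then show ?thesis using Q by blast
  next
    case False
    then obtain R C where "R \<in> gen j" "C \<in> children R" "Q \<subseteq> C" using Suc.IH[OF Q(1)] Suc.prems by force
    then show ?thesis using children_sub(2)[OF Q(2)] by blast
  qed
qed simp

text \<open>Cubes of one generation are disjoint, so the ancestor of P in the generation of R is R.\<close>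

lemma gen_below:
  assumes P: "P \<in> gen k" and R: "R \<in> gen j" and jk: "j < k" and meet: "P \<inter> R \<noteq> {}"
  shows "P \<subseteq> \<Union>(children R)" "P \<subset> R"
proof -
  obtain R' C where R': "R' \<in> gen j" "C \<in> children R'" "P \<subseteq> C" using gen_ancestor[OF P jk] by blast
  have "C \<subset> R'" by (rule children_strict[OF gen_\<D>[OF R'(1)] R'(2)])
  moreover from this have "R' = R" using gen_disjoint[OF R'(1) R] R'(3) meet by blast
  ultimately show "P \<subseteq> \<Union>(children R)" "P \<subset> R" using R' by blast+
qed

lemma gen_inter: "j \<noteq> k \<Longrightarrow> gen j \<inter> gen k = {}"
proof -
  have *: "gen j \<inter> gen k = {}" if "j < k" for j k
  proof (rule ccontr)
    assume "gen j \<inter> gen k \<noteq> {}"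
    then obtain P where P: "P \<in> gen k" "P \<in> gen j" by blast
    then have "P \<subset> P" using gen_below(2)[OF P that] \<D>_nonempty[OF gen_\<D>[OF P(1)]] by simp
    then show False by blast
  qed
  assume "j \<noteq> k"
  then show ?thesis using *[of j k] *[of k j] by (cases "j < k") auto
qed

lemma \<G>_\<D>: "P \<in> \<G> \<Longrightarrow> P \<in> \<D>" by (auto simp: \<G>_def intro: gen_\<D>)

lemma \<G>_countable: "countable \<G>" by (simp add: \<G>_def gen_countable)

lemma \<G>_essential_disjoint:
  assumes "P \<in> \<G>" "R \<in> \<G>" "P \<noteq> R" shows "(P - \<Union>(children P)) \<inter> (R - \<Union>(children R)) = {}"
proof -
  obtain j k where jk: "P \<in> gen k" "R \<in> gen j" using assms by (auto simp: \<G>_def)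
  consider "j = k" | "j < k" | "k < j" by linarith
  then show ?thesis
  proof cases
    case 1
    then show ?thesis using gen_disjoint[OF jk(1)] jk(2) assms(3) by blast
  next
    case 2
    then show ?thesis using gen_below(1)[OF jk 2] by blast
  next
    case 3
    then show ?thesis using gen_below(1)[OF jk(2,1) 3] by blast
  qed
qed

lemma cover_sets: "cover k \<in> sets lebesgue"
  unfolding cover_def using gen_countable gen_\<D> \<D>_sets by (intro sets.countable_Union) auto

lemma cover_Suc: "cover (Suc k) \<subseteq> cover k"
  using children_sub(2) by (fastforce simp: cover_def)

lemma cover_emeasure_Suc: "vol (cover (Suc k)) \<le> ennreal \<theta> * vol (cover k)"
proof -
  have chs: "\<Union>(children Q) \<in> sets lebesgue" for Q
    using children_countable children_sub(1) \<D>_sets by (intro sets.countable_Union) auto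
  have "cover (Suc k) = (\<Union>Q\<in>gen k. \<Union>(children Q))" by (auto simp: cover_def)
  also have "vol \<dots> \<le> (\<integral>\<^sup>+Q. vol (\<Union>(children Q)) \<partial>count_space (gen k))"
    by (rule emeasure_UN_le_nn_integral_count_space[OF gen_countable chs])
  also have "\<dots> \<le> (\<integral>\<^sup>+Q. ennreal \<theta> * vol Q \<partial>count_space (gen k))"
    using children_small gen_\<D> by (intro nn_integral_mono) simp
  also have "\<dots> = ennreal \<theta> * (\<integral>\<^sup>+Q. vol Q \<partial>count_space (gen k))"
    by (rule nn_integral_cmult) simp
  also have "(\<integral>\<^sup>+Q. vol Q \<partial>count_space (gen k)) = vol (\<Union>Q\<in>gen k. Q)"
    by (rule emeasure_UN_countable[symmetric])
      (use gen_countable gen_\<D> \<D>_sets gen_disjoint in \<open>auto simp: disjoint_family_on_def\<close>)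
  finally show ?thesis by (simp add: cover_def)
qed

lemma cover_null: "(\<lambda>k. vol (cover k)) \<longlonglongrightarrow> 0"
proof -
  have le: "vol (cover k) \<le> ennreal (\<theta> ^ k * measure lebesgue T)" for k
  proof (induction k)
    case 0
    then show ?case using emeasure_measure[OF T_in_\<D>] by (simp add: cover_def)
  next
    case (Suc k)
    have "vol (cover (Suc k)) \<le> ennreal \<theta> * vol (cover k)" by (rule cover_emeasure_Suc)
    also have "\<dots> \<le> ennreal \<theta> * ennreal (\<theta> ^ k * measure lebesgue T)" by (intro mult_left_mono Suc.IH) simp
    also have "\<dots> = ennreal (\<theta> ^ Suc k * measure lebesgue T)" using \<theta> by (simp add: ennreal_mult[symmetric] mult.assoc)
    finally show ?case .
  qed
  have "(\<lambda>k. \<theta> ^ k * measure lebesgue T) \<longlonglongrightarrow> 0 * measure lebesgue T"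
    using \<theta> by (intro tendsto_intros LIMSEQ_realpow_zero) auto
  then have "(\<lambda>k. ennreal (\<theta> ^ k * measure lebesgue T)) \<longlonglongrightarrow> ennreal 0" by (intro tendsto_ennrealI) simp
  then have lim: "(\<lambda>k. ennreal (\<theta> ^ k * measure lebesgue T)) \<longlonglongrightarrow> 0" by simp
  show ?thesis by (rule tendsto_sandwich[OF _ _ tendsto_const lim]) (simp_all add: le)
qed

section \<open>Summing over all generations\<close>

definition step_term :: "(real^'n) set \<Rightarrow> ennreal" where
  "step_term Q = B * (1 + A * ennreal \<Lambda>) * ennreal (3 powr (CARD('n) / q) * level Q powr (1 / q)) * (vol Q * avg Q dual_exp g)"

lemma iterated_step:
  assumes B: "1 \<le> B"
  shows "pairing T \<le> (\<Sum>k<n. \<integral>\<^sup>+Q. step_term Q \<partial>count_space (gen k)) + (\<integral>\<^sup>+Q. pairing Q \<partial>count_space (gen n))"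
proof (induction n)
  case 0
  show ?case by (simp add: nn_integral_count_space_finite)
next
  case (Suc n)
  have "(\<integral>\<^sup>+Q. pairing Q \<partial>count_space (gen n)) \<le> (\<integral>\<^sup>+Q. step_term Q + (\<integral>\<^sup>+P. pairing P \<partial>count_space (children Q)) \<partial>count_space (gen n))"
    using stopping_step[OF B] gen_\<D> by (intro nn_integral_mono) (simp add: step_term_def)
  also have "\<dots> = (\<integral>\<^sup>+Q. step_term Q \<partial>count_space (gen n)) + (\<integral>\<^sup>+Q. (\<integral>\<^sup>+P. pairing P \<partial>count_space (children Q)) \<partial>count_space (gen n))"
    by (rule nn_integral_add) simp_all
  also have "(\<integral>\<^sup>+Q. (\<integral>\<^sup>+P. pairing P \<partial>count_space (children Q)) \<partial>count_space (gen n)) = (\<integral>\<^sup>+P. pairing P \<partial>count_space (\<Union>Q\<in>gen n. children Q))"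
  proof (rule nn_integral_count_space_UN[OF gen_countable children_countable])
    fix Q Q' assume Q: "Q \<in> gen n" "Q' \<in> gen n" "Q \<noteq> Q'"
    show "children Q \<inter> children Q' = {}"
    proof (rule ccontr)
      assume "children Q \<inter> children Q' \<noteq> {}"
      then obtain P where "P \<in> children Q" "P \<in> children Q'" by blast
      then have "P \<subseteq> Q \<inter> Q'" "P \<noteq> {}" using children_sub(1,2) \<D>_nonempty by blast+
      then show False using gen_disjoint[OF Q] by blast
    qed
  qed
  finally have step: "(\<integral>\<^sup>+Q. pairing Q \<partial>count_space (gen n)) \<le> (\<integral>\<^sup>+Q. step_term Q \<partial>count_space (gen n)) + (\<integral>\<^sup>+P. pairing P \<partial>count_space (gen (Suc n)))" by simp
  note Suc.IH
  also have "(\<Sum>k<n. \<integral>\<^sup>+Q. step_term Q \<partial>count_space (gen k)) + (\<integral>\<^sup>+Q. pairing Q \<partial>count_space (gen n)) \<le>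
    (\<Sum>k<n. \<integral>\<^sup>+Q. step_term Q \<partial>count_space (gen k)) + ((\<integral>\<^sup>+Q. step_term Q \<partial>count_space (gen n)) + (\<integral>\<^sup>+P. pairing P \<partial>count_space (gen (Suc n))))"
    by (rule add_left_mono[OF step])
  finally show ?case by (simp add: add.assoc)
qed

lemma steps_le: "(\<Sum>k<n. \<integral>\<^sup>+Q. step_term Q \<partial>count_space (gen k)) \<le> (\<integral>\<^sup>+Q. step_term Q \<partial>count_space \<G>)"
proof -
  have "(\<Sum>k<n. \<integral>\<^sup>+Q. step_term Q \<partial>count_space (gen k)) = (\<integral>\<^sup>+k. (\<integral>\<^sup>+Q. step_term Q \<partial>count_space (gen k)) \<partial>count_space {..<n})"
    by (simp add: nn_integral_count_space_finite)
  also have "\<dots> = (\<integral>\<^sup>+Q. step_term Q \<partial>count_space (\<Union>k<n. gen k))"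
    by (rule nn_integral_count_space_UN[OF _ gen_countable gen_inter]) auto
  also have "\<dots> \<le> (\<integral>\<^sup>+Q. step_term Q \<partial>count_space \<G>)"
    by (rule nn_integral_count_space_mono_set) (auto simp: \<G>_def)
  finally show ?thesis .
qed

lemma A_finite: "A < top"
proof -
  obtain N0 where "N0 < top" "lower_estimate O0 \<Omega> a q N0" using lower by (auto simp: admissible_lower_def)
  then show ?thesis unfolding A_def N_low_def by (blast intro: le_less_trans Inf_lower)
qed

text \<open>The lower exponent bounds the gradient of the local solution in \<open>L\<^sup>q\<close>, and Hoelder's inequality passes
  to the first power.\<close>

lemma pairing_le:
  assumes Q: "Q \<in> \<D>" and K: "0 \<le> K" "AE x in lebesgue. x \<in> T \<longrightarrow> \<bar>g x\<bar> \<le> K"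
  shows "pairing Q \<le> ennreal K * (A * ennreal (3 powr (CARD('n) / q))) * (vol Q * data_avg Q)"
proof -
  define \<mu> where "\<mu> = measure lebesgue Q"
  have \<mu>: "0 < \<mu>" unfolding \<mu>_def by (rule measure_\<D>_pos[OF Q])
  have em: "vol Q = ennreal \<mu>" unfolding \<mu>_def by (rule emeasure_measure[OF Q])
  have [measurable]: "loc_grad Q \<in> borel_measurable lebesgue" "Q \<in> sets lebesgue" using loc_grad_measurable[OF Q] \<D>_sets[OF Q] by auto
  have "pairing Q \<le> (\<integral>\<^sup>+x. ennreal K * (ennreal \<bar>loc_grad Q x\<bar> * indicator Q x) \<partial>lebesgue)"
    unfolding pairing_def
  proof (rule nn_integral_mono_AE)
    show "AE x in lebesgue. ennreal (loc_grad Q x * \<bar>g x\<bar>) * indicator Q x \<le> ennreal K * (ennreal \<bar>loc_grad Q x\<bar> * indicator Q x)"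
      using K(2)
    proof eventually_elim
      fix x assume g: "x \<in> T \<longrightarrow> \<bar>g x\<bar> \<le> K"
      show "ennreal (loc_grad Q x * \<bar>g x\<bar>) * indicator Q x \<le> ennreal K * (ennreal \<bar>loc_grad Q x\<bar> * indicator Q x)"
      proof (cases "x \<in> Q")
        case True
        then have "\<bar>g x\<bar> \<le> K" using g \<D>_sub_T[OF Q] by blast
        then have "loc_grad Q x * \<bar>g x\<bar> \<le> K * \<bar>loc_grad Q x\<bar>" using loc_grad_nonneg[of Q x] by (subst mult.commute) (simp add: mult_right_mono)
        then have "ennreal (loc_grad Q x * \<bar>g x\<bar>) \<le> ennreal K * ennreal \<bar>loc_grad Q x\<bar>" using K(1) by (simp add: ennreal_mult[symmetric] ennreal_leI)
        then show ?thesis using True by simp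
      qed simp
    qed
  qed
  also have "\<dots> = ennreal K * (\<integral>\<^sup>+x\<in>Q. ennreal \<bar>loc_grad Q x\<bar> \<partial>lebesgue)" by (rule nn_integral_cmult) measurable
  also have "(\<integral>\<^sup>+x\<in>Q. ennreal \<bar>loc_grad Q x\<bar> \<partial>lebesgue) = ennreal \<mu> * avg Q 1 (loc_grad Q)"
    unfolding avg_1_eq em by (rule ennreal_cancel[OF \<mu>, symmetric])
  also have "avg Q 1 (loc_grad Q) \<le> avg Q q (loc_grad Q)"
    using q_bounds \<D>_emeasure_pos[OF Q] by (intro avg_mono_exp measurable_restrict_space1) auto
  also have "avg Q q (loc_grad Q) \<le> A * ennreal (3 powr (CARD('n) / q)) * data_avg Q"
  proof -
    define \<nu> where "\<nu> = \<mu> powr (1 / q)"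
    have \<nu>: "0 < \<nu>" using \<mu> by (simp add: \<nu>_def)
    have "ennreal \<nu> * avg Q q (loc_grad Q) = Lp_norm q Q (Gr (loc_sol Q))"
      unfolding avg_Lp_norm[OF em \<mu>] \<nu>_def by (simp add: loc_grad_def[abs_def])
    also have "\<dots> \<le> Lp_norm q UNIV (Gr (loc_sol Q))" using q_bounds by (intro Lp_norm_mono_set) auto
    also have "\<dots> = ennreal (energy Q powr (1 / q))"
      using energy_eq[OF Q] by (simp add: Lp_norm_def loc_grad_def epowr_ennreal)
    also have "\<dots> \<le> A * (ennreal (3 powr (CARD('n) / q) * \<nu>) * data_avg Q)" using data_bound[OF Q] by (simp add: \<nu>_def \<mu>_def)
    also have "\<dots> = ennreal \<nu> * (A * ennreal (3 powr (CARD('n) / q)) * data_avg Q)"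
      using \<nu> by (simp add: ennreal_mult mult_ac)
    finally have "ennreal \<nu> * avg Q q (loc_grad Q) / ennreal \<nu> \<le> ennreal \<nu> * (A * ennreal (3 powr (CARD('n) / q)) * data_avg Q) / ennreal \<nu>"
      by (rule divide_right_mono_ennreal)
    then show ?thesis unfolding ennreal_cancel_left[OF \<nu>] .
  qed
  finally have "pairing Q \<le> ennreal K * (ennreal \<mu> * (A * ennreal (3 powr (CARD('n) / q)) * data_avg Q))"
    by (simp add: mult_left_mono)
  then show ?thesis unfolding em by (simp add: mult_ac)
qed

text \<open>A majorant of the averaged data that does not depend on the cube.  For q' \<le> 1 the function f
  vanishes, and the root of its maximal function would not be integrable in general.\<close>

definition data_maximal :: "real^'n \<Rightarrow> ennreal" where
  "data_maximal x = epowr (dyadic_maximal Q0 (\<lambda>y. indicator \<Omega> y * norm (F y) powr q) x) (1 / q) +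
    ennreal (3 * s) * (if q' \<le> 1 then 0 else epowr (dyadic_maximal Q0 (\<lambda>y. indicator \<Omega> y * \<bar>f y\<bar> powr q') x) (1 / q'))"

lemma dilate_3_AE:
  assumes "Q \<in> \<D>" shows "AE y in lebesgue. y \<in> dilate 3 Q \<longrightarrow> y \<in> \<Omega>"
  using cube_at_AE_open[OF cube_at_dilate[OF \<D>_cube_at[OF assms], of 3, simplified]]
  by eventually_elim (use dilate_3_open[OF assms] in blast)

lemma avg_le_maximal_root:
  fixes h :: "real^'n \<Rightarrow> real"
  assumes Q: "Q \<in> \<D>" "x \<in> Q" and r: "0 < r"
  shows "avg (dilate 3 Q) r h \<le> epowr (dyadic_maximal Q0 (\<lambda>y. indicator \<Omega> y * \<bar>h y\<bar> powr r) x) (1 / r)"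
proof -
  obtain k z where kz: "Q = dyad m s k z" "z \<in> T" using Q(1) by (rule dyadsE)
  have "avg (dilate 3 Q) 1 (\<lambda>y. \<bar>h y\<bar> powr r) = avg (dilate 3 Q) 1 (\<lambda>y. indicator \<Omega> y * \<bar>h y\<bar> powr r)"
  proof (rule avg_cong_AE)
    show "AE y in lebesgue. y \<in> dilate 3 Q \<longrightarrow> \<bar>\<bar>h y\<bar> powr r\<bar> = \<bar>indicator \<Omega> y * \<bar>h y\<bar> powr r\<bar>"
      using dilate_3_AE[OF Q(1)] by eventually_elim auto
  qed
  also have "\<dots> \<le> dyadic_maximal Q0 (\<lambda>y. indicator \<Omega> y * \<bar>h y\<bar> powr r) x"
    unfolding kz(1) by (rule avg_le_dyadic_maximal[OF Q0 kz(2)]) (use Q(2) kz in simp)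
  finally show ?thesis unfolding avg_eq_epowr_avg_1[of _ r h] using r by (intro epowr_mono) auto
qed

lemma data_avg_le_data_maximal:
  assumes Q: "Q \<in> \<D>" "x \<in> Q" shows "data_avg Q \<le> data_maximal x"
  unfolding data_avg_def data_maximal_def
proof (intro add_mono mult_mono)
  show "avg (dilate 3 Q) q (\<lambda>x. norm (F x)) \<le> epowr (dyadic_maximal Q0 (\<lambda>y. indicator \<Omega> y * norm (F y) powr q) x) (1 / q)"
    using avg_le_maximal_root[OF Q q_bounds(3), of "\<lambda>x. norm (F x)"] by simp
  obtain k z where "side Q = s / 2 ^ k" using Q(1) by (rule \<D>_cube)
  then have "side Q \<le> s" using s_pos by (simp add: divide_le_eq)
  then show "ennreal (3 * side Q) \<le> ennreal (3 * s)" by (intro ennreal_leI) simp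
  show "avg (dilate 3 Q) q' (\<lambda>x. \<bar>f x\<bar>) \<le>
    (if q' \<le> 1 then 0 else epowr (dyadic_maximal Q0 (\<lambda>y. indicator \<Omega> y * \<bar>f y\<bar> powr q') x) (1 / q'))"
  proof (cases "q' \<le> 1")
    case True
    have "avg (dilate 3 Q) q' (\<lambda>x. \<bar>f x\<bar>) = avg (dilate 3 Q) q' (\<lambda>x. 0)"
    proof (rule avg_cong_AE)
      have "AE x in lebesgue. x \<in> \<Omega> \<longrightarrow> f x = 0"
        using f(3)[OF True] sets_\<Omega> by (simp add: AE_restrict_space_iff)
      with dilate_3_AE[OF Q(1)] show "AE x in lebesgue. x \<in> dilate 3 Q \<longrightarrow> \<bar>\<bar>f x\<bar>\<bar> = \<bar>0\<bar>"
        by eventually_elim auto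
    qed
    also have "\<dots> = 0" by (simp add: avg_def)
    finally show ?thesis using True by simp
  next
    case False
    then show ?thesis using avg_le_maximal_root[OF Q, of q' "\<lambda>x. \<bar>f x\<bar>"] by simp
  qed
qed simp_all

lemma data_maximal_measurable: "data_maximal \<in> borel_measurable lebesgue"
proof -
  have [measurable]: "dyadic_maximal Q0 h \<in> borel_measurable lebesgue" for h by (rule dyadic_maximal_measurable[OF Q0])
  show ?thesis unfolding data_maximal_def[abs_def] by (cases "q' \<le> 1") (simp_all, measurable)
qed

lemma Lp_loc_indicator_measurable:
  fixes h :: "real^'n \<Rightarrow> 'b::real_normed_vector"
  assumes "Lp_loc r \<Omega> h" shows "(\<lambda>y. indicator \<Omega> y * norm (h y) powr r) \<in> borel_measurable lebesgue"
proof -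
  have [measurable]: "h \<in> borel_measurable (lebesgue_on \<Omega>)" using assms by (simp add: Lp_loc_def)
  have "(\<lambda>y. norm (h y) powr r) \<in> borel_measurable (lebesgue_on \<Omega>)" by measurable
  then have "(\<lambda>y. indicator \<Omega> y *\<^sub>R (norm (h y) powr r)) \<in> borel_measurable lebesgue"
    using sets_\<Omega> by (subst (asm) borel_measurable_restrict_space_iff) simp_all
  then show ?thesis by simp
qed

lemma maximal_data_root_integrable:
  fixes h :: "real^'n \<Rightarrow> 'b::real_normed_vector"
  assumes h: "Lp_loc r \<Omega> h" "(\<integral>\<^sup>+x\<in>\<Omega>. ennreal (norm (h x) powr r) \<partial>lebesgue) < top" and r: "1 < r"
  shows "(\<integral>\<^sup>+x\<in>T. epowr (dyadic_maximal Q0 (\<lambda>y. indicator \<Omega> y * norm (h y) powr r) x) (1 / r) \<partial>lebesgue) < top"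
proof (rule maximal_root_integrable[OF Q0 Lp_loc_indicator_measurable[OF h(1)] _ r])
  have "(\<integral>\<^sup>+x. ennreal \<bar>indicator \<Omega> x * norm (h x) powr r\<bar> \<partial>lebesgue) = (\<integral>\<^sup>+x\<in>\<Omega>. ennreal (norm (h x) powr r) \<partial>lebesgue)"
    by (intro nn_integral_cong) (simp add: indicator_def)
  then show "(\<integral>\<^sup>+x. ennreal \<bar>indicator \<Omega> x * norm (h x) powr r\<bar> \<partial>lebesgue) < top" using h(2) by simp
qed (use \<D>_sets[OF T_in_\<D>] \<D>_emeasure_pos(2)[OF T_in_\<D>] in auto)

lemma data_maximal_integrable: "(\<integral>\<^sup>+x\<in>T. data_maximal x \<partial>lebesgue) < top"
proof -
  have [measurable]: "dyadic_maximal Q0 h \<in> borel_measurable lebesgue" for h by (rule dyadic_maximal_measurable[OF Q0])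
  have [measurable]: "T \<in> sets lebesgue" by (rule \<D>_sets[OF T_in_\<D>])
  define a where "a x = epowr (dyadic_maximal Q0 (\<lambda>y. indicator \<Omega> y * norm (F y) powr q) x) (1 / q) * indicator T x" for x
  define b where "b x = (if q' \<le> 1 then 0 else epowr (dyadic_maximal Q0 (\<lambda>y. indicator \<Omega> y * \<bar>f y\<bar> powr q') x) (1 / q')) * indicator T x" for x
  have [measurable]: "a \<in> borel_measurable lebesgue" unfolding a_def[abs_def] by measurable
  have [measurable]: "b \<in> borel_measurable lebesgue"
    unfolding b_def[abs_def] by (cases "q' \<le> 1") (simp_all, measurable)
  have "(\<integral>\<^sup>+x\<in>T. data_maximal x \<partial>lebesgue) = (\<integral>\<^sup>+x. a x + ennreal (3 * s) * b x \<partial>lebesgue)"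
    by (intro nn_integral_cong) (simp add: data_maximal_def a_def b_def distrib_right mult.assoc)
  also have "\<dots> = (\<integral>\<^sup>+x. a x \<partial>lebesgue) + ennreal (3 * s) * (\<integral>\<^sup>+x. b x \<partial>lebesgue)"
    by (simp add: nn_integral_add nn_integral_cmult)
  also have "\<dots> < top"
  proof -
    have "(\<integral>\<^sup>+x. a x \<partial>lebesgue) < top" unfolding a_def using maximal_data_root_integrable[OF F q_bounds(1)] .
    moreover have "(\<integral>\<^sup>+x. b x \<partial>lebesgue) < top"
    proof (cases "q' \<le> 1")
      case False
      then show ?thesis unfolding b_def using maximal_data_root_integrable[of q' f] f(1,2) by simp
    qed (simp add: b_def)
    ultimately show ?thesis by (simp add: less_top[symmetric] ennreal_mult_eq_top_iff)
  qed
  finally show ?thesis .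
qed

text \<open>The cubes of generation n cover a set whose measure decays geometrically, and the majorant is
  integrable.\<close>

lemma remainder_small:
  assumes K: "0 \<le> K" "AE x in lebesgue. x \<in> T \<longrightarrow> \<bar>g x\<bar> \<le> K" and e: "0 < e"
  shows "\<exists>n. (\<integral>\<^sup>+Q. pairing Q \<partial>count_space (gen n)) \<le> ennreal e"
proof -
  define c where "c = enn2real (ennreal K * (A * ennreal (3 powr (CARD('n) / q))))"
  have c: "ennreal K * (A * ennreal (3 powr (CARD('n) / q))) = ennreal c" "0 \<le> c"
    using A_finite by (simp_all add: c_def ennreal_mult_less_top)
  have T0: "cover 0 \<subseteq> T" by (simp add: cover_def)
  have "\<exists>n. (\<integral>\<^sup>+x\<in>cover n. data_maximal x \<partial>lebesgue) < ennreal (e / (c + 1))"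
    by (rule nn_integral_decseq_null[OF data_maximal_measurable \<D>_sets[OF T_in_\<D>] data_maximal_integrable cover_sets cover_Suc T0 cover_null])
      (use e c in simp)
  then obtain n where n: "(\<integral>\<^sup>+x\<in>cover n. data_maximal x \<partial>lebesgue) < ennreal (e / (c + 1))" by blast
  have "(\<integral>\<^sup>+Q. pairing Q \<partial>count_space (gen n)) \<le> (\<integral>\<^sup>+Q. ennreal c * (\<integral>\<^sup>+x\<in>Q. data_maximal x \<partial>lebesgue) \<partial>count_space (gen n))"
  proof (rule nn_integral_mono)
    fix Q assume "Q \<in> space (count_space (gen n))"
    then have Q: "Q \<in> \<D>" by (simp add: gen_\<D>)
    have "pairing Q \<le> ennreal c * (vol Q * data_avg Q)" using pairing_le[OF Q K] unfolding c(1) .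
    also have "vol Q * data_avg Q = (\<integral>\<^sup>+x. data_avg Q * indicator Q x \<partial>lebesgue)"
      using \<D>_sets[OF Q] by (subst nn_integral_cmult_indicator) (simp_all add: mult.commute)
    also have "\<dots> \<le> (\<integral>\<^sup>+x\<in>Q. data_maximal x \<partial>lebesgue)"
      using data_avg_le_data_maximal[OF Q] by (intro nn_integral_mono) (auto simp: indicator_def)
    finally show "pairing Q \<le> ennreal c * (\<integral>\<^sup>+x\<in>Q. data_maximal x \<partial>lebesgue)" by (simp add: mult_left_mono)
  qed
  also have "\<dots> = ennreal c * (\<integral>\<^sup>+Q. (\<integral>\<^sup>+x\<in>Q. data_maximal x \<partial>lebesgue) \<partial>count_space (gen n))"
    by (rule nn_integral_cmult) simp
  also have "(\<integral>\<^sup>+Q. (\<integral>\<^sup>+x\<in>Q. data_maximal x \<partial>lebesgue) \<partial>count_space (gen n)) = (\<integral>\<^sup>+x\<in>cover n. data_maximal x \<partial>lebesgue)"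
  proof -
    have "(\<integral>\<^sup>+x\<in>cover n. data_maximal x \<partial>lebesgue) = (\<integral>\<^sup>+x\<in>cover n - \<Union>(gen n). data_maximal x \<partial>lebesgue) +
        (\<integral>\<^sup>+Q. (\<integral>\<^sup>+x\<in>Q. data_maximal x \<partial>lebesgue) \<partial>count_space (gen n))"
      by (rule nn_integral_stopping_split[OF gen_countable _ _ gen_disjoint cover_sets data_maximal_measurable])
        (auto simp: cover_def gen_\<D> \<D>_sets)
    then show ?thesis by (simp add: cover_def)
  qed
  also have "ennreal c * (\<integral>\<^sup>+x\<in>cover n. data_maximal x \<partial>lebesgue) \<le> ennreal c * ennreal (e / (c + 1))"
    by (rule mult_left_mono[OF less_imp_le[OF n]]) simp
  also have "\<dots> \<le> ennreal e"
    using c(2) e by (simp add: ennreal_mult[symmetric] ennreal_leI divide_le_eq mult_right_mono algebra_simps)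
  finally show ?thesis by blast
qed

definition sparse_const :: ennreal where
  "sparse_const = ennreal (9 powr (CARD('n) / q)) * (A * ennreal \<Lambda> + 1) * A * B *
             epowr (maximal_weak_norm Q0 / ennreal \<theta>) (1 / q)"

lemma step_term_le:
  assumes Q: "Q \<in> \<D>"
  shows "step_term Q \<le> sparse_const * (vol Q * data_avg Q * avg Q dual_exp g)"
proof -
  define \<alpha> where "\<alpha> = ennreal (3 powr (CARD('n) / q))"
  define \<nu> where "\<nu> = epowr (maximal_weak_norm Q0 / ennreal \<theta>) (1 / q)"
  \<comment> \<open>One factor comes from the stopping step, the other from the triples in the threshold.\<close>
  have \<alpha>2: "\<alpha> * \<alpha> = ennreal (9 powr (CARD('n) / q))"
    by (simp add: \<alpha>_def ennreal_mult[symmetric] powr_mult[symmetric])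
  have t: "ennreal (level Q powr (1 / q)) \<le> \<nu> * (A * (\<alpha> * data_avg Q))"
    using threshold_bound[OF Q] by (simp add: \<alpha>_def \<nu>_def)
  have "step_term Q = (B * (1 + A * ennreal \<Lambda>) * \<alpha>) * ennreal (level Q powr (1 / q)) * (vol Q * avg Q dual_exp g)"
    by (simp add: step_term_def \<alpha>_def ennreal_mult mult.assoc)
  also have "\<dots> \<le> (B * (1 + A * ennreal \<Lambda>) * \<alpha>) * (\<nu> * (A * (\<alpha> * data_avg Q))) * (vol Q * avg Q dual_exp g)"
    by (intro mult_right_mono mult_left_mono t) simp_all
  also have "\<dots> = (\<alpha> * \<alpha>) * (A * ennreal \<Lambda> + 1) * A * B * \<nu> * (vol Q * data_avg Q * avg Q dual_exp g)"
    by (simp only: mult_ac add.commute)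
  finally show ?thesis unfolding \<alpha>2 \<nu>_def sparse_const_def .
qed

lemma sparse_sum:
  assumes B: "1 \<le> B" and K: "0 \<le> K" "AE x in lebesgue. x \<in> T \<longrightarrow> \<bar>g x\<bar> \<le> K"
  shows "pairing T \<le> sparse_const *
    (\<integral>\<^sup>+Q. vol Q * data_avg Q * avg Q dual_exp g \<partial>count_space \<G>)"
proof -
  have "pairing T \<le> (\<integral>\<^sup>+Q. step_term Q \<partial>count_space \<G>)"
  proof (rule ennreal_le_epsilon)
    fix e :: real assume "0 < e"
    then obtain n where n: "(\<integral>\<^sup>+Q. pairing Q \<partial>count_space (gen n)) \<le> ennreal e" using remainder_small[OF K] by blast
    have "pairing T \<le> (\<Sum>k<n. \<integral>\<^sup>+Q. step_term Q \<partial>count_space (gen k)) + (\<integral>\<^sup>+Q. pairing Q \<partial>count_space (gen n))" by (rule iterated_step[OF B])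
    also have "\<dots> \<le> (\<integral>\<^sup>+Q. step_term Q \<partial>count_space \<G>) + ennreal e" by (rule add_mono[OF steps_le n])
    finally show "pairing T \<le> (\<integral>\<^sup>+Q. step_term Q \<partial>count_space \<G>) + ennreal e" .
  qed
  also have "\<dots> \<le> (\<integral>\<^sup>+Q. sparse_const * (vol Q * data_avg Q * avg Q dual_exp g) \<partial>count_space \<G>)"
    using step_term_le[OF \<G>_\<D>] by (intro nn_integral_mono) simp
  also have "\<dots> = sparse_const *
    (\<integral>\<^sup>+Q. vol Q * data_avg Q * avg Q dual_exp g \<partial>count_space \<G>)"
    by (rule nn_integral_cmult) simp
  finally show ?thesis .
qed

section \<open>The sparse family\<close>

text \<open>The half-open dyadic cubes are replaced by their interiors, so that the triples stay inside
  the triple of Q0 whichever of its faces belong to it.\<close>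

definition open_core :: "(real^'n) set \<Rightarrow> (real^'n) set" where
  "open_core P = open_cube (center P) (side P)"

lemma open_core:
  assumes P: "P \<in> \<D>"
  shows "cube_at (open_core P) (center P) (side P)" "open_core P \<subseteq> P" "is_cube (open_core P)"
    "vol (open_core P) = vol P" "side (open_core P) = side P"
    "avg (open_core P) r h = avg P r h" "avg (dilate 3 (open_core P)) r h = avg (dilate 3 P) r h"
    "dilate 3 (open_core P) \<subseteq> \<Omega>"
proof -
  note r = \<D>_side_pos[OF P] and c = \<D>_cube_at[OF P]
  show c': "cube_at (open_core P) (center P) (side P)" unfolding open_core_def by (rule cube_at_open_cube[OF r])
  show "open_core P \<subseteq> P" using c by (simp add: open_core_def cube_at_def)
  show "is_cube (open_core P)" unfolding open_core_def by (rule is_cube_open_cube[OF r])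
  show "vol (open_core P) = vol P" unfolding cube_at_emeasure[OF c'] cube_at_emeasure[OF c] ..
  show "side (open_core P) = side P" by (rule cube_at_side[OF c'])
  show "avg (open_core P) r h = avg P r h" unfolding open_core_def by (rule cube_at_avg[OF c, symmetric])
  show "avg (dilate 3 (open_core P)) r h = avg (dilate 3 P) r h"
    unfolding cube_at_avg[OF cube_at_dilate[OF c', of 3, simplified]] cube_at_avg[OF cube_at_dilate[OF c, of 3, simplified]] ..
  show "dilate 3 (open_core P) \<subseteq> \<Omega>"
    unfolding open_core_def dilate_open_cube[OF r zero_less_numeral] by (rule dilate_3_open[OF P])
qed

lemma open_core_inj: "inj_on open_core \<D>"
proof (rule inj_onI)
  fix P R assume P: "P \<in> \<D>" and R: "R \<in> \<D>" and eq: "open_core P = open_core R"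
  have "open_core P \<noteq> {}" using open_core(4)[OF P] \<D>_emeasure_pos(1)[OF P] by auto
  then have "P \<inter> R \<noteq> {}" using open_core(2)[OF P] open_core(2)[OF R] eq by blast
  then have "P \<subseteq> R \<or> R \<subseteq> P" by (rule dyads_nested_or_disjoint[OF P R])
  moreover have "side P = side R" using open_core(5)[OF P] open_core(5)[OF R] eq by simp
  ultimately show "P = R"
    using strict_sub_side[OF P R] strict_sub_side[OF R P] \<D>_side_pos[OF P] by (auto simp: psubset_eq)
qed

text \<open>The children cover at most the fraction \<theta>, so each cube minus its children keeps the fraction
  1 - \<theta>.\<close>

lemma open_cores_sparse: "sparse_family (1 - \<theta>) (open_core ` \<G>)"
proof -
  define \<kappa> where "\<kappa> = the_inv_into \<G> open_core"
  have inj: "inj_on open_core \<G>" by (rule inj_on_subset[OF open_core_inj subsetI[OF \<G>_\<D>]])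
  have \<kappa>: "\<kappa> (open_core P) = P" if "P \<in> \<G>" for P unfolding \<kappa>_def by (rule the_inv_into_f_f[OF inj that])
  define E where "E Q = Q - \<Union>(children (\<kappa> Q))" for Q
  have chs: "\<Union>(children P) \<in> sets lebesgue" for P
    using children_countable children_sub(1) \<D>_sets by (intro sets.countable_Union) auto
  have big: "ennreal (1 - \<theta>) * vol (open_core P) \<le> vol (E (open_core P))"
    and Es: "E (open_core P) \<in> sets lebesgue" if P: "P \<in> \<G>" for P
  proof -
    have PD: "P \<in> \<D>" by (rule \<G>_\<D>[OF P])
    have os: "open_core P \<in> sets lebesgue" by (rule cube_at_sets[OF open_core(1)[OF PD]])
    show Es: "E (open_core P) \<in> sets lebesgue" unfolding E_def using os chs by auto
    define \<mu> where "\<mu> = measure lebesgue P"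
    have \<mu>: "0 < \<mu>" unfolding \<mu>_def by (rule measure_\<D>_pos[OF PD])
    have em: "vol (open_core P) = ennreal \<mu>" unfolding open_core(4)[OF PD] \<mu>_def by (rule emeasure_measure[OF PD])
    have "vol (open_core P) \<le> vol (E (open_core P) \<union> \<Union>(children P))"
      by (rule emeasure_mono[OF _ sets.Un[OF Es chs]]) (use \<kappa>[OF P] in \<open>auto simp: E_def\<close>)
    also have "\<dots> \<le> vol (E (open_core P)) + vol (\<Union>(children P))"
      by (rule emeasure_subadditive[OF Es chs])
    also have "vol (\<Union>(children P)) \<le> ennreal (\<theta> * \<mu>)"
      using children_small[OF PD] \<theta> unfolding emeasure_measure[OF PD] \<mu>_def by (simp add: ennreal_mult)
    finally have le: "ennreal \<mu> \<le> vol (E (open_core P)) + ennreal (\<theta> * \<mu>)" unfolding em by (simp add: add_left_mono)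
    have "ennreal (\<mu> - \<theta> * \<mu>) \<le> vol (E (open_core P))"
    proof (cases "vol (E (open_core P))")
      case (real v)
      have "\<mu> \<le> v + \<theta> * \<mu>" using le real \<theta> \<mu> by (simp add: ennreal_plus[symmetric] del: ennreal_plus)
      then show ?thesis using real by (simp add: ennreal_leI)
    qed simp
    then show "ennreal (1 - \<theta>) * vol (open_core P) \<le> vol (E (open_core P))"
      unfolding em using \<theta> \<mu> by (simp add: ennreal_mult[symmetric] left_diff_distrib)
  qed
  have disj: "disjoint_family_on E (open_core ` \<G>)"
    unfolding disjoint_family_on_def
  proof (intro ballI impI)
    fix Q Q' assume Q: "Q \<in> open_core ` \<G>" "Q' \<in> open_core ` \<G>" "Q \<noteq> Q'"
    then obtain P P' where P: "P \<in> \<G>" "Q = open_core P" "P' \<in> \<G>" "Q' = open_core P'" by blast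
    then have "(P - \<Union>(children P)) \<inter> (P' - \<Union>(children P')) = {}" using \<G>_essential_disjoint Q(3) by blast
    moreover have "E Q \<subseteq> P - \<Union>(children P)" "E Q' \<subseteq> P' - \<Union>(children P')"
      using open_core(2)[OF \<G>_\<D>[OF P(1)]] open_core(2)[OF \<G>_\<D>[OF P(3)]] \<kappa>[OF P(1)] \<kappa>[OF P(3)] by (auto simp: E_def P)
    ultimately show "E Q \<inter> E Q' = {}" by blast
  qed
  have one: "(\<Sum>\<^sub>\<infinity>Q\<in>open_core ` \<G>. indicator (E Q) x :: ennreal) \<le> 1" for x
  proof (subst nonneg_infsum_complete)
    show "(SUP S\<in>{S. finite S \<and> S \<subseteq> open_core ` \<G>}. \<Sum>Q\<in>S. indicator (E Q) x) \<le> (1 :: ennreal)"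
    proof (rule SUP_least)
      fix S assume "S \<in> {S. finite S \<and> S \<subseteq> open_core ` \<G>}"
      then have S: "finite S" "S \<subseteq> open_core ` \<G>" by auto
      have "(\<Sum>Q\<in>S. indicator (E Q) x :: ennreal) = indicator (\<Union>Q\<in>S. E Q) x"
        by (rule indicator_UN_disjoint[symmetric, OF S(1) disjoint_family_on_mono[OF S(2) disj]])
      then show "(\<Sum>Q\<in>S. indicator (E Q) x :: ennreal) \<le> 1" by (simp add: indicator_def)
    qed
  qed simp
  show ?thesis unfolding sparse_family_def
  proof (intro conjI exI[of _ E] ballI allI)
    fix Q assume "Q \<in> open_core ` \<G>"
    then obtain P where P: "P \<in> \<G>" "Q = open_core P" by blast
    show "is_cube Q" "E Q \<in> sets lebesgue" "ennreal (1 - \<theta>) * vol Q \<le> vol (E Q)"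
      using open_core(3)[OF \<G>_\<D>[OF P(1)]] Es[OF P(1)] big[OF P(1)] P(2) by auto
    show "E Q \<subseteq> Q" by (auto simp: E_def)
  qed (rule one)
qed

lemma infsum_open_cores:
  fixes \<phi> :: "(real^'n) set \<Rightarrow> ennreal"
  assumes "\<And>P. P \<in> \<D> \<Longrightarrow> \<phi> (open_core P) = \<psi> P"
  shows "(\<integral>\<^sup>+P. \<psi> P \<partial>count_space \<G>) \<le> (\<Sum>\<^sub>\<infinity>P\<in>open_core ` \<G>. \<phi> P)"
proof -
  have inj: "inj_on open_core \<G>" by (rule inj_on_subset[OF open_core_inj subsetI[OF \<G>_\<D>]])
  have "(\<integral>\<^sup>+P. \<psi> P \<partial>count_space \<G>) \<le> (\<Sum>\<^sub>\<infinity>P\<in>\<G>. \<psi> P)" by (rule nn_integral_count_space_le_infsum[OF \<G>_countable])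
  also have "\<dots> = (\<Sum>\<^sub>\<infinity>P\<in>\<G>. \<phi> (open_core P))" using assms \<G>_\<D> by (intro infsum_cong) simp
  also have "\<dots> = (\<Sum>\<^sub>\<infinity>P\<in>open_core ` \<G>. \<phi> P)" unfolding infsum_reindex[OF inj] by (simp add: o_def)
  finally show ?thesis .
qed

theorem sparse_bound:
  assumes K: "0 \<le> K" "AE x in lebesgue. x \<in> T \<longrightarrow> \<bar>g x\<bar> \<le> K"
  shows "\<exists>\<P>. sparse_family (1 - \<theta>) \<P> \<and> (\<forall>P\<in>\<P>. P \<subseteq> \<Omega> \<and> dilate 3 P \<subseteq> \<Omega>) \<and>
    pairing T \<le>
      sparse_const * (\<Sum>\<^sub>\<infinity>P\<in>\<P>. vol P * avg (dilate 3 P) q (\<lambda>x. norm (F x)) * avg P dual_exp g) +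
      sparse_const * (\<Sum>\<^sub>\<infinity>P\<in>\<P>. vol P * ennreal (3 * side P) * avg (dilate 3 P) q' (\<lambda>x. \<bar>f x\<bar>) * avg P dual_exp g)"
proof (cases "1 \<le> B")
  case True
  let ?\<phi> = "\<lambda>P. vol P * avg (dilate 3 P) q (\<lambda>x. norm (F x)) * avg P dual_exp g"
  let ?\<psi> = "\<lambda>P. vol P * ennreal (3 * side P) * avg (dilate 3 P) q' (\<lambda>x. \<bar>f x\<bar>) * avg P dual_exp g"
  have "pairing T \<le> sparse_const * (\<integral>\<^sup>+Q. vol Q * data_avg Q * avg Q dual_exp g \<partial>count_space \<G>)" by (rule sparse_sum[OF True K])
  also have "(\<integral>\<^sup>+Q. vol Q * data_avg Q * avg Q dual_exp g \<partial>count_space \<G>) = (\<integral>\<^sup>+Q. ?\<phi> Q + ?\<psi> Q \<partial>count_space \<G>)"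
    by (intro nn_integral_cong) (simp add: data_avg_def distrib_left distrib_right mult.assoc)
  also have "\<dots> = (\<integral>\<^sup>+Q. ?\<phi> Q \<partial>count_space \<G>) + (\<integral>\<^sup>+Q. ?\<psi> Q \<partial>count_space \<G>)" by (rule nn_integral_add) simp_all
  also have "\<dots> \<le> (\<Sum>\<^sub>\<infinity>P\<in>open_core ` \<G>. ?\<phi> P) + (\<Sum>\<^sub>\<infinity>P\<in>open_core ` \<G>. ?\<psi> P)"
    by (intro add_mono infsum_open_cores) (simp_all add: open_core)
  finally have "pairing T \<le> sparse_const * ((\<Sum>\<^sub>\<infinity>P\<in>open_core ` \<G>. ?\<phi> P) + (\<Sum>\<^sub>\<infinity>P\<in>open_core ` \<G>. ?\<psi> P))" by (simp add: mult_left_mono)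
  then have "pairing T \<le> sparse_const * (\<Sum>\<^sub>\<infinity>P\<in>open_core ` \<G>. ?\<phi> P) + sparse_const * (\<Sum>\<^sub>\<infinity>P\<in>open_core ` \<G>. ?\<psi> P)" by (simp only: distrib_left)
  moreover have "P \<subseteq> \<Omega> \<and> dilate 3 P \<subseteq> \<Omega>" if "P \<in> open_core ` \<G>" for P
  proof -
    obtain R where "R \<in> \<G>" "P = open_core R" using \<open>P \<in> open_core ` \<G>\<close> by (elim imageE)
    then have R: "R \<in> \<D>" "P = open_core R" using \<G>_\<D> by auto
    have "P \<subseteq> open_cube (center R) (3 * side R)"
      unfolding R(2) open_core_def using \<D>_side_pos[OF R(1)] by (intro open_cube_mono(1)) simp
    then show ?thesis using open_core(8)[OF R(1)] dilate_3_open[OF R(1)] R(2) by blast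
  qed
  ultimately show ?thesis using open_cores_sparse by blast
next
  case False
  then have "AE x in lebesgue. x \<in> T \<longrightarrow> Gr u x = 0" by (intro small_B_imp_zero) simp
  then have "AE x in lebesgue. ennreal (loc_grad T x * \<bar>g x\<bar>) * indicator T x = 0"
    by eventually_elim (auto simp: loc_grad_def loc_sol_def indicator_def)
  then have "pairing T = (\<integral>\<^sup>+x. (0 :: ennreal) \<partial>(lebesgue :: (real^'n) measure))"
    unfolding pairing_def by (intro nn_integral_cong_AE)
  then have "pairing T = 0" by simp
  moreover have "sparse_family (1 - \<theta>) {}" by (simp add: sparse_family_def)
  ultimately show ?thesis by (intro exI[of _ "{}"]) simp
qed

end

section \<open>The sparse bound\<close>

text \<open>On a set of finite measure, because \<open>t\<^sup>p \<le> 1 + t\<^sup>r\<close>.\<close>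

lemma Lp_mono_exponent:
  fixes h :: "real^'n \<Rightarrow> 'b::real_normed_vector"
  assumes h: "Lp r D h" and D: "D \<in> sets lebesgue" "vol D < top"
    and p: "0 \<le> p" "p \<le> r" and U: "U \<subseteq> D" "U \<in> sets lebesgue"
  shows "Lp p U h"
proof -
  have [measurable]: "D \<in> sets lebesgue" "h \<in> borel_measurable (lebesgue_on D)" using h D by (auto simp: Lp_def)
  have hU: "h \<in> borel_measurable (lebesgue_on U)" using h U(1) unfolding Lp_def by (blast intro: measurable_restrict_mono)
  have "(\<lambda>x. norm (h x) powr r) \<in> borel_measurable (lebesgue_on D)" by measurable
  then have "(\<lambda>x. indicator D x *\<^sub>R (norm (h x) powr r)) \<in> borel_measurable lebesgue"
    using D(1) by (subst (asm) borel_measurable_restrict_space_iff) simp_all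
  then have "(\<lambda>x. ennreal (indicator D x *\<^sub>R (norm (h x) powr r))) \<in> borel_measurable lebesgue" by measurable
  moreover have "(\<lambda>x. ennreal (indicator D x *\<^sub>R (norm (h x) powr r))) = (\<lambda>x. ennreal (norm (h x) powr r) * indicator D x)"
    by (rule ext) (simp add: indicator_def)
  ultimately have m: "(\<lambda>x. ennreal (norm (h x) powr r) * indicator D x) \<in> borel_measurable lebesgue" by (simp only:)
  have le: "norm (h x) powr p \<le> 1 + norm (h x) powr r" for x
  proof (cases "norm (h x) \<le> 1")
    case True
    then have "norm (h x) powr p \<le> 1" using p(1) by (intro powr_le1) auto
    then show ?thesis using powr_ge_zero[of "norm (h x)" r] by linarith
  next
    case False
    then have "norm (h x) powr p \<le> norm (h x) powr r" using p(2) by (intro powr_mono) auto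
    then show ?thesis by linarith
  qed
  have "(\<integral>\<^sup>+x\<in>U. ennreal (norm (h x) powr p) \<partial>lebesgue) \<le>
      (\<integral>\<^sup>+x. indicator D x + ennreal (norm (h x) powr r) * indicator D x \<partial>lebesgue)"
  proof (rule nn_integral_mono)
    fix x
    have "ennreal (norm (h x) powr p) \<le> 1 + ennreal (norm (h x) powr r)"
      using ennreal_leI[OF le[of x]] by simp
    then show "ennreal (norm (h x) powr p) * indicator U x \<le> indicator D x + ennreal (norm (h x) powr r) * indicator D x"
      using U(1) by (auto simp: indicator_def)
  qed
  also have "\<dots> = vol D + (\<integral>\<^sup>+x\<in>D. ennreal (norm (h x) powr r) \<partial>lebesgue)"
    using m D(1) by (subst nn_integral_add) simp_all
  also have "\<dots> < top" using h D(2) by (simp add: Lp_def less_top[symmetric])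
  finally show ?thesis using hU by (simp add: Lp_def)
qed

lemma lower_star_mono:
  assumes "0 < p" "p \<le> r" shows "lower_star TYPE('n::finite) p \<le> lower_star TYPE('n) r"
proof -
  have "0 < real CARD('n)" by simp
  then have "real CARD('n) * p * (real CARD('n) + r) \<le> real CARD('n) * r * (real CARD('n) + p)"
    using assms by (simp add: algebra_simps)
  then show ?thesis using assms by (simp add: lower_star_def frac_le_eq divide_le_eq pos_divide_le_eq field_simps)
qed

theorem theorem3p1:
  fixes O0 Q0 \<Omega> :: "(real^'n) set"
    and a :: "real^'n \<Rightarrow> real^'n \<Rightarrow> real^'n"
    and F :: "real^'n \<Rightarrow> real^'n"
    and f u g :: "real^'n \<Rightarrow> real"
    and \<theta> lam \<Lambda> q\<^sub>l q\<^sub>h p :: real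
    and A B C :: ennreal
  assumes "smooth_domain O0"
    and "cbox (\<chi> i. - (299 / 200)) (\<chi> i. 299 / 200) \<subseteq> O0"
    and "O0 \<subseteq> cbox (\<chi> i. - (3 / 2)) (\<chi> i. 3 / 2)"
    and "0 < \<theta>" "\<theta> < 1"
    and "0 < lam" "lam \<le> \<Lambda>"
    and "is_cube Q0"
    and "elliptic_coeff lam \<Lambda> (dilate 3 Q0) a"
    and "\<Omega> = interior (dilate 3 Q0)"
    and "admissible_lower O0 \<Omega> a q\<^sub>l"
    and "admissible_upper O0 \<Omega> a q\<^sub>h"
    and "A = N_low O0 \<Omega> a q\<^sub>l"
    and "B = N_high_loc O0 \<Omega> a q\<^sub>h"
    and "q\<^sub>l < p"
    and "Lp p (dilate 3 Q0) F"
    and "Lp (lower_star TYPE('n) p) (dilate 3 Q0) f"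
    and "\<not> (AE x in lebesgue_on (dilate 3 Q0). f x = 0) \<Longrightarrow> 1 < lower_star TYPE('n) q\<^sub>l"
    and "u \<in> W12_0 \<Omega>"
    and "solves \<Omega> a F f u"
    and "Linfty (dilate 3 Q0) g"
    and "AE x in lebesgue_on (dilate 3 Q0). 0 \<le> g x"
    and "C = ennreal (9 powr (real CARD('n) / q\<^sub>l)) * (A * ennreal \<Lambda> + 1) * A * B *
             epowr (maximal_weak_norm Q0 / ennreal \<theta>) (1 / q\<^sub>l)"
  shows "\<exists>\<P>. sparse_family (1 - \<theta>) \<P> \<and> (\<forall>P\<in>\<P>. dilate 3 P \<subseteq> dilate 3 Q0) \<and>
    (\<integral>\<^sup>+x\<in>Q0. ennreal (norm (weak_grad \<Omega> u x) * g x) \<partial>lebesgue) \<le>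
      C * (\<Sum>\<^sub>\<infinity>P\<in>\<P>. emeasure lebesgue P *
             avg (dilate 3 P) q\<^sub>l (\<lambda>x. norm (F x)) * avg P (conj_exp q\<^sub>h) g) +
      C * (\<Sum>\<^sub>\<infinity>P\<in>\<P>. emeasure lebesgue P * ennreal (3 * side P) *
             avg (dilate 3 P) (lower_star TYPE('n) q\<^sub>l) (\<lambda>x. \<bar>f x\<bar>) * avg P (conj_exp q\<^sub>h) g)"
proof -
  obtain m s where ms: "cube_at Q0 m s" using \<open>is_cube Q0\<close> by (rule is_cube_imp_cube_at)
  have s: "0 < s" using ms by (simp add: cube_at_def)
  define D where "D = dilate 3 Q0"
  have D3: "cube_at D m (3 * s)" unfolding D_def by (rule cube_at_dilate[OF ms]) simp
  have \<Omega>: "\<Omega> = open_cube m (3 * s)" using cube_at_interior[OF D3] \<open>\<Omega> = interior (dilate 3 Q0)\<close> by (simp add: D_def)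
  have D: "D \<in> sets lebesgue" "vol D < top" using cube_at_sets[OF D3] cube_at_emeasure_pos[OF D3] by auto
  have \<Omega>s: "\<Omega> \<in> sets lebesgue" "\<Omega> \<subseteq> D" using D3 unfolding \<Omega> by (auto simp: cube_at_def)
  have ql: "1 < q\<^sub>l" using \<open>admissible_lower O0 \<Omega> a q\<^sub>l\<close> by (simp add: admissible_lower_def)
  define q' where "q' = lower_star TYPE('n) q\<^sub>l"
  have q'0: "0 \<le> q'" using ql by (simp add: q'_def lower_star_def)
  have q'p: "q' \<le> lower_star TYPE('n) p" unfolding q'_def using ql \<open>q\<^sub>l < p\<close> by (intro lower_star_mono) auto
  \<comment> \<open>The given g is measurable only on the triple of Q0.\<close>
  define g0 where "g0 x = indicator \<Omega> x * g x" for x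
  have F: "Lp q\<^sub>l U F" if "U \<subseteq> D" "U \<in> sets lebesgue" for U
    by (rule Lp_mono_exponent[OF _ D _ _ that]) (use \<open>Lp p (dilate 3 Q0) F\<close> ql \<open>q\<^sub>l < p\<close> in \<open>auto simp: D_def\<close>)
  have f: "Lp q' U f" if "U \<subseteq> D" "U \<in> sets lebesgue" for U
    by (rule Lp_mono_exponent[OF _ D q'0 q'p that]) (use \<open>Lp (lower_star TYPE('n) p) (dilate 3 Q0) f\<close> in \<open>auto simp: D_def\<close>)
  have loc: "Lp_loc q\<^sub>l \<Omega> F" "Lp_loc q' \<Omega> f"
    unfolding Lp_loc_def using F[OF \<Omega>s(2,1)] f[OF \<Omega>s(2,1)] F f \<Omega>s(2)
    by (auto simp: Lp_def[of _ \<Omega>] lmeasurable_compact fmeasurableD)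
  have gm: "g \<in> borel_measurable (lebesgue_on D)" using \<open>Linfty (dilate 3 Q0) g\<close> by (simp add: Linfty_def D_def)
  obtain K where K: "AE x in lebesgue_on D. \<bar>g x\<bar> \<le> K"
    using \<open>Linfty (dilate 3 Q0) g\<close> unfolding Linfty_def D_def by blast
  have "g \<in> borel_measurable (lebesgue_on \<Omega>)" using gm \<Omega>s(2) by (rule measurable_restrict_mono)
  then have g0m: "g0 \<in> borel_measurable lebesgue"
    using \<Omega>s(1) unfolding g0_def[abs_def] by (subst (asm) borel_measurable_restrict_space_iff) simp_all
  interpret sparse_setting O0 Q0 \<Omega> a lam \<Lambda> q\<^sub>l s m u f g0 F q\<^sub>h \<theta> q' A B
  proof unfold_locales
    show "open O0" using \<open>smooth_domain O0\<close> by (simp add: smooth_domain_def)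
    show "q' = lower_star TYPE('n) q\<^sub>l" by (rule q'_def)
    show "2 < q\<^sub>h" using \<open>admissible_upper O0 \<Omega> a q\<^sub>h\<close> by (simp add: admissible_upper_def)
    show "(\<integral>\<^sup>+x\<in>\<Omega>. ennreal (norm (F x) powr q\<^sub>l) \<partial>lebesgue) < top" using F[OF \<Omega>s(2,1)] by (simp add: Lp_def)
    show "(\<integral>\<^sup>+x\<in>\<Omega>. ennreal (\<bar>f x\<bar> powr q') \<partial>lebesgue) < top" using f[OF \<Omega>s(2,1)] by (simp add: Lp_def)
    show "AE x in lebesgue_on \<Omega>. f x = 0" if "q' \<le> 1"
    proof -
      have "AE x in lebesgue_on D. f x = 0" using assms(18) that unfolding q'_def D_def by force
      then show ?thesis using D(1) \<Omega>s by (simp add: AE_restrict_space_iff) (auto elim: AE_mp)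
    qed
  qed (fact assms ms \<Omega> loc g0m)+
  have gK: "AE x in lebesgue. x \<in> T \<longrightarrow> \<bar>g0 x\<bar> \<le> max K 0"
  proof -
    have "AE x in lebesgue. x \<in> D \<longrightarrow> \<bar>g x\<bar> \<le> K" using K D(1) by (simp add: AE_restrict_space_iff)
    then show ?thesis
      by eventually_elim (use \<Omega>s(2) in \<open>auto simp: g0_def indicator_def\<close>)
  qed
  \<comment> \<open>The half-open root cube and Q0 have the same interior.\<close>
  have lhs: "(\<integral>\<^sup>+x\<in>Q0. ennreal (norm (weak_grad \<Omega> u x) * g x) \<partial>lebesgue) = pairing T"
    unfolding pairing_def
  proof (rule nn_integral_cong_AE)
    have "AE x in lebesgue. x \<in> D \<longrightarrow> 0 \<le> g x"
      using assms(22) D(1) by (simp add: AE_restrict_space_iff D_def)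
    then show "AE x in lebesgue. ennreal (norm (weak_grad \<Omega> u x) * g x) * indicator Q0 x = ennreal (loc_grad T x * \<bar>g0 x\<bar>) * indicator T x"
      using cube_at_AE_open[OF ms] cube_at_AE_open[OF T_cube]
    proof eventually_elim
      fix x assume x: "x \<in> D \<longrightarrow> 0 \<le> g x" "x \<in> Q0 \<longleftrightarrow> x \<in> open_cube m s" "x \<in> T \<longleftrightarrow> x \<in> open_cube m s"
      have sub: "open_cube m s \<subseteq> \<Omega>" unfolding \<Omega> using s by (intro open_cube_mono(1)) simp
      show "ennreal (norm (weak_grad \<Omega> u x) * g x) * indicator Q0 x = ennreal (loc_grad T x * \<bar>g0 x\<bar>) * indicator T x"
      proof (cases "x \<in> open_cube m s")
        case True
        then have "x \<in> \<Omega>" using sub by blast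
        moreover from this have "0 \<le> g x" using x(1) \<Omega>s(2) by blast
        ultimately show ?thesis using x(2,3) True by (simp add: loc_grad_def loc_sol_def Gr_def g0_def)
      next
        case False
        then show ?thesis using x(2,3) by simp
      qed
    qed
  qed
  have gavg: "avg P r g0 = avg P r g" if "P \<subseteq> \<Omega>" for P r
    by (rule avg_cong_AE, rule AE_I2) (use that in \<open>auto simp: g0_def\<close>)
  obtain \<P> where \<P>: "sparse_family (1 - \<theta>) \<P>" "\<And>P. P \<in> \<P> \<Longrightarrow> P \<subseteq> \<Omega> \<and> dilate 3 P \<subseteq> \<Omega>"
    and le: "pairing T \<le>
      C * (\<Sum>\<^sub>\<infinity>P\<in>\<P>. vol P * avg (dilate 3 P) q\<^sub>l (\<lambda>x. norm (F x)) * avg P dual_exp g0) +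
      C * (\<Sum>\<^sub>\<infinity>P\<in>\<P>. vol P * ennreal (3 * side P) * avg (dilate 3 P) q' (\<lambda>x. \<bar>f x\<bar>) * avg P dual_exp g0)"
    using sparse_bound[OF max.cobounded2 gK] unfolding sparse_const_def assms(23)[symmetric] by blast
  have pg: "avg P dual_exp g0 = avg P (conj_exp q\<^sub>h) g" if "P \<in> \<P>" for P
    using gavg \<P>(2)[OF that] by (simp add: dual_exp_def)
  have "pairing T \<le>
      C * (\<Sum>\<^sub>\<infinity>P\<in>\<P>. vol P * avg (dilate 3 P) q\<^sub>l (\<lambda>x. norm (F x)) * avg P (conj_exp q\<^sub>h) g) +
      C * (\<Sum>\<^sub>\<infinity>P\<in>\<P>. vol P * ennreal (3 * side P) * avg (dilate 3 P) q' (\<lambda>x. \<bar>f x\<bar>) * avg P (conj_exp q\<^sub>h) g)"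
    using le by (simp add: pg cong: infsum_cong)
  moreover have "\<forall>P\<in>\<P>. dilate 3 P \<subseteq> dilate 3 Q0" using \<P>(2) \<Omega>s(2) by (auto simp: D_def)
  ultimately show ?thesis unfolding lhs q'_def[symmetric] using \<P>(1) by blast
qed

end
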